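(* The operator $T: W^{1,1}(G)\to W^{1,1}(G)$ has at least one fixed point. That is, the boundary value problem $$\mathrm{div}\left(D(\nabla u_\sigma)\nabla u\right)=0 \ \text{ on } G,\qquad u=f \ \text{ on } \partial K,\qquad D(\nabla u_\sigma)\nabla u\cdot \mathcal{N}=0 \ \text{ on } \partial\Omega\setminus\partial K$$ (with $\mathcal{N}$ the outward unit normal to $\Omega$) has at least one weak solution.
   Context: Setting. $\Omega\subset\mathbb{R}^2$ is a bounded Lipschitz domain. $C_1,\dots,C_N\subset\Omega$ ($N\ge 1$) are finitely many disjoint open Lipschitz domains, $C_i\neq\Omega$, with $\mathrm{dist}(C_i,C_j)>0$ for $i\ne j$. Put $C:=\bigcup_{i=1}^N C_i$, $K:=\overline{C}$, $G:=\Omega\setminus K$, and assume $K$ is a compact subset of $\Omega$ (so $\partial K\subset\partial G$). The function $f: C\to[0,1]$ is of class $W^{1,2}(C)$; a fixed extension of it to a function in $W^{1,2}(\Omega)$ is also denoted $f$. The map $D:\mathbb{R}^2\to\mathbb{R}^{2\times2}$ is continuous, $D(p)$ is symmetric for every $p\in\mathbb{R}^2$, and there are constants $\lambda,c_1,c_2>0$ with $$c_1\left(1+\frac{|p|^2}{\lambda^2}\right)^{-1/2}|q|^2\le D(p)q\cdot q\le c_2|q|^2\quad\text{for all }p,q\in\mathbb{R}^2.$$ A parameter $\sigma>0$ is fixed. For $w\in L^1(G)$ set $w_\sigma(x):=\int_G k_\sigma(x-z)w(z)\,dz$, $x\in\mathbb{R}^2$, where $k_\sigma(z)=\frac{1}{2\pi\sigma^2}\exp\left(-\frac{|z|^2}{2\sigma^2}\right)$.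 Operator $T$. Let $\mathcal{C}:=\{v\in W^{1,2}(G): v=f \text{ on }\partial K\text{ in the trace sense}\}$. For $w\in W^{1,1}(G)$ and $v\in W^{1,2}(G)$ let $J_w(v):=\int_G D(\nabla w_\sigma)\nabla v\cdot\nabla v\,dx$. For $w\in W^{1,1}(G)$, $T(w)$ is defined as the unique minimiser of $J_w$ in $\mathcal{C}$; this defines $T:W^{1,1}(G)\to W^{1,1}(G)$. Weak solution. A weak solution of the boundary value problem is a fixed point $u=T(u)$; such a $u$ lies in $\mathcal{C}$ and satisfies $\int_G D(\nabla u_\sigma)\nabla u\cdot\nabla\phi\,dx=0$ for all $\phi\in W^{1,2}(G)$ with $\phi|_{\partial K}=0$ in the trace sense. *)

theory Defs
  imports "HOL-Analysis.Analysis"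
begin

section \<open>Lipschitz domains in the plane\<close>

text \<open>
  A domain is a nonempty connected open set. It is Lipschitz if near each boundary point, in
  orthonormal coordinates with axes e, n centred at that point, it is the strict epigraph of a
  Lipschitz function of one variable.
\<close>

definition lipschitz_domain :: "(real^2) set \<Rightarrow> bool" where
  "lipschitz_domain U \<longleftrightarrow> open U \<and> connected U \<and> U \<noteq> {} \<and>
     (\<forall>x\<in>frontier U. \<exists>r>0. \<exists>e n. \<exists>L. \<exists>\<gamma>::real \<Rightarrow> real.
        norm e = 1 \<and> norm n = 1 \<and> e \<bullet> n = 0 \<and> L-lipschitz_on UNIV \<gamma> \<and>
        (\<forall>y\<in>ball x r. y \<in> U \<longleftrightarrow> \<gamma> ((y - x) \<bullet> e) < (y - x) \<bullet> n))"

section \<open>Smooth functions\<close>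

definition gradient :: "(real^2 \<Rightarrow> real) \<Rightarrow> real^2 \<Rightarrow> real^2" where
  "gradient h x = (\<chi> i. frechet_derivative h (at x) (axis i 1))"

fun C_k :: "nat \<Rightarrow> (real^2 \<Rightarrow> real) \<Rightarrow> bool" where
  "C_k 0 h \<longleftrightarrow> continuous_on UNIV h"
| "C_k (Suc k) h \<longleftrightarrow> (\<forall>x. h differentiable (at x)) \<and> (\<forall>i. C_k k (\<lambda>x. gradient h x $ i))"

definition test_functions :: "(real^2) set \<Rightarrow> (real^2 \<Rightarrow> real) set" where
  "test_functions U = {\<phi>. (\<forall>k. C_k k \<phi>) \<and> (\<exists>M. compact M \<and> M \<subseteq> U \<and> (\<forall>x. x \<notin> M \<longrightarrow> \<phi> x = 0))}"

section \<open>Lebesgue and Sobolev spaces\<close>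

text \<open>
  Elements of these spaces are represented by functions; two functions that agree almost
  everywhere on the underlying set represent the same element, and values outside that set are
  irrelevant.
\<close>

definition lebesgue_space ::
  "real \<Rightarrow> (real^2) set \<Rightarrow> (real^2 \<Rightarrow> 'b::euclidean_space) set" where
  "lebesgue_space p U = {u. u \<in> borel_measurable (lebesgue_on U) \<and>
     integrable (lebesgue_on U) (\<lambda>x. norm (u x) powr p)}"

definition locally_integrable ::
  "(real^2) set \<Rightarrow> (real^2 \<Rightarrow> 'b::euclidean_space) \<Rightarrow> bool" where
  "locally_integrable U u \<longleftrightarrow> (\<forall>M. compact M \<and> M \<subseteq> U \<longrightarrow> integrable (lebesgue_on M) u)"

text \<open>
  Local integrability is needed because the Bochner integral of a non-integrable function is 0 by
  convention. With it, the weak gradient on an open set is unique up to null sets.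
\<close>

definition has_weak_gradient ::
  "(real^2) set \<Rightarrow> (real^2 \<Rightarrow> real) \<Rightarrow> (real^2 \<Rightarrow> real^2) \<Rightarrow> bool" where
  "has_weak_gradient U u g \<longleftrightarrow> locally_integrable U u \<and> locally_integrable U g \<and>
     (\<forall>\<phi>\<in>test_functions U.
        (LINT x|lebesgue_on U. u x *\<^sub>R gradient \<phi> x) = - (LINT x|lebesgue_on U. \<phi> x *\<^sub>R g x))"

definition weak_gradient :: "(real^2) set \<Rightarrow> (real^2 \<Rightarrow> real) \<Rightarrow> real^2 \<Rightarrow> real^2" where
  "weak_gradient U u = (SOME g. has_weak_gradient U u g)"

text \<open>The Sobolev space of order 1 and exponent p, for open U.\<close>

definition sobolev :: "real \<Rightarrow> (real^2) set \<Rightarrow> (real^2 \<Rightarrow> real) set" where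
  "sobolev p U = {u. u \<in> lebesgue_space p U \<and>
     (\<exists>g. g \<in> lebesgue_space p U \<and> has_weak_gradient U u g)}"

definition sobolev_norm :: "real \<Rightarrow> (real^2) set \<Rightarrow> (real^2 \<Rightarrow> real) \<Rightarrow> real" where
  "sobolev_norm p U u =
     ((LINT x|lebesgue_on U. \<bar>u x\<bar> powr p)
      + (LINT x|lebesgue_on U. norm (weak_gradient U u x) powr p)) powr (1 / p)"

section \<open>Traces\<close>

text \<open>
  One-dimensional Hausdorff measure, normalised so that it is arc length on rectifiable curves.
  The outer measure below is a metric outer measure, hence countably additive on the Borel sets.
\<close>

definition hausdorff1_pre :: "real \<Rightarrow> (real^2) set \<Rightarrow> ennreal" where
  "hausdorff1_pre \<delta> A =
     (INF E \<in> {E :: nat \<Rightarrow> (real^2) set. A \<subseteq> (\<Union>i. E i) \<and> (\<forall>i. bounded (E i) \<and> diameter (E i) \<le> \<delta>)}.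
        \<Sum>i. ennreal (diameter (E i)))"

definition hausdorff1_outer :: "(real^2) set \<Rightarrow> ennreal" where
  "hausdorff1_outer A = (SUP \<delta>\<in>{0<..}. hausdorff1_pre \<delta> A)"

definition hausdorff1 :: "(real^2) measure" where
  "hausdorff1 = measure_of UNIV (sets borel) hausdorff1_outer"

text \<open>
  The trace on a part S of the boundary of U is the continuous extension, from the Sobolev norm to
  the square-integrable functions on S, of the restriction map, which is defined
  classically on those Sobolev functions that are continuous up to S. For S = frontier U
  these are the ones continuous on closure U.
\<close>

definition has_trace ::
  "(real^2) set \<Rightarrow> (real^2) set \<Rightarrow> (real^2 \<Rightarrow> real) \<Rightarrow> (real^2 \<Rightarrow> real) \<Rightarrow> bool" where
  "has_trace U S u g \<longleftrightarrow>
     u \<in> sobolev 2 U \<and>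
     g \<in> borel_measurable (restrict_space hausdorff1 S) \<and>
     (\<integral>\<^sup>+x\<in>S. ennreal ((g x)\<^sup>2) \<partial>hausdorff1) < \<infinity> \<and>
     (\<exists>\<phi> :: nat \<Rightarrow> real^2 \<Rightarrow> real.
        (\<forall>n. \<phi> n \<in> sobolev 2 U \<and> continuous_on (U \<union> S) (\<phi> n)) \<and>
        (\<lambda>n. sobolev_norm 2 U (\<lambda>x. \<phi> n x - u x)) \<longlonglongrightarrow> 0 \<and>
        (\<lambda>n. \<integral>\<^sup>+x\<in>S. ennreal ((\<phi> n x - g x)\<^sup>2) \<partial>hausdorff1) \<longlonglongrightarrow> 0)"

definition equal_trace ::
  "(real^2) set \<Rightarrow> (real^2) set \<Rightarrow> (real^2 \<Rightarrow> real) \<Rightarrow> (real^2 \<Rightarrow> real) \<Rightarrow> bool" where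
  "equal_trace U S u v \<longleftrightarrow> (\<exists>g. has_trace U S u g \<and> has_trace U S v g)"

section \<open>The operator\<close>

definition gauss_kernel :: "real \<Rightarrow> real^2 \<Rightarrow> real" where
  "gauss_kernel \<sigma> z = 1 / (2 * pi * \<sigma>\<^sup>2) * exp (- (norm z)\<^sup>2 / (2 * \<sigma>\<^sup>2))"

definition smoothed :: "(real^2) set \<Rightarrow> real \<Rightarrow> (real^2 \<Rightarrow> real) \<Rightarrow> real^2 \<Rightarrow> real" where
  "smoothed G \<sigma> w x = (LINT z|lebesgue_on G. gauss_kernel \<sigma> (x - z) * w z)"

definition admissible ::
  "(real^2) set \<Rightarrow> (real^2) set \<Rightarrow> (real^2 \<Rightarrow> real) \<Rightarrow> (real^2 \<Rightarrow> real) set" where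
  "admissible G K f = {v \<in> sobolev 2 G. equal_trace G (frontier K) v f}"

definition diffusion_form ::
  "(real^2) set \<Rightarrow> (real^2 \<Rightarrow> real^2^2) \<Rightarrow> real \<Rightarrow> (real^2 \<Rightarrow> real) \<Rightarrow>
   (real^2 \<Rightarrow> real) \<Rightarrow> (real^2 \<Rightarrow> real) \<Rightarrow> real" where
  "diffusion_form G D \<sigma> w v \<phi> =
     (LINT x|lebesgue_on G.
        (D (gradient (smoothed G \<sigma> w) x) *v weak_gradient G v x) \<bullet> weak_gradient G \<phi> x)"

definition energy ::
  "(real^2) set \<Rightarrow> (real^2 \<Rightarrow> real^2^2) \<Rightarrow> real \<Rightarrow> (real^2 \<Rightarrow> real) \<Rightarrow> (real^2 \<Rightarrow> real) \<Rightarrow> real" where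
  "energy G D \<sigma> w v = diffusion_form G D \<sigma> w v v"

text \<open>Uniqueness is as an element of a Sobolev space, i.e. up to null sets of G.\<close>

definition unique_minimiser ::
  "(real^2) set \<Rightarrow> ((real^2 \<Rightarrow> real) \<Rightarrow> real) \<Rightarrow> (real^2 \<Rightarrow> real) set \<Rightarrow> (real^2 \<Rightarrow> real) \<Rightarrow> bool" where
  "unique_minimiser G J A v \<longleftrightarrow> v \<in> A \<and> (\<forall>v'\<in>A. J v \<le> J v') \<and>
     (\<forall>v'\<in>A. (\<forall>v''\<in>A. J v' \<le> J v'') \<longrightarrow> (AE x in lebesgue_on G. v' x = v x))"

definition T_op ::
  "(real^2) set \<Rightarrow> (real^2) set \<Rightarrow> (real^2 \<Rightarrow> real) \<Rightarrow> (real^2 \<Rightarrow> real^2^2) \<Rightarrow> real \<Rightarrow>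
   (real^2 \<Rightarrow> real) \<Rightarrow> real^2 \<Rightarrow> real" where
  "T_op G K f D \<sigma> w = (SOME v. unique_minimiser G (energy G D \<sigma> w) (admissible G K f) v)"

text \<open>
  A weak solution is a fixed point of the operator, as an element of a Sobolev space. That T_op at
  u is the unique minimiser is required explicitly, so that the choice in its definition is not
  vacuous at u.
\<close>

definition weak_solution ::
  "(real^2) set \<Rightarrow> (real^2) set \<Rightarrow> (real^2 \<Rightarrow> real) \<Rightarrow> (real^2 \<Rightarrow> real^2^2) \<Rightarrow> real \<Rightarrow>
   (real^2 \<Rightarrow> real) \<Rightarrow> bool" where
  "weak_solution G K f D \<sigma> u \<longleftrightarrow>
     u \<in> sobolev 1 G \<and>
     unique_minimiser G (energy G D \<sigma> u) (admissible G K f) (T_op G K f D \<sigma> u) \<and>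
     (AE x in lebesgue_on G. T_op G K f D \<sigma> u x = u x)"

end

theory Submission
  imports Defs "HOL-Complex_Analysis.Great_Picard"
begin

text \<open>
  The unknown of the fixed point problem is taken to be the smoothed gradient p of u, a continuous vector field on
  the closure of G, instead of u itself. For given p the linear problem with coefficient D(p) and datum f has one solution v,
  and p is mapped to the gradient of the Gaussian smoothing of v (next_gradient). A fixed point p yields a weak solution
  u = v, because the coefficient of the linear problem is then the one that belongs to u, and because the solution of
  the linear problem is the unique minimiser of the energy (exists_weak_solution).

  The map has a fixed point because smoothing makes it compact. Its images are Lipschitz with a constant that is
  controlled by the integral norm of v, and it is uniformly continuous in the supremum norm
  since v depends continuously on the coefficient. So schauder_lipschitz applies as soon as some ball is mapped into itself.
  This is where the lower bound for D enters: for p bounded by R the ellipticity constant is of order 1/R.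
  Comparing the energies of v and f bounds the squared norm of the gradient of v by a multiple of R, hence the norm of v
  and the smoothed gradient by a multiple of the square root of R, which is less than R for large R
  (sol_fun_growth, next_gradient_bounds). The fixed point theorem itself follows from Kuhn's combinatorial lemma by
  interpolation on finite nets and from the theorem of Arzela and Ascoli.

  The linear problem (dirichlet_problem) is solved by minimising the energy over f + W0, where W0 consists of
  the functions with zero trace on the boundary of K. This needs two facts. First, the admissible functions are such a coset
  (admissible_iff), which requires that f has a trace at all (trace_exists): Sobolev functions on a Lipschitz domain are
  limits of functions that are continuous inside it, obtained by averaging over balls that are shifted
  inwards, and a trace inequality makes the boundary values converge. Second, the gradients of the functions in W0
  are complete, by Poincare's inequality (poincare).

  Both the trace inequality and Poincare's inequality rest on translation_identity: the increment of a Sobolev function along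
  a segment is the integral of its weak gradient. In the chart of a Lipschitz graph it compares the values on the graph with
  the values at positive depth in both directions. A function with zero trace is thus controlled near the boundary of K.
  Translations carry the control into the interior of G and from there to the boundary of \<Omega>, and it reaches
  all of G because the closure of every component of G meets the boundary of K (component_meets_boundary).
\<close>

section \<open>Smooth functions and cutoffs\<close>

lemma gradient_eqI:
  assumes "(h has_derivative (\<lambda>q. q \<bullet> g)) (at x)"
  shows "gradient h x = g"
proof -
  have "frechet_derivative h (at x) = (\<lambda>q. q \<bullet> g)" using frechet_derivative_at[OF assms] by simp
  then show ?thesis by (simp add: gradient_def vec_eq_iff inner_axis' )
qed

lemma has_derivative_gradient:
  assumes "h differentiable (at x)"
  shows "(h has_derivative (\<lambda>q. q \<bullet> gradient h x)) (at x)"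
proof -
  let ?F = "frechet_derivative h (at x)"
  have F: "(h has_derivative ?F) (at x)" using assms frechet_derivative_works by blast
  then have lin: "linear ?F" by (rule has_derivative_linear)
  have "?F q = q \<bullet> gradient h x" for q
  proof -
    have "?F q = ?F (\<Sum>i\<in>UNIV. (q $ i) *\<^sub>R axis i 1)"
      by (metis (no_types, lifting) basis_expansion scalar_mult_eq_scaleR sum.cong)
    also have "... = (\<Sum>i\<in>UNIV. (q $ i) * ?F (axis i 1))" using lin by (simp add: linear_sum linear_cmul o_def)
    finally show ?thesis by (simp add: gradient_def inner_vec_def)
  qed
  then have "?F = (\<lambda>q. q \<bullet> gradient h x)" by blast
  then show ?thesis using F by simp
qed

lemma C_k_SucI:
  assumes "\<And>x. (h has_derivative (\<lambda>q. q \<bullet> g x)) (at x)"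
    and "\<And>i. C_k k (\<lambda>x. g x $ i)"
  shows "C_k (Suc k) h"
proof -
  have "gradient h = g" using assms(1) gradient_eqI by blast
  then show ?thesis using assms by (auto simp: differentiable_def)
qed

lemma C_k_Suc_has_derivative:
  "C_k (Suc k) h ==> (h has_derivative (\<lambda>q. q \<bullet> gradient h x)) (at x)" by (simp add: has_derivative_gradient)

lemma C_k_Suc_D: "C_k (Suc k) h ==> C_k k h"
proof (induction k arbitrary: h)
  case 0
  then show ?case by (auto intro!: continuous_at_imp_continuous_on differentiable_imp_continuous_within)
next
  case (Suc k)
  then show ?case by (metis C_k.simps(2))
qed

lemma C_k_const: "C_k k (\<lambda>x. c)"
proof (induction k arbitrary: c)
  case (Suc k)
  show ?case by (rule C_k_SucI[where g="\<lambda>x. 0"]) (auto simp: Suc)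
qed auto

lemma C_k_add: "C_k k f ==> C_k k h ==> C_k k (\<lambda>x. f x + h x)"
proof (induction k arbitrary: f h)
  case (Suc k)
  show ?case by (rule C_k_SucI[where g="\<lambda>x. gradient f x + gradient h x"])
      (use Suc in \<open>auto intro!: derivative_eq_intros has_derivative_gradient simp: inner_add_right\<close>)
qed (auto intro: continuous_intros)

lemma C_k_mult: "C_k k f ==> C_k k h ==> C_k k (\<lambda>x. f x * h x)"
proof (induction k arbitrary: f h)
  case (Suc k)
  have "C_k k f" "C_k k h" using Suc C_k_Suc_D by blast+
  then show ?case by (intro C_k_SucI[where g="\<lambda>x. f x *\<^sub>R gradient h x + h x *\<^sub>R gradient f x"])
      (use Suc in \<open>auto intro!: derivative_eq_intros has_derivative_gradient C_k_add
        simp: inner_add_right algebra_simps\<close>)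
qed (auto intro: continuous_intros)

lemma C_k_inner: "C_k k (\<lambda>x. (x - a) \<bullet> b)"
proof (cases k)
  case (Suc l)
  show ?thesis unfolding Suc by (rule C_k_SucI[where g="\<lambda>x. b"]) (auto intro!: derivative_eq_intros C_k_const)
qed (auto intro!: continuous_intros)

lemma C_k_shift: "C_k k h ==> C_k k (\<lambda>x. h (x - a))"
proof (induction k arbitrary: h)
  case 0
  then show ?case by (auto intro!: continuous_on_compose2[where g=h and t=UNIV] continuous_intros)
next
  case (Suc k)
  show ?case
  proof (rule C_k_SucI[where g="\<lambda>x. gradient h (x - a)"])
    fix x
    show "((\<lambda>x. h (x - a)) has_derivative (\<lambda>q. q \<bullet> gradient h (x - a))) (at x)"
      by (rule has_derivative_compose[OF _ C_k_Suc_has_derivative[OF Suc.prems]])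
        (auto intro!: derivative_eq_intros)
  qed (use Suc in auto)
qed

text \<open>The one-dimensional analogue of the smoothness classes, for building cutoffs by composition.\<close>

fun D_k :: "nat => (real => real) => bool" where
  "D_k 0 h \<longleftrightarrow> continuous_on UNIV h"
| "D_k (Suc k) h \<longleftrightarrow> (\<exists>h'. (\<forall>x. (h has_real_derivative h' x) (at x)) \<and> D_k k h')"

lemma D_k_add: "D_k k f ==> D_k k h ==> D_k k (\<lambda>x. f x + h x)"
proof (induction k arbitrary: f h)
  case (Suc k)
  then obtain f' h' where "\<forall>x. (f has_real_derivative f' x) (at x)" "D_k k f'"
    "\<forall>x. (h has_real_derivative h' x) (at x)" "D_k k h'" by auto
  then show ?case by (auto intro!: exI[where x="\<lambda>x. f' x + h' x"] derivative_eq_intros Suc.IH)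
qed (auto intro: continuous_intros)

lemma D_k_cmult: "D_k k f ==> D_k k (\<lambda>x. c * f x)"
proof (induction k arbitrary: f)
  case (Suc k)
  then obtain f' where "\<forall>x. (f has_real_derivative f' x) (at x)" "D_k k f'" by auto
  then show ?case by (auto intro!: exI[where x="\<lambda>x. c * f' x"] derivative_eq_intros Suc.IH)
qed (auto intro: continuous_intros)

lemma C_k_compose: "D_k k h ==> C_k k f ==> C_k k (\<lambda>x. h (f x))"
proof (induction k arbitrary: f h)
  case 0
  then show ?case by (auto intro!: continuous_on_compose2[where g=h and t=UNIV] continuous_intros)
next
  case (Suc k)
  then obtain h' where h': "\<And>x. (h has_real_derivative h' x) (at x)" "D_k k h'" by auto
  show ?case
  proof (rule C_k_SucI[where g="\<lambda>x. h' (f x) *\<^sub>R gradient f x"])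
    fix x
    show "((\<lambda>x. h (f x)) has_derivative (\<lambda>q. q \<bullet> h' (f x) *\<^sub>R gradient f x)) (at x)"
      using has_derivative_compose[of f "\<lambda>q. q \<bullet> gradient f x" x UNIV h "\<lambda>q. h' (f x) * q"]
        C_k_Suc_has_derivative[OF Suc.prems(2), of x] h'(1)[of "f x"] by (auto simp: has_field_derivative_def)
    show "C_k k (\<lambda>x. (h' (f x) *\<^sub>R gradient f x) $ i)" for i
      using C_k_mult[of k "\<lambda>x. h' (f x)" "\<lambda>x. gradient f x $ i"] Suc C_k_Suc_D h'(2) by auto
  qed
qed

definition flat :: "nat => real => real" where
  "flat n t = (if t > 0 then inverse t ^ n * exp (- inverse t) else 0)"

text \<open>
  The derivative of a member of the family is a combination of members, so one induction shows that all of them are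
  smooth. At 0 the exponential function beats every power of the inverse.
\<close>

lemma flat_has_derivative:
  "(flat n has_real_derivative (flat (n + 2) t - n * flat (n + 1) t)) (at t)"
proof -
  consider "t > 0" | "t < 0" | "t = 0" by linarith
  then show ?thesis
  proof cases
    case 1
    have I: "(inverse has_real_derivative - (inverse t ^ 2)) (at t)"
      using DERIV_inverse[of t] 1 by (simp add: power2_eq_square)
    have "((\<lambda>t. inverse t ^ n) has_real_derivative - (real n * inverse t ^ (n + 1))) (at t)"
      by (rule DERIV_cong[OF DERIV_power[OF I]]) (cases n; simp add: power2_eq_square ac_simps)
    moreover have "((\<lambda>t. exp (- inverse t)) has_real_derivative exp (- inverse t) * inverse t ^ 2) (at t)"
      using DERIV_chain2[OF DERIV_exp DERIV_minus[OF I]] by simp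
    ultimately have "((\<lambda>t. inverse t ^ n * exp (- inverse t)) has_real_derivative
        - (real n * inverse t ^ (n + 1)) * exp (- inverse t)
        + (exp (- inverse t) * inverse t ^ 2) * inverse t ^ n) (at t)" by (rule DERIV_mult)
    then have "((\<lambda>t. inverse t ^ n * exp (- inverse t)) has_real_derivative
        (flat (n + 2) t - n * flat (n + 1) t)) (at t)"
      by (rule DERIV_cong) (use 1 in \<open>simp add: flat_def power2_eq_square algebra_simps\<close>)
    then show ?thesis by (rule has_field_derivative_transform_within_open[where S="{0<..}"])
        (use 1 in \<open>auto simp: flat_def\<close>)
  next
    case 2
    have "((\<lambda>t. 0) has_real_derivative (flat (n + 2) t - n * flat (n + 1) t)) (at t)"
      using 2 by (simp add: flat_def)
    then show ?thesis by (rule has_field_derivative_transform_within_open[where S="{..<0}"])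
        (use 2 in \<open>auto simp: flat_def\<close>)
  next
    case 3
    have lim: "((\<lambda>x. x ^ Suc n / exp x) \<longlongrightarrow> (0::real)) at_top" by (rule tendsto_power_div_exp_0)
    have "((\<lambda>h. inverse h ^ Suc n / exp (inverse h)) \<longlongrightarrow> (0::real)) (at_right 0)"
      by (rule filterlim_compose[OF lim filterlim_inverse_at_top_right])
    then have R: "((\<lambda>h. flat n h / h) \<longlongrightarrow> 0) (at_right 0)" by (rule Lim_transform_eventually)
        (auto simp: eventually_at_filter flat_def exp_minus field_simps)
    have L: "((\<lambda>h. flat n h / h) \<longlongrightarrow> 0) (at_left 0)"
      by (rule Lim_transform_eventually[where f="\<lambda>x. 0"]) (auto simp: eventually_at_filter flat_def)
    have "((\<lambda>h. flat n h / h) \<longlongrightarrow> 0) (at 0)" using L R filterlim_split_at_real by blast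
    then show ?thesis using 3 by (simp add: DERIV_def flat_def)
  qed
qed

lemma D_k_flat: "D_k k (flat n)"
proof (induction k arbitrary: n)
  case 0
  show ?case using flat_has_derivative by (auto intro!: DERIV_continuous_on)
next
  case (Suc k)
  have "D_k k (\<lambda>t. flat (n + 2) t + (- real n) * flat (n + 1) t)" by (intro D_k_add D_k_cmult Suc)
  then show ?case using flat_has_derivative[of n]
    by (auto intro!: exI[where x="\<lambda>t. flat (n + 2) t + (- real n) * flat (n + 1) t"])
qed

lemma flat_nonpos: "t \<le> 0 ==> flat n t = 0" by (simp add: flat_def)

lemma flat0_mono: "s \<le> t ==> flat 0 s \<le> flat 0 t" by (auto simp: flat_def le_imp_inverse_le)

lemma flat0_bounds: "0 \<le> flat 0 t" "flat 0 t \<le> 1" by (auto simp: flat_def)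

text \<open>
  A smooth plateau: applying the flat function to itself upside down turns the set where it vanishes into a set on which
  the result is constant.
\<close>

lemma exists_smooth_cutoff:
  fixes x0 :: "real^2"
  assumes "0 < r"
  shows "\<exists>b. (\<forall>k. C_k k b) \<and> (\<forall>x\<in>ball x0 r. b x = 1) \<and> (\<forall>x. x \<notin> ball x0 (2 * r) --> b x = 0)
    \<and> (\<forall>x. 0 \<le> b x \<and> b x \<le> 1)"
proof -
  define p where "p x = (x - x0) \<bullet> axis 1 1 * ((x - x0) \<bullet> axis 1 1)
    + (x - x0) \<bullet> axis 2 1 * ((x - x0) \<bullet> axis 2 1)" for x
  have p: "p x = (dist x0 x)\<^sup>2" for x
    by (simp add: p_def inner_axis dist_norm norm_minus_commute[of x0] power2_norm_eq_inner)
      (simp add: inner_vec_def sum_2)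
  define t where "t x = (1 / r\<^sup>2) * p x + (- 1)" for x
  define b where "b x = exp 1 * flat 0 (1 + (- exp 1) * flat 0 (t x))" for x
  (* t is negative inside the small ball and at least 1 outside the large one *)
  have "C_k k t" for k unfolding t_def p_def by (intro C_k_add C_k_mult C_k_const C_k_inner)
  then have C: "C_k k b" for k unfolding b_def by (intro C_k_mult C_k_const C_k_compose[OF D_k_flat] C_k_add)
  have 1: "b x = 1" if "x \<in> ball x0 r" for x
  proof -
    have "(dist x0 x)\<^sup>2 \<le> r\<^sup>2" using that by (intro power_mono) auto
    then have "t x \<le> 0" using assms by (simp add: t_def p)
    then show ?thesis by (simp add: b_def flat_def exp_minus)
  qed
  have 0: "b x = 0" if "x \<notin> ball x0 (2 * r)" for x
  proof -
    have "(2 * r)\<^sup>2 \<le> (dist x0 x)\<^sup>2" using that assms by (intro power_mono) auto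
    then have "(dist x0 x)\<^sup>2 / r\<^sup>2 \<ge> 4" using assms by (simp add: power_mult_distrib field_simps)
    then have "t x \<ge> 1" by (simp add: t_def p)
    then have "flat 0 (t x) \<ge> flat 0 1" by (rule flat0_mono)
    then have "exp 1 * flat 0 (t x) \<ge> exp 1 * flat 0 1" by (intro mult_left_mono) auto
    then have "exp 1 * flat 0 (t x) \<ge> 1" by (simp add: flat_def exp_minus)
    then show ?thesis by (simp add: b_def flat_nonpos)
  qed
  have "0 \<le> b x \<and> b x \<le> 1" for x
  proof -
    have "flat 0 (1 + (- exp 1) * flat 0 (t x)) \<le> flat 0 1" by (rule flat0_mono) (simp add: flat0_bounds)
    then have "b x \<le> exp 1 * flat 0 1" by (simp add: b_def)
    also have "... = 1" by (simp add: flat_def exp_minus)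
    finally show ?thesis by (simp add: b_def flat0_bounds)
  qed
  with C 0 1 show ?thesis by blast
qed

lemma test_functionsI:
  "(\<And>k. C_k k \<phi>) ==> compact M ==> M \<subseteq> U ==> (\<And>x. x \<notin> M ==> \<phi> x = 0) ==> \<phi> \<in> test_functions U"
  by (auto simp: test_functions_def)

text \<open>
  The functions flat 0 ((n + 1) t) increase to the indicator function of the positive numbers. A product of four of them,
  one for each side, approximates a box from inside.
\<close>

lemma exists_smooth_box_approximation:
  fixes a b :: "real^2"
  assumes "cbox a b \<subseteq> U"
  shows "\<exists>\<phi>. (\<forall>n. \<phi> n \<in> test_functions U) \<and> (\<forall>n x. 0 \<le> \<phi> n x \<and> \<phi> n x \<le> 1) \<and>
     (\<forall>n x. x \<notin> box a b --> \<phi> n x = 0) \<and> (\<forall>x. (\<lambda>n. \<phi> n x) \<longlonglongrightarrow> indicator (box a b) x)"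
proof -
  define s where "s n t = flat 0 (real (Suc n) * t)" for n t
  have s_lim: "(\<lambda>n. s n t) \<longlonglongrightarrow> (if t > 0 then 1 else 0)" for t
  proof (cases "t > 0")
    case True
    have "(\<lambda>n. exp (- (inverse t * inverse (real (Suc n))))) \<longlonglongrightarrow> exp (- (inverse t * 0))"
      by (intro tendsto_intros LIMSEQ_inverse_real_of_nat)
    then show ?thesis using True by (simp add: s_def flat_def zero_less_mult_iff ac_simps)
  next
    case False
    then have "real (Suc n) * t \<le> 0" for n by (simp add: mult_nonneg_nonpos)
    then show ?thesis using False by (simp add: s_def flat_nonpos)
  qed
  have s_lim1: "(\<lambda>n. s n t) \<longlonglongrightarrow> 1" if "t > 0" for t using s_lim[of t] that by simp
  have s01: "0 \<le> s n t" "s n t \<le> 1" for n t by (simp_all add: s_def flat0_bounds)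
  have s0: "s n t = 0" if "t \<le> 0" for n t using that by (simp add: s_def flat_nonpos mult_nonneg_nonpos)
  define \<phi> where "\<phi> n x = (s n ((x - a) \<bullet> axis 1 1) * s n ((x - b) \<bullet> (- axis 1 1))) *
    (s n ((x - a) \<bullet> axis 2 1) * s n ((x - b) \<bullet> (- axis 2 1)))" for n x
  have C: "C_k k (\<phi> n)" for k n unfolding \<phi>_def s_def
    by (intro C_k_mult C_k_compose[OF D_k_flat] C_k_const C_k_inner)
  have in_box: "x \<in> box a b \<longleftrightarrow> (x - a) \<bullet> axis 1 1 > 0 \<and> (x - b) \<bullet> (- axis 1 1) > 0
     \<and> (x - a) \<bullet> axis 2 1 > 0 \<and> (x - b) \<bullet> (- axis 2 1) > 0" for x
    by (auto simp: mem_box_cart forall_2 inner_axis)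
  have z: "\<phi> n x = 0" if "x \<notin> box a b" for n x using that unfolding in_box \<phi>_def by (auto simp: s0 not_less)
  have "\<phi> n \<in> test_functions U" for n
  proof -
    have "\<phi> n x = 0" if "x \<notin> cbox a b" for x using that z box_subset_cbox[of a b] by auto
    then show ?thesis by (rule test_functionsI[OF C compact_cbox assms])
  qed
  moreover have "0 \<le> \<phi> n x \<and> \<phi> n x \<le> 1" for n x
    unfolding \<phi>_def by (auto intro!: mult_nonneg_nonneg mult_le_one s01)
  moreover have "(\<lambda>n. \<phi> n x) \<longlonglongrightarrow> indicator (box a b) x" for x
  proof (cases "x \<in> box a b")
    case True
    have "(\<lambda>n. \<phi> n x) \<longlonglongrightarrow> (1 * 1) * (1 * 1)"
      unfolding \<phi>_def by (intro tendsto_mult) (use True in \<open>auto simp: in_box intro!: s_lim1\<close>)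
    then show ?thesis using True by simp
  qed (simp add: z)
  ultimately show ?thesis using z by blast
qed


lemma test_has_derivative:
  "\<phi> \<in> test_functions U ==> (\<phi> has_derivative (\<lambda>q. q \<bullet> gradient \<phi> x)) (at x)"
  unfolding test_functions_def using C_k_Suc_has_derivative by blast

lemma smooth_continuous: "(\<And>k. C_k k \<phi>) ==> continuous_on UNIV \<phi>" by (metis C_k.simps(1))

lemma smooth_continuous_gradient: "(\<And>k. C_k k \<phi>) ==> continuous_on UNIV (gradient \<phi>)"
proof -
  assume "\<And>k. C_k k \<phi>"
  then have "C_k 0 (\<lambda>x. gradient \<phi> x $ i)" for i by (metis C_k.simps(2))
  then show ?thesis by (simp add: continuous_on_componentwise[of UNIV "gradient \<phi>"] Basis_vec_def inner_axis)
qed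

lemma gradient_outside_support:
  assumes "compact M" "\<And>x. x \<notin> M ==> \<phi> x = 0" "x \<notin> M"
  shows "gradient \<phi> x = 0"
proof (rule gradient_eqI)
  have "open (- M)" using assms compact_imp_closed by blast
  have "((\<lambda>x. 0) has_derivative (\<lambda>q. q \<bullet> 0)) (at x)" by simp
  then show "(\<phi> has_derivative (\<lambda>q. q \<bullet> 0)) (at x)"
    by (rule has_derivative_transform_within_open[where s="- M"]) (use assms \<open>open (- M)\<close> in auto)
qed

lemma compact_support_bounded:
  fixes h :: "real^2 => 'b::real_normed_vector"
  assumes "continuous_on UNIV h" "compact M" "\<And>x. x \<notin> M ==> h x = 0"
  shows "\<exists>B>0. \<forall>x. norm (h x) \<le> B"
proof -
  have "compact (h ` M)" using assms by (auto intro: compact_continuous_image continuous_on_subset)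
  then obtain B where "B > 0" "\<And>y. y \<in> h ` M ==> norm y \<le> B" using compact_imp_bounded bounded_pos by metis
  then have "norm (h x) \<le> B" for x using assms(3)[of x] by (cases "x \<in> M") auto
  with \<open>B > 0\<close> show ?thesis by blast
qed

lemma test_bounded:
  assumes "\<phi> \<in> test_functions U"
  shows "\<exists>B>0. \<forall>x. \<bar>\<phi> x\<bar> \<le> B \<and> norm (gradient \<phi> x) \<le> B"
proof -
  from assms obtain M where M: "compact M" "\<And>x. x \<notin> M ==> \<phi> x = 0" and C: "\<And>k. C_k k \<phi>"
    by (auto simp: test_functions_def)
  obtain B1 where "B1 > 0" "\<forall>x. norm (\<phi> x) \<le> B1"
    using compact_support_bounded[OF smooth_continuous[OF C] M] by blast
  moreover obtain B2 where "B2 > 0" "\<forall>x. norm (gradient \<phi> x) \<le> B2"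
    using compact_support_bounded[OF smooth_continuous_gradient[OF C] M(1)]
      gradient_outside_support[of M \<phi>] M by metis
  ultimately show ?thesis by (intro exI[of _ "max B1 B2"]) (auto simp: le_max_iff_disj)
qed

lemma test_borel:
  assumes "\<phi> \<in> test_functions U"
  shows "\<phi> \<in> borel_measurable borel" "gradient \<phi> \<in> borel_measurable borel"
  using assms smooth_continuous smooth_continuous_gradient
  by (auto simp: test_functions_def intro!: borel_measurable_continuous_onI)

lemma test_zero_outside:
  assumes "\<phi> \<in> test_functions U" "x \<notin> U"
  shows "\<phi> x = 0" "gradient \<phi> x = 0"
  using assms gradient_outside_support unfolding test_functions_def by (blast, blast)

lemma test_mono: "\<phi> \<in> test_functions U ==> U \<subseteq> V ==> \<phi> \<in> test_functions V" by (auto simp: test_functions_def)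

lemma test_mult:
  assumes "\<And>k. C_k k b" "\<And>x. x \<notin> B ==> b x = 0" "closed B" "\<phi> \<in> test_functions U"
  shows "(\<lambda>x. b x * \<phi> x) \<in> test_functions (U \<inter> B)"
proof -
  from assms obtain M where M: "compact M" "M \<subseteq> U" "\<And>x. x \<notin> M ==> \<phi> x = 0" and C: "\<And>k. C_k k \<phi>"
    by (auto simp: test_functions_def)
  have "compact (M \<inter> B)" using M assms by (simp add: compact_Int_closed)
  then show ?thesis using M assms C by (auto simp: test_functions_def intro!: C_k_mult exI[of _ "M \<inter> B"])
qed

lemma gradient_mult:
  assumes "\<And>k. C_k k b" "\<And>k. C_k k \<phi>"
  shows "gradient (\<lambda>x. b x * \<phi> x) x = b x *\<^sub>R gradient \<phi> x + \<phi> x *\<^sub>R gradient b x"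
  using C_k_Suc_has_derivative[OF assms(1)[of "Suc 0"], of x]
    C_k_Suc_has_derivative[OF assms(2)[of "Suc 0"], of x]
  by (intro gradient_eqI) (auto intro!: derivative_eq_intros simp: inner_add_right algebra_simps)

lemma test_shift:
  assumes "\<phi> \<in> test_functions A" "\<And>x. x \<in> A ==> x + a \<in> U"
  shows "(\<lambda>x. \<phi> (x - a)) \<in> test_functions U"
proof -
  from assms obtain M where M: "compact M" "M \<subseteq> A" "\<And>x. x \<notin> M ==> \<phi> x = 0" and C: "\<And>k. C_k k \<phi>"
    by (auto simp: test_functions_def)
  have 1: "compact ((+) a ` M)" using M compact_translation by blast
  have 2: "(+) a ` M \<subseteq> U" using M assms(2) by (auto simp: add.commute)
  have 3: "\<phi> (x - a) = 0" if "x \<notin> (+) a ` M" for x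
    using M(3)[of "x - a"] that by (metis add_diff_cancel_left' image_eqI diff_add_cancel add.commute)
  show ?thesis using C 1 2 3 by (auto simp: test_functions_def intro!: C_k_shift exI[of _ "(+) a ` M"])
qed

lemma gradient_shift:
  assumes "\<And>k. C_k k \<phi>"
  shows "gradient (\<lambda>x. \<phi> (x - a)) x = gradient \<phi> (x - a)"
proof (rule gradient_eqI)
  show "((\<lambda>x. \<phi> (x - a)) has_derivative (\<lambda>q. q \<bullet> gradient \<phi> (x - a))) (at x)"
    by (rule has_derivative_compose[OF _ C_k_Suc_has_derivative[OF assms[of "Suc 0"]]])
      (auto intro!: derivative_eq_intros)
qed

section \<open>Square-integrable functions\<close>

definition L2 :: "'a measure => ('a => 'b::euclidean_space) => bool" where
  "L2 M f \<longleftrightarrow> f \<in> borel_measurable M \<and> integrable M (\<lambda>x. (norm (f x))\<^sup>2)"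

definition nsq :: "'a measure => ('a => 'b::euclidean_space) => real" where
  "nsq M f = (\<integral>x. (norm (f x))\<^sup>2 \<partial>M)"

text \<open>Squared norms and squared distances in mean square; the short forms refer to Lebesgue measure.\<close>

abbreviation "sqn f \<equiv> nsq lborel f"
abbreviation "sq_dist M f g \<equiv> nsq M (\<lambda>x. f x - g x)"
abbreviation "sqd f g \<equiv> nsq lborel (\<lambda>x. f x - g x)"

lemma L2_measurable: "L2 M f ==> f \<in> borel_measurable M"
  and L2_integrable_sq: "L2 M f ==> integrable M (\<lambda>x. (norm (f x))\<^sup>2)" by (auto simp: L2_def)

lemma nsq_nonneg [simp]: "0 \<le> nsq M f" by (simp add: nsq_def)

lemma nsq_nn_integral: "L2 M f ==> (\<integral>\<^sup>+x. ennreal ((norm (f x))\<^sup>2) \<partial>M) = ennreal (nsq M f)"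
  unfolding nsq_def by (intro nn_integral_eq_integral) (auto simp: L2_def)

lemma L2_nn_integralI:
  assumes "f \<in> borel_measurable M" "(\<integral>\<^sup>+x. ennreal ((norm (f x))\<^sup>2) \<partial>M) \<le> ennreal B" "0 \<le> B"
  shows "L2 M f" "nsq M f \<le> B"
proof -
  show L: "L2 M f"
    unfolding L2_def using assms by (intro conjI integrableI_bounded) (auto simp: le_less_trans)
  show "nsq M f \<le> B" using assms nsq_nn_integral[OF L] by simp
qed

lemma L2_dominated:
  assumes "L2 M g" "f \<in> borel_measurable M" "\<And>x. norm (f x) \<le> c * norm (g x)" "c \<ge> 0"
  shows "L2 M f" "nsq M f \<le> c\<^sup>2 * nsq M g"
proof -
  have *: "(norm (f x))\<^sup>2 \<le> c\<^sup>2 * (norm (g x))\<^sup>2" for x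
    using power_mono[OF assms(3)[of x], of 2] by (simp add: power_mult_distrib)
  have i: "integrable M (\<lambda>x. c\<^sup>2 * (norm (g x))\<^sup>2)" using assms by (auto simp: L2_def)
  have i': "integrable M (\<lambda>x. (norm (f x))\<^sup>2)"
    by (rule Bochner_Integration.integrable_bound[OF i]) (use assms * in auto)
  then show "L2 M f" using assms by (simp add: L2_def)
  show "nsq M f \<le> c\<^sup>2 * nsq M g" using integral_mono[OF i' i *] by (simp add: nsq_def)
qed

lemma norm_add_sq_le: "(norm (a + b))\<^sup>2 \<le> 2 * (norm a)\<^sup>2 + 2 * (norm (b::'b::real_inner))\<^sup>2"
  using zero_le_power2[of "norm (a - b)"]
  by (simp add: power2_norm_eq_inner inner_add_left inner_add_right inner_diff_left inner_diff_right inner_commute)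

lemma L2_add:
  assumes "L2 M f" "L2 M g"
  shows "L2 M (\<lambda>x. f x + g x)" "nsq M (\<lambda>x. f x + g x) \<le> 2 * nsq M f + 2 * nsq M g"
proof -
  have i: "integrable M (\<lambda>x. 2 * (norm (f x))\<^sup>2 + 2 * (norm (g x))\<^sup>2)" using assms by (auto simp: L2_def)
  have m: "(\<lambda>x. f x + g x) \<in> borel_measurable M" using assms by (auto simp: L2_def)
  have i': "integrable M (\<lambda>x. (norm (f x + g x))\<^sup>2)"
    by (rule Bochner_Integration.integrable_bound[OF i]) (use m norm_add_sq_le in auto)
  then show "L2 M (\<lambda>x. f x + g x)" using m by (simp add: L2_def)
  have "nsq M (\<lambda>x. f x + g x) \<le> (\<integral>x. 2 * (norm (f x))\<^sup>2 + 2 * (norm (g x))\<^sup>2 \<partial>M)"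
    unfolding nsq_def by (intro integral_mono i i' norm_add_sq_le)
  then show "nsq M (\<lambda>x. f x + g x) \<le> 2 * nsq M f + 2 * nsq M g" using assms by (simp add: nsq_def L2_def)
qed

lemma L2_scaleR: "L2 M f ==> L2 M (\<lambda>x. c *\<^sub>R f x)" and nsq_scaleR: "nsq M (\<lambda>x. c *\<^sub>R f x) = c\<^sup>2 * nsq M f"
  by (auto simp: L2_def nsq_def power_mult_distrib)

lemma L2_minus: "L2 M f ==> L2 M (\<lambda>x. - f x)" and nsq_minus: "nsq M (\<lambda>x. - f x) = nsq M f"
  by (auto simp: L2_def nsq_def)

lemma L2_diff:
  assumes "L2 M f" "L2 M g"
  shows "L2 M (\<lambda>x. f x - g x)" "sq_dist M f g \<le> 2 * nsq M f + 2 * nsq M g"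
  using L2_add[OF assms(1) L2_minus[OF assms(2)]] by (simp_all add: nsq_minus)

lemma nsq_diff_commute: "sq_dist M f g = sq_dist M g f" by (simp add: nsq_def norm_minus_commute)

lemma nsq_triangle:
  assumes "L2 M f" "L2 M g" "L2 M h"
  shows "sq_dist M f h \<le> 2 * sq_dist M f g + 2 * sq_dist M g h"
  using L2_add(2)[OF L2_diff(1)[OF assms(1,2)] L2_diff(1)[OF assms(2,3)]] by simp

lemma nsq_triangle':
  assumes "L2 M f" "L2 M g"
  shows "nsq M f \<le> 2 * sq_dist M f g + 2 * nsq M g"
  using L2_add(2)[OF L2_diff(1)[OF assms(1,2)] assms(2)] by simp

lemma L2_zero [simp]: "L2 M (\<lambda>x. 0)" by (simp add: L2_def)

lemma nsq_zero [simp]: "nsq M (\<lambda>x. 0) = 0" by (simp add: nsq_def)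

lemma nsq_cong_AE:
  assumes "AE x in M. f x = g x" "f \<in> borel_measurable M" "g \<in> borel_measurable M"
  shows "nsq M f = nsq M g" unfolding nsq_def by (rule integral_cong_AE) (use assms in auto)

lemma nsq_eq_0_AE:
  assumes "L2 M f" "nsq M f = 0"
  shows "AE x in M. f x = 0"
  using integral_nonneg_eq_0_iff_AE[OF L2_integrable_sq[OF assms(1)]] assms(2) by (simp add: nsq_def)

lemma L2_inner:
  assumes "L2 M f" "L2 M g"
  shows "integrable M (\<lambda>x. f x \<bullet> g x)"
proof (rule Bochner_Integration.integrable_bound)
  show "integrable M (\<lambda>x. (norm (f x))\<^sup>2 + (norm (g x))\<^sup>2)" using assms by (auto simp: L2_def)
  show "AE x in M. norm (f x \<bullet> g x) \<le> norm ((norm (f x))\<^sup>2 + (norm (g x))\<^sup>2)"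
  proof (rule AE_I2)
    fix x
    have "\<bar>f x \<bullet> g x\<bar> \<le> norm (f x) * norm (g x)" by (rule Cauchy_Schwarz_ineq2)
    also have "... \<le> (norm (f x))\<^sup>2 + (norm (g x))\<^sup>2"
      using sum_squares_bound[of "norm (f x)" "norm (g x)"]
        mult_nonneg_nonneg[OF norm_ge_zero norm_ge_zero, of "f x" "g x"] by linarith
    finally show "norm (f x \<bullet> g x) \<le> norm ((norm (f x))\<^sup>2 + (norm (g x))\<^sup>2)" by simp
  qed
qed (use assms in \<open>auto simp: L2_def\<close>)

lemma nsq_add_scaled:
  assumes "L2 M f" "L2 M g"
  shows "nsq M (\<lambda>x. f x + t *\<^sub>R g x) = nsq M f + 2 * t * (\<integral>x. f x \<bullet> g x \<partial>M) + t\<^sup>2 * nsq M g"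
proof -
  have "(norm (f x + t *\<^sub>R g x))\<^sup>2 = (norm (f x))\<^sup>2 + (2 * t * (f x \<bullet> g x) + t\<^sup>2 * (norm (g x))\<^sup>2)" for x
    unfolding power2_norm_eq_inner
    by (simp add: inner_add_left inner_add_right inner_commute algebra_simps power2_eq_square)
  then show ?thesis using assms L2_inner[OF assms] by (simp add: nsq_def L2_def)
qed

lemma quadratic_nonneg_imp:
  fixes a b c :: real
  assumes "\<And>t. 0 \<le> a + 2 * t * b + t\<^sup>2 * c" "0 \<le> c"
  shows "b\<^sup>2 \<le> a * c"
proof (cases "c = 0")
  case True
  have "b = 0"
  proof (rule ccontr)
    assume "b \<noteq> 0"
    then show False using assms(1)[of "- (a + 1) / (2 * b)"] True by (simp add: field_simps)
  qed
  then show ?thesis using True by simp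
next
  case False
  then have "c > 0" using assms by simp
  then show ?thesis using assms(1)[of "- b / c"] by (simp add: field_simps power2_eq_square)
qed

lemma L2_Cauchy_Schwarz:
  assumes "L2 M f" "L2 M g"
  shows "(\<integral>x. f x \<bullet> g x \<partial>M)\<^sup>2 \<le> nsq M f * nsq M g"
  by (rule quadratic_nonneg_imp) (auto simp flip: nsq_add_scaled[OF assms])

text \<open>
  Along a subsequence the squared increments, weighted by the powers of 2, have a finite sum of integrals, which makes
  the increments absolutely summable almost everywhere. Fatou's lemma shows that the pointwise limit is also the limit in
  mean square.
\<close>

lemma L2_complete:
  fixes f :: "nat => 'a => 'b::euclidean_space"
  assumes L: "\<And>n. L2 M (f n)"
    and C: "\<And>e. e > 0 ==> \<exists>N. \<forall>m\<ge>N. \<forall>n\<ge>N. sq_dist M (f m) (f n) < e"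
  shows "\<exists>g. L2 M g \<and> (\<lambda>n. sq_dist M (f n) g) \<longlonglongrightarrow> 0"
proof -
  have [measurable]: "f n \<in> borel_measurable M" for n using L by (rule L2_measurable)
  obtain N where N: "\<And>k m n. m \<ge> N k ==> n \<ge> N k ==> sq_dist M (f m) (f n) < (1 / 4) ^ k"
    using C[of "(1 / 4) ^ k" for k] by (metis zero_less_power zero_less_divide_1_iff zero_less_numeral)
  define r where "r k = (\<Sum>j\<le>k. N j) + k" for k
  have rN: "r k \<ge> N k" "r (Suc k) \<ge> N k" "r k \<ge> k" for k
    by (auto simp: r_def intro: member_le_sum order_trans[OF member_le_sum[of k "{..k}" N]])
  define d where "d k x = f (r (Suc k)) x - f (r k) x" for k x
  have Ld: "L2 M (d k)" for k unfolding d_def by (rule L2_diff(1)[OF L L])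
  have "(\<integral>\<^sup>+x. (\<Sum>k. ennreal (2 ^ k * (norm (d k x))\<^sup>2)) \<partial>M) = (\<Sum>k. \<integral>\<^sup>+x. ennreal (2 ^ k * (norm (d k x))\<^sup>2) \<partial>M)"
    using L2_measurable[OF Ld] by (intro nn_integral_suminf) measurable
  also have "... \<le> (\<Sum>k. ennreal ((1 / 2) ^ k))"
  proof (intro suminf_le summableI)
    fix k
    have "(\<integral>\<^sup>+x. ennreal (2 ^ k * (norm (d k x))\<^sup>2) \<partial>M) = ennreal (2 ^ k) * ennreal (nsq M (d k))"
      using L2_measurable[OF Ld[of k]]
      by (simp add: ennreal_mult nn_integral_cmult nsq_nn_integral[OF Ld, symmetric])
    also have "... \<le> ennreal (2 ^ k) * ennreal ((1 / 4) ^ k)"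
      using N[OF rN(2) rN(1), of k] by (intro mult_left_mono ennreal_leI) (auto simp: d_def[abs_def])
    also have "... = ennreal ((1 / 2) ^ k)" by (simp flip: ennreal_mult power_mult_distrib)
    finally show "(\<integral>\<^sup>+x. ennreal (2 ^ k * (norm (d k x))\<^sup>2) \<partial>M) \<le> ennreal ((1 / 2) ^ k)" .
  qed
  also have "... = ennreal (\<Sum>k. (1 / 2) ^ k)" by (intro suminf_ennreal2) (auto simp: summable_geometric)
  finally have fin: "(\<integral>\<^sup>+x. (\<Sum>k. ennreal (2 ^ k * (norm (d k x))\<^sup>2)) \<partial>M) \<noteq> \<infinity>" by (auto simp: top_unique)
  have "AE x in M. (\<Sum>k. ennreal (2 ^ k * (norm (d k x))\<^sup>2)) \<noteq> \<infinity>"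
    by (rule nn_integral_PInf_AE[OF _ fin]) (use L2_measurable[OF Ld] in measurable)
  then have conv: "AE x in M. convergent (\<lambda>k. f (r k) x)"
  proof eventually_elim
    case (elim x)
    then have "summable (\<lambda>k. 2 ^ k * (norm (d k x))\<^sup>2)" by (intro summable_suminf_not_top) auto
    then have s: "summable (\<lambda>k. (1 / 2) ^ k + 2 ^ k * (norm (d k x))\<^sup>2)"
      by (intro summable_add) (auto simp: summable_geometric)
    (* with c = 2^(-k), the bound is |d| c \<le> c^2 + d^2 divided by c *)
    have "summable (\<lambda>k. d k x)"
    proof (rule summable_comparison_test'[OF s])
      fix k
      define c :: real where "c = (1 / 2) ^ k"
      have c: "c > 0" "2 ^ k = 1 / c" by (auto simp: c_def power_one_over)
      have "norm (d k x) * c \<le> c * c + (norm (d k x))\<^sup>2"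
        using sum_squares_bound[of "norm (d k x)" c] mult_nonneg_nonneg[of "norm (d k x)" c] c(1)
        by (simp add: power2_eq_square del: mult_nonneg_nonneg zero_le_mult_iff)
      then show "norm (d k x) \<le> (1 / 2) ^ k + 2 ^ k * (norm (d k x))\<^sup>2"
        unfolding c(2) c_def[symmetric] using c(1) by (simp add: field_simps)
    qed
    then have "convergent (\<lambda>n. \<Sum>k<n. d k x)" by (simp add: summable_iff_convergent)
    then have "convergent (\<lambda>n. f (r n) x - f (r 0) x)"
      unfolding d_def by (simp only: sum_lessThan_telescope[of "\<lambda>k. f (r k) x"])
    then obtain l where "(\<lambda>n. f (r n) x - f (r 0) x) \<longlonglongrightarrow> l" by (auto simp: convergent_def)
    then have "(\<lambda>n. f (r n) x - f (r 0) x + f (r 0) x) \<longlonglongrightarrow> l + f (r 0) x" by (intro tendsto_intros)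
    then show ?case by (auto simp: convergent_def)
  qed
  define g where "g x = lim (\<lambda>k. f (r k) x)" for x
  have [measurable]: "g \<in> borel_measurable M" unfolding g_def by measurable
  have lim: "AE x in M. (\<lambda>k. f (r k) x) \<longlonglongrightarrow> g x"
    using conv by eventually_elim (simp add: g_def convergent_LIMSEQ_iff)
  have bound: "(\<integral>\<^sup>+x. ennreal ((norm (f n x - g x))\<^sup>2) \<partial>M) \<le> ennreal e"
    if n: "\<forall>k\<ge>N'. sq_dist M (f n) (f k) < e" for n e N'
  proof -
    have "(\<integral>\<^sup>+x. ennreal ((norm (f n x - g x))\<^sup>2) \<partial>M)
       = (\<integral>\<^sup>+x. liminf (\<lambda>k. ennreal ((norm (f n x - f (r k) x))\<^sup>2)) \<partial>M)"
      using lim by (intro nn_integral_cong_AE, eventually_elim)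
        (auto intro!: lim_imp_Liminf[symmetric] tendsto_intros)
    also have "... \<le> liminf (\<lambda>k. \<integral>\<^sup>+x. ennreal ((norm (f n x - f (r k) x))\<^sup>2) \<partial>M)"
      by (rule nn_integral_liminf) auto
    also have "... = liminf (\<lambda>k. ennreal (sq_dist M (f n) (f (r k))))"
      using nsq_nn_integral[OF L2_diff(1)[OF L L]] by simp
    also have "... \<le> ennreal e"
    proof (rule Liminf_le)
      have "ennreal (sq_dist M (f n) (f (r k))) \<le> ennreal e" if "k \<ge> N'" for k
        using n[rule_format, of "r k"] rN(3)[of k] that by (intro ennreal_leI) simp
      then show "\<forall>\<^sub>F k in sequentially. ennreal (sq_dist M (f n) (f (r k))) \<le> ennreal e"
        by (auto simp: eventually_sequentially)
    qed simp
    finally show ?thesis .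
  qed
  have Lfg: "L2 M (\<lambda>x. f n x - g x) \<and> sq_dist M (f n) g \<le> e"
    if "\<forall>k\<ge>N'. sq_dist M (f n) (f k) < e" "e > 0" for n e N'
    using L2_nn_integralI[OF _ bound[OF that(1)]] that(2) by simp
  obtain N1 where N1: "\<forall>m\<ge>N1. \<forall>n\<ge>N1. sq_dist M (f m) (f n) < 1" using C[of 1] by auto
  then have "L2 M (\<lambda>x. f N1 x - g x)" using Lfg[of N1 N1 1] by simp
  then have Lg: "L2 M g" using L2_diff(1)[OF L[of N1], of "\<lambda>x. f N1 x - g x"] by simp
  have "(\<lambda>n. sq_dist M (f n) g) \<longlonglongrightarrow> 0"
  proof (rule LIMSEQ_I)
    fix e :: real assume "e > 0"
    then obtain N' where "\<forall>m\<ge>N'. \<forall>n\<ge>N'. sq_dist M (f m) (f n) < e / 2" using C[of "e / 2"] by auto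
    then have "sq_dist M (f n) g \<le> e / 2" if "n \<ge> N'" for n using Lfg[of N' n "e / 2"] that \<open>e > 0\<close> by simp
    then show "\<exists>no. \<forall>n\<ge>no. norm (sq_dist M (f n) g - 0) < e"
      using \<open>e > 0\<close> by (intro exI[of _ N']) (force simp: field_simps)
  qed
  with Lg show ?thesis by blast
qed

lemma L2_limit_inner:
  assumes "\<And>n. L2 M (f n)" "L2 M g" "(\<lambda>n. sq_dist M (f n) g) \<longlonglongrightarrow> 0" "L2 M h"
  shows "(\<lambda>n. \<integral>x. f n x \<bullet> h x \<partial>M) \<longlonglongrightarrow> (\<integral>x. g x \<bullet> h x \<partial>M)"
proof -
  have "(\<lambda>n. sqrt (sq_dist M (f n) g * nsq M h)) \<longlonglongrightarrow> sqrt (0 * nsq M h)" by (intro tendsto_intros assms)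
  then have "(\<lambda>n. sqrt (sq_dist M (f n) g * nsq M h)) \<longlonglongrightarrow> 0" by simp
  then have "(\<lambda>n. (\<integral>x. f n x \<bullet> h x \<partial>M) - (\<integral>x. g x \<bullet> h x \<partial>M)) \<longlonglongrightarrow> 0"
  proof (rule Lim_null_comparison[rotated])
    show "\<forall>\<^sub>F n in sequentially. norm ((\<integral>x. f n x \<bullet> h x \<partial>M) - (\<integral>x. g x \<bullet> h x \<partial>M))
        \<le> sqrt (sq_dist M (f n) g * nsq M h)"
    proof (rule always_eventually, rule allI)
      fix n
      have "(\<integral>x. f n x \<bullet> h x \<partial>M) - (\<integral>x. g x \<bullet> h x \<partial>M) = (\<integral>x. (f n x - g x) \<bullet> h x \<partial>M)"
        using L2_inner[OF assms(1)[of n] assms(4)] L2_inner[OF assms(2,4)] by (simp add: inner_diff_left)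
      then show "norm ((\<integral>x. f n x \<bullet> h x \<partial>M) - (\<integral>x. g x \<bullet> h x \<partial>M))
        \<le> sqrt (sq_dist M (f n) g * nsq M h)"
        using L2_Cauchy_Schwarz[OF L2_diff(1)[OF assms(1)[of n] assms(2)] assms(4)]
        by (auto intro!: real_le_rsqrt)
    qed
  qed
  then show ?thesis by (simp add: LIM_zero_iff)
qed

lemma L2_integrable:
  assumes "L2 M f" "A \<in> sets M" "emeasure M A < \<infinity>" "\<And>x. x \<notin> A ==> f x = 0"
  shows "integrable M f"
proof (rule Bochner_Integration.integrable_bound)
  show "integrable M (\<lambda>x. indicator A x + (norm (f x))\<^sup>2)" using assms by (auto simp: L2_def)
  show "AE x in M. norm (f x) \<le> norm (indicator A x + (norm (f x))\<^sup>2)"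
  proof (rule AE_I2)
    fix x
    have "norm (f x) \<le> 1 + (norm (f x))\<^sup>2"
      using sum_squares_bound[of "norm (f x)" 1] norm_ge_zero[of "f x"] unfolding power_one by linarith
    then show "norm (f x) \<le> norm (indicator A x + (norm (f x))\<^sup>2)" using assms(4) by (cases "x \<in> A") auto
  qed
qed (use assms in \<open>auto simp: L2_def\<close>)


subsection \<open>Continuity of translations\<close>

lemma distr_lborel_shift: "distr lborel borel (\<lambda>x. x + c) = (lborel :: 'a::euclidean_space measure)"
proof -
  have "(\<lambda>x. x + c) = (+) c" by (auto simp: add.commute)
  then show ?thesis using lborel_distr_plus[of c] by simp
qed

lemma nn_integral_lborel_shift:
  fixes h :: "'a::euclidean_space => ennreal"
  assumes "h \<in> borel_measurable borel"
  shows "(\<integral>\<^sup>+x. h (x + c) \<partial>lborel) = (\<integral>\<^sup>+x. h x \<partial>lborel)"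
proof -
  have "(\<integral>\<^sup>+x. h x \<partial>lborel) = (\<integral>\<^sup>+x. h x \<partial>distr lborel borel (\<lambda>x. x + c))" by (simp add: distr_lborel_shift)
  also have "... = (\<integral>\<^sup>+x. h (x + c) \<partial>lborel)" using assms by (intro nn_integral_distr) auto
  finally show ?thesis ..
qed

lemma integral_lborel_shift:
  fixes h :: "'a::euclidean_space => 'b::euclidean_space"
  assumes "h \<in> borel_measurable borel"
  shows "(\<integral>x. h (x + c) \<partial>lborel) = (\<integral>x. h x \<partial>lborel)"
proof -
  have "(\<integral>x. h x \<partial>lborel) = (\<integral>x. h x \<partial>distr lborel borel (\<lambda>x. x + c))" by (simp add: distr_lborel_shift)
  also have "... = (\<integral>x. h (x + c) \<partial>lborel)" using assms by (intro integral_distr) auto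
  finally show ?thesis ..
qed

lemma integrable_lborel_shift:
  fixes h :: "'a::euclidean_space => 'b::euclidean_space"
  assumes "integrable lborel h"
  shows "integrable lborel (\<lambda>x. h (x + c))"
proof -
  have "integrable (distr lborel borel (\<lambda>x. x + c)) h" using assms by (simp add: distr_lborel_shift)
  then show ?thesis by (rule integrable_distr[rotated]) simp
qed

lemma
  fixes f :: "'a::euclidean_space => 'b::euclidean_space"
  assumes "L2 lborel f"
  shows L2_shift: "L2 lborel (\<lambda>x. f (x + c))" and nsq_shift: "sqn (\<lambda>x. f (x + c)) = sqn f"
proof -
  have m: "f \<in> borel_measurable borel" using L2_measurable[OF assms] by simp
  show "L2 lborel (\<lambda>x. f (x + c))"
    using m integrable_lborel_shift[OF L2_integrable_sq[OF assms], of c] by (simp add: L2_def)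
  show "sqn (\<lambda>x. f (x + c)) = sqn f"
    unfolding nsq_def using m by (intro integral_lborel_shift[of "\<lambda>x. (norm (f x))\<^sup>2"]) simp
qed

lemma L2_approx_by_bounded:
  assumes "L2 M f" "e > 0"
  shows "\<exists>K>0. nsq M (\<lambda>x. f x - (if norm (f x) \<le> K then f x else 0)) < e"
proof -
  have [measurable]: "f \<in> borel_measurable M" using assms by (simp add: L2_def)
  have "(\<lambda>n. nsq M (\<lambda>x. f x - (if norm (f x) \<le> real (Suc n) then f x else 0))) \<longlonglongrightarrow> (\<integral>x. 0 \<partial>M)"
    unfolding nsq_def
  proof (rule integral_dominated_convergence[OF _ _ L2_integrable_sq[OF assms(1)]])
    show "AE x in M. (\<lambda>n. (norm (f x - (if norm (f x) \<le> real (Suc n) then f x else 0)))\<^sup>2) \<longlonglongrightarrow> 0"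
    proof (rule AE_I2, rule tendsto_eventually)
      fix x
      show "\<forall>\<^sub>F n in sequentially. (norm (f x - (if norm (f x) \<le> real (Suc n) then f x else 0)))\<^sup>2 = 0"
        using eventually_ge_at_top[of "nat \<lceil>norm (f x)\<rceil>"] by eventually_elim (auto simp: nat_ceiling_le_eq)
    qed
  qed auto
  then have "\<forall>\<^sub>F n in sequentially. nsq M (\<lambda>x. f x - (if norm (f x) \<le> real (Suc n) then f x else 0)) < e"
    using assms(2) by (simp add: order_tendstoD)
  then obtain n where "nsq M (\<lambda>x. f x - (if norm (f x) \<le> real (Suc n) then f x else 0)) < e"
    by (auto simp: eventually_sequentially)
  then show ?thesis by (intro exI[of _ "real (Suc n)"]) auto
qed

text \<open>
  A measurable function is a limit almost everywhere of continuous functions. Projecting these to the ball of radius K and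
  cutting them off far away makes the convergence dominated.
\<close>

lemma L2_approx_by_continuous:
  fixes f :: "'a::euclidean_space => 'b::euclidean_space"
  assumes f: "f \<in> borel_measurable borel" "\<And>x. norm (f x) \<le> K" "\<And>x. x \<notin> ball 0 R ==> f x = 0"
    and "K > 0" "R > 0" "e > 0"
  shows "\<exists>w. continuous_on UNIV w \<and> (\<forall>x. x \<notin> ball 0 (2 * R) --> w x = 0) \<and> L2 lborel w
     \<and> sqd f w < e"
proof -
  have "f \<in> borel_measurable lebesgue" using f(1) by (intro measurable_completion) simp
  then have "f measurable_on UNIV" by (rule lebesgue_measurable_imp_measurable_on) simp
  then obtain N g where N: "negligible N" and g: "\<And>n. continuous_on UNIV (g n)"
    and lim: "\<And>x. x \<notin> N ==> (\<lambda>n. g n x) \<longlonglongrightarrow> f x" by (auto simp: measurable_on_def)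
  define c where "c x = max 0 (min 1 (2 - norm x / R))" for x :: 'a
  define w where "w n x = c x *\<^sub>R closest_point (cball 0 K) (g n x)" for n x
  have cp: "continuous_on UNIV (closest_point (cball (0::'b) K))"
    using assms by (intro continuous_on_closest_point) auto
  have w_cont: "continuous_on UNIV (w n)" for n
    unfolding w_def c_def using assms by (intro continuous_intros continuous_on_compose2[OF cp g]) auto
  have w0: "w n x = 0" if "x \<notin> ball 0 (2 * R)" for n x using that assms by (simp add: w_def c_def field_simps)
  have w_le: "norm (w n x) \<le> K" for n x
  proof -
    have "closest_point (cball 0 K) (g n x) \<in> cball 0 K" using assms by (intro closest_point_in_set) auto
    then have "norm (closest_point (cball 0 K) (g n x)) \<le> K" by simp
    moreover have "\<bar>c x\<bar> \<le> 1" by (auto simp: c_def)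
    ultimately show ?thesis unfolding w_def norm_scaleR
      using mult_mono[of "\<bar>c x\<bar>" 1 "norm (closest_point (cball 0 K) (g n x))" K] by simp
  qed
  have [measurable]: "w n \<in> borel_measurable borel" for n by (rule borel_measurable_continuous_onI[OF w_cont])
  have L: "integrable lborel (\<lambda>x. (2 * K)\<^sup>2 * indicat_real (ball 0 (2 * R)) x :: real)"
    by (intro integrable_mult_right integrable_real_indicator emeasure_lborel_ball_finite) simp
  have "(\<lambda>n. sqd f (w n)) \<longlonglongrightarrow> (\<integral>x. 0 \<partial>(lborel :: 'a measure))"
    unfolding nsq_def
  proof (rule integral_dominated_convergence[OF _ _ L])
    obtain N' where "N' \<in> null_sets lborel" "N \<subseteq> N'"
      using N by (auto simp: negligible_iff_null_sets null_sets_completion_iff2)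
    then have "AE x in lborel. x \<notin> N" using AE_not_in[of N' lborel] by (auto elim!: eventually_mono)
    then show "AE x in lborel. (\<lambda>n. (norm (f x - w n x))\<^sup>2) \<longlonglongrightarrow> 0"
    proof eventually_elim
      case (elim x)
      have "(\<lambda>n. closest_point (cball 0 K) (g n x)) \<longlonglongrightarrow> closest_point (cball 0 K) (f x)"
        using lim[OF elim] cp by (intro continuous_on_tendsto_compose[OF cp]) auto
      also have "closest_point (cball 0 K) (f x) = f x" using f(2) by (intro closest_point_self) auto
      finally have "(\<lambda>n. (norm (f x - w n x))\<^sup>2) \<longlonglongrightarrow> (norm (f x - c x *\<^sub>R f x))\<^sup>2"
        unfolding w_def by (intro tendsto_intros)
      moreover have "c x *\<^sub>R f x = f x"
        using f(3)[of x] \<open>R > 0\<close> by (cases "x \<in> ball 0 R") (auto simp: c_def field_simps)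
      ultimately show ?case by simp
    qed
    show "AE x in lborel. norm ((norm (f x - w n x))\<^sup>2) \<le> (2 * K)\<^sup>2 * indicat_real (ball 0 (2 * R)) x" for n
    proof (rule AE_I2)
      fix x
      have "norm (f x - w n x) \<le> 2 * K" using norm_triangle_ineq4[of "f x" "w n x"] f(2)[of x] w_le[of n x] by linarith
      then have "(norm (f x - w n x))\<^sup>2 \<le> (2 * K)\<^sup>2" by (intro power_mono) auto
      then show "norm ((norm (f x - w n x))\<^sup>2) \<le> (2 * K)\<^sup>2 * indicat_real (ball 0 (2 * R)) x"
      proof (cases "x \<in> ball 0 (2 * R)")
        case False
        then have "f x = 0" using \<open>R > 0\<close> by (intro f(3)) simp
        then show ?thesis using w0[OF False] False by simp
      qed simp
    qed
  qed (use f(1) in simp_all)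
  then have "\<forall>\<^sub>F n in sequentially. sqd f (w n) < e" using assms by (simp add: order_tendstoD)
  then obtain n where n: "sqd f (w n) < e" by (auto simp: eventually_sequentially)
  have "integrable lborel (\<lambda>x. (norm (w n x))\<^sup>2)"
  proof (rule Bochner_Integration.integrable_bound[OF L])
    show "AE x in lborel. norm ((norm (w n x))\<^sup>2) \<le> norm ((2 * K)\<^sup>2 * indicat_real (ball 0 (2 * R)) x)"
    proof (rule AE_I2)
      fix x
      have "(norm (w n x))\<^sup>2 \<le> (2 * K)\<^sup>2" using w_le[of n x] \<open>K > 0\<close> by (intro power_mono) auto
      then show "norm ((norm (w n x))\<^sup>2) \<le> norm ((2 * K)\<^sup>2 * indicat_real (ball 0 (2 * R)) x)"
        using w0[of x n] by (cases "x \<in> ball 0 (2 * R)") (simp_all del: mem_ball)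
    qed
  qed auto
  then have "L2 lborel (w n)" by (simp add: L2_def)
  with n w_cont w0 show ?thesis by blast
qed

text \<open>
  The claim holds for continuous functions with bounded support, and translations preserve distances in mean square.
\<close>

lemma L2_translation_continuous:
  fixes u :: "'a::euclidean_space => 'b::euclidean_space"
  assumes u: "L2 lborel u" "bounded U" "\<And>x. x \<notin> U ==> u x = 0" and "e > 0"
  shows "\<exists>d>0. \<forall>c. norm c < d --> sqn (\<lambda>x. u (x + c) - u x) < e"
proof -
  (* u is within 4 e' of a continuous w, and the triangle inequality for squares gives 2 * 4 + 4 + 4 * 4 = 28 *)
  define e' where "e' = e / 28"
  have "e' > 0" using \<open>e > 0\<close> by (simp add: e'_def)
  have [measurable]: "u \<in> borel_measurable borel" using u(1) by (simp add: L2_def)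
  obtain R where R: "R > 0" "U \<subseteq> ball 0 R" using bounded_subset_ballD[OF u(2), of 0] by auto
  obtain K where K: "K > 0" "sqn (\<lambda>x. u x - (if norm (u x) \<le> K then u x else 0)) < e'"
    using L2_approx_by_bounded[OF u(1) \<open>e' > 0\<close>] by blast
  let ?v = "\<lambda>x. if norm (u x) \<le> K then u x else 0"
  obtain w where w: "continuous_on UNIV w" "\<And>x. x \<notin> ball 0 (2 * R) ==> w x = 0" "L2 lborel w"
     "sqd ?v w < e'"
  proof -
    have 1: "?v \<in> borel_measurable borel" by measurable
    have 2: "norm (?v x) \<le> K" for x using K by auto
    have 3: "?v x = 0" if "x \<notin> ball 0 R" for x
    proof -
      have "x \<notin> U" using R(2) that by blast
      then show ?thesis using u(3) by simp
    qed
    have "\<exists>w. continuous_on UNIV w \<and> (\<forall>x. x \<notin> ball 0 (2 * R) --> w x = 0) \<and> L2 lborel w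
        \<and> sqd ?v w < e'" by (rule L2_approx_by_continuous[OF 1 2 _ K(1) R(1) \<open>e' > 0\<close>]) (rule 3)
    then show thesis by (elim exE conjE) (rule that, auto)
  qed
  have Lv: "L2 lborel ?v" by (rule L2_dominated[OF u(1), of _ 1]) auto
  have uw: "sqd u w < 4 * e'" using nsq_triangle[OF u(1) Lv w(3)] K(2) w(4) by simp
  let ?m = "measure lborel (ball (0::'a) (2 * R + 1))"
  have uc: "uniformly_continuous_on (cball 0 (2 * R + 2)) w"
    using w(1) by (intro compact_uniformly_continuous) (auto intro: continuous_on_subset)
  obtain d where d: "d > 0" "\<And>x y. x \<in> cball 0 (2 * R + 2) ==> y \<in> cball 0 (2 * R + 2)
      ==> dist y x < d ==> dist (w y) (w x) < sqrt (e' / (?m + 1))"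
  proof -
    have "sqrt (e' / (?m + 1)) > 0" using \<open>e' > 0\<close> by (simp add: add_nonneg_pos)
    then show thesis using that uc unfolding uniformly_continuous_on_def by blast
  qed
  show ?thesis
  proof (intro exI[of _ "min d 1"] conjI allI impI)
    fix c :: 'a assume c: "norm c < min d 1"
    have pw: "(norm (w (x + c) - w x))\<^sup>2 \<le> (e' / (?m + 1)) * indicator (ball 0 (2 * R + 1)) x" for x
    proof (cases "x \<in> ball 0 (2 * R + 1)")
      case True
      then have "norm (x + c) \<le> 2 * R + 2" using c norm_triangle_ineq[of x c] by simp
      then have "dist (w (x + c)) (w x) < sqrt (e' / (?m + 1))"
        using True c by (intro d(2)) (simp_all add: mem_cball_0 dist_norm del: mem_cball)
      then have "(norm (w (x + c) - w x))\<^sup>2 \<le> (sqrt (e' / (?m + 1)))\<^sup>2"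
        by (intro power_mono) (auto simp: dist_norm)
      then show ?thesis using True \<open>e' > 0\<close> by (simp add: measure_nonneg add_nonneg_nonneg)
    next
      case False
      then have "norm (x + c) \<ge> 2 * R" using c norm_triangle_ineq2[of x "- c"] by simp
      then have "w (x + c) = 0" "w x = 0" using False by (auto intro!: w(2))
      then show ?thesis using False by simp
    qed
    have i1: "integrable lborel (\<lambda>x. (norm (w (x + c) - w x))\<^sup>2)"
      by (rule L2_integrable_sq[OF L2_diff(1)[OF L2_shift[OF w(3)] w(3)]])
    have i2: "integrable lborel (\<lambda>x. (e' / (?m + 1)) * indicat_real (ball (0::'a) (2 * R + 1)) x)"
      by (intro integrable_mult_right integrable_real_indicator emeasure_lborel_ball_finite) simp
    have "sqn (\<lambda>x. w (x + c) - w x)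
        \<le> (\<integral>x. (e' / (?m + 1)) * indicat_real (ball (0::'a) (2 * R + 1)) x \<partial>lborel)"
      unfolding nsq_def by (rule integral_mono[OF i1 i2 pw])
    also have "... = (e' / (?m + 1)) * ?m" by simp
    also have "... \<le> e'"
    proof -
      have "0 \<le> ?m" by simp
      then have "0 < ?m + 1" by linarith
      moreover have "e' * ?m \<le> e' * (?m + 1)" using \<open>e' > 0\<close> by simp
      ultimately show ?thesis by (simp add: pos_divide_le_eq)
    qed
    finally have ww: "sqn (\<lambda>x. w (x + c) - w x) \<le> e'" .
    have A: "sqn (\<lambda>x. u (x + c) - w (x + c)) < 4 * e'"
      using nsq_shift[OF L2_diff(1)[OF u(1) w(3)], of c] uw by simp
    have B: "sqn (\<lambda>x. w (x + c) - u x) \<le> 2 * e' + 2 * (4 * e')"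
      using nsq_triangle[OF L2_shift[OF w(3), of c] w(3) u(1)] ww uw nsq_diff_commute[of lborel w u] by simp
    have "sqn (\<lambda>x. u (x + c) - u x) \<le> 2 * sqn (\<lambda>x. u (x + c) - w (x + c))
        + 2 * sqn (\<lambda>x. w (x + c) - u x)" by (rule nsq_triangle[OF L2_shift[OF u(1)] L2_shift[OF w(3)] u(1)])
    also have "... < 2 * (4 * e') + 2 * (2 * e' + 2 * (4 * e'))"
      by (intro add_less_le_mono mult_strict_left_mono mult_left_mono A B) auto
    also have "... = 28 * e'" by simp
    finally show "sqn (\<lambda>x. u (x + c) - u x) < e" by (simp add: e'_def)
  qed (use d in auto)
qed

section \<open>The fundamental lemma of the calculus of variations\<close>

text \<open>
  Boxes generate the Borel sets and are closed under intersection, so the integral over every Borel set is 0.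
\<close>

lemma AE_eq_0_if_box_integrals_0:
  fixes h :: "'a::euclidean_space => real"
  assumes h: "integrable lborel h"
    and z: "\<And>a b. (LINT x:box a b|lborel. h x) = 0"
  shows "AE x in lborel. h x = 0"
proof -
  have [measurable]: "h \<in> borel_measurable borel" using h by auto
  have si: "set_integrable lborel A h" if "A \<in> sets borel" for A
    unfolding set_integrable_def using h that by (intro integrable_mult_indicator) auto
  define G where "G = range (\<lambda>(a, b). box a b :: 'a set)"
  have stable: "Int_stable G" unfolding G_def Int_stable_def by (auto simp: box_Int_box)
  have "(\<lambda>n. LINT x:box (- real n *\<^sub>R One) (real n *\<^sub>R One)|lborel. h x) \<longlonglongrightarrow> (\<integral>x. h x \<partial>lborel)"
    unfolding set_lebesgue_integral_def
  proof (rule integral_dominated_convergence[where w="\<lambda>x. norm (h x)"])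
    show "AE x in lborel. (\<lambda>n. indicator (box (- real n *\<^sub>R One) (real n *\<^sub>R One)) x *\<^sub>R h x) \<longlonglongrightarrow> h x"
    proof (rule AE_I2, rule tendsto_eventually)
      fix x :: 'a
      have "\<forall>\<^sub>F n in sequentially. x \<in> box (- real n *\<^sub>R One) (real n *\<^sub>R One)"
        using eventually_gt_at_top[of "nat \<lceil>norm x\<rceil>"]
      proof eventually_elim
        case (elim n)
        then have "norm x < real n" by linarith
        then have "\<bar>x \<bullet> i\<bar> < real n" if "i \<in> Basis" for i using Basis_le_norm[OF that, of x] by simp
        then show ?case by (auto simp: mem_box abs_less_iff minus_less_iff)
      qed
      then show "\<forall>\<^sub>F n in sequentially. indicator (box (- real n *\<^sub>R One) (real n *\<^sub>R One)) x *\<^sub>R h x = h x"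
        by eventually_elim simp
    qed
  qed (use h in \<open>auto simp: indicator_def\<close>)
  then have total: "(\<integral>x. h x \<partial>lborel) = 0" using z by (simp add: LIMSEQ_const_iff)
  have all: "(LINT x:A|lborel. h x) = 0" if "A \<in> sets borel" for A
  proof -
    have A: "A \<in> sigma_sets UNIV G" using that unfolding G_def borel_eq_box by simp
    have sub: "G \<subseteq> Pow UNIV" by simp
    show ?thesis using stable sub A
    proof (induct rule: sigma_sets_induct_disjoint)
      case (basic A) then show ?case using z by (auto simp: G_def)
    next
      case empty show ?case by (simp add: set_lebesgue_integral_def)
    next
      case (compl A)
      then have [measurable]: "A \<in> sets borel" unfolding G_def borel_eq_box by simp
      have "(LINT x:(UNIV - A)|lborel. h x) = (\<integral>x. h x - indicator A x *\<^sub>R h x \<partial>lborel)"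
        unfolding set_lebesgue_integral_def
        by (rule Bochner_Integration.integral_cong) (auto simp: indicator_def)
      also have "... = (\<integral>x. h x \<partial>lborel) - (LINT x:A|lborel. h x)"
        using si[of A] h unfolding set_lebesgue_integral_def set_integrable_def by simp
      finally show ?case using compl total by (simp add: set_lebesgue_integral_def)
    next
      case (union A)
      have A: "A i \<in> sets borel" for i using union unfolding G_def borel_eq_box by auto
      have "(LINT x:(\<Union>i. A i)|lborel. h x) = (\<Sum>i. LINT x:A i|lborel. h x)"
        by (rule lebesgue_integral_countable_add) (use A union in \<open>auto simp: disjoint_family_on_def intro!: si\<close>)
      then show ?case using union by simp
    qed
  qed
  have "AE x in lborel. indicator {x. h x > 0} x * h x = 0"
    using all[of "{x. h x > 0}"] si[of "{x. h x > 0}"] by (intro integral_nonneg_eq_0_iff_AE[THEN iffD1])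
      (auto simp: set_lebesgue_integral_def set_integrable_def indicator_def)
  moreover have "AE x in lborel. indicator {x. h x < 0} x * (- h x) = 0"
    using all[of "{x. h x < 0}"] si[of "{x. h x < 0}"] by (intro integral_nonneg_eq_0_iff_AE[THEN iffD1])
      (auto simp: set_lebesgue_integral_def set_integrable_def indicator_def)
  ultimately show ?thesis by eventually_elim (auto simp: indicator_def split: if_splits)
qed

lemma cbox_diff_box_null: "cbox a b - box a b \<in> null_sets (lborel :: 'a::euclidean_space measure)"
proof -
  have "cbox a b - box a b \<in> null_sets lebesgue"
    using negligible_frontier_interval[of a b] by (simp add: negligible_iff_null_sets)
  then show ?thesis by (simp add: null_sets_def)
qed

text \<open>Test functions converge boundedly to the indicator function of any box inside U.\<close>

lemma fundamental_lemma_box: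
  fixes h :: "real^2 => real"
  assumes h: "integrable lborel h" and U: "cbox c d \<subseteq> U"
    and z: "\<And>\<phi>. \<phi> \<in> test_functions U ==> (\<And>x. x \<notin> cbox c d ==> \<phi> x = 0) ==> (\<integral>x. \<phi> x * h x \<partial>lborel) = 0"
  shows "AE x in lborel. x \<in> cbox c d --> h x = 0"
proof -
  have [measurable]: "h \<in> borel_measurable borel" using h by auto
  have i: "integrable lborel (\<lambda>x. indicator (box c d) x * h x)"
    using integrable_mult_indicator[OF _ h, of "box c d"] by simp
  have "AE x in lborel. indicator (box c d) x * h x = 0"
  proof (rule AE_eq_0_if_box_integrals_0[OF i])
    fix a b :: "real^2"
    define a' where "a' = (\<Sum>i\<in>Basis. max (a \<bullet> i) (c \<bullet> i) *\<^sub>R i)"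
    define b' where "b' = (\<Sum>i\<in>Basis. min (b \<bullet> i) (d \<bullet> i) *\<^sub>R i)"
    have int: "box a b \<inter> box c d = box a' b'" unfolding a'_def b'_def by (rule box_Int_box)
    have sub: "cbox a' b' \<subseteq> cbox c d" unfolding a'_def b'_def by (auto simp: mem_box)
    obtain \<phi> where \<phi>: "\<And>n. \<phi> n \<in> test_functions U" "\<And>n x. 0 \<le> \<phi> n x \<and> \<phi> n x \<le> 1"
      "\<And>n x. x \<notin> box a' b' ==> \<phi> n x = 0" "\<And>x. (\<lambda>n. \<phi> n x) \<longlonglongrightarrow> indicator (box a' b') x"
      using exists_smooth_box_approximation[of a' b' U] sub U by (metis subset_trans)
    have "(\<lambda>n. \<integral>x. \<phi> n x * h x \<partial>lborel) \<longlonglongrightarrow> (\<integral>x. indicator (box a' b') x * h x \<partial>lborel)"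
    proof (rule integral_dominated_convergence[where w="\<lambda>x. norm (h x)"])
      show "(\<lambda>x. \<phi> n x * h x) \<in> borel_measurable lborel" for n using test_borel(1)[OF \<phi>(1)] by simp
      show "AE x in lborel. norm (\<phi> n x * h x) \<le> norm (h x)" for n
        using \<phi>(2)[of n] by (intro AE_I2) (simp add: abs_mult mult_left_le_one_le)
      show "AE x in lborel. (\<lambda>n. \<phi> n x * h x) \<longlonglongrightarrow> indicator (box a' b') x * h x"
        using \<phi>(4) by (intro AE_I2 tendsto_mult tendsto_const) 
    qed (use h in auto)
    moreover have "(\<integral>x. \<phi> n x * h x \<partial>lborel) = 0" for n
    proof (rule z[OF \<phi>(1)])
      fix x assume "x \<notin> cbox c d"
      then have "x \<notin> box a' b'" using sub box_subset_cbox[of a' b'] by blast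
      then show "\<phi> n x = 0" by (rule \<phi>(3))
    qed
    ultimately have "(\<integral>x. indicator (box a' b') x * h x \<partial>lborel) = 0" by (simp add: LIMSEQ_const_iff)
    then show "(LINT x:box a b|lborel. indicator (box c d) x * h x) = 0"
      unfolding set_lebesgue_integral_def int[symmetric] by (simp add: indicator_inter_arith mult.assoc)
  qed
  moreover have "AE x in lborel. x \<notin> cbox c d - box c d" using cbox_diff_box_null by (rule AE_not_in)
  ultimately show ?thesis by eventually_elim auto
qed

lemma AE_on_open_if_AE_on_cboxes:
  fixes U :: "'a::euclidean_space set"
  assumes "open U" "\<And>c d. cbox c d \<subseteq> U ==> AE x in lborel. x \<in> cbox c d --> P x"
  shows "AE x in lborel. x \<in> U --> P x"
proof -
  obtain \<D> where D: "countable \<D>" "\<And>X. X \<in> \<D> ==> X \<subseteq> U \<and> (\<exists>a b. X = cbox a b)" "\<Union>\<D> = U"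
    using open_countable_Union_open_cbox[OF assms(1)] by (metis Pow_iff subsetD)
  have "AE x in lborel. \<forall>X\<in>\<D>. x \<in> X --> P x" unfolding AE_ball_countable[OF D(1)] using D(2) assms(2) by blast
  then show ?thesis using D(3) by (auto elim!: eventually_mono)
qed

lemma fundamental_lemma:
  fixes h :: "real^2 => real"
  assumes "integrable lborel h" "open U"
    and "\<And>\<phi>. \<phi> \<in> test_functions U ==> (\<integral>x. \<phi> x * h x \<partial>lborel) = 0"
  shows "AE x in lborel. x \<in> U --> h x = 0"
  by (rule AE_on_open_if_AE_on_cboxes[OF assms(2)], rule fundamental_lemma_box[OF assms(1)], assumption)
    (rule assms(3))

section \<open>Sobolev functions extended by zero\<close>

text \<open>
  Translations and Fubini's theorem need functions that are Borel measurable on the whole plane.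
  A function of the Sobolev space with exponent 2 is therefore represented by a Borel pair (v, g)
  that vanishes outside U; g is the weak gradient inside U only, because the extension by zero
  has no weak gradient across the boundary in general.
\<close>

definition H1 :: "(real^2) set => (real^2 => real) => (real^2 => real^2) => bool" where
  "H1 U v g \<longleftrightarrow> L2 lborel v \<and> L2 lborel g \<and> (\<forall>x. x \<notin> U --> v x = 0 \<and> g x = 0) \<and>
    (\<forall>\<phi>\<in>test_functions U. (\<integral>x. v x *\<^sub>R gradient \<phi> x \<partial>lborel) = - (\<integral>x. \<phi> x *\<^sub>R g x \<partial>lborel))"

lemma H1_L2: "H1 U v g ==> L2 lborel v" "H1 U v g ==> L2 lborel g"
  and H1_outside: "H1 U v g ==> x \<notin> U ==> v x = 0" "H1 U v g ==> x \<notin> U ==> g x = 0"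
  and H1_weak: "H1 U v g ==> \<phi> \<in> test_functions U ==>
    (\<integral>x. v x *\<^sub>R gradient \<phi> x \<partial>lborel) = - (\<integral>x. \<phi> x *\<^sub>R g x \<partial>lborel)" by (auto simp: H1_def)

lemma H1_borel: "H1 U v g ==> v \<in> borel_measurable borel" "H1 U v g ==> g \<in> borel_measurable borel"
  by (auto simp: H1_def L2_def)

lemma H1_integrable:
  assumes "H1 U v g" "bounded U"
  shows "integrable lborel v" "integrable lborel g"
proof -
  obtain R where R: "U \<subseteq> ball 0 R" using bounded_subset_ballD[OF assms(2)] by blast
  have "emeasure lborel (ball 0 R :: (real^2) set) < \<infinity>" by (rule emeasure_lborel_ball_finite)
  then show "integrable lborel v" "integrable lborel g"
    using L2_integrable[of lborel v "ball 0 R"] L2_integrable[of lborel g "ball 0 R"]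
      H1_L2[OF assms(1)] H1_outside[OF assms(1)] R by (auto simp: subset_eq)
qed

lemma integrable_bounded_mult:
  fixes f :: "'a => 'b::euclidean_space" and h :: "'a => real"
  assumes "integrable M f" "h \<in> borel_measurable M" "\<And>x. \<bar>h x\<bar> \<le> B"
  shows "integrable M (\<lambda>x. h x *\<^sub>R f x)"
proof (rule Bochner_Integration.integrable_bound)
  show "integrable M (\<lambda>x. B *\<^sub>R f x)" using assms by auto
  show "AE x in M. norm (h x *\<^sub>R f x) \<le> norm (B *\<^sub>R f x)"
    using assms(3) by (intro AE_I2) (auto intro!: mult_right_mono intro: order_trans[OF _ abs_ge_self])
qed (use assms in auto)

lemma integrable_bounded_mult':
  fixes f :: "'a => real" and h :: "'a => 'b::euclidean_space"
  assumes "integrable M f" "h \<in> borel_measurable M" "\<And>x. norm (h x) \<le> B"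
  shows "integrable M (\<lambda>x. f x *\<^sub>R h x)"
proof (rule Bochner_Integration.integrable_bound)
  show "integrable M (\<lambda>x. B *\<^sub>R f x)" using assms by auto
  show "AE x in M. norm (f x *\<^sub>R h x) \<le> norm (B *\<^sub>R f x)"
  proof (rule AE_I2)
    fix x
    have "norm (h x) \<le> \<bar>B\<bar>" using assms(3)[of x] by simp
    then have "\<bar>f x\<bar> * norm (h x) \<le> \<bar>f x\<bar> * \<bar>B\<bar>" by (intro mult_left_mono) auto
    then show "norm (f x *\<^sub>R h x) \<le> norm (B *\<^sub>R f x)" by (simp add: abs_mult ac_simps)
  qed
qed (use assms in auto)

lemma test_integrable:
  assumes "\<phi> \<in> test_functions U" "integrable lborel f"
  shows "integrable lborel (\<lambda>x. \<phi> x *\<^sub>R (f x :: 'b::euclidean_space))"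
  using test_bounded[OF assms(1)] test_borel[OF assms(1)] assms(2) by (auto intro: integrable_bounded_mult)

lemma test_gradient_integrable:
  assumes "\<phi> \<in> test_functions U" "integrable lborel f"
  shows "integrable lborel (\<lambda>x. f x *\<^sub>R gradient \<phi> x)"
  using test_bounded[OF assms(1)] test_borel[OF assms(1)] assms(2) by (auto intro: integrable_bounded_mult')

lemma test_L2:
  assumes "\<phi> \<in> test_functions U"
  shows "L2 lborel \<phi>" "L2 lborel (gradient \<phi>)"
proof -
  from assms obtain M where M: "compact M" "\<And>x. x \<notin> M ==> \<phi> x = 0" and C: "\<And>k. C_k k \<phi>"
    by (auto simp: test_functions_def)
  obtain B where B: "B > 0" "\<And>x. \<bar>\<phi> x\<bar> \<le> B \<and> norm (gradient \<phi> x) \<le> B" using test_bounded[OF assms] by blast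
  have [measurable]: "M \<in> sets borel" using M(1) by (simp add: borel_compact)
  have "(\<lambda>x. (norm (indicator M x :: real))\<^sup>2) = indicator M" by (auto simp: indicator_def)
  then have i: "L2 lborel (\<lambda>x. indicator M x :: real)"
    using emeasure_bounded_finite[OF compact_imp_bounded[OF M(1)]] unfolding L2_def by simp
  show "L2 lborel \<phi>"
    by (rule L2_dominated(1)[OF i, of _ B]) (use B M test_borel[OF assms] in \<open>auto simp: indicator_def\<close>)
  show "L2 lborel (gradient \<phi>)" by (rule L2_dominated(1)[OF i, of _ B])
      (use B M test_borel[OF assms] gradient_outside_support[OF M] in \<open>auto simp: indicator_def\<close>)
qed

lemma H1_linear:
  assumes "H1 U v g" "H1 U w h" "bounded U"
  shows "H1 U (\<lambda>x. v x + c * w x) (\<lambda>x. g x + c *\<^sub>R h x)"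
  unfolding H1_def
proof (intro conjI ballI allI impI)
  show "L2 lborel (\<lambda>x. v x + c * w x)" "L2 lborel (\<lambda>x. g x + c *\<^sub>R h x)"
    using L2_add(1)[OF H1_L2(1)[OF assms(1)] L2_scaleR[OF H1_L2(1)[OF assms(2)]]]
      L2_add(1)[OF H1_L2(2)[OF assms(1)] L2_scaleR[OF H1_L2(2)[OF assms(2)]]] by auto
  fix \<phi> assume \<phi>: "\<phi> \<in> test_functions U"
  have "(\<integral>x. (v x + c * w x) *\<^sub>R gradient \<phi> x \<partial>lborel)
      = (\<integral>x. v x *\<^sub>R gradient \<phi> x \<partial>lborel) + c *\<^sub>R (\<integral>x. w x *\<^sub>R gradient \<phi> x \<partial>lborel)"
    using test_gradient_integrable[OF \<phi> H1_integrable(1)[OF assms(1,3)]]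
      test_gradient_integrable[OF \<phi> H1_integrable(1)[OF assms(2,3)]]
    by (simp add: scaleR_add_left flip: scaleR_scaleR)
  moreover have "(\<integral>x. \<phi> x *\<^sub>R (g x + c *\<^sub>R h x) \<partial>lborel)
      = (\<integral>x. \<phi> x *\<^sub>R g x \<partial>lborel) + c *\<^sub>R (\<integral>x. \<phi> x *\<^sub>R h x \<partial>lborel)"
  proof -
    have "\<phi> x *\<^sub>R (g x + c *\<^sub>R h x) = \<phi> x *\<^sub>R g x + c *\<^sub>R (\<phi> x *\<^sub>R h x)" for x
      by (simp add: scaleR_add_right mult.commute)
    then show ?thesis
      using test_integrable[OF \<phi> H1_integrable(2)[OF assms(1,3)]]
        test_integrable[OF \<phi> H1_integrable(2)[OF assms(2,3)]] by (simp del: scaleR_scaleR)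
  qed
  ultimately show "(\<integral>x. (v x + c * w x) *\<^sub>R gradient \<phi> x \<partial>lborel) = - (\<integral>x. \<phi> x *\<^sub>R (g x + c *\<^sub>R h x) \<partial>lborel)"
    using H1_weak[OF assms(1) \<phi>] H1_weak[OF assms(2) \<phi>] by simp
qed (use H1_outside[OF assms(1)] H1_outside[OF assms(2)] in auto)

lemma H1_diff:
  assumes "H1 U v g" "H1 U w h" "bounded U"
  shows "H1 U (\<lambda>x. v x - w x) (\<lambda>x. g x - h x)" using H1_linear[OF assms, of "-1"] by simp

lemma H1_zero: "H1 U (\<lambda>x. 0) (\<lambda>x. 0)" by (simp add: H1_def)

text \<open>
  Both sides of the identity that defines the weak gradient are continuous in mean square. The limits vanish outside U
  only up to a null set and are therefore cut off.
\<close>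

lemma H1_limit:
  assumes H: "\<And>n. H1 U (v n) (g n)" and "bounded U" "open U"
    and L: "L2 lborel w" "L2 lborel h"
    and lim: "(\<lambda>n. sqd (v n) w) \<longlonglongrightarrow> 0" "(\<lambda>n. sqd (g n) h) \<longlonglongrightarrow> 0"
  shows "H1 U (\<lambda>x. indicator U x * w x) (\<lambda>x. indicator U x *\<^sub>R h x)"
  unfolding H1_def
proof (intro conjI ballI allI impI)
  have [measurable]: "U \<in> sets borel" "w \<in> borel_measurable borel" "h \<in> borel_measurable borel"
    using assms L2_measurable[OF L(1)] L2_measurable[OF L(2)] by auto
  show "L2 lborel (\<lambda>x. indicator U x * w x)" by (rule L2_dominated[OF L(1), of _ 1]) (auto simp: indicator_def)
  show "L2 lborel (\<lambda>x. indicator U x *\<^sub>R h x)"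
    by (rule L2_dominated[OF L(2), of _ 1]) (auto simp: indicator_def)
  fix \<phi> assume \<phi>: "\<phi> \<in> test_functions U"
  note out = test_zero_outside[OF \<phi>]
  have eq: "(\<integral>x. (indicator U x * w x) *\<^sub>R gradient \<phi> x \<partial>lborel) = (\<integral>x. w x *\<^sub>R gradient \<phi> x \<partial>lborel)"
    "(\<integral>x. \<phi> x *\<^sub>R indicator U x *\<^sub>R h x \<partial>lborel) = (\<integral>x. \<phi> x *\<^sub>R h x \<partial>lborel)"
    by (rule Bochner_Integration.integral_cong[OF refl], case_tac "x \<in> U", simp_all add: out)+
  have prod_L1: "integrable lborel (\<lambda>x. u x *\<^sub>R f x)"
    if "L2 lborel (u :: real^2 => real)" "L2 lborel (f :: real^2 => real^2)" for u f
  proof (rule Bochner_Integration.integrable_bound)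
    show "integrable lborel (\<lambda>x. (norm (u x))\<^sup>2 + (norm (f x))\<^sup>2)" using that by (auto simp: L2_def)
    show "AE x in lborel. norm (u x *\<^sub>R f x) \<le> norm ((norm (u x))\<^sup>2 + (norm (f x))\<^sup>2)"
    proof (rule AE_I2)
      fix x
      have "\<bar>u x\<bar> * norm (f x) \<le> \<bar>u x\<bar>\<^sup>2 + (norm (f x))\<^sup>2"
        using sum_squares_bound[of "\<bar>u x\<bar>" "norm (f x)"]
          mult_nonneg_nonneg[OF abs_ge_zero norm_ge_zero, of "u x" "f x"] by linarith
      then show "norm (u x *\<^sub>R f x) \<le> norm ((norm (u x))\<^sup>2 + (norm (f x))\<^sup>2)" by simp
    qed
  qed (use that in \<open>auto simp: L2_def\<close>)
  have "(\<integral>x. w x *\<^sub>R gradient \<phi> x \<partial>lborel) \<bullet> q = - (\<integral>x. \<phi> x *\<^sub>R h x \<partial>lborel) \<bullet> q" for q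
  proof -
    have Lq: "L2 lborel (\<lambda>x. gradient \<phi> x \<bullet> q)" by (rule L2_dominated[OF test_L2(2)[OF \<phi>], of _ "norm q"])
        (use test_borel[OF \<phi>] Cauchy_Schwarz_ineq2[of _ q] in \<open>auto simp: mult.commute[of "norm q"]\<close>)
    have Lq': "L2 lborel (\<lambda>x. \<phi> x *\<^sub>R q)" by (rule L2_dominated[OF test_L2(1)[OF \<phi>], of _ "norm q"])
        (use test_borel[OF \<phi>] in \<open>auto simp: mult.commute\<close>)
    have "(\<lambda>n. \<integral>x. v n x \<bullet> (gradient \<phi> x \<bullet> q) \<partial>lborel) \<longlonglongrightarrow> (\<integral>x. w x \<bullet> (gradient \<phi> x \<bullet> q) \<partial>lborel)"
      by (rule L2_limit_inner[OF H1_L2(1)[OF H] L(1) lim(1) Lq])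
    moreover have "(\<lambda>n. \<integral>x. g n x \<bullet> (\<phi> x *\<^sub>R q) \<partial>lborel) \<longlonglongrightarrow> (\<integral>x. h x \<bullet> (\<phi> x *\<^sub>R q) \<partial>lborel)"
      by (rule L2_limit_inner[OF H1_L2(2)[OF H] L(2) lim(2) Lq'])
    moreover have "(\<integral>x. v x \<bullet> (gradient \<phi> x \<bullet> q) \<partial>lborel) = (\<integral>x. v x *\<^sub>R gradient \<phi> x \<partial>lborel) \<bullet> q"
      "(\<integral>x. f x \<bullet> (\<phi> x *\<^sub>R q) \<partial>lborel) = (\<integral>x. \<phi> x *\<^sub>R f x \<partial>lborel) \<bullet> q"
      if "L2 lborel v" "L2 lborel f" for v f
      using prod_L1[OF that(1) test_L2(2)[OF \<phi>]] prod_L1[OF test_L2(1)[OF \<phi>] that(2)]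
      by (auto simp flip: integral_inner_left intro!: Bochner_Integration.integral_cong)
    ultimately show ?thesis
      using H1_weak[OF H \<phi>] L H1_L2[OF H]
        LIMSEQ_unique[of "\<lambda>n. - (\<integral>x. g n x \<bullet> (\<phi> x *\<^sub>R q) \<partial>lborel)" "- (\<integral>x. h x \<bullet> (\<phi> x *\<^sub>R q) \<partial>lborel)"]
      by (auto dest: tendsto_minus)
  qed
  then show "(\<integral>x. (indicator U x * w x) *\<^sub>R gradient \<phi> x \<partial>lborel) = - (\<integral>x. \<phi> x *\<^sub>R indicator U x *\<^sub>R h x \<partial>lborel)"
    unfolding eq using vector_eq_rdot by blast
qed auto

lemma H1_restrict:
  assumes "H1 U v g" "open V" "V \<subseteq> U"
  shows "H1 V (\<lambda>x. indicator V x * v x) (\<lambda>x. indicator V x *\<^sub>R g x)"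
  unfolding H1_def
proof (intro conjI ballI allI impI)
  have [measurable]: "V \<in> sets borel" "v \<in> borel_measurable borel" "g \<in> borel_measurable borel"
    using assms(2) H1_borel[OF assms(1)] by auto
  show "L2 lborel (\<lambda>x. indicator V x * v x)"
    by (rule L2_dominated[OF H1_L2(1)[OF assms(1)], of _ 1]) (auto simp: indicator_def)
  show "L2 lborel (\<lambda>x. indicator V x *\<^sub>R g x)"
    by (rule L2_dominated[OF H1_L2(2)[OF assms(1)], of _ 1]) (auto simp: indicator_def)
  fix \<phi> assume \<phi>: "\<phi> \<in> test_functions V"
  note out = test_zero_outside[OF \<phi>]
  have eq: "(\<integral>x. (indicator V x * v x) *\<^sub>R gradient \<phi> x \<partial>lborel) = (\<integral>x. v x *\<^sub>R gradient \<phi> x \<partial>lborel)"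
    "(\<integral>x. \<phi> x *\<^sub>R indicator V x *\<^sub>R g x \<partial>lborel) = (\<integral>x. \<phi> x *\<^sub>R g x \<partial>lborel)"
    by (rule Bochner_Integration.integral_cong[OF refl], case_tac "x \<in> V", simp_all add: out)+
  show "(\<integral>x. (indicator V x * v x) *\<^sub>R gradient \<phi> x \<partial>lborel) = - (\<integral>x. \<phi> x *\<^sub>R indicator V x *\<^sub>R g x \<partial>lborel)"
    unfolding eq by (rule H1_weak[OF assms(1) test_mono[OF \<phi> assms(3)]])
qed auto

subsection \<open>Relation to the Sobolev space\<close>

lemma AE_lebesgue_on: "open U ==> (AE x in lebesgue_on U. P x) \<longleftrightarrow> (AE x in lborel. x \<in> U --> P x)"
  by (simp add: AE_restrict_space_iff AE_completion_iff)

lemma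
  fixes h :: "real^2 => 'b::euclidean_space"
  assumes "open U" "h \<in> borel_measurable borel"
  shows integral_lebesgue_on: "(LINT x|lebesgue_on U. h x) = (\<integral>x. indicator U x *\<^sub>R h x \<partial>lborel)"
    and integrable_lebesgue_on: "integrable (lebesgue_on U) h \<longleftrightarrow> integrable lborel (\<lambda>x. indicator U x *\<^sub>R h x)"
proof -
  have [measurable]: "U \<in> sets borel" "h \<in> borel_measurable borel" using assms by auto
  have m: "(\<lambda>x. indicator U x *\<^sub>R h x) \<in> borel_measurable lborel" by simp
  show "(LINT x|lebesgue_on U. h x) = (\<integral>x. indicator U x *\<^sub>R h x \<partial>lborel)"
    using m by (simp add: integral_restrict_space integral_completion)
  show "integrable (lebesgue_on U) h \<longleftrightarrow> integrable lborel (\<lambda>x. indicator U x *\<^sub>R h x)"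
    using m by (simp add: integrable_restrict_space integrable_completion)
qed

lemma borel_imp_lebesgue_on:
  "h \<in> borel_measurable borel ==> h \<in> borel_measurable (lebesgue_on V)"
  by (intro measurable_restrict_space1 measurable_completion) simp

lemma lebesgue_on_measurable_if_AE_borel:
  fixes h :: "real^2 => 'b::euclidean_space"
  assumes "h \<in> borel_measurable borel" "AE x in lebesgue_on U. f x = h x" "U \<in> sets lebesgue"
  shows "f \<in> borel_measurable (lebesgue_on U)"
proof (rule borel_measurable_if_D)
  have [measurable]: "h \<in> borel_measurable lebesgue" using assms(1) by (intro measurable_completion) simp
  show "(\<lambda>x. if x \<in> U then f x else 0) \<in> borel_measurable lebesgue"
  proof (rule borel_measurable_AE)
    show "(\<lambda>x. if x \<in> U then h x else 0) \<in> borel_measurable lebesgue" using assms(3) by measurable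
    show "AE x in lebesgue. (if x \<in> U then h x else 0) = (if x \<in> U then f x else 0)"
      using assms(2,3) by (auto simp: AE_restrict_space_iff elim!: eventually_mono)
  qed
qed

lemma lebesgue_on_borel_version:
  fixes f :: "real^2 => 'b::euclidean_space"
  assumes "f \<in> borel_measurable (lebesgue_on U)" "open U"
  shows "\<exists>f'. f' \<in> borel_measurable borel \<and> (\<forall>x. x \<notin> U --> f' x = 0) \<and> (AE x in lebesgue_on U. f x = f' x)"
proof -
  have [measurable]: "U \<in> sets borel" using assms by auto
  define F where "F x = (if x \<in> U then f x else 0)" for x
  have F: "F \<in> borel_measurable lebesgue"
    unfolding F_def[abs_def] using assms by (intro borel_measurable_if_I) auto
  have "\<forall>i. \<exists>F'. F' \<in> borel_measurable lborel \<and> (AE x in lborel. F x \<bullet> i = (F' x :: real))"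
  proof
    fix i
    have "(\<lambda>x. F x \<bullet> i) \<in> borel_measurable lebesgue" using F by simp
    from completion_ex_borel_measurable_real[OF this]
    show "\<exists>F'. F' \<in> borel_measurable lborel \<and> (AE x in lborel. F x \<bullet> i = (F' x :: real))" by blast
  qed
  then obtain F' where F': "\<And>i. F' i \<in> borel_measurable lborel" "\<And>i. AE x in lborel. F x \<bullet> i = (F' i x :: real)"
    by metis
  define f' where "f' x = indicator U x *\<^sub>R (\<Sum>i\<in>Basis. F' i x *\<^sub>R i)" for x
  have [measurable]: "F' i \<in> borel_measurable borel" for i using F'(1)[of i] by simp
  have "f' \<in> borel_measurable borel" unfolding f'_def[abs_def] by measurable
  moreover have "AE x in lborel. \<forall>i\<in>Basis. F x \<bullet> i = F' i x" by (intro AE_finite_allI F'(2)) auto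
  then have "AE x in lebesgue_on U. f x = f' x"
    unfolding AE_lebesgue_on[OF assms(2)]
  proof eventually_elim
    case (elim x)
    then have "(\<Sum>i\<in>Basis. F' i x *\<^sub>R i) = (\<Sum>i\<in>Basis. (F x \<bullet> i) *\<^sub>R i)" by simp
    also have "... = F x" by (rule euclidean_representation)
    finally show ?case by (simp add: F_def f'_def)
  qed
  ultimately show ?thesis by (auto simp: f'_def)
qed

lemma lebesgue_space_2_iff:
  "f \<in> lebesgue_space 2 U \<longleftrightarrow> f \<in> borel_measurable (lebesgue_on U) \<and> integrable (lebesgue_on U) (\<lambda>x. (norm (f x))\<^sup>2)"
proof -
  have "(\<lambda>x. norm (f x) powr 2) = (\<lambda>x. (norm (f x))\<^sup>2)" by (simp add: powr_numeral)
  then show ?thesis by (simp add: lebesgue_space_def)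
qed

lemma test_weak_eq:
  assumes "open U" "\<phi> \<in> test_functions U" "f \<in> borel_measurable borel" "h \<in> borel_measurable borel"
    "AE x in lebesgue_on U. u x = (f x :: real)" "AE x in lebesgue_on U. g x = (h x :: real^2)"
    "u \<in> borel_measurable (lebesgue_on U)" "g \<in> borel_measurable (lebesgue_on U)"
  shows "(LINT x|lebesgue_on U. u x *\<^sub>R gradient \<phi> x) = (\<integral>x. f x *\<^sub>R gradient \<phi> x \<partial>lborel)"
    "(LINT x|lebesgue_on U. \<phi> x *\<^sub>R g x) = (\<integral>x. \<phi> x *\<^sub>R h x \<partial>lborel)"
proof -
  note [measurable] = assms(3,4) test_borel[OF assms(2)]
  note m = borel_imp_lebesgue_on[OF assms(3)] borel_imp_lebesgue_on[OF assms(4)]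
    borel_imp_lebesgue_on[OF test_borel(1)[OF assms(2)]] borel_imp_lebesgue_on[OF test_borel(2)[OF assms(2)]]
  have "(LINT x|lebesgue_on U. u x *\<^sub>R gradient \<phi> x) = (LINT x|lebesgue_on U. f x *\<^sub>R gradient \<phi> x)"
    by (rule integral_cong_AE) (use assms(5,7) m in auto)
  also have "... = (\<integral>x. indicator U x *\<^sub>R (f x *\<^sub>R gradient \<phi> x) \<partial>lborel)"
    by (rule integral_lebesgue_on) (use assms(1) in auto)
  also have "... = (\<integral>x. f x *\<^sub>R gradient \<phi> x \<partial>lborel)"
    by (rule Bochner_Integration.integral_cong[OF refl], case_tac "x \<in> U")
      (simp_all add: test_zero_outside[OF assms(2)])
  finally show "(LINT x|lebesgue_on U. u x *\<^sub>R gradient \<phi> x) = (\<integral>x. f x *\<^sub>R gradient \<phi> x \<partial>lborel)" .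
  have "(LINT x|lebesgue_on U. \<phi> x *\<^sub>R g x) = (LINT x|lebesgue_on U. \<phi> x *\<^sub>R h x)"
    by (rule integral_cong_AE) (use assms(6,8) m in auto)
  also have "... = (\<integral>x. indicator U x *\<^sub>R (\<phi> x *\<^sub>R h x) \<partial>lborel)"
    by (rule integral_lebesgue_on) (use assms(1) in auto)
  also have "... = (\<integral>x. \<phi> x *\<^sub>R h x \<partial>lborel)"
    by (rule Bochner_Integration.integral_cong[OF refl], case_tac "x \<in> U")
      (simp_all add: test_zero_outside[OF assms(2)])
  finally show "(LINT x|lebesgue_on U. \<phi> x *\<^sub>R g x) = (\<integral>x. \<phi> x *\<^sub>R h x \<partial>lborel)" .
qed

definition represents :: "(real^2) set => (real^2 => real) => (real^2 => real) => (real^2 => real^2) => bool" where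
  "represents U u v g \<longleftrightarrow> H1 U v g \<and> (AE x in lebesgue_on U. u x = v x)"

lemma L2_from_lebesgue_on:
  fixes f f' :: "real^2 => 'b::euclidean_space"
  assumes "open U" "f' \<in> borel_measurable borel" "\<And>x. x \<notin> U ==> f' x = 0"
    "AE x in lebesgue_on U. f x = f' x" "f \<in> borel_measurable (lebesgue_on U)"
    "integrable (lebesgue_on U) (\<lambda>x. (norm (f x))\<^sup>2)"
  shows "L2 lborel f'"
proof -
  have [measurable]: "f' \<in> borel_measurable borel" by fact
  have "f' \<in> borel_measurable (lebesgue_on U)"
    using assms(2) by (intro measurable_restrict_space1 measurable_completion) simp
  then have "integrable (lebesgue_on U) (\<lambda>x. (norm (f' x))\<^sup>2)"
    using assms(4,5,6) by (subst integrable_cong_AE[where g="\<lambda>x. (norm (f x))\<^sup>2"]) auto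
  then have "integrable lborel (\<lambda>x. indicator U x *\<^sub>R (norm (f' x))\<^sup>2)"
    using integrable_lebesgue_on[OF assms(1), of "\<lambda>x. (norm (f' x))\<^sup>2"] by simp
  also have "(\<lambda>x. indicator U x *\<^sub>R (norm (f' x))\<^sup>2) = (\<lambda>x. (norm (f' x))\<^sup>2)"
    using assms(3) by (force simp: indicator_def fun_eq_iff)
  finally show ?thesis by (simp add: L2_def)
qed

lemma sobolev_imp_represents:
  assumes "u \<in> sobolev 2 U" "open U"
  shows "\<exists>v g. represents U u v g"
proof -
  from assms obtain g0 where u: "u \<in> lebesgue_space 2 U" and g0: "g0 \<in> lebesgue_space 2 U" "has_weak_gradient U u g0"
    by (auto simp: sobolev_def)
  note u' = u[unfolded lebesgue_space_2_iff] and g0' = g0(1)[unfolded lebesgue_space_2_iff]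
  obtain v where v: "v \<in> borel_measurable borel" "\<And>x. x \<notin> U ==> v x = 0" "AE x in lebesgue_on U. u x = v x"
    using lebesgue_on_borel_version[OF u'[THEN conjunct1] assms(2)] by blast
  obtain g where g: "g \<in> borel_measurable borel" "\<And>x. x \<notin> U ==> g x = 0" "AE x in lebesgue_on U. g0 x = g x"
    using lebesgue_on_borel_version[OF g0'[THEN conjunct1] assms(2)] by blast
  have "H1 U v g" unfolding H1_def
  proof (intro conjI ballI allI impI)
    show "L2 lborel v" by (rule L2_from_lebesgue_on[OF assms(2) v]) (use u' in auto)
    show "L2 lborel g" by (rule L2_from_lebesgue_on[OF assms(2) g]) (use g0' in auto)
    fix \<phi> assume \<phi>: "\<phi> \<in> test_functions U"
    show "(\<integral>x. v x *\<^sub>R gradient \<phi> x \<partial>lborel) = - (\<integral>x. \<phi> x *\<^sub>R g x \<partial>lborel)"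
      using test_weak_eq[OF assms(2) \<phi> v(1) g(1) v(3) g(3) u'[THEN conjunct1] g0'[THEN conjunct1]] g0(2) \<phi>
      by (simp add: has_weak_gradient_def)
  qed (use v g in auto)
  then show ?thesis using v(3) by (auto simp: represents_def)
qed

lemma H1_has_weak_gradient:
  assumes "represents U u v g" "open U" "bounded U"
  shows "u \<in> lebesgue_space 2 U" "g \<in> lebesgue_space 2 U" "has_weak_gradient U u g"
proof -
  have H: "H1 U v g" and AE: "AE x in lebesgue_on U. u x = v x" using assms by (auto simp: represents_def)
  note [measurable] = H1_borel[OF H]
  note c = borel_imp_lebesgue_on
  have ind: "(\<lambda>x. indicator U x *\<^sub>R (norm (v x))\<^sup>2) = (\<lambda>x. (norm (v x))\<^sup>2)"
     "(\<lambda>x. indicator U x *\<^sub>R (norm (g x))\<^sup>2) = (\<lambda>x. (norm (g x))\<^sup>2)"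
    using H1_outside[OF H] by (force simp: indicator_def)+
  have um: "u \<in> borel_measurable (lebesgue_on U)"
    by (rule lebesgue_on_measurable_if_AE_borel[OF H1_borel(1)[OF H] AE]) (use assms(2) in simp)
  have "integrable (lebesgue_on U) (\<lambda>x. (norm (v x))\<^sup>2)"
    by (subst integrable_lebesgue_on[OF assms(2)], measurable, unfold ind) (rule L2_integrable_sq[OF H1_L2(1)[OF H]])
  then have "integrable (lebesgue_on U) (\<lambda>x. (norm (u x))\<^sup>2)"
    using AE um c[OF H1_borel(1)[OF H]] by (subst integrable_cong_AE[where g="\<lambda>x. (norm (v x))\<^sup>2"]) auto
  with um show uL: "u \<in> lebesgue_space 2 U" by (simp add: lebesgue_space_2_iff)
  have "integrable (lebesgue_on U) (\<lambda>x. (norm (g x))\<^sup>2)"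
    by (subst integrable_lebesgue_on[OF assms(2)], measurable, unfold ind) (rule L2_integrable_sq[OF H1_L2(2)[OF H]])
  then show "g \<in> lebesgue_space 2 U" using c[OF H1_borel(2)[OF H]] by (simp add: lebesgue_space_2_iff)
  have loc: "integrable (lebesgue_on M) h" if "integrable lborel h" "h \<in> borel_measurable borel" "compact M"
    for M and h :: "real^2 => 'c::euclidean_space"
  proof -
    have [measurable]: "M \<in> sets borel" using that by (simp add: borel_compact)
    have "integrable lborel (\<lambda>x. indicator M x *\<^sub>R h x)" using that by (intro integrable_mult_indicator) auto
    then have "integrable lebesgue (\<lambda>x. indicator M x *\<^sub>R h x)" using that by (subst integrable_completion) auto
    then show ?thesis by (subst integrable_restrict_space) auto
  qed
  show "has_weak_gradient U u g"
    unfolding has_weak_gradient_def locally_integrable_def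
  proof (intro conjI allI impI ballI; (elim conjE)?)
    fix M :: "(real^2) set" assume M: "compact M" "M \<subseteq> U"
    show "integrable (lebesgue_on M) g" by (rule loc[OF H1_integrable(2)[OF H assms(3)] _ M(1)]) simp
    have v: "integrable (lebesgue_on M) v" by (rule loc[OF H1_integrable(1)[OF H assms(3)] _ M(1)]) simp
    have AEM: "AE x in lebesgue_on M. u x = v x"
      using AE M assms(2) borel_compact[OF M(1)] by (auto simp: AE_restrict_space_iff elim!: eventually_mono)
    have "u \<in> borel_measurable (lebesgue_on M)"
      by (rule lebesgue_on_measurable_if_AE_borel[OF H1_borel(1)[OF H] AEM]) (use borel_compact[OF M(1)] in simp)
    then show "integrable (lebesgue_on M) u"
      using v AEM c[OF H1_borel(1)[OF H]] by (subst integrable_cong_AE[where g=v]) auto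
  next
    fix \<phi> assume \<phi>: "\<phi> \<in> test_functions U"
    show "(LINT x|lebesgue_on U. u x *\<^sub>R gradient \<phi> x) = - (LINT x|lebesgue_on U. \<phi> x *\<^sub>R g x)"
      using test_weak_eq[OF assms(2) \<phi> H1_borel[OF H] AE _ um c[OF H1_borel(2)[OF H]]] H1_weak[OF H \<phi>] by simp
  qed
qed

lemma represents_imp_sobolev: "represents U u v g ==> open U ==> bounded U ==> u \<in> sobolev 2 U"
  unfolding sobolev_def using H1_has_weak_gradient[of U u v g] by blast

text \<open>
  On a closed box inside U both gradients are integrable, so that the fundamental lemma applies to their difference.
\<close>

lemma weak_gradient_unique:
  assumes g1: "has_weak_gradient U u g1" and g2: "has_weak_gradient U u g2" and "open U"
  shows "AE x in lebesgue_on U. g1 x = g2 x"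
  unfolding AE_lebesgue_on[OF assms(3)]
proof (rule AE_on_open_if_AE_on_cboxes[OF assms(3)])
  fix c d assume cd: "cbox c d \<subseteq> U"
  let ?Q = "cbox c d"
  have [measurable]: "?Q \<in> sets borel" "U \<in> sets borel" using assms by auto
  have i: "integrable (lebesgue_on ?Q) g1" "integrable (lebesgue_on ?Q) g2"
    using g1 g2 cd by (auto simp: has_weak_gradient_def locally_integrable_def)
  have comp: "AE x in lborel. x \<in> ?Q --> (g1 x - g2 x) $ k = 0" for k
  proof -
    define h where "h x = indicator ?Q x *\<^sub>R ((g1 x - g2 x) $ k)" for x
    have "integrable (lebesgue_on ?Q) (\<lambda>x. (g1 x - g2 x) \<bullet> axis k 1)" using i by auto
    then have h: "integrable lebesgue h"
      by (subst (asm) integrable_restrict_space) (auto simp: h_def[abs_def] inner_axis)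
    then obtain h' where h': "h' \<in> borel_measurable lborel" "AE x in lborel. h x = h' x"
      using completion_ex_borel_measurable_real[of h lborel] by auto
    have "integrable lebesgue h'"
      by (rule integrable_cong_AE_imp[OF h]) (use h' in \<open>auto simp: AE_completion_iff intro: measurable_completion\<close>)
    then have ih': "integrable lborel h'" using h' by (simp add: integrable_completion)
    have "AE x in lborel. x \<in> ?Q --> h' x = 0"
    proof (rule fundamental_lemma_box[OF ih' cd])
      fix \<phi> assume \<phi>: "\<phi> \<in> test_functions U" and z: "\<And>x. x \<notin> ?Q ==> \<phi> x = 0"
      note [measurable] = test_borel[OF \<phi>]
      have \<phi>m: "\<phi> \<in> borel_measurable lebesgue" by (intro measurable_completion) simp
      have ip: "integrable (lebesgue_on U) (\<lambda>x. \<phi> x *\<^sub>R g x)"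
        if "integrable (lebesgue_on ?Q) (g :: real^2 => real^2)" for g
      proof -
        obtain B where B: "\<And>x. \<bar>\<phi> x\<bar> \<le> B" using test_bounded[OF \<phi>] by blast
        have "\<phi> \<in> borel_measurable (lebesgue_on ?Q)" using \<phi>m by (rule measurable_restrict_space1)
        then have "integrable (lebesgue_on ?Q) (\<lambda>x. \<phi> x *\<^sub>R g x)"
          by (intro integrable_bounded_mult[OF that _ B])
        then have "integrable lebesgue (\<lambda>x. indicator ?Q x *\<^sub>R \<phi> x *\<^sub>R g x)"
          by (subst (asm) integrable_restrict_space) auto
        also have "(\<lambda>x. indicator ?Q x *\<^sub>R \<phi> x *\<^sub>R g x) = (\<lambda>x. indicator U x *\<^sub>R \<phi> x *\<^sub>R g x)"
          using z cd by (auto simp: fun_eq_iff indicator_def)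
        finally show ?thesis by (subst integrable_restrict_space) auto
      qed
      have "(LINT x|lebesgue_on U. \<phi> x *\<^sub>R g1 x) = (LINT x|lebesgue_on U. \<phi> x *\<^sub>R g2 x)"
        using g1 g2 \<phi> by (simp add: has_weak_gradient_def)
      then have "(LINT x|lebesgue_on U. (\<phi> x *\<^sub>R g1 x - \<phi> x *\<^sub>R g2 x)) \<bullet> axis k 1 = 0"
        using ip[OF i(1)] ip[OF i(2)] by simp
      then have "(LINT x|lebesgue_on U. (\<phi> x *\<^sub>R g1 x - \<phi> x *\<^sub>R g2 x) \<bullet> axis k 1) = 0"
        using ip[OF i(1)] ip[OF i(2)] by (subst integral_inner_left) auto
      then have "(\<integral>x. indicator U x *\<^sub>R ((\<phi> x *\<^sub>R g1 x - \<phi> x *\<^sub>R g2 x) \<bullet> axis k 1) \<partial>lebesgue) = 0"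
        by (subst (asm) integral_restrict_space) auto
      also have "(\<lambda>x. indicator U x *\<^sub>R ((\<phi> x *\<^sub>R g1 x - \<phi> x *\<^sub>R g2 x) \<bullet> axis k 1)) = (\<lambda>x. \<phi> x * h x)"
        using z cd by (auto simp: fun_eq_iff indicator_def h_def inner_axis algebra_simps)
      also have "(\<integral>x. \<phi> x * h x \<partial>lebesgue) = (\<integral>x. \<phi> x * h' x \<partial>lebesgue)"
        using h' h \<phi>m by (intro integral_cong_AE)
          (auto simp: AE_completion_iff intro!: borel_measurable_times measurable_completion[of h'])
      also have "... = (\<integral>x. \<phi> x * h' x \<partial>lborel)" using h'(1) by (intro integral_completion) simp
      finally show "(\<integral>x. \<phi> x * h' x \<partial>lborel) = 0" .
    qed
    with h'(2) show ?thesis by eventually_elim (auto simp: h_def)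
  qed
  have "AE x in lborel. \<forall>k\<in>UNIV. x \<in> ?Q --> (g1 x - g2 x) $ k = 0" by (rule AE_finite_allI) (use comp in auto)
  then show "AE x in lborel. x \<in> ?Q --> g1 x = g2 x" by eventually_elim (auto simp: vec_eq_iff)
qed

lemma weak_gradient_represents:
  assumes "represents U u v g" "open U" "bounded U"
  shows "AE x in lebesgue_on U. weak_gradient U u x = g x"
proof -
  have "has_weak_gradient U u (weak_gradient U u)"
    unfolding weak_gradient_def
    by (rule someI[where P="has_weak_gradient U u", OF H1_has_weak_gradient(3)[OF assms]])
  then show ?thesis using weak_gradient_unique H1_has_weak_gradient(3)[OF assms] assms(2) by blast
qed

lemma lebesgue_on_integral_AE_borel:
  fixes h :: "real^2 => 'b::euclidean_space"
  assumes "open U" "h \<in> borel_measurable borel" "AE x in lebesgue_on U. f x = h x" "\<And>x. x \<notin> U ==> h x = 0"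
  shows "(LINT x|lebesgue_on U. f x) = (\<integral>x. h x \<partial>lborel)"
proof -
  have "(LINT x|lebesgue_on U. f x) = (LINT x|lebesgue_on U. h x)"
    using lebesgue_on_measurable_if_AE_borel[OF assms(2,3)] assms(1,3) borel_imp_lebesgue_on[OF assms(2)]
    by (intro integral_cong_AE) auto
  also have "... = (\<integral>x. indicator U x *\<^sub>R h x \<partial>lborel)" by (rule integral_lebesgue_on[OF assms(1,2)])
  also have "(\<lambda>x. indicator U x *\<^sub>R h x) = h" using assms(4) by (auto simp: fun_eq_iff indicator_def)
  finally show ?thesis .
qed

lemma sobolev_norm_represents:
  assumes "represents U u v g" "open U" "bounded U"
  shows "sobolev_norm 2 U u = sqrt (sqn v + sqn g)"
proof -
  have H: "H1 U v g" and AE: "AE x in lebesgue_on U. u x = v x" using assms by (auto simp: represents_def)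
  note [measurable] = H1_borel[OF H]
  have "(LINT x|lebesgue_on U. \<bar>u x\<bar> powr 2) = sqn v"
    unfolding nsq_def by (rule lebesgue_on_integral_AE_borel[OF assms(2)])
      (use AE H1_outside[OF H] in \<open>auto simp: powr_numeral elim!: eventually_mono\<close>)
  moreover have "(LINT x|lebesgue_on U. norm (weak_gradient U u x) powr 2) = sqn g"
    unfolding nsq_def by (rule lebesgue_on_integral_AE_borel[OF assms(2)])
      (use weak_gradient_represents[OF assms] H1_outside[OF H] in \<open>auto simp: powr_numeral elim!: eventually_mono\<close>)
  ultimately show ?thesis by (simp add: sobolev_norm_def powr_half_sqrt)
qed

lemma represents_diff:
  assumes "represents U u v g" "represents U u' v' g'" "bounded U"
  shows "represents U (\<lambda>x. u x - u' x) (\<lambda>x. v x - v' x) (\<lambda>x. g x - g' x)"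
  using assms H1_diff by (auto simp: represents_def elim!: eventually_elim2)

lemma represents_self: "H1 U v g ==> represents U v v g" by (simp add: represents_def)

section \<open>Averages of translates\<close>

text \<open>Jensen's inequality for the square.\<close>

lemma norm_integral_sq_le:
  fixes f :: "'a => 'b::euclidean_space"
  assumes N: "emeasure N (space N) = 1" and "f \<in> borel_measurable N"
  shows "ennreal ((norm (\<integral>z. f z \<partial>N))\<^sup>2) \<le> (\<integral>\<^sup>+z. ennreal ((norm (f z))\<^sup>2) \<partial>N)"
proof (cases "(\<integral>\<^sup>+z. ennreal ((norm (f z))\<^sup>2) \<partial>N) = \<infinity>")
  case False
  interpret finite_measure N by (rule finite_measureI) (simp add: N)
  have "measure N (space N) = 1" using N by (simp add: measure_def)
  have L: "L2 N f" using False assms unfolding L2_def by (intro conjI integrableI_bounded) (auto simp: less_top)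
  have L': "L2 N (\<lambda>z. norm (f z))" "L2 N (\<lambda>z. 1::real)" using L by (auto simp: L2_def)
  have "(norm (\<integral>z. f z \<partial>N))\<^sup>2 \<le> (\<integral>z. norm (f z) \<bullet> 1 \<partial>N)\<^sup>2"
    by (intro power_mono) (auto intro: integral_norm_bound)
  also have "... \<le> nsq N (\<lambda>z. norm (f z)) * nsq N (\<lambda>z. 1::real)" by (rule L2_Cauchy_Schwarz[OF L'])
  also have "... = nsq N f" by (simp add: nsq_def \<open>measure N (space N) = 1\<close>)
  finally show ?thesis by (simp add: nsq_nn_integral[OF L] ennreal_leI)
qed simp

lemma shift_integrable_product:
  fixes f :: "'a::euclidean_space => 'b::euclidean_space" and N :: "'z measure"
  assumes "finite_measure N" "\<tau> \<in> borel_measurable N" "integrable lborel f"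
  shows "integrable (N \<Otimes>\<^sub>M lborel) (\<lambda>(z, x). f (x + \<tau> z))"
proof (rule integrableI_bounded)
  interpret finite_measure N by fact
  have [measurable]: "f \<in> borel_measurable borel" "\<tau> \<in> borel_measurable N" using assms by auto
  show "(\<lambda>(z, x). f (x + \<tau> z)) \<in> borel_measurable (N \<Otimes>\<^sub>M lborel)" by measurable
  have "(\<integral>\<^sup>+p. ennreal (norm (case p of (z, x) => f (x + \<tau> z))) \<partial>(N \<Otimes>\<^sub>M lborel))
      = (\<integral>\<^sup>+z. \<integral>\<^sup>+x. ennreal (norm (f (x + \<tau> z))) \<partial>lborel \<partial>N)" by (subst lborel.nn_integral_fst[symmetric]) auto
  also have "... = (\<integral>\<^sup>+z. \<integral>\<^sup>+x. ennreal (norm (f x)) \<partial>lborel \<partial>N)"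
    by (intro nn_integral_cong nn_integral_lborel_shift) simp
  also have "... = (\<integral>\<^sup>+x. ennreal (norm (f x)) \<partial>lborel) * emeasure N (space N)" by simp
  also have "... < \<infinity>"
  proof -
    have "emeasure N (space N) < top" using emeasure_finite[of "space N"] by (simp add: less_top[symmetric])
    moreover have "(\<integral>\<^sup>+x. ennreal (norm (f x)) \<partial>lborel) < top" using assms(3) by (simp add: integrable_iff_bounded)
    ultimately show ?thesis by (simp add: ennreal_mult_less_top)
  qed
  finally show "(\<integral>\<^sup>+p. ennreal (norm (case p of (z, x) => f (x + \<tau> z))) \<partial>(N \<Otimes>\<^sub>M lborel)) < \<infinity>" .
qed

text \<open>
  Fubini's theorem and a change of variables move a translation from the function to the weight. The general bilinear
  product serves both pairings in the definition of the weak gradient.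
\<close>

lemma integral_shift_Fubini:
  fixes f :: "'a::euclidean_space => 'b::euclidean_space" and \<psi> :: "'a => 'c::euclidean_space"
    and prod :: "'c => 'b => 'd::euclidean_space"
  assumes N: "finite_measure N" and \<tau>: "\<tau> \<in> borel_measurable N" and f: "integrable lborel f"
    and \<psi>: "\<psi> \<in> borel_measurable borel" "\<And>x. norm (\<psi> x) \<le> B" and p: "bounded_bilinear prod"
  shows "(\<integral>x. prod (\<psi> x) (\<integral>z. f (x + \<tau> z) \<partial>N) \<partial>lborel)
      = (\<integral>z. (\<integral>x. prod (\<psi> (x - \<tau> z)) (f x) \<partial>lborel) \<partial>N)"
    and "integrable lborel (\<lambda>x. \<integral>z. f (x + \<tau> z) \<partial>N)"
    and "AE x in lborel. integrable N (\<lambda>z. f (x + \<tau> z))"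
proof -
  interpret finite_measure N by fact
  interpret bounded_bilinear prod by fact
  interpret NL: pair_sigma_finite N "lborel :: 'a measure" ..
  interpret LN: pair_sigma_finite "lborel :: 'a measure" N ..
  have [measurable]: "f \<in> borel_measurable borel" "\<tau> \<in> borel_measurable N" "\<psi> \<in> borel_measurable borel"
    using f \<tau> \<psi> by auto
  obtain K where K: "\<And>a b. norm (prod a b) \<le> norm a * norm b * K" "K \<ge> 0" using nonneg_bounded by auto
  have i: "integrable (N \<Otimes>\<^sub>M lborel) (\<lambda>(z, x). f (x + \<tau> z))" by (rule shift_integrable_product[OF N \<tau> f])
  have i': "integrable (lborel \<Otimes>\<^sub>M N) (\<lambda>(x, z). f (x + \<tau> z))"
    using NL.integrable_product_swap[OF i] by (simp add: case_prod_beta)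
  have pm [measurable]: "(\<lambda>(a, b). prod a b) \<in> borel_measurable borel" by (rule borel_measurable_continuous_onI)
      (auto simp: case_prod_beta intro!: continuous_on_fst continuous_on_snd continuous_on)
  have "integrable (N \<Otimes>\<^sub>M lborel) (\<lambda>(z, x). prod (\<psi> x) (f (x + \<tau> z)))"
  proof (rule Bochner_Integration.integrable_bound)
    show "integrable (N \<Otimes>\<^sub>M lborel) (\<lambda>p. (B * K) *\<^sub>R (case p of (z, x) => f (x + \<tau> z)))" using i by simp
    have "(\<lambda>p. case (\<psi> (snd p), f (snd p + \<tau> (fst p))) of (a, b) => prod a b) \<in> borel_measurable (N \<Otimes>\<^sub>M lborel)"
      by (rule measurable_compose[OF _ pm]) (simp add: borel_prod[symmetric])
    then show "(\<lambda>(z, x). prod (\<psi> x) (f (x + \<tau> z))) \<in> borel_measurable (N \<Otimes>\<^sub>M lborel)"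
      by (simp add: case_prod_beta)
    show "AE p in N \<Otimes>\<^sub>M lborel. norm (case p of (z, x) => prod (\<psi> x) (f (x + \<tau> z)))
        \<le> norm ((B * K) *\<^sub>R (case p of (z, x) => f (x + \<tau> z)))"
    proof (rule AE_I2, clarsimp)
      fix z x
      have "norm (prod (\<psi> x) (f (x + \<tau> z))) \<le> norm (\<psi> x) * norm (f (x + \<tau> z)) * K" by (rule K(1))
      also have "... \<le> B * norm (f (x + \<tau> z)) * K" using \<psi>(2)[of x] K(2) by (intro mult_right_mono) auto
      also have "... = (B * K) * norm (f (x + \<tau> z))" by simp
      also have "... \<le> \<bar>B * K\<bar> * norm (f (x + \<tau> z))" by (intro mult_right_mono) auto
      finally show "norm (prod (\<psi> x) (f (x + \<tau> z))) \<le> \<bar>B * K\<bar> * norm (f (x + \<tau> z))" .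
    qed
  qed
  then have F: "(\<integral>x. (\<integral>z. prod (\<psi> x) (f (x + \<tau> z)) \<partial>N) \<partial>lborel) = (\<integral>z. (\<integral>x. prod (\<psi> x) (f (x + \<tau> z)) \<partial>lborel) \<partial>N)"
    by (rule NL.Fubini_integral)
  show int: "integrable lborel (\<lambda>x. \<integral>z. f (x + \<tau> z) \<partial>N)" using LN.integrable_fst'[OF i'] by simp
  show AE: "AE x in lborel. integrable N (\<lambda>z. f (x + \<tau> z))" using LN.AE_integrable_fst'[OF i'] by simp
  have pm2: "(\<lambda>x. prod (F x) (G x)) \<in> borel_measurable M"
    if "F \<in> borel_measurable M" "G \<in> borel_measurable M" for F G and M :: "'m measure"
    using measurable_compose[OF measurable_Pair[OF that] pm[unfolded borel_prod[symmetric]]] by simp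
  have "(\<integral>x. prod (\<psi> x) (\<integral>z. f (x + \<tau> z) \<partial>N) \<partial>lborel) = (\<integral>x. (\<integral>z. prod (\<psi> x) (f (x + \<tau> z)) \<partial>N) \<partial>lborel)"
  proof (rule integral_cong_AE)
    show "AE x in lborel. prod (\<psi> x) (\<integral>z. f (x + \<tau> z) \<partial>N) = (\<integral>z. prod (\<psi> x) (f (x + \<tau> z)) \<partial>N)"
      using AE by eventually_elim (simp add: integral_bounded_linear[OF bounded_linear_right])
  next
    have "(\<lambda>x. \<integral>z. f (x + \<tau> z) \<partial>N) \<in> borel_measurable borel" using int by auto
    then show "(\<lambda>x. prod (\<psi> x) (\<integral>z. f (x + \<tau> z) \<partial>N)) \<in> borel_measurable lborel" by (simp add: pm2)
    have "(\<lambda>p. prod (\<psi> (fst p)) (f (fst p + \<tau> (snd p)))) \<in> borel_measurable (borel \<Otimes>\<^sub>M N)" by (rule pm2) auto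
    then show "(\<lambda>x. \<integral>z. prod (\<psi> x) (f (x + \<tau> z)) \<partial>N) \<in> borel_measurable lborel"
      by (intro borel_measurable_lebesgue_integral) (simp add: case_prod_beta)
  qed
  also have "... = (\<integral>z. (\<integral>x. prod (\<psi> (x - \<tau> z)) (f x) \<partial>lborel) \<partial>N)"
    unfolding F
  proof (rule Bochner_Integration.integral_cong[OF refl])
    fix z
    have "(\<lambda>x. prod (\<psi> (x - \<tau> z)) (f x)) \<in> borel_measurable borel" by (rule pm2) auto
    from integral_lborel_shift[OF this, of "\<tau> z"]
    show "(\<integral>x. prod (\<psi> x) (f (x + \<tau> z)) \<partial>lborel) = (\<integral>x. prod (\<psi> (x - \<tau> z)) (f x) \<partial>lborel)" by simp
  qed
  finally show "(\<integral>x. prod (\<psi> x) (\<integral>z. f (x + \<tau> z) \<partial>N) \<partial>lborel)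
      = (\<integral>z. (\<integral>x. prod (\<psi> (x - \<tau> z)) (f x) \<partial>lborel) \<partial>N)" .
qed

text \<open>
  Each shift of a test function on A is a test function on U, so the identity that defines the weak gradient can be
  averaged over the shifts.
\<close>

lemma average_weak_gradient:
  assumes H: "H1 U v g" and U: "bounded U" and N: "finite_measure N" and \<tau>: "\<tau> \<in> borel_measurable N"
    and A: "\<And>x z. x \<in> A ==> z \<in> space N ==> x + \<tau> z \<in> U" and \<phi>: "\<phi> \<in> test_functions A"
  shows "(\<integral>x. (\<integral>z. v (x + \<tau> z) \<partial>N) *\<^sub>R gradient \<phi> x \<partial>lborel) = - (\<integral>x. \<phi> x *\<^sub>R (\<integral>z. g (x + \<tau> z) \<partial>N) \<partial>lborel)"
proof -
  obtain B where B: "\<And>x. norm (\<phi> x) \<le> B" "\<And>x. norm (gradient \<phi> x) \<le> B" using test_bounded[OF \<phi>] by auto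
  have C: "\<And>k. C_k k \<phi>" using \<phi> by (simp add: test_functions_def)
  have bb: "bounded_bilinear (\<lambda>(a::real^2) (b::real). b *\<^sub>R a)"
    using bounded_bilinear.flip[OF bounded_bilinear_scaleR] .
  have "(\<integral>x. (\<integral>z. v (x + \<tau> z) \<partial>N) *\<^sub>R gradient \<phi> x \<partial>lborel)
      = (\<integral>z. (\<integral>x. v x *\<^sub>R gradient \<phi> (x - \<tau> z) \<partial>lborel) \<partial>N)"
    by (rule integral_shift_Fubini(1)[OF N \<tau> H1_integrable(1)[OF H U] test_borel(2)[OF \<phi>] B(2) bb])
  also have "... = (\<integral>z. - (\<integral>x. \<phi> (x - \<tau> z) *\<^sub>R g x \<partial>lborel) \<partial>N)"
  proof (rule Bochner_Integration.integral_cong[OF refl])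
    fix z assume "z \<in> space N"
    then have "(\<lambda>x. \<phi> (x - \<tau> z)) \<in> test_functions U" using A by (intro test_shift[OF \<phi>]) auto
    from H1_weak[OF H this]
    show "(\<integral>x. v x *\<^sub>R gradient \<phi> (x - \<tau> z) \<partial>lborel) = - (\<integral>x. \<phi> (x - \<tau> z) *\<^sub>R g x \<partial>lborel)"
      by (simp add: gradient_shift[OF C])
  qed
  also have "... = - (\<integral>x. \<phi> x *\<^sub>R (\<integral>z. g (x + \<tau> z) \<partial>N) \<partial>lborel)"
    using integral_shift_Fubini(1)[OF N \<tau> H1_integrable(2)[OF H U] test_borel(1)[OF \<phi>] B(1) bounded_bilinear_scaleR]
    by simp
  finally show ?thesis .
qed

section \<open>The translation identity\<close>

abbreviation unit_interval_measure :: "real measure" where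
  "unit_interval_measure \<equiv> restrict_space lborel {0..1}"

lemma unit_interval_measure_space: "emeasure unit_interval_measure (space unit_interval_measure) = 1"
  by (simp add: emeasure_restrict_space space_restrict_space)

lemma finite_unit_interval: "finite_measure unit_interval_measure"
  by (rule finite_measureI, unfold unit_interval_measure_space, simp)

lemma test_line_integral:
  assumes "\<phi> \<in> test_functions A"
  shows "(\<integral>r. gradient \<phi> (x - r *\<^sub>R c) \<bullet> c \<partial>unit_interval_measure) = \<phi> x - \<phi> (x - c)"
proof -
  have C: "\<And>k. C_k k \<phi>" using assms by (simp add: test_functions_def)
  have "(\<integral>r. indicator {0..1} r *\<^sub>R (gradient \<phi> (x - r *\<^sub>R c) \<bullet> c) \<partial>lborel)
      = - \<phi> (x - 1 *\<^sub>R c) - (- \<phi> (x - 0 *\<^sub>R c))"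
  proof (rule integral_FTC_Icc[where F="\<lambda>r. - \<phi> (x - r *\<^sub>R c)"])
    show "((\<lambda>r. - \<phi> (x - r *\<^sub>R c)) has_vector_derivative gradient \<phi> (x - r *\<^sub>R c) \<bullet> c) (at r within {0..1})" for r
    proof -
      have "((\<lambda>r. \<phi> (x - r *\<^sub>R c)) has_derivative (\<lambda>q. - (q *\<^sub>R c) \<bullet> gradient \<phi> (x - r *\<^sub>R c))) (at r within {0..1})"
        by (rule has_derivative_compose[OF _ test_has_derivative[OF assms]]) (auto intro!: derivative_eq_intros)
      then show ?thesis
        unfolding has_vector_derivative_def by (auto intro!: derivative_eq_intros simp: inner_commute)
    qed
    show "continuous_on {0..1} (\<lambda>r. gradient \<phi> (x - r *\<^sub>R c) \<bullet> c)"
      by (intro continuous_on_inner continuous_on_const continuous_on_diff continuous_on_scaleR continuous_on_id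
          continuous_on_compose2[OF smooth_continuous_gradient[OF C]]) auto
  qed simp
  then show ?thesis by (simp add: integral_restrict_space)
qed

text \<open>
  By the fundamental lemma it suffices to test with functions on A. The weak gradient then passes to the test function,
  which can be moved along the whole segment without leaving U, and for smooth functions the identity is the fundamental
  theorem of calculus.
\<close>

lemma translation_identity:
  assumes H: "H1 U v g" and U: "bounded U" and A: "open A" "\<And>x r. x \<in> A ==> r \<in> {0..1} ==> x + r *\<^sub>R c \<in> U"
  shows "AE x in lborel. x \<in> A --> v (x + c) - v x = (\<integral>r. g (x + r *\<^sub>R c) \<partial>unit_interval_measure) \<bullet> c"
proof -
  let ?N = unit_interval_measure
  interpret N: finite_measure ?N by (rule finite_unit_interval)
  interpret NL: pair_sigma_finite ?N "lborel :: (real^2) measure" ..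
  note N = finite_unit_interval
  define \<tau> where "\<tau> r = r *\<^sub>R c" for r :: real
  have \<tau> [measurable]: "\<tau> \<in> borel_measurable ?N"
    unfolding \<tau>_def[abs_def] by (intro measurable_restrict_space1) simp
  note iv = H1_integrable(1)[OF H U] and ig = H1_integrable(2)[OF H U]
  note [measurable] = H1_borel[OF H]
  define G where "G x = (\<integral>r. g (x + \<tau> r) \<partial>?N)" for x
  have iG: "integrable lborel G"
    unfolding G_def[abs_def]
    by (rule integral_shift_Fubini(2)[OF N \<tau> ig, of "\<lambda>x. 0::real" 0, OF _ _ bounded_bilinear_scaleR]) auto
  define h where "h x = v (x + c) - v x - G x \<bullet> c" for x
  have "integrable lborel h" unfolding h_def[abs_def] using iG iv integrable_lborel_shift[OF iv] by auto
  moreover have "(\<integral>x. \<phi> x * h x \<partial>lborel) = 0" if \<phi>: "\<phi> \<in> test_functions A" for \<phi>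
  proof -
    note [measurable] = test_borel[OF \<phi>]
    obtain B where B: "\<And>x. \<bar>\<phi> x\<bar> \<le> B" "\<And>x. norm (gradient \<phi> x) \<le> B" using test_bounded[OF \<phi>] by auto
    have i1: "integrable lborel (\<lambda>x. \<phi> x * v (x + c))" "integrable lborel (\<lambda>x. \<phi> x * v x)"
      "integrable lborel (\<lambda>x. \<phi> x *\<^sub>R G x)"
      using test_integrable[OF \<phi> integrable_lborel_shift[OF iv]] test_integrable[OF \<phi> iv] test_integrable[OF \<phi> iG] by auto
    have i2: "integrable lborel (\<lambda>x. \<phi> (x - c) * v x)"
      using integrable_bounded_mult[OF iv, of "\<lambda>x. \<phi> (x - c)" B] B by simp
    have a: "(\<integral>x. \<phi> x * v (x + c) \<partial>lborel) = (\<integral>x. \<phi> (x - c) * v x \<partial>lborel)"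
      using integral_lborel_shift[of "\<lambda>x. \<phi> (x - c) * v x" c] by simp
    have "(\<integral>x. \<phi> x *\<^sub>R G x \<partial>lborel) = - (\<integral>x. (\<integral>r. v (x + \<tau> r) \<partial>?N) *\<^sub>R gradient \<phi> x \<partial>lborel)"
      unfolding G_def using average_weak_gradient[OF H U N \<tau> _ \<phi>] A(2) by (simp add: \<tau>_def space_restrict_space)
    also have "(\<integral>x. (\<integral>r. v (x + \<tau> r) \<partial>?N) *\<^sub>R gradient \<phi> x \<partial>lborel)
       = (\<integral>r. (\<integral>x. v x *\<^sub>R gradient \<phi> (x - \<tau> r) \<partial>lborel) \<partial>?N)"
      by (rule integral_shift_Fubini(1)[OF N \<tau> iv _ B(2) bounded_bilinear.flip[OF bounded_bilinear_scaleR]]) simp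
    also have "... = (\<integral>x. (\<integral>r. v x *\<^sub>R gradient \<phi> (x - \<tau> r) \<partial>?N) \<partial>lborel)"
    proof (rule NL.Fubini_integral[symmetric])
      have "integrable (?N \<Otimes>\<^sub>M lborel) (\<lambda>(r, x). v (x + 0))" by (rule shift_integrable_product[OF N _ iv]) simp
      then have "integrable (?N \<Otimes>\<^sub>M lborel) (\<lambda>p. v (snd p))" by (simp add: split_beta')
      then have "integrable (?N \<Otimes>\<^sub>M lborel) (\<lambda>p. v (snd p) *\<^sub>R gradient \<phi> (snd p - \<tau> (fst p)))"
        by (intro integrable_bounded_mult'[where B=B]) (use B(2) in \<open>auto simp: split_beta'\<close>)
      then show "integrable (?N \<Otimes>\<^sub>M lborel) (\<lambda>(r, x). v x *\<^sub>R gradient \<phi> (x - \<tau> r))" by (simp add: split_beta')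
    qed
    finally have "(\<integral>x. \<phi> x *\<^sub>R G x \<partial>lborel) \<bullet> c = - ((\<integral>x. (\<integral>r. v x *\<^sub>R gradient \<phi> (x - \<tau> r) \<partial>?N) \<partial>lborel) \<bullet> c)"
      by simp
    also have "(\<integral>x. (\<integral>r. v x *\<^sub>R gradient \<phi> (x - \<tau> r) \<partial>?N) \<partial>lborel) \<bullet> c
        = (\<integral>x. (\<integral>r. v x *\<^sub>R gradient \<phi> (x - \<tau> r) \<partial>?N) \<bullet> c \<partial>lborel)"
    proof (rule integral_inner_left[symmetric])
      have "integrable lborel (\<lambda>x. v x *\<^sub>R (\<integral>r. gradient \<phi> (x - \<tau> r) \<partial>?N))"
      proof (rule integrable_bounded_mult'[OF iv])
        show "(\<lambda>x. \<integral>r. gradient \<phi> (x - \<tau> r) \<partial>?N) \<in> borel_measurable lborel" by measurable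
        show "norm (\<integral>r. gradient \<phi> (x - \<tau> r) \<partial>?N) \<le> B" for x
        proof -
          have "integrable ?N (\<lambda>r. norm (gradient \<phi> (x - \<tau> r)))"
            using integrable_bounded_mult'[of ?N "\<lambda>_. 1" "\<lambda>r. gradient \<phi> (x - \<tau> r)" B] B(2) by simp
          then have "(\<integral>r. norm (gradient \<phi> (x - \<tau> r)) \<partial>?N) \<le> (\<integral>r. B \<partial>?N)"
            by (intro integral_mono) (use B(2) in auto)
          also have "... = B" using unit_interval_measure_space by (simp add: measure_def)
          finally show ?thesis by (rule order_trans[OF integral_norm_bound])
        qed
      qed
      then show "integrable lborel (\<lambda>x. \<integral>r. v x *\<^sub>R gradient \<phi> (x - \<tau> r) \<partial>?N)" by simp
    qed
    also have "(\<lambda>x. (\<integral>r. v x *\<^sub>R gradient \<phi> (x - \<tau> r) \<partial>?N) \<bullet> c) = (\<lambda>x. v x * (\<phi> x - \<phi> (x - c)))"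
    proof
      fix x
      have "integrable ?N (\<lambda>r. gradient \<phi> (x - \<tau> r))"
        using integrable_bounded_mult'[of ?N "\<lambda>_. 1" "\<lambda>r. gradient \<phi> (x - \<tau> r)" B] B(2) by simp
      then have "(\<integral>r. gradient \<phi> (x - \<tau> r) \<partial>?N) \<bullet> c = \<phi> x - \<phi> (x - c)"
        unfolding test_line_integral[OF \<phi>, of x c, symmetric] \<tau>_def by simp
      then show "(\<integral>r. v x *\<^sub>R gradient \<phi> (x - \<tau> r) \<partial>?N) \<bullet> c = v x * (\<phi> x - \<phi> (x - c))" by simp
    qed
    finally have b: "(\<integral>x. \<phi> x *\<^sub>R G x \<partial>lborel) \<bullet> c = (\<integral>x. \<phi> (x - c) * v x \<partial>lborel) - (\<integral>x. \<phi> x * v x \<partial>lborel)"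
      using i1 i2 by (simp add: algebra_simps)
    have i4: "integrable lborel (\<lambda>x. (\<phi> x *\<^sub>R G x) \<bullet> c)" using i1(3) by (intro integrable_inner_left) auto
    have "(\<integral>x. \<phi> x * h x \<partial>lborel) = (\<integral>x. \<phi> x * v (x + c) - \<phi> x * v x - (\<phi> x *\<^sub>R G x) \<bullet> c \<partial>lborel)"
      by (simp add: h_def algebra_simps)
    also have "... = (\<integral>x. \<phi> x * v (x + c) \<partial>lborel) - (\<integral>x. \<phi> x * v x \<partial>lborel) - (\<integral>x. (\<phi> x *\<^sub>R G x) \<bullet> c \<partial>lborel)"
      using Bochner_Integration.integral_diff[OF Bochner_Integration.integrable_diff[OF i1(1,2)] i4]
        Bochner_Integration.integral_diff[OF i1(1,2)] by (simp only:)
    also have "(\<integral>x. (\<phi> x *\<^sub>R G x) \<bullet> c \<partial>lborel) = (\<integral>x. \<phi> x *\<^sub>R G x \<partial>lborel) \<bullet> c"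
      using i1(3) by (intro integral_inner_left) auto
    finally show ?thesis using a b by simp
  qed
  ultimately have "AE x in lborel. x \<in> A --> h x = 0" by (rule fundamental_lemma[OF _ A(1)])
  then show ?thesis by eventually_elim (auto simp: h_def G_def \<tau>_def)
qed

lemma translation_estimate_pointwise:
  assumes "H1 U v g" "bounded U" "open A" "\<And>x r. x \<in> A ==> r \<in> {0..1} ==> x + r *\<^sub>R c \<in> U"
  shows "AE x in lborel. x \<in> A --> ennreal ((v (x + c) - v x)\<^sup>2)
     \<le> ennreal ((norm c)\<^sup>2) * (\<integral>\<^sup>+r. ennreal ((norm (g (x + r *\<^sub>R c)))\<^sup>2) \<partial>unit_interval_measure)"
proof -
  have "AE x in lborel. x \<in> A --> v (x + c) - v x = (\<integral>r. g (x + r *\<^sub>R c) \<partial>unit_interval_measure) \<bullet> c"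
    by (rule translation_identity[OF assms(1,2,3)]) (rule assms(4))
  then show ?thesis
proof eventually_elim
  case (elim x)
  show ?case
  proof
    assume "x \<in> A"
    note [measurable] = H1_borel[OF assms(1)]
    let ?I = "\<integral>r. g (x + r *\<^sub>R c) \<partial>unit_interval_measure"
    have m: "(\<lambda>r. g (x + r *\<^sub>R c)) \<in> borel_measurable unit_interval_measure"
      by (intro measurable_restrict_space1) simp
    have "\<bar>v (x + c) - v x\<bar> \<le> norm c * norm ?I"
      using elim \<open>x \<in> A\<close> Cauchy_Schwarz_ineq2[of ?I c] by (simp add: mult.commute)
    then have "(v (x + c) - v x)\<^sup>2 \<le> (norm c)\<^sup>2 * (norm ?I)\<^sup>2"
      using power_mono[of "\<bar>v (x + c) - v x\<bar>" "norm c * norm ?I" 2] by (simp add: power_mult_distrib)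
    then have "ennreal ((v (x + c) - v x)\<^sup>2) \<le> ennreal ((norm c)\<^sup>2) * ennreal ((norm ?I)\<^sup>2)"
      by (simp add: ennreal_leI flip: ennreal_mult)
    also have "... \<le> ennreal ((norm c)\<^sup>2) * (\<integral>\<^sup>+r. ennreal ((norm (g (x + r *\<^sub>R c)))\<^sup>2) \<partial>unit_interval_measure)"
      by (intro mult_left_mono norm_integral_sq_le unit_interval_measure_space m) simp
    finally show "ennreal ((v (x + c) - v x)\<^sup>2)
     \<le> ennreal ((norm c)\<^sup>2) * (\<integral>\<^sup>+r. ennreal ((norm (g (x + r *\<^sub>R c)))\<^sup>2) \<partial>unit_interval_measure)" .
  qed
qed
qed

lemma translation_estimate:
  assumes H: "H1 U v g" and U: "bounded U" and A: "open A" "\<And>x r. x \<in> A ==> r \<in> {0..1} ==> x + r *\<^sub>R c \<in> U"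
    and C: "C \<in> sets borel" "\<And>x. x \<in> A ==> x + c \<in> C"
  shows "sqn (\<lambda>x. indicator A x * v x) \<le> 2 * sqn (\<lambda>x. indicator C x * v x) + 2 * (norm c)\<^sup>2 * sqn g"
proof -
  note [measurable] = H1_borel[OF H] C(1)
  have [measurable]: "A \<in> sets borel" using A by auto
  let ?N = unit_interval_measure
  interpret N: finite_measure ?N by (rule finite_unit_interval)
  interpret NL: pair_sigma_finite "lborel :: (real^2) measure" ?N ..
  have rm [measurable]: "(\<lambda>r. r) \<in> borel_measurable ?N" by (intro measurable_restrict_space1) simp
  have L: "L2 lborel (\<lambda>x. indicator A x * v x)" "L2 lborel (\<lambda>x. indicator C x * v x)"
    by (rule L2_dominated[OF H1_L2(1)[OF H], of _ 1], auto simp: indicator_def)+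
  have LC: "L2 lborel (\<lambda>x. indicator C (x + c) * v (x + c))" by (rule L2_shift[OF L(2)])
  have LA: "L2 lborel (\<lambda>x. indicator A x * v (x + c))"
    by (rule L2_dominated[OF LC, of _ 1]) (use C(2) in \<open>auto simp: indicator_def\<close>)
  have 1: "sqn (\<lambda>x. indicator A x * v (x + c)) \<le> sqn (\<lambda>x. indicator C x * v x)"
    using L2_dominated(2)[OF LC, of "\<lambda>x. indicator A x * v (x + c)" 1] C(2) nsq_shift[OF L(2), of c]
    by (auto simp: indicator_def)
  have pointwise: "AE x in lborel. x \<in> A --> ennreal ((v (x + c) - v x)\<^sup>2)
     \<le> ennreal ((norm c)\<^sup>2) * (\<integral>\<^sup>+r. ennreal ((norm (g (x + r *\<^sub>R c)))\<^sup>2) \<partial>?N)"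
    by (rule translation_estimate_pointwise[OF H U A(1)]) (rule A(2))
  have Ld: "(\<integral>\<^sup>+x. ennreal ((norm (indicator A x * v x - indicator A x * v (x + c)))\<^sup>2) \<partial>lborel)
      \<le> ennreal ((norm c)\<^sup>2 * sqn g)"
  proof -
    have "(\<integral>\<^sup>+x. ennreal ((norm (indicator A x * v x - indicator A x * v (x + c)))\<^sup>2) \<partial>lborel)
      \<le> (\<integral>\<^sup>+x. ennreal ((norm c)\<^sup>2) * (\<integral>\<^sup>+r. ennreal ((norm (g (x + r *\<^sub>R c)))\<^sup>2) \<partial>?N) \<partial>lborel)"
    proof (rule nn_integral_mono_AE)
      show "AE x in lborel. ennreal ((norm (indicator A x * v x - indicator A x * v (x + c)))\<^sup>2)
        \<le> ennreal ((norm c)\<^sup>2) * (\<integral>\<^sup>+r. ennreal ((norm (g (x + r *\<^sub>R c)))\<^sup>2) \<partial>?N)"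
        using pointwise
      proof eventually_elim
        case (elim x)
        then show ?case by (cases "x \<in> A") (auto simp: power2_commute[of "v x"])
      qed
    qed
    also have "... = ennreal ((norm c)\<^sup>2) * (\<integral>\<^sup>+x. (\<integral>\<^sup>+r. ennreal ((norm (g (x + r *\<^sub>R c)))\<^sup>2) \<partial>?N) \<partial>lborel)"
      by (intro nn_integral_cmult) measurable
    also have "(\<integral>\<^sup>+x. (\<integral>\<^sup>+r. ennreal ((norm (g (x + r *\<^sub>R c)))\<^sup>2) \<partial>?N) \<partial>lborel)
        = (\<integral>\<^sup>+r. (\<integral>\<^sup>+x. ennreal ((norm (g (x + r *\<^sub>R c)))\<^sup>2) \<partial>lborel) \<partial>?N)"
      by (rule NL.Fubini'[symmetric]) measurable
    also have "... = (\<integral>\<^sup>+r. ennreal (sqn g) \<partial>?N)"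
      by (intro nn_integral_cong) (simp add: nn_integral_lborel_shift[of "\<lambda>x. ennreal ((norm (g x))\<^sup>2)"]
          nsq_nn_integral[OF H1_L2(2)[OF H]])
    also have "... = ennreal (sqn g)" by (subst nn_integral_const, subst unit_interval_measure_space) simp
    finally show ?thesis by (simp add: ennreal_mult)
  qed
  have 2: "sqn (\<lambda>x. indicator A x * v x - indicator A x * v (x + c)) \<le> (norm c)\<^sup>2 * sqn g"
    by (rule L2_nn_integralI(2)[OF _ Ld]) auto
  show ?thesis using nsq_triangle'[OF L(1) LA] 1 2 by simp
qed

section \<open>Density of continuous functions\<close>

definition ball_measure :: "real^2 => real => (real^2) measure" where
  "ball_measure c t = scale_measure (ennreal (1 / measure lborel (ball c t))) (restrict_space lborel (ball c t))"

definition ball_average :: "real^2 => real => (real^2 => 'b::euclidean_space) => real^2 => 'b" where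
  "ball_average c t u x = (\<integral>z. u (x + z) \<partial>ball_measure c t)"

lemma space_ball_measure: "space (ball_measure c t) = ball c t"
  by (simp add: ball_measure_def space_scale_measure space_restrict_space)

lemma ball_measure_space:
  assumes "t > 0"
  shows "emeasure (ball_measure c t) (space (ball_measure c t)) = 1"
proof -
  have pos: "measure lborel (ball c t) > 0" using content_ball_pos[OF assms, of c] by simp
  have "emeasure lborel (ball c t) = ennreal (measure lborel (ball c t))"
    using emeasure_lborel_ball_finite[of c t] by (intro emeasure_eq_ennreal_measure) auto
  then have "emeasure (ball_measure c t) (ball c t) = ennreal (1 / measure lborel (ball c t) * measure lborel (ball c t))"
    using pos by (simp add: ball_measure_def emeasure_restrict_space flip: ennreal_mult)
  also have "... = 1" using pos by simp
  finally show ?thesis by (simp add: space_ball_measure)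
qed

lemma finite_ball_measure: "t > 0 ==> finite_measure (ball_measure c t)"
  by (rule finite_measureI, unfold ball_measure_space, simp)

lemma ball_measure_measurable: "h \<in> borel_measurable borel ==> h \<in> borel_measurable (ball_measure c t)"
  unfolding ball_measure_def measurable_cong_sets[OF sets_scale_measure refl]
  by (rule measurable_restrict_space1) simp

lemma nn_integral_ball_measure_le:
  assumes "h \<in> borel_measurable borel"
  shows "(\<integral>\<^sup>+z. h z \<partial>ball_measure c t) \<le> ennreal (1 / measure lborel (ball c t)) * (\<integral>\<^sup>+z. h z \<partial>lborel)"
proof -
  have "(\<integral>\<^sup>+z. h z \<partial>ball_measure c t)
      = ennreal (1 / measure lborel (ball c t)) * (\<integral>\<^sup>+z. h z * indicator (ball c t) z \<partial>lborel)"
    unfolding ball_measure_def using assms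
    by (subst nn_integral_scale_measure) (auto simp: measurable_restrict_space1 nn_integral_restrict_space)
  also have "... \<le> ennreal (1 / measure lborel (ball c t)) * (\<integral>\<^sup>+z. h z \<partial>lborel)"
    by (intro mult_left_mono nn_integral_mono) (auto simp: indicator_def)
  finally show ?thesis .
qed

text \<open>
  The averages at two points differ by an average of the difference of two translates, which is small in mean square.
\<close>

lemma ball_average_continuous:
  fixes u :: "real^2 => 'b::euclidean_space"
  assumes "L2 lborel u" "integrable lborel u" "bounded U" "\<And>x. x \<notin> U ==> u x = 0" "t > 0"
  shows "continuous_on UNIV (ball_average c t u)"
proof -
  let ?m = "measure lborel (ball c t)"
  let ?N = "ball_measure c t"
  have pos: "?m > 0" using content_ball_pos[OF assms(5), of c] by simp
  have [measurable]: "u \<in> borel_measurable borel" using assms(1) by (simp add: L2_def)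
  have int: "integrable ?N (\<lambda>z. u (x + z))" for x
  proof (rule integrableI_bounded)
    show "(\<lambda>z. u (x + z)) \<in> borel_measurable ?N" by (rule ball_measure_measurable) simp
    have "(\<integral>\<^sup>+z. ennreal (norm (u (x + z))) \<partial>?N) \<le> ennreal (1 / ?m) * (\<integral>\<^sup>+z. ennreal (norm (u (x + z))) \<partial>lborel)"
      by (rule nn_integral_ball_measure_le) simp
    also have "(\<integral>\<^sup>+z. ennreal (norm (u (x + z))) \<partial>lborel) = (\<integral>\<^sup>+z. ennreal (norm (u z)) \<partial>lborel)"
      using nn_integral_lborel_shift[of "\<lambda>z. ennreal (norm (u z))" x] by (simp add: add.commute)
    also have "ennreal (1 / ?m) * ... < \<infinity>"
      using assms(2) by (simp add: integrable_iff_bounded ennreal_mult_less_top)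
    finally show "(\<integral>\<^sup>+z. ennreal (norm (u (x + z))) \<partial>?N) < \<infinity>" .
  qed
  have "\<exists>d>0. \<forall>y. dist y x < d --> dist (ball_average c t u y) (ball_average c t u x) < e" if "e > 0" for x e
  proof -
    have "e\<^sup>2 * ?m > 0" using that pos by simp
    have "\<exists>d>0. \<forall>h. norm h < d --> sqn (\<lambda>x. u (x + h) - u x) < e\<^sup>2 * ?m"
      by (rule L2_translation_continuous[OF assms(1,3) _ \<open>e\<^sup>2 * ?m > 0\<close>]) (rule assms(4))
    then obtain d where d: "d > 0" "\<forall>h. norm h < d --> sqn (\<lambda>x. u (x + h) - u x) < e\<^sup>2 * ?m"
      by (elim exE conjE) (rule that)
    show ?thesis
    proof (intro exI[of _ d] conjI allI impI)
      fix y assume y: "dist y x < d"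
      let ?h = "y - x"
      have L: "L2 lborel (\<lambda>x. u (x + ?h) - u x)" by (rule L2_diff(1)[OF L2_shift[OF assms(1)] assms(1)])
      have "ball_average c t u y - ball_average c t u x = (\<integral>z. u (y + z) - u (x + z) \<partial>?N)"
        unfolding ball_average_def by (rule Bochner_Integration.integral_diff[OF int int, symmetric])
      then have "ennreal ((norm (ball_average c t u y - ball_average c t u x))\<^sup>2)
          \<le> (\<integral>\<^sup>+z. ennreal ((norm (u (y + z) - u (x + z)))\<^sup>2) \<partial>?N)"
        using norm_integral_sq_le[OF ball_measure_space[OF assms(5)], of "\<lambda>z. u (y + z) - u (x + z)" c]
        by (simp add: ball_measure_measurable)
      also have "... \<le> ennreal (1 / ?m) * (\<integral>\<^sup>+z. ennreal ((norm (u (y + z) - u (x + z)))\<^sup>2) \<partial>lborel)"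
        by (rule nn_integral_ball_measure_le) simp
      also have "(\<integral>\<^sup>+z. ennreal ((norm (u (y + z) - u (x + z)))\<^sup>2) \<partial>lborel)
          = (\<integral>\<^sup>+z. ennreal ((norm (u (z + ?h) - u z))\<^sup>2) \<partial>lborel)"
        using nn_integral_lborel_shift[of "\<lambda>z. ennreal ((norm (u (z + ?h) - u z))\<^sup>2)" x] by (simp add: algebra_simps)
      also have "... = ennreal (sqn (\<lambda>x. u (x + ?h) - u x))" by (rule nsq_nn_integral[OF L])
      also have "ennreal (1 / ?m) * ... = ennreal (sqn (\<lambda>x. u (x + ?h) - u x) / ?m)"
        using pos by (simp flip: ennreal_mult)
      finally have "(norm (ball_average c t u y - ball_average c t u x))\<^sup>2 \<le> sqn (\<lambda>x. u (x + ?h) - u x) / ?m"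
        using pos by (simp add: ennreal_le_iff)
      also have "... < e\<^sup>2" using d(2)[rule_format, of ?h] y pos by (simp add: dist_norm pos_divide_less_eq)
      finally show "dist (ball_average c t u y) (ball_average c t u x) < e"
        using that by (simp add: dist_norm power_less_imp_less_base)
    qed (rule d(1))
  qed
  then show ?thesis by (simp add: continuous_on_iff)
qed

text \<open>By Jensen's inequality the error is at most the average of the errors made by the single translates.\<close>

lemma ball_average_close:
  fixes u :: "real^2 => 'b::euclidean_space"
  assumes u: "L2 lborel u" "integrable lborel u" and "t > 0" "e \<ge> 0"
    and e: "\<And>z. z \<in> ball c t ==> sqn (\<lambda>x. u (x + z) - u x) \<le> e"
  shows "integrable lborel (ball_average c t u)" "L2 lborel (\<lambda>x. ball_average c t u x - u x)"
    "sqd (ball_average c t u) u \<le> e"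
proof -
  let ?N = "ball_measure c t"
  interpret N: finite_measure ?N by (rule finite_ball_measure[OF assms(3)])
  interpret NL: pair_sigma_finite "lborel :: (real^2) measure" ?N ..
  have sp: "measure ?N (space ?N) = 1" using ball_measure_space[OF assms(3), of c] by (simp add: measure_def)
  have [measurable]: "u \<in> borel_measurable borel" using u by (simp add: L2_def)
  have id [measurable]: "(\<lambda>z. z) \<in> borel_measurable ?N" by (rule ball_measure_measurable) simp
  note F = integral_shift_Fubini(2,3)[OF finite_ball_measure[OF assms(3)] id u(2),
      of "\<lambda>x. 0::real" 0, OF _ _ bounded_bilinear_scaleR]
  show i: "integrable lborel (ball_average c t u)" unfolding ball_average_def[abs_def] by (rule F) auto
  then have [measurable]: "ball_average c t u \<in> borel_measurable borel" by auto
  have AEi: "AE x in lborel. integrable ?N (\<lambda>z. u (x + z))" by (rule F) auto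
  have "(\<integral>\<^sup>+x. ennreal ((norm (ball_average c t u x - u x))\<^sup>2) \<partial>lborel)
      \<le> (\<integral>\<^sup>+x. (\<integral>\<^sup>+z. ennreal ((norm (u (x + z) - u x))\<^sup>2) \<partial>?N) \<partial>lborel)"
  proof (rule nn_integral_mono_AE)
    show "AE x in lborel. ennreal ((norm (ball_average c t u x - u x))\<^sup>2)
        \<le> (\<integral>\<^sup>+z. ennreal ((norm (u (x + z) - u x))\<^sup>2) \<partial>?N)"
      using AEi
    proof eventually_elim
      case (elim x)
      have "ball_average c t u x - u x = (\<integral>z. u (x + z) - u x \<partial>?N)"
        unfolding ball_average_def using elim by (simp add: sp)
      then show ?case
        using norm_integral_sq_le[OF ball_measure_space[OF assms(3)], of "\<lambda>z. u (x + z) - u x" c]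
        by (simp add: ball_measure_measurable)
    qed
  qed
  also have "... = (\<integral>\<^sup>+z. (\<integral>\<^sup>+x. ennreal ((norm (u (x + z) - u x))\<^sup>2) \<partial>lborel) \<partial>?N)"
    by (rule NL.Fubini'[symmetric]) measurable
  also have "... \<le> (\<integral>\<^sup>+z. ennreal e \<partial>?N)"
  proof (rule nn_integral_mono)
    fix z assume "z \<in> space ?N"
    then have "z \<in> ball c t" by (simp add: space_ball_measure)
    then show "(\<integral>\<^sup>+x. ennreal ((norm (u (x + z) - u x))\<^sup>2) \<partial>lborel) \<le> ennreal e"
      using e nsq_nn_integral[OF L2_diff(1)[OF L2_shift[OF u(1)] u(1)], of z] by (simp add: ennreal_leI)
  qed
  also have "... = ennreal e" by (subst nn_integral_const, subst ball_measure_space[OF assms(3)]) simp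
  finally have *: "(\<integral>\<^sup>+x. ennreal ((norm (ball_average c t u x - u x))\<^sup>2) \<partial>lborel) \<le> ennreal e" .
  show "L2 lborel (\<lambda>x. ball_average c t u x - u x)" "sqd (ball_average c t u) u \<le> e"
    by (rule L2_nn_integralI[OF _ * assms(4)], simp)+
qed

lemma ball_average_approx:
  fixes u :: "real^2 => 'b::euclidean_space"
  assumes u: "L2 lborel u" "integrable lborel u" "bounded U" "\<And>x. x \<notin> U ==> u x = 0" and "e > 0"
  shows "\<exists>t0>0. \<forall>t. 0 < t \<and> t < t0 --> sqd (ball_average (t *\<^sub>R a) t u) u \<le> e"
proof -
  have "\<exists>d>0. \<forall>h. norm h < d --> sqn (\<lambda>x. u (x + h) - u x) < e"
    by (rule L2_translation_continuous[OF u(1,3) _ \<open>e > 0\<close>]) (rule u(4))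
  then obtain d where d: "d > 0" "\<forall>h. norm h < d --> sqn (\<lambda>x. u (x + h) - u x) < e"
    by (elim exE conjE) (rule that)
  show ?thesis
  proof (intro exI[of _ "d / (norm a + 1)"] conjI allI impI)
    show "0 < d / (norm a + 1)" using d(1) by (simp add: add_nonneg_pos)
    fix t assume t: "0 < t \<and> t < d / (norm a + 1)"
    show "sqd (ball_average (t *\<^sub>R a) t u) u \<le> e"
    proof (rule ball_average_close(3)[OF u(1,2)])
      fix z assume "z \<in> ball (t *\<^sub>R a) t"
      then have "norm (z - t *\<^sub>R a) < t" by (simp add: dist_norm norm_minus_commute)
      then have "norm z < t + t * norm a" using norm_triangle_ineq2[of z "t *\<^sub>R a"] t by simp
      also have "... = t * (norm a + 1)" by (simp add: algebra_simps)
      also have "... < d" using t by (simp add: pos_less_divide_eq add_nonneg_pos)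
      finally show "sqn (\<lambda>x. u (x + z) - u x) \<le> e" using d(2)[rule_format, of z] by simp
    qed (use t \<open>e > 0\<close> in auto)
  qed
qed

text \<open>
  The product rule in weak form: b \<phi> is a test function on the smaller set, where the identity for w is known.
\<close>

lemma cutoff_product:
  assumes w: "integrable lborel w" "integrable lborel h"
    and weak: "\<And>\<phi>. \<phi> \<in> test_functions (U \<inter> B) ==>
      (\<integral>x. w x *\<^sub>R gradient \<phi> x \<partial>lborel) = - (\<integral>x. \<phi> x *\<^sub>R h x \<partial>lborel)"
    and b: "\<And>k. C_k k b" "compact B" "\<And>x. x \<notin> B ==> b x = 0" and \<phi>: "\<phi> \<in> test_functions U"
  shows "(\<integral>x. (b x * w x) *\<^sub>R gradient \<phi> x \<partial>lborel) = - (\<integral>x. \<phi> x *\<^sub>R (b x *\<^sub>R h x + w x *\<^sub>R gradient b x) \<partial>lborel)"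
proof -
  have C: "\<And>k. C_k k \<phi>" using \<phi> by (simp add: test_functions_def)
  have bt: "b \<in> test_functions UNIV" by (rule test_functionsI[OF b(1,2) _ b(3)]) auto
  have b\<phi>: "(\<lambda>x. b x * \<phi> x) \<in> test_functions (U \<inter> B)"
    by (rule test_mult[OF b(1,3) compact_imp_closed[OF b(2)] \<phi>])
  note [measurable] = test_borel[OF \<phi>] test_borel[OF bt]
  obtain B1 where B1: "\<And>x. \<bar>b x\<bar> \<le> B1 \<and> norm (gradient b x) \<le> B1" using test_bounded[OF bt] by blast
  have i1: "integrable lborel (\<lambda>x. (b x * w x) *\<^sub>R gradient \<phi> x)"
    using test_gradient_integrable[OF \<phi> test_integrable[OF bt w(1)]] by simp
  have i2: "integrable lborel (\<lambda>x. \<phi> x *\<^sub>R (w x *\<^sub>R gradient b x))"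
    by (rule test_integrable[OF \<phi> test_gradient_integrable[OF bt w(1)]])
  have i3: "integrable lborel (\<lambda>x. \<phi> x *\<^sub>R (b x *\<^sub>R h x))"
    by (rule test_integrable[OF \<phi> test_integrable[OF bt w(2)]])
  have "(\<integral>x. (b x * w x) *\<^sub>R gradient \<phi> x \<partial>lborel) + (\<integral>x. \<phi> x *\<^sub>R (w x *\<^sub>R gradient b x) \<partial>lborel)
     = (\<integral>x. (b x * w x) *\<^sub>R gradient \<phi> x + \<phi> x *\<^sub>R (w x *\<^sub>R gradient b x) \<partial>lborel)" using i1 i2 by simp
  also have "... = (\<integral>x. w x *\<^sub>R gradient (\<lambda>x. b x * \<phi> x) x \<partial>lborel)"
    unfolding gradient_mult[OF b(1) C] by (simp add: scaleR_add_right mult.commute)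
  also have "... = - (\<integral>x. (b x * \<phi> x) *\<^sub>R h x \<partial>lborel)" by (rule weak[OF b\<phi>])
  also have "... = - (\<integral>x. \<phi> x *\<^sub>R (b x *\<^sub>R h x) \<partial>lborel)" by (simp add: mult.commute)
  finally have "(\<integral>x. (b x * w x) *\<^sub>R gradient \<phi> x \<partial>lborel)
      = - ((\<integral>x. \<phi> x *\<^sub>R (b x *\<^sub>R h x) \<partial>lborel) + (\<integral>x. \<phi> x *\<^sub>R (w x *\<^sub>R gradient b x) \<partial>lborel))"
    by (simp add: eq_diff_eq[symmetric])
  also have "(\<integral>x. \<phi> x *\<^sub>R (b x *\<^sub>R h x) \<partial>lborel) + (\<integral>x. \<phi> x *\<^sub>R (w x *\<^sub>R gradient b x) \<partial>lborel)
     = (\<integral>x. \<phi> x *\<^sub>R (b x *\<^sub>R h x + w x *\<^sub>R gradient b x) \<partial>lborel)"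
    using Bochner_Integration.integral_add[OF i3 i2] by (simp only: scaleR_add_right)
  finally show ?thesis .
qed

text \<open>
  Averaging over the ball of radius t around t a only uses values of u at points x + z with z in that ball. Near a
  boundary point of a Lipschitz domain the vector a points inwards, so these points stay inside.
\<close>

definition inward_cone :: "(real^2) set => real^2 => real => real^2 => real => bool" where
  "inward_cone U x0 r a t0 \<longleftrightarrow> r > 0 \<and> t0 > 0 \<and>
     (\<forall>x\<in>U \<inter> cball x0 (2 * r). \<forall>t. 0 < t \<and> t < t0 --> (\<forall>z\<in>ball (t *\<^sub>R a) t. x + z \<in> U))"

text \<open>
  The function becomes u + b (M u - u) with a cutoff b and an average M u over balls shifted inwards. This is the continuous
  function M u where b = 1, and it is continuous wherever u was, so that the construction can be repeated elsewhere.
\<close>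

lemma continuity_improvement:
  assumes U: "open U" "bounded U" and cone: "inward_cone U x0 r a t0" and H: "H1 U u g" and "e > 0"
  shows "\<exists>u' g'. H1 U u' g' \<and> sqd u' u < e \<and> sqd g' g < e \<and>
     continuous_on (U \<inter> ball x0 r) u' \<and>
     (\<forall>V. continuous_on (U \<inter> V) u --> continuous_on (U \<inter> V) u')"
proof -
  have r: "r > 0" and t0: "t0 > 0"
    and cone': "\<And>x t z. x \<in> U \<inter> cball x0 (2 * r) ==> 0 < t ==> t < t0 ==> z \<in> ball (t *\<^sub>R a) t ==> x + z \<in> U"
    using cone by (auto simp: inward_cone_def)
  obtain b where b: "\<And>k. C_k k b" "\<And>x. x \<in> ball x0 r ==> b x = 1" "\<And>x. x \<notin> ball x0 (2 * r) ==> b x = 0"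
    "\<And>x. 0 \<le> b x \<and> b x \<le> 1" using exists_smooth_cutoff[OF r, of x0] by blast
  let ?B = "cball x0 (2 * r)"
  have b0: "b x = 0" if "x \<notin> ?B" for x using b(3)[of x] that by simp
  have bt: "b \<in> test_functions UNIV" by (rule test_functionsI[OF b(1) compact_cball _ b0]) auto
  note [measurable] = test_borel[OF bt] H1_borel[OF H]
  have [measurable]: "U \<in> sets borel" using U by auto
  obtain B1 where B1: "B1 > 0" "\<And>x. norm (gradient b x) \<le> B1" using test_bounded[OF bt] by blast
  (* the gradient of the correction also contains w times the gradient of b, which costs the factor B1^2 *)
  define e' where "e' = (e / 4) / (1 + B1\<^sup>2)"
  have p: "1 + B1\<^sup>2 > 0" by (simp add: add_pos_nonneg)
  have e': "e' > 0" using \<open>e > 0\<close> p by (simp add: e'_def)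
  have e4: "e' * (1 + B1\<^sup>2) = e / 4" unfolding e'_def using p by (intro nonzero_eq_divide_eq[THEN iffD1] refl) simp
  then have ee: "2 * e' + 2 * B1\<^sup>2 * e' = e / 2" by (simp add: algebra_simps)
  note iu = H1_integrable[OF H U(2)] and L = H1_L2[OF H]
  obtain t1 where t1: "t1 > 0" "\<forall>t. 0 < t \<and> t < t1 --> sqd (ball_average (t *\<^sub>R a) t u) u \<le> e'"
  proof -
    have "\<exists>t0>0. \<forall>t. 0 < t \<and> t < t0 --> sqd (ball_average (t *\<^sub>R a) t u) u \<le> e'"
      by (rule ball_average_approx[OF L(1) iu(1) U(2) _ e']) (rule H1_outside(1)[OF H])
    then show thesis by (elim exE conjE) (rule that)
  qed
  obtain t2 where t2: "t2 > 0" "\<forall>t. 0 < t \<and> t < t2 --> sqd (ball_average (t *\<^sub>R a) t g) g \<le> e'"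
  proof -
    have "\<exists>t0>0. \<forall>t. 0 < t \<and> t < t0 --> sqd (ball_average (t *\<^sub>R a) t g) g \<le> e'"
      by (rule ball_average_approx[OF L(2) iu(2) U(2) _ e']) (rule H1_outside(2)[OF H])
    then show thesis by (elim exE conjE) (rule that)
  qed
  define t where "t = min t0 (min t1 t2) / 2"
  have t: "0 < t" "t < t0" "t < t1" "t < t2" using t0 t1 t2 by (auto simp: t_def)
  let ?M = "ball_average (t *\<^sub>R a) t u" and ?G = "ball_average (t *\<^sub>R a) t g"
  have close: "integrable lborel (ball_average c t f) \<and> L2 lborel (\<lambda>x. ball_average c t f x - f x)"
    if "L2 lborel f" "integrable lborel f" for f :: "real^2 => 'q::euclidean_space" and c
  proof -
    have "sqn (\<lambda>x. f (x + z) - f x) \<le> 4 * sqn f" for z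
      using L2_diff(2)[OF L2_shift[OF that(1)] that(1)] by (simp add: nsq_shift[OF that(1)])
    moreover have "0 \<le> 4 * sqn f" by simp
    ultimately show ?thesis using ball_average_close(1,2)[OF that t(1)] by blast
  qed
  have Mu: "integrable lborel ?M" "L2 lborel (\<lambda>x. ?M x - u x)"
    and Mg: "integrable lborel ?G" "L2 lborel (\<lambda>x. ?G x - g x)"
    using close[OF L(1) iu(1)] close[OF L(2) iu(2)] by auto
  have [measurable]: "?M \<in> borel_measurable borel" "?G \<in> borel_measurable borel" using Mu Mg by auto
  have id: "(\<lambda>z. z) \<in> borel_measurable (ball_measure (t *\<^sub>R a) t)" by (rule ball_measure_measurable) simp
  define w where "w x = ?M x - u x" for x
  define h where "h x = ?G x - g x" for x
  have Lw: "L2 lborel w" "L2 lborel h" using Mu Mg by (auto simp: w_def[abs_def] h_def[abs_def])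
  note [measurable] = L2_measurable[OF Lw(1), simplified] L2_measurable[OF Lw(2), simplified]
  have nw: "sqn w \<le> e'" "sqn h \<le> e'"
    using t1(2)[rule_format, of t] t2(2)[rule_format, of t] t by (simp_all add: w_def[abs_def] h_def[abs_def])
  have weak: "(\<integral>x. w x *\<^sub>R gradient \<phi> x \<partial>lborel) = - (\<integral>x. \<phi> x *\<^sub>R h x \<partial>lborel)"
    if \<phi>: "\<phi> \<in> test_functions (U \<inter> ?B)" for \<phi>
  proof -
    have "(\<integral>x. ?M x *\<^sub>R gradient \<phi> x \<partial>lborel) = - (\<integral>x. \<phi> x *\<^sub>R ?G x \<partial>lborel)"
      unfolding ball_average_def by (rule average_weak_gradient[OF H U(2) finite_ball_measure[OF t(1)] id _ \<phi>])
        (use cone'[OF _ t(1,2)] in \<open>simp add: space_ball_measure\<close>)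
    moreover have "(\<integral>x. u x *\<^sub>R gradient \<phi> x \<partial>lborel) = - (\<integral>x. \<phi> x *\<^sub>R g x \<partial>lborel)"
      using H1_weak[OF H] test_mono[OF \<phi>] by blast
    ultimately show ?thesis
      using test_gradient_integrable[OF \<phi> Mu(1)] test_gradient_integrable[OF \<phi> iu(1)]
        test_integrable[OF \<phi> Mg(1)] test_integrable[OF \<phi> iu(2)]
      by (simp add: w_def h_def scaleR_diff_left scaleR_diff_right)
  qed
  define w' where "w' x = indicator U x * (b x * w x)" for x
  define h' where "h' x = indicator U x *\<^sub>R (b x *\<^sub>R h x + w x *\<^sub>R gradient b x)" for x
  have [measurable]: "w' \<in> borel_measurable borel" "h' \<in> borel_measurable borel"
    by (auto simp: w'_def[abs_def] h'_def[abs_def])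
  have b_abs: "\<bar>b x\<bar> \<le> 1" for x using b(4)[of x] by simp
  have "norm (w' x) \<le> 1 * norm (w x)" for x
    using mult_right_mono[OF b_abs, of "\<bar>w x\<bar>" x] by (auto simp: w'_def indicator_def abs_mult)
  then have Lw': "L2 lborel w'" "sqn w' \<le> sqn w" using L2_dominated[OF Lw(1), of w' 1] by auto
  have "norm ((indicator U x * b x) *\<^sub>R h x) \<le> 1 * norm (h x)" for x
    using mult_right_mono[OF b_abs, of "norm (h x)" x] by (auto simp: indicator_def)
  then have L1: "L2 lborel (\<lambda>x. (indicator U x * b x) *\<^sub>R h x)"
      "sqn (\<lambda>x. (indicator U x * b x) *\<^sub>R h x) \<le> sqn h"
    using L2_dominated[OF Lw(2), of "\<lambda>x. (indicator U x * b x) *\<^sub>R h x" 1] by auto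
  have "norm ((indicator U x * w x) *\<^sub>R gradient b x) \<le> B1 * norm (w x)" for x
    using mult_left_mono[OF B1(2), of "\<bar>w x\<bar>" x] B1(1)
    by (auto simp: indicator_def abs_mult mult.commute[of B1])
  then have L2': "L2 lborel (\<lambda>x. (indicator U x * w x) *\<^sub>R gradient b x)"
      "sqn (\<lambda>x. (indicator U x * w x) *\<^sub>R gradient b x) \<le> B1\<^sup>2 * sqn w"
    using L2_dominated[OF Lw(1), of "\<lambda>x. (indicator U x * w x) *\<^sub>R gradient b x" B1] B1(1) by auto
  have h'_eq: "h' = (\<lambda>x. (indicator U x * b x) *\<^sub>R h x + (indicator U x * w x) *\<^sub>R gradient b x)"
    by (auto simp: h'_def algebra_simps)
  have Lh': "L2 lborel h'" "sqn h' \<le> 2 * sqn h + 2 * (B1\<^sup>2 * sqn w)"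
    using L2_add[OF L1(1) L2'(1)] L1(2) L2'(2) unfolding h'_eq by auto
  have iw: "integrable lborel w" "integrable lborel h"
    unfolding w_def[abs_def] h_def[abs_def] using Mu(1) Mg(1) iu by auto
  have "H1 U w' h'" unfolding H1_def
  proof (intro conjI ballI allI impI Lw'(1) Lh'(1))
    fix \<phi> assume \<phi>: "\<phi> \<in> test_functions U"
    have "(\<integral>x. w' x *\<^sub>R gradient \<phi> x \<partial>lborel) = (\<integral>x. (b x * w x) *\<^sub>R gradient \<phi> x \<partial>lborel)"
      by (rule Bochner_Integration.integral_cong[OF refl], case_tac "x \<in> U")
        (simp_all add: w'_def test_zero_outside[OF \<phi>])
    also have "... = - (\<integral>x. \<phi> x *\<^sub>R (b x *\<^sub>R h x + w x *\<^sub>R gradient b x) \<partial>lborel)"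
      by (rule cutoff_product[OF iw weak b(1) compact_cball b0 \<phi>])
    also have "(\<integral>x. \<phi> x *\<^sub>R (b x *\<^sub>R h x + w x *\<^sub>R gradient b x) \<partial>lborel) = (\<integral>x. \<phi> x *\<^sub>R h' x \<partial>lborel)"
      by (rule Bochner_Integration.integral_cong[OF refl], case_tac "x \<in> U")
        (simp_all add: h'_def test_zero_outside[OF \<phi>])
    finally show "(\<integral>x. w' x *\<^sub>R gradient \<phi> x \<partial>lborel) = - (\<integral>x. \<phi> x *\<^sub>R h' x \<partial>lborel)" .
  qed (auto simp: w'_def h'_def)
  then have H': "H1 U (\<lambda>x. u x + w' x) (\<lambda>x. g x + h' x)" using H1_linear[OF H _ U(2), of w' h' 1] by simp
  have bc: "continuous_on V b" for V using smooth_continuous[OF b(1)] by (rule continuous_on_subset) simp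
  have Mc: "continuous_on V ?M" for V
    by (rule continuous_on_subset[OF ball_average_continuous[OF L(1) iu(1) U(2) _ t(1)]])
      (auto intro: H1_outside(1)[OF H])
  show ?thesis
  proof (intro exI conjI allI impI)
    show "H1 U (\<lambda>x. u x + w' x) (\<lambda>x. g x + h' x)" by (rule H')
    have "0 \<le> e' * B1\<^sup>2" using e' by simp
    moreover have "e' + e' * B1\<^sup>2 = e / 4" using e4 by (simp only: distrib_left mult_1_right)
    ultimately have "e' \<le> e / 4" by linarith
    then show "sqn (\<lambda>x. u x + w' x - u x) < e" using Lw'(2) nw \<open>e > 0\<close> by simp
    have "sqn h' \<le> 2 * e' + 2 * (B1\<^sup>2 * e')" using Lh'(2) nw mult_left_mono[OF nw(1), of "B1\<^sup>2"] by simp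
    also have "... < e" using ee \<open>e > 0\<close> by simp
    finally show "sqn (\<lambda>x. g x + h' x - g x) < e" by simp
    have "continuous_on (U \<inter> ball x0 r) (\<lambda>x. ?M x)" by (rule Mc)
    then show "continuous_on (U \<inter> ball x0 r) (\<lambda>x. u x + w' x)"
      by (rule continuous_on_eq) (auto simp: w'_def w_def b(2))
    fix V assume "continuous_on (U \<inter> V) u"
    then have "continuous_on (U \<inter> V) (\<lambda>x. u x + b x * (?M x - u x))" by (intro continuous_intros Mc bc)
    then show "continuous_on (U \<inter> V) (\<lambda>x. u x + w' x)" by (rule continuous_on_eq) (auto simp: w'_def w_def)
  qed
qed

text \<open>
  The improvement is made at finitely many points, one after the other, whose balls cover the closure of U.
\<close>

lemma continuous_approximation:
  assumes U: "open U" "bounded U" and cone: "\<And>x. x \<in> closure U ==> \<exists>r a t0. inward_cone U x r a t0"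
    and H: "H1 U u g" and "e > 0"
  shows "\<exists>u' g'. H1 U u' g' \<and> sqd u' u < e \<and> sqd g' g < e \<and> continuous_on U u'"
proof -
  obtain r where r: "\<And>x. x \<in> closure U ==> \<exists>a t0. inward_cone U x (r x) a t0" using cone by metis
  have rpos: "r x > 0" if "x \<in> closure U" for x using r[OF that] by (auto simp: inward_cone_def)
  have "compact (closure U)" using U by (simp add: compact_closure)
  moreover have "closure U \<subseteq> (\<Union>x\<in>closure U. ball x (r x))" using rpos by force
  ultimately obtain F where F: "F \<subseteq> closure U" "finite F" "closure U \<subseteq> (\<Union>x\<in>F. ball x (r x))"
    using compactE_image[of "closure U" "closure U" "\<lambda>x. ball x (r x)"] by (metis open_ball)
  have "\<exists>u' g'. H1 U u' g' \<and> sqd u' u < e \<and> sqd g' g < e \<and>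
      continuous_on (U \<inter> (\<Union>x\<in>F. ball x (r x))) u'" if "e > 0" for e
    using F(2,1) that
  proof (induction F arbitrary: e)
    case empty
    then show ?case using H by (intro exI[of _ u] exI[of _ g]) auto
  next
    case (insert x F)
    obtain u1 g1 where 1: "H1 U u1 g1" "sqd u1 u < e / 4" "sqd g1 g < e / 4"
      "continuous_on (U \<inter> (\<Union>x\<in>F. ball x (r x))) u1" using insert.IH[of "e / 4"] insert.prems by auto
    obtain a t0 where c: "inward_cone U x (r x) a t0" using r[of x] insert.prems(1) by blast
    have "e / 4 > 0" using insert.prems by simp
    from continuity_improvement[OF U c 1(1) this]
    obtain u2 g2 where 2: "H1 U u2 g2" "sqd u2 u1 < e / 4" "sqd g2 g1 < e / 4"
      "continuous_on (U \<inter> ball x (r x)) u2"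
      "\<And>V. continuous_on (U \<inter> V) u1 ==> continuous_on (U \<inter> V) u2" by blast
    have "continuous_on (U \<inter> ball x (r x) \<union> (U \<inter> (\<Union>x\<in>F. ball x (r x)))) u2"
      using 2(4) 2(5)[OF 1(4)] U by (intro continuous_on_open_Un) auto
    moreover have "U \<inter> ball x (r x) \<union> (U \<inter> (\<Union>x\<in>F. ball x (r x))) = U \<inter> (\<Union>x\<in>insert x F. ball x (r x))" by auto
    ultimately have "continuous_on (U \<inter> (\<Union>x\<in>insert x F. ball x (r x))) u2" by simp
    moreover have "sqd u2 u < e"
      using nsq_triangle[OF H1_L2(1)[OF 2(1)] H1_L2(1)[OF 1(1)] H1_L2(1)[OF H]] 1(2) 2(2) by simp
    moreover have "sqd g2 g < e"
      using nsq_triangle[OF H1_L2(2)[OF 2(1)] H1_L2(2)[OF 1(1)] H1_L2(2)[OF H]] 1(3) 2(3) by simp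
    ultimately show ?case using 2(1) by blast
  qed
  from this[OF \<open>e > 0\<close>] obtain u' g' where "H1 U u' g'" "sqd u' u < e"
    "sqd g' g < e" "continuous_on (U \<inter> (\<Union>x\<in>F. ball x (r x))) u'" by blast
  moreover have "U \<inter> (\<Union>x\<in>F. ball x (r x)) = U" using F(3) closure_subset by blast
  ultimately show ?thesis by auto
qed

text \<open>
  Frontier points lie on the graph: as x0 is not in U, \<gamma> 0 is at least 0, and the points of U near x0 show that it
  is at most 0.
\<close>

lemma lipschitz_domain_chart:
  assumes "lipschitz_domain U" "x0 \<in> frontier U"
  obtains r e n L \<gamma> where "r > 0" "norm e = 1" "norm n = 1" "e \<bullet> n = 0" "L-lipschitz_on UNIV \<gamma>" "\<gamma> 0 = 0"
    "\<And>y. y \<in> ball x0 r ==> y \<in> U \<longleftrightarrow> \<gamma> ((y - x0) \<bullet> e) < (y - x0) \<bullet> n"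
proof -
  from assms obtain r e n L and \<gamma> :: "real => real" where c: "r > 0" "norm e = 1" "norm n = 1" "e \<bullet> n = 0" "L-lipschitz_on UNIV \<gamma>"
    "\<And>y. y \<in> ball x0 r ==> y \<in> U \<longleftrightarrow> \<gamma> ((y - x0) \<bullet> e) < (y - x0) \<bullet> n" unfolding lipschitz_domain_def by blast
  have nn: "n \<bullet> n = 1" using c(3) by (simp add: dot_square_norm)
  have L: "L \<ge> 0" using c(5) by (rule lipschitz_on_nonneg)
  have "open U" using assms by (simp add: lipschitz_domain_def)
  then have "x0 \<notin> U" using assms(2) by (simp add: frontier_def interior_open)
  then have le: "\<gamma> 0 \<ge> 0" using c(6)[of x0] c(1) by simp
  have "\<gamma> 0 \<le> 0"
  proof (rule ccontr)
    assume pos: "\<not> \<gamma> 0 \<le> 0"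
    define d where "d = min r (\<gamma> 0 / (2 * (L + 1)))"
    have "d > 0" using pos c(1) L by (simp add: d_def)
    moreover have "x0 \<in> closure U" using assms(2) by (simp add: frontier_def)
    ultimately obtain y where y: "y \<in> U" "dist y x0 < d" using closure_approachable by blast
    then have "y \<in> ball x0 r" by (simp add: d_def dist_commute)
    then have "\<gamma> ((y - x0) \<bullet> e) < (y - x0) \<bullet> n" using c(6) y by blast
    moreover have "\<bar>(y - x0) \<bullet> e\<bar> \<le> d" "\<bar>(y - x0) \<bullet> n\<bar> \<le> d"
      using Cauchy_Schwarz_ineq2[of "y - x0" e] Cauchy_Schwarz_ineq2[of "y - x0" n] c y by (auto simp: dist_norm)
    moreover have "\<bar>\<gamma> ((y - x0) \<bullet> e) - \<gamma> 0\<bar> \<le> L * \<bar>(y - x0) \<bullet> e\<bar>"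
      using lipschitz_onD[OF c(5), of "(y - x0) \<bullet> e" 0] by (simp add: dist_real_def)
    moreover have "L * \<bar>(y - x0) \<bullet> e\<bar> \<le> L * d" using calculation(2) L by (intro mult_left_mono)
    ultimately have "\<gamma> 0 < d + L * d" by linarith
    also have "... = d * (L + 1)" by (simp add: algebra_simps)
    also have "... \<le> \<gamma> 0 / (2 * (L + 1)) * (L + 1)" using L by (intro mult_right_mono) (auto simp: d_def)
    also have "... = \<gamma> 0 / 2" using L by (simp add: field_simps)
    finally show False using pos by simp
  qed
  with le have "\<gamma> 0 = 0" by simp
  then show thesis using that c by blast
qed

text \<open>
  A step of t (L + 1) along n rises above a graph of slope L by enough to leave room for a ball of radius t.
\<close>

lemma lipschitz_domain_inward_cone:
  assumes U: "lipschitz_domain U" and x0: "x0 \<in> closure U"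
  shows "\<exists>r a t0. inward_cone U x0 r a t0"
proof (cases "x0 \<in> U")
  case True
  have "open U" using U by (simp add: lipschitz_domain_def)
  then obtain d where d: "d > 0" "ball x0 d \<subseteq> U" using True openE by blast
  have "inward_cone U x0 (d / 4) 0 (d / 4)"
    unfolding inward_cone_def
  proof (intro conjI ballI allI impI)
    fix x t z assume a: "x \<in> U \<inter> cball x0 (2 * (d / 4))" "0 < t \<and> t < d / 4" "z \<in> ball (t *\<^sub>R (0::real^2)) t"
    have "dist x0 (x + z) \<le> dist x0 x + norm z" using dist_triangle[of x0 "x + z" x] by (simp add: dist_norm)
    also have "... < d" using a by simp
    finally show "x + z \<in> U" using d by auto
  qed (use d in auto)
  then show ?thesis by blast
next
  case False
  then have "x0 \<in> frontier U" using x0 U by (simp add: frontier_def interior_open lipschitz_domain_def)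
  with U obtain r e n L \<gamma> where c: "r > 0" "norm e = 1" "norm n = 1" "e \<bullet> n = 0" "L-lipschitz_on UNIV \<gamma>"
    "\<And>y. y \<in> ball x0 r ==> y \<in> U \<longleftrightarrow> \<gamma> ((y - x0) \<bullet> e) < (y - x0) \<bullet> n" by (rule lipschitz_domain_chart) blast
  have L: "L \<ge> 0" using c(5) by (rule lipschitz_on_nonneg)
  have nn: "n \<bullet> n = 1" using c(3) by (simp add: dot_square_norm)
  have "inward_cone U x0 (r / 4) ((L + 1) *\<^sub>R n) (r / (2 * (L + 2)))"
    unfolding inward_cone_def
  proof (intro conjI ballI allI impI)
    fix x t z assume a: "x \<in> U \<inter> cball x0 (2 * (r / 4))" "0 < t \<and> t < r / (2 * (L + 2))"
      "z \<in> ball (t *\<^sub>R (L + 1) *\<^sub>R n) t"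
    define y where "y = z - (t * (L + 1)) *\<^sub>R n"
    have y: "norm y < t" "z = (t * (L + 1)) *\<^sub>R n + y" using a(3) by (auto simp: y_def dist_norm norm_minus_commute)
    have "norm z \<le> t * (L + 1) + norm y"
      unfolding y(2) using norm_triangle_ineq[of "(t * (L + 1)) *\<^sub>R n" y] c(3) L a(2) by simp
    then have "norm z < t * (L + 2)" using y(1) by (simp add: algebra_simps)
    also have "... < r / 2" using a(2) L by (simp add: field_simps)
    finally have "norm z < r / 2" .
    moreover have "dist x0 (x + z) \<le> dist x0 x + norm z" using dist_triangle[of x0 "x + z" x] by (simp add: dist_norm)
    moreover have "dist x0 x \<le> r / 2" using a(1) by simp
    ultimately have in_ball: "x + z \<in> ball x0 r" "x \<in> ball x0 r" using c(1) by auto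
    have "\<gamma> ((x - x0) \<bullet> e) < (x - x0) \<bullet> n" using c(6) a(1) in_ball(2) by blast
    moreover have "(x + z - x0) \<bullet> e = (x - x0) \<bullet> e + y \<bullet> e"
      using c(4) unfolding y(2) by (simp add: algebra_simps inner_commute)
    moreover have "(x + z - x0) \<bullet> n = (x - x0) \<bullet> n + t * (L + 1) + y \<bullet> n"
      unfolding y(2) by (simp add: algebra_simps nn)
    moreover have "\<bar>\<gamma> ((x - x0) \<bullet> e + y \<bullet> e) - \<gamma> ((x - x0) \<bullet> e)\<bar> \<le> L * \<bar>y \<bullet> e\<bar>"
      using lipschitz_onD[OF c(5), of "(x - x0) \<bullet> e + y \<bullet> e" "(x - x0) \<bullet> e"] by (simp add: dist_real_def)
    moreover have ye: "\<bar>y \<bullet> e\<bar> \<le> t" "\<bar>y \<bullet> n\<bar> < t"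
      using Cauchy_Schwarz_ineq2[of y e] Cauchy_Schwarz_ineq2[of y n] c y(1) by auto
    moreover have "L * \<bar>y \<bullet> e\<bar> \<le> L * t" using ye(1) L by (intro mult_left_mono)
    ultimately have "\<gamma> ((x + z - x0) \<bullet> e) < (x + z - x0) \<bullet> n" by (simp add: algebra_simps abs_less_iff abs_le_iff)
    then show "x + z \<in> U" using c(6)[OF in_ball(1)] by blast
  qed (use c L in auto)
  then show ?thesis by blast
qed

section \<open>One-dimensional Hausdorff measure\<close>

lemma hausdorff1_pre_le:
  assumes "A \<subseteq> (\<Union>i. E i)" "\<And>i. bounded (E i)" "\<And>i. diameter (E i) \<le> \<delta>"
  shows "hausdorff1_pre \<delta> A \<le> (\<Sum>i. ennreal (diameter (E i)))"
  unfolding hausdorff1_pre_def by (rule INF_lower) (use assms in auto)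

lemma hausdorff1_pre_mono: "A \<subseteq> B ==> hausdorff1_pre \<delta> A \<le> hausdorff1_pre \<delta> B"
  unfolding hausdorff1_pre_def by (rule INF_superset_mono) auto

lemma hausdorff1_pre_antimono: "\<delta> \<le> \<delta>' ==> hausdorff1_pre \<delta>' A \<le> hausdorff1_pre \<delta> A"
  unfolding hausdorff1_pre_def by (rule INF_superset_mono) (auto intro: order_trans)

lemma hausdorff1_pre_le_outer: "\<delta> > 0 ==> hausdorff1_pre \<delta> A \<le> hausdorff1_outer A"
  unfolding hausdorff1_outer_def by (rule SUP_upper) auto

lemma hausdorff1_outer_mono: "A \<subseteq> B ==> hausdorff1_outer A \<le> hausdorff1_outer B"
  unfolding hausdorff1_outer_def by (intro SUP_mono) (auto intro: hausdorff1_pre_mono)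

lemma hausdorff1_outer_empty: "hausdorff1_outer {} = 0"
proof -
  have "hausdorff1_pre \<delta> {} \<le> 0" if "\<delta> > 0" for \<delta> using hausdorff1_pre_le[of "{}" "\<lambda>i. {}" \<delta>] that by simp
  then have "hausdorff1_outer {} \<le> 0" unfolding hausdorff1_outer_def by (intro SUP_least) auto
  then show ?thesis by simp
qed

lemma hausdorff1_pre_countably_subadditive:
  assumes "\<delta> > 0"
  shows "hausdorff1_pre \<delta> (\<Union>i. A i) \<le> (\<Sum>i. hausdorff1_pre \<delta> (A i))"
proof (cases "(\<Sum>i. hausdorff1_pre \<delta> (A i)) = \<infinity>")
  case False
  have fin: "hausdorff1_pre \<delta> (A i) \<noteq> \<infinity>" for i
  proof
    assume "hausdorff1_pre \<delta> (A i) = \<infinity>"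
    moreover have "hausdorff1_pre \<delta> (A i) \<le> (\<Sum>i. hausdorff1_pre \<delta> (A i))"
      using sum_le_suminf[of "\<lambda>i. hausdorff1_pre \<delta> (A i)" "{i}"] by simp
    ultimately show False using False by (simp add: top_unique)
  qed
  show ?thesis
  proof (rule ennreal_le_epsilon)
    fix e :: real assume "e > 0"
    let ?S = "\<lambda>A. {E :: nat => (real^2) set. A \<subseteq> (\<Union>i. E i) \<and> (\<forall>i. bounded (E i) \<and> diameter (E i) \<le> \<delta>)}"
    have "\<exists>E. E \<in> ?S (A i) \<and> (\<Sum>j. ennreal (diameter (E j))) < hausdorff1_pre \<delta> (A i) + ennreal (e * (1/2) ^ Suc i)" for i
      unfolding Bex_def[symmetric]
      by (rule INF_approx_ennreal[OF _ hausdorff1_pre_def fin]) (use \<open>e > 0\<close> in simp)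
    from choice[OF allI[OF this]] obtain E where E':
      "\<forall>i. E i \<in> ?S (A i) \<and> (\<Sum>j. ennreal (diameter (E i j))) < hausdorff1_pre \<delta> (A i) + ennreal (e * (1/2) ^ Suc i)" ..
    then have E: "E i \<in> ?S (A i)"
      "(\<Sum>j. ennreal (diameter (E i j))) < hausdorff1_pre \<delta> (A i) + ennreal (e * (1/2) ^ Suc i)" for i by simp_all
    define F where "F n = (case prod_decode n of (i, j) => E i j)" for n
    have "hausdorff1_pre \<delta> (\<Union>i. A i) \<le> (\<Sum>n. ennreal (diameter (F n)))"
    proof (rule hausdorff1_pre_le)
      show "(\<Union>i. A i) \<subseteq> (\<Union>n. F n)"
      proof
        fix x assume "x \<in> (\<Union>i. A i)"
        then obtain i where "x \<in> A i" by blast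
        then obtain j where "x \<in> E i j" using E(1)[of i] by blast
        then have "x \<in> F (prod_encode (i, j))" by (simp add: F_def)
        then show "x \<in> (\<Union>n. F n)" by blast
      qed
    qed (use E(1) in \<open>auto simp: F_def split: prod.split\<close>)
    also have "... = (\<Sum>i. \<Sum>j. ennreal (diameter (E i j)))"
      using suminf_ennreal_2dimen[of "\<lambda>i. \<Sum>j. ennreal (diameter (E i j))" "\<lambda>(i, j). ennreal (diameter (E i j))"]
      by (simp add: F_def case_prod_beta)
    also have "... \<le> (\<Sum>i. hausdorff1_pre \<delta> (A i) + ennreal (e * (1/2) ^ Suc i))"
      using E(2) by (intro suminf_le summableI) (auto simp: less_imp_le)
    also have "... = (\<Sum>i. hausdorff1_pre \<delta> (A i)) + (\<Sum>i. ennreal (e * (1/2) ^ Suc i))"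
      by (rule suminf_add[symmetric]) auto
    also have "(\<Sum>i. ennreal (e * (1/2) ^ Suc i)) = ennreal e"
    proof (rule suminf_ennreal_eq)
      show "(\<lambda>i. e * (1/2) ^ Suc i) sums e" using sums_mult[OF power_half_series, of e] by simp
    qed (use \<open>e > 0\<close> in simp)
    finally show "hausdorff1_pre \<delta> (\<Union>i. A i) \<le> (\<Sum>i. hausdorff1_pre \<delta> (A i)) + ennreal e" .
  qed
qed simp

lemma hausdorff1_outer_countably_subadditive: "hausdorff1_outer (\<Union>i. A i) \<le> (\<Sum>i. hausdorff1_outer (A i))"
proof -
  have "hausdorff1_pre \<delta> (\<Union>i. A i) \<le> (\<Sum>i. hausdorff1_outer (A i))" if "\<delta> > 0" for \<delta>
    using hausdorff1_pre_countably_subadditive[OF that, of A]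
    by (rule order_trans) (intro suminf_le summableI hausdorff1_pre_le_outer that)
  then show ?thesis unfolding hausdorff1_outer_def[of "\<Union>i. A i"] by (intro SUP_least) auto
qed

lemma hausdorff1_outer_subadditive: "hausdorff1_outer (A \<union> B) \<le> hausdorff1_outer A + hausdorff1_outer B"
proof -
  let ?A = "\<lambda>i::nat. if i = 0 then A else if i = 1 then B else {}"
  have "A \<union> B \<subseteq> (\<Union>i. ?A i)" using UN_upper[of 0 UNIV ?A] UN_upper[of 1 UNIV ?A] by auto
  then have "hausdorff1_outer (A \<union> B) \<le> hausdorff1_outer (\<Union>i. ?A i)" by (rule hausdorff1_outer_mono)
  also have "... \<le> (\<Sum>i. hausdorff1_outer (?A i))" by (rule hausdorff1_outer_countably_subadditive)
  also have "(\<Sum>i. hausdorff1_outer (?A i)) = (\<Sum>i\<in>{0, 1}. hausdorff1_outer (?A i))"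
    by (rule suminf_finite) (auto simp: hausdorff1_outer_empty)
  finally show ?thesis by simp
qed

text \<open>
  A set of diameter less than d meets at most one of A and B, so a fine cover of the union splits into two covers.
\<close>

lemma hausdorff1_outer_separated:
  assumes d: "d > 0" "\<And>x y. x \<in> A ==> y \<in> B ==> d \<le> dist x y"
  shows "hausdorff1_outer A + hausdorff1_outer B \<le> hausdorff1_outer (A \<union> B)"
proof -
  have key: "hausdorff1_pre \<delta> A + hausdorff1_pre \<delta> B \<le> hausdorff1_pre \<delta> (A \<union> B)" if \<delta>: "0 < \<delta>" "\<delta> < d" for \<delta>
    unfolding hausdorff1_pre_def[of \<delta> "A \<union> B"]
  proof (rule INF_greatest, clarify)
    fix E :: "nat => (real^2) set"
    assume E: "A \<union> B \<subseteq> (\<Union>i. E i)" "\<forall>i. bounded (E i) \<and> diameter (E i) \<le> \<delta>"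
    let ?EA = "\<lambda>i. if E i \<inter> A = {} then {} else E i" and ?EB = "\<lambda>i. if E i \<inter> B = {} then {} else E i"
    have "hausdorff1_pre \<delta> A \<le> (\<Sum>i. ennreal (diameter (?EA i)))" "hausdorff1_pre \<delta> B \<le> (\<Sum>i. ennreal (diameter (?EB i)))"
      by (rule hausdorff1_pre_le; use E \<delta> in \<open>force split: if_splits\<close>)+
    then have "hausdorff1_pre \<delta> A + hausdorff1_pre \<delta> B
        \<le> (\<Sum>i. ennreal (diameter (?EA i))) + (\<Sum>i. ennreal (diameter (?EB i)))" by (rule add_mono)
    also have "... = (\<Sum>i. ennreal (diameter (?EA i)) + ennreal (diameter (?EB i)))" by (rule suminf_add) auto
    also have "... \<le> (\<Sum>i. ennreal (diameter (E i)))"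
    proof (intro suminf_le summableI)
      fix i
      have "E i \<inter> A = {} \<or> E i \<inter> B = {}"
      proof (rule ccontr)
        assume "\<not> (E i \<inter> A = {} \<or> E i \<inter> B = {})"
        then obtain x y where xy: "x \<in> E i" "x \<in> A" "y \<in> E i" "y \<in> B" by blast
        then have "dist x y \<le> diameter (E i)" using E(2) by (intro diameter_bounded_bound) auto
        also have "... \<le> \<delta>" using E(2) by blast
        also have "... < d" by (rule \<delta>(2))
        finally show False using d(2) xy by force
      qed
      then show "ennreal (diameter (?EA i)) + ennreal (diameter (?EB i)) \<le> ennreal (diameter (E i))" by auto
    qed
    finally show "hausdorff1_pre \<delta> A + hausdorff1_pre \<delta> B \<le> (\<Sum>i. ennreal (diameter (E i)))" .
  qed
  have le: "hausdorff1_pre \<delta> A + hausdorff1_pre \<delta>' B \<le> hausdorff1_outer (A \<union> B)" if "\<delta> > 0" "\<delta>' > 0" for \<delta> \<delta>'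
  proof -
    define \<eta> where "\<eta> = min (min \<delta> \<delta>') (d / 2)"
    have \<eta>: "0 < \<eta>" "\<eta> < d" "\<eta> \<le> \<delta>" "\<eta> \<le> \<delta>'" using that d by (auto simp: \<eta>_def)
    have "hausdorff1_pre \<delta> A + hausdorff1_pre \<delta>' B \<le> hausdorff1_pre \<eta> A + hausdorff1_pre \<eta> B"
      by (intro add_mono hausdorff1_pre_antimono \<eta>)
    also have "... \<le> hausdorff1_pre \<eta> (A \<union> B)" by (rule key[OF \<eta>(1,2)])
    also have "... \<le> hausdorff1_outer (A \<union> B)" by (rule hausdorff1_pre_le_outer[OF \<eta>(1)])
    finally show ?thesis .
  qed
  have "(SUP \<delta>\<in>{0<..}. hausdorff1_pre \<delta> A) + (SUP \<delta>\<in>{0<..}. hausdorff1_pre \<delta> B)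
      = (SUP \<delta>\<in>{0<..}. hausdorff1_pre \<delta> A + (SUP \<delta>\<in>{0<..}. hausdorff1_pre \<delta> B))"
    by (rule ennreal_SUP_add_left[symmetric]) auto
  also have "... = (SUP \<delta>\<in>{0<..}. SUP \<delta>'\<in>{0<..}. hausdorff1_pre \<delta> A + hausdorff1_pre \<delta>' B)"
    by (intro SUP_cong refl ennreal_SUP_add_right) auto
  also have "... \<le> hausdorff1_outer (A \<union> B)" by (intro SUP_least le) auto
  finally show ?thesis by (simp add: hausdorff1_outer_def)
qed

text \<open>
  The layers of X around the closed set F at distances in [1/(k+2), 1/(k+1)) are separated from each other when their
  indices differ by 2, so that the sums over even and over odd indices are at most the outer measure of X.
  Hence the layers close to F contribute arbitrarily little.
\<close>

lemma hausdorff1_layers_summable: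
  assumes F: "F \<noteq> {}" and fin: "hausdorff1_outer X \<noteq> \<infinity>"
    and R: "\<And>k. R k = {x\<in>X. 1 / (real k + 2) \<le> infdist x F \<and> infdist x F < 1 / (real k + 1)}"
  shows "(\<Sum>k. hausdorff1_outer (R k)) \<noteq> \<infinity>"
proof -
  have part: "(\<Sum>j<m. hausdorff1_outer (R (2 * j + p))) \<le> hausdorff1_outer X" for m p
  proof -
    have "(\<Sum>j<m. hausdorff1_outer (R (2 * j + p))) \<le> hausdorff1_outer (\<Union>j<m. R (2 * j + p))"
    proof (induction m)
      case (Suc m)
      define d where "d = 1 / (real (2 * m + p)) - 1 / (real (2 * m + p) + 1)"
      show ?case
      proof (cases "m = 0")
        case False
        then have pos: "real (2 * m + p) > 0" by simp
        then have "1 / (real (2 * m + p) + 1) < 1 / real (2 * m + p)"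
          by (intro divide_strict_left_mono mult_pos_pos; use pos in linarith)
        then have "d > 0" by (simp add: d_def)
        have "(\<Sum>j<Suc m. hausdorff1_outer (R (2 * j + p)))
            \<le> hausdorff1_outer (\<Union>j<m. R (2 * j + p)) + hausdorff1_outer (R (2 * m + p))"
          using Suc by (simp add: add_mono)
        also have "... \<le> hausdorff1_outer ((\<Union>j<m. R (2 * j + p)) \<union> R (2 * m + p))"
        proof (rule hausdorff1_outer_separated[OF \<open>d > 0\<close>])
          fix x y assume x: "x \<in> (\<Union>j<m. R (2 * j + p))" and y: "y \<in> R (2 * m + p)"
          then obtain j where j: "j < m" "1 / (real (2 * j + p) + 2) \<le> infdist x F" using R by auto
          have "1 / real (2 * m + p) \<le> 1 / (real (2 * j + p) + 2)"
            using j(1) pos by (intro divide_left_mono) auto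
          then have "1 / real (2 * m + p) \<le> infdist x F" using j(2) by simp
          moreover have "infdist y F < 1 / (real (2 * m + p) + 1)" using y R by auto
          moreover have "infdist x F \<le> infdist y F + dist x y" by (rule infdist_triangle)
          ultimately show "d \<le> dist x y" by (simp add: d_def)
        qed
        also have "(\<Union>j<m. R (2 * j + p)) \<union> R (2 * m + p) = (\<Union>j<Suc m. R (2 * j + p))"
          by (auto simp: less_Suc_eq)
        finally show ?thesis .
      qed (simp add: lessThan_Suc)
    qed (simp add: hausdorff1_outer_empty)
    also have "... \<le> hausdorff1_outer X" using R by (intro hausdorff1_outer_mono) auto
    finally show ?thesis .
  qed
  have "(\<Sum>k<n. hausdorff1_outer (R k)) \<le> 2 * hausdorff1_outer X" for n
  proof -
    have "(\<Sum>k<n. hausdorff1_outer (R k)) \<le> (\<Sum>k<2 * n. hausdorff1_outer (R k))" by (rule sum_mono2) auto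
    also have "... = (\<Sum>j<n. hausdorff1_outer (R (2 * j + 0))) + (\<Sum>j<n. hausdorff1_outer (R (2 * j + 1)))"
      by (induction n) (simp_all add: ac_simps)
    also have "... \<le> hausdorff1_outer X + hausdorff1_outer X" by (intro add_mono part)
    finally show ?thesis by (simp add: mult_2)
  qed
  then have "(\<Sum>k. hausdorff1_outer (R k)) \<le> 2 * hausdorff1_outer X" by (intro suminf_le_const summableI) auto
  then show ?thesis using fin by (auto simp: top_unique ennreal_mult_eq_top_iff)
qed

text \<open>
  Caratheodory's criterion for a metric outer measure: X - F consists of the part Y n, at positive distance from F, and
  of layers whose total measure tends to 0.
\<close>

lemma hausdorff1_closed_measurable:
  assumes "closed F"
  shows "hausdorff1_outer (F \<inter> X) + hausdorff1_outer (X - F) \<le> hausdorff1_outer X"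
proof (cases "F = {} \<or> hausdorff1_outer X = \<infinity>")
  case True
  then show ?thesis by (auto simp: hausdorff1_outer_empty)
next
  case False
  then have F: "F \<noteq> {}" and fin: "hausdorff1_outer X \<noteq> \<infinity>" by auto
  define R where "R k = {x\<in>X. 1 / (real k + 2) \<le> infdist x F \<and> infdist x F < 1 / (real k + 1)}" for k
  define Y where "Y n = {x\<in>X. 1 / (real n + 1) \<le> infdist x F}" for n
  let ?h = hausdorff1_outer
  have sep: "?h (F \<inter> X) + ?h (Y n) \<le> ?h X" for n
  proof -
    have "?h (F \<inter> X) + ?h (Y n) \<le> ?h (F \<inter> X \<union> Y n)"
    proof (rule hausdorff1_outer_separated)
      show "0 < 1 / (real n + 1)" by simp
      fix x y assume "x \<in> F \<inter> X" "y \<in> Y n"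
      then show "1 / (real n + 1) \<le> dist x y" using infdist_le[of x F y] by (auto simp: Y_def dist_commute)
    qed
    also have "... \<le> ?h X" by (intro hausdorff1_outer_mono) (auto simp: Y_def)
    finally show ?thesis .
  qed
  have sum: "(\<Sum>k. ?h (R k)) \<noteq> \<infinity>" by (rule hausdorff1_layers_summable[OF F fin R_def])
  have tail: "?h (X - F) \<le> ?h (Y n) + (\<Sum>k. ?h (R (k + n)))" for n
  proof -
    have "X - F \<subseteq> Y n \<union> (\<Union>k. R (k + n))"
    proof
      fix x assume x: "x \<in> X - F"
      then have pos: "infdist x F > 0" using assms F in_closed_iff_infdist_zero[of F x] infdist_nonneg[of x F] by force
      show "x \<in> Y n \<union> (\<Union>k. R (k + n))"
      proof (cases "1 / (real n + 1) \<le> infdist x F")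
        case False
        define P where "P m \<longleftrightarrow> 1 / (real m + 1) \<le> infdist x F" for m
        obtain m0 where "inverse (real (Suc m0)) < infdist x F" using reals_Archimedean[OF pos] by blast
        then have "P m0" by (simp add: P_def inverse_eq_divide add.commute)
        define m where "m = (LEAST m. P m)"
        have Pm: "P m" using \<open>P m0\<close> unfolding m_def by (rule LeastI)
        have least: "\<not> P j" if "j < m" for j using that not_less_Least unfolding m_def by blast
        have "m > n"
        proof (rule ccontr)
          assume "\<not> n < m"
          then have "1 / (real n + 1) \<le> 1 / (real m + 1)" by (intro divide_left_mono) auto
          then show False using Pm False by (simp add: P_def)
        qed
        then obtain k where k: "m = Suc (k + n)" using less_iff_Suc_add by (metis add.commute)
        have "x \<in> R (k + n)" using Pm least[of "k + n"] x k unfolding R_def P_def by (simp add: not_le add.commute)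
        then show ?thesis by blast
      qed (use x in \<open>auto simp: Y_def\<close>)
    qed
    then have "?h (X - F) \<le> ?h (Y n \<union> (\<Union>k. R (k + n)))" by (rule hausdorff1_outer_mono)
    also have "... \<le> ?h (Y n) + ?h (\<Union>k. R (k + n))" by (rule hausdorff1_outer_subadditive)
    also have "... \<le> ?h (Y n) + (\<Sum>k. ?h (R (k + n)))"
      by (intro add_left_mono hausdorff1_outer_countably_subadditive)
    finally show ?thesis .
  qed
  have tail0: "(\<lambda>n. \<Sum>k. ?h (R (k + n))) \<longlonglongrightarrow> 0"
  proof -
    have fk: "?h (R k) \<noteq> \<infinity>" for k
    proof -
      have "?h (R k) \<le> ?h X" by (rule hausdorff1_outer_mono) (auto simp: R_def)
      then show ?thesis using fin by (auto simp: top_unique)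
    qed
    define r where "r k = enn2real (?h (R k))" for k
    have r: "?h (R k) = ennreal (r k)" "r k \<ge> 0" for k using fk[of k] by (auto simp: r_def less_top)
    have s: "summable r" by (rule summable_suminf_not_top) (use r sum in auto)
    have "(\<Sum>k. ?h (R (k + n))) = ennreal (\<Sum>k. r (k + n))" for n
      unfolding r(1) by (rule suminf_ennreal2) (use r s summable_ignore_initial_segment in auto)
    moreover have "(\<lambda>n. \<Sum>k. r (k + n)) \<longlonglongrightarrow> 0" by (rule suminf_exist_split2[OF s])
    ultimately show ?thesis using tendsto_ennrealI[of "\<lambda>n. \<Sum>k. r (k + n)" 0] by simp
  qed
  have "?h (F \<inter> X) + ?h (X - F) \<le> ?h X + (\<Sum>k. ?h (R (k + n)))" for n
  proof -
    have "?h (F \<inter> X) + ?h (X - F) \<le> ?h (F \<inter> X) + (?h (Y n) + (\<Sum>k. ?h (R (k + n))))"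
      by (intro add_left_mono tail)
    also have "... = (?h (F \<inter> X) + ?h (Y n)) + (\<Sum>k. ?h (R (k + n)))" by (simp add: add.assoc)
    also have "... \<le> ?h X + (\<Sum>k. ?h (R (k + n)))" by (intro add_right_mono sep)
    finally show ?thesis .
  qed
  moreover have "(\<lambda>n. ?h X + (\<Sum>k. ?h (R (k + n)))) \<longlonglongrightarrow> ?h X + 0" by (intro tendsto_add tendsto_const tail0)
  ultimately have "?h (F \<inter> X) + ?h (X - F) \<le> ?h X + 0" by (intro LIMSEQ_le_const) auto
  then show ?thesis by simp
qed

text \<open>
  The measure generated by an outer measure is the zero measure unless the outer measure is countably additive on the
  Borel sets; here this follows since all closed sets satisfy Caratheodory's criterion.
\<close>

lemma emeasure_hausdorff1:
  assumes "A \<in> sets borel"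
  shows "emeasure hausdorff1 A = hausdorff1_outer A"
proof -
  let ?L = "lambda_system UNIV (Pow UNIV) hausdorff1_outer"
  interpret P: sigma_algebra "UNIV :: (real^2) set" "Pow UNIV" by (rule sigma_algebra_Pow)
  have "outer_measure_space (Pow UNIV) hausdorff1_outer"
    unfolding outer_measure_space_def positive_def increasing_def countably_subadditive_def
    by (auto simp: hausdorff1_outer_empty intro: hausdorff1_outer_mono hausdorff1_outer_countably_subadditive)
  from P.caratheodory_lemma[OF this] have ms: "measure_space UNIV ?L hausdorff1_outer" .
  then interpret L: sigma_algebra UNIV ?L by (simp add: measure_space_def)
  have "F \<in> ?L" if "closed F" for F :: "(real^2) set"
  proof -
    have "hausdorff1_outer (F \<inter> X) + hausdorff1_outer ((UNIV - F) \<inter> X) = hausdorff1_outer X" for X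
    proof (rule antisym)
      have eq: "(UNIV - F) \<inter> X = X - F" by auto
      show "hausdorff1_outer (F \<inter> X) + hausdorff1_outer ((UNIV - F) \<inter> X) \<le> hausdorff1_outer X"
        unfolding eq by (rule hausdorff1_closed_measurable[OF that])
      have "X = (F \<inter> X) \<union> ((UNIV - F) \<inter> X)" by auto
      then show "hausdorff1_outer X \<le> hausdorff1_outer (F \<inter> X) + hausdorff1_outer ((UNIV - F) \<inter> X)"
        using hausdorff1_outer_subadditive[of "F \<inter> X" "(UNIV - F) \<inter> X"] by simp
    qed
    then show ?thesis by (simp add: lambda_system_def)
  qed
  then have "sigma_sets UNIV (Collect closed) \<subseteq> ?L" by (intro L.sigma_sets_subset) auto
  then have "sets borel \<subseteq> ?L" by (simp add: borel_eq_closed)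
  then have "measure_space UNIV (sets borel) hausdorff1_outer"
    using sets.sigma_algebra_axioms[of "borel :: (real^2) measure"] by (intro measure_down[OF ms]) auto
  then show ?thesis
    unfolding hausdorff1_def using assms sets.sigma_algebra_axioms[of "borel :: (real^2) measure"]
    by (intro emeasure_measure_of_sigma) (auto simp: measure_space_def)
qed

lemma sets_hausdorff1 [simp, measurable_cong]: "sets hausdorff1 = sets borel"
  and space_hausdorff1 [simp]: "space hausdorff1 = UNIV"
  using sets.sigma_sets_eq[of "borel :: (real^2) measure"] by (simp_all add: hausdorff1_def)

section \<open>Lipschitz graphs\<close>

text \<open>
  Coordinates at a Lipschitz graph: s runs along the axis e, and the depth t is measured from the graph against the
  direction n, so that the points below the graph have positive depth.
\<close>

locale graph_chart =
  fixes x0 e n :: "real^2" and L :: real and \<gamma> :: "real => real"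
  assumes e1: "norm e = 1" and n1: "norm n = 1" and en: "e \<bullet> n = 0" and lip: "L-lipschitz_on UNIV \<gamma>"
begin

definition chart :: "real => real => real^2" where
  "chart s t = x0 + s *\<^sub>R e + (\<gamma> s - t) *\<^sub>R n"

definition hor :: "real^2 => real" where
  "hor x = (x - x0) \<bullet> e"

definition depth :: "real^2 => real" where
  "depth x = \<gamma> (hor x) - (x - x0) \<bullet> n"

lemma inner_frame: "e \<bullet> e = 1" "n \<bullet> n = 1" "e \<bullet> n = 0" "n \<bullet> e = 0"
  using e1 n1 en by (auto simp: dot_square_norm inner_commute)

definition rotation :: "real^2 => real^2" where
  "rotation v = (v $ 1) *\<^sub>R e + (v $ 2) *\<^sub>R n"

lemma rotation_orthogonal: "orthogonal_transformation rotation"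
proof -
  have "linear rotation" by (rule linearI) (auto simp: rotation_def algebra_simps)
  moreover have "rotation v \<bullet> rotation w = v \<bullet> w" for v w
  proof -
    have "v \<bullet> w = v $ 1 * w $ 1 + v $ 2 * w $ 2" by (simp add: inner_vec_def sum_2)
    then show ?thesis by (simp add: rotation_def inner_add_left inner_add_right inner_frame)
  qed
  ultimately show ?thesis by (simp add: orthogonal_transformation_def)
qed

lemma frame_expansion: "(x \<bullet> e) *\<^sub>R e + (x \<bullet> n) *\<^sub>R n = x"
proof -
  obtain v where "x = rotation v" using orthogonal_transformation_surj[OF rotation_orthogonal] by (metis surjD)
  then show ?thesis by (simp add: rotation_def inner_add_left inner_frame)
qed

lemma L_nonneg: "L \<ge> 0" using lip by (rule lipschitz_on_nonneg)

lemma \<gamma>_diff: "\<bar>\<gamma> s - \<gamma> t\<bar> \<le> L * \<bar>s - t\<bar>" using lipschitz_onD[OF lip, of s t] by (simp add: dist_real_def)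

lemma \<gamma>_continuous: "continuous_on A \<gamma>"
  using lipschitz_on_continuous_on[OF lip] by (rule continuous_on_subset) simp

lemma \<gamma>_borel [measurable]: "\<gamma> \<in> borel_measurable borel"
  by (rule borel_measurable_continuous_onI[OF \<gamma>_continuous])

lemma hor_chart [simp]: "hor (chart s t) = s" by (simp add: hor_def chart_def inner_add_left inner_frame)

lemma depth_chart [simp]: "depth (chart s t) = t"
proof -
  have "(chart s t - x0) \<bullet> n = \<gamma> s - t" by (simp add: chart_def inner_add_left inner_frame)
  then show ?thesis unfolding depth_def hor_chart by simp
qed

lemma chart_hor_depth [simp]: "chart (hor x) (depth x) = x"
  using frame_expansion[of "x - x0"] by (simp add: chart_def depth_def hor_def algebra_simps)

lemma hor_continuous: "continuous_on A hor" unfolding hor_def[abs_def] by (intro continuous_intros)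

lemma depth_continuous: "continuous_on A depth"
  unfolding depth_def[abs_def]
  by (intro continuous_intros continuous_on_compose2[OF \<gamma>_continuous[of UNIV]] hor_continuous) auto

lemma graph_continuous: "continuous_on A (\<lambda>s. chart s t)"
  unfolding chart_def by (intro continuous_intros \<gamma>_continuous)

lemma hor_borel [measurable]: "hor \<in> borel_measurable borel"
  by (rule borel_measurable_continuous_onI[OF hor_continuous])

lemma depth_borel [measurable]: "depth \<in> borel_measurable borel"
  by (rule borel_measurable_continuous_onI[OF depth_continuous])

lemma chart_borel [measurable (raw)]:
  "f \<in> borel_measurable M ==> g \<in> borel_measurable M ==> (\<lambda>x. chart (f x) (g x)) \<in> borel_measurable M"
  unfolding chart_def
  by (intro borel_measurable_add borel_measurable_scaleR borel_measurable_diff borel_measurable_const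
      measurable_compose[OF _ \<gamma>_borel])

lemma chart_shift: "chart s t - c *\<^sub>R n = chart s (t + c)" by (simp add: chart_def algebra_simps)

lemma hor_dist: "\<bar>hor x - hor y\<bar> \<le> dist x y"
proof -
  have "hor x - hor y = (x - y) \<bullet> e" by (simp add: hor_def inner_diff_left)
  then show ?thesis using Cauchy_Schwarz_ineq2[of "x - y" e] e1 by (simp add: dist_norm)
qed

lemma graph_dist: "dist (chart s 0) (chart t 0) \<le> (1 + L) * \<bar>s - t\<bar>"
proof -
  have "chart s 0 - chart t 0 = (s - t) *\<^sub>R e + (\<gamma> s - \<gamma> t) *\<^sub>R n" by (simp add: chart_def algebra_simps)
  then have "dist (chart s 0) (chart t 0) \<le> \<bar>s - t\<bar> + \<bar>\<gamma> s - \<gamma> t\<bar>"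
    using norm_triangle_ineq[of "(s - t) *\<^sub>R e" "(\<gamma> s - \<gamma> t) *\<^sub>R n"] e1 n1 by (simp add: dist_norm)
  then show ?thesis using \<gamma>_diff[of s t] by (simp add: algebra_simps)
qed

subsection \<open>Integration in graph coordinates\<close>

lemma distr_rotation: "distr lborel borel rotation = lborel"
proof (rule lborel_eqI[symmetric])
  have cont: "continuous_on UNIV rotation" unfolding rotation_def[abs_def] by (intro continuous_intros)
  have m [measurable]: "rotation \<in> borel_measurable borel" by (rule borel_measurable_continuous_onI[OF cont])
  fix l u :: "real^2" assume lu: "\<And>b. b \<in> Basis ==> l \<bullet> b \<le> u \<bullet> b"
  have bij: "bij rotation" by (rule orthogonal_transformation_bij[OF rotation_orthogonal])
  have vi: "rotation -` box l u = inv rotation ` box l u" using bij by (simp add: bij_vimage_eq_inv_image)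
  have io: "orthogonal_transformation (inv rotation)" by (rule orthogonal_transformation_inv[OF rotation_orthogonal])
  have lm: "inv rotation ` box l u \<in> lmeasurable" by (rule measurable_orthogonal_image[OF io]) simp
  have sb: "rotation -` box l u \<in> sets borel" using measurable_sets[OF m, of "box l u"] by simp
  have "emeasure (distr lborel borel rotation) (box l u) = emeasure lborel (rotation -` box l u)"
    by (subst emeasure_distr) auto
  also have "... = emeasure lebesgue (rotation -` box l u)" using sb by simp
  also have "... = ennreal (measure lebesgue (rotation -` box l u))"
    using lm unfolding vi by (simp add: emeasure_eq_measure2)
  also have "... = ennreal (measure lebesgue (box l u))"
    unfolding vi using measure_orthogonal_image[OF io, of "box l u"] by simp
  also have "... = emeasure lebesgue (box l u)" by (rule emeasure_eq_measure2[symmetric]) simp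
  also have "... = emeasure lborel (box l u)" by simp
  also have "... = (\<Prod>b\<in>Basis. (u - l) \<bullet> b)" by (rule emeasure_lborel_box[OF lu])
  finally show "emeasure (distr lborel borel rotation) (box l u) = (\<Prod>b\<in>Basis. (u - l) \<bullet> b)" .
qed simp

end

definition pair_vec :: "real \<times> real => real^2" where
  "pair_vec p = (\<chi> i. if i = 1 then fst p else snd p)"

lemma pair_vec_borel [measurable]: "pair_vec \<in> borel_measurable borel"
proof (rule borel_measurable_continuous_onI)
  show "continuous_on UNIV pair_vec"
    unfolding pair_vec_def[abs_def]
  proof (rule continuous_on_vec_lambda)
    show "continuous_on UNIV (\<lambda>p. if i = 1 then fst p else snd p)" for i :: 2
      by (cases "i = 1") (auto intro: continuous_intros)
  qed
qed

lemma Basis_real2: "(Basis :: (real^2) set) = {axis 1 1, axis 2 1}" by (auto simp: Basis_vec_def UNIV_2)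

lemma axis12_neq: "(axis 1 1 :: real^2) \<noteq> axis 2 1" by (simp add: axis_eq_axis)

lemma distr_pair_vec: "distr lborel borel pair_vec = lborel"
proof (rule lborel_eqI[symmetric])
  fix l u :: "real^2" assume lu: "\<And>b. b \<in> Basis ==> l \<bullet> b \<le> u \<bullet> b"
  have le: "l $ 1 \<le> u $ 1" "l $ 2 \<le> u $ 2"
    using lu[of "axis 1 1"] lu[of "axis 2 1"] by (auto simp: Basis_real2 inner_axis)
  have vi: "pair_vec -` box l u = {l $ 1<..<u $ 1} \<times> {l $ 2<..<u $ 2}"
    by (auto simp: pair_vec_def mem_box_cart forall_2)
  have "emeasure (distr lborel borel pair_vec) (box l u) = emeasure lborel (pair_vec -` box l u)"
    by (subst emeasure_distr) auto
  also have "... = emeasure (lborel \<Otimes>\<^sub>M lborel) ({l $ 1<..<u $ 1} \<times> {l $ 2<..<u $ 2})"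
    unfolding vi lborel_prod ..
  also have "... = ennreal (u $ 1 - l $ 1) * ennreal (u $ 2 - l $ 2)"
    by (subst lborel.emeasure_pair_measure_Times) (use le in auto)
  also have "... = (\<Prod>b\<in>Basis. (u - l) \<bullet> b)"
    using le axis12_neq by (simp add: Basis_real2 inner_axis ennreal_mult)
  finally show "emeasure (distr lborel borel pair_vec) (box l u) = (\<Prod>b\<in>Basis. (u - l) \<bullet> b)" .
qed simp

context graph_chart
begin

text \<open>Up to a translation and a reflection the chart is a shear followed by a rotation.\<close>

lemma nn_integral_chart:
  assumes [measurable]: "h \<in> borel_measurable borel"
  shows "(\<integral>\<^sup>+x. h x \<partial>lborel) = (\<integral>\<^sup>+s. \<integral>\<^sup>+t. h (chart s t) \<partial>lborel \<partial>lborel)"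
proof -
  have cont: "continuous_on UNIV rotation" unfolding rotation_def[abs_def] by (intro continuous_intros)
  have [measurable]: "rotation \<in> borel_measurable borel" by (rule borel_measurable_continuous_onI[OF cont])
  have "(\<integral>\<^sup>+x. h x \<partial>lborel) = (\<integral>\<^sup>+x. h (x + x0) \<partial>lborel)" by (rule nn_integral_lborel_shift[symmetric]) simp
  also have "... = (\<integral>\<^sup>+x. h (x + x0) \<partial>distr lborel borel rotation)" by (simp add: distr_rotation)
  also have "... = (\<integral>\<^sup>+v. h (rotation v + x0) \<partial>distr lborel borel pair_vec)"
    by (subst nn_integral_distr) (simp_all add: distr_pair_vec)
  also have "... = (\<integral>\<^sup>+p. h (rotation (pair_vec p) + x0) \<partial>(lborel \<Otimes>\<^sub>M lborel))"
    by (subst nn_integral_distr) (simp_all add: lborel_prod)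
  also have "... = (\<integral>\<^sup>+s. \<integral>\<^sup>+y. h (rotation (pair_vec (s, y)) + x0) \<partial>lborel \<partial>lborel)"
    by (rule lborel.nn_integral_fst[symmetric]) (simp add: lborel_prod)
  also have "... = (\<integral>\<^sup>+s. \<integral>\<^sup>+t. h (chart s t) \<partial>lborel \<partial>lborel)"
  proof (rule nn_integral_cong)
    fix s :: real
    have "(\<integral>\<^sup>+y. h (rotation (pair_vec (s, y)) + x0) \<partial>lborel) = (\<integral>\<^sup>+y. h (x0 + s *\<^sub>R e + y *\<^sub>R n) \<partial>lborel)"
      by (simp add: rotation_def pair_vec_def add.commute add.left_commute)
    also have "... = \<bar>-1::real\<bar> * (\<integral>\<^sup>+t. h (x0 + s *\<^sub>R e + (\<gamma> s + (- 1) * t) *\<^sub>R n) \<partial>lborel)"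
      by (rule nn_integral_real_affine) auto
    finally show "(\<integral>\<^sup>+y. h (rotation (pair_vec (s, y)) + x0) \<partial>lborel) = (\<integral>\<^sup>+t. h (chart s t) \<partial>lborel)"
      by (simp add: chart_def)
  qed
  finally show ?thesis .
qed

subsection \<open>Hausdorff measure on a Lipschitz graph\<close>

text \<open>
  The projection to the axis e does not increase distances, so a cover of B yields a cover of the parameters by
  intervals that are no longer.
\<close>

lemma graph_hausdorff1_lower: "emeasure lborel {s. chart s 0 \<in> B} \<le> hausdorff1_outer B" if [measurable]: "B \<in> sets borel"
proof -
  have "emeasure lborel {s. chart s 0 \<in> B} \<le> hausdorff1_pre 1 B"
    unfolding hausdorff1_pre_def
  proof (rule INF_greatest, clarify)
    fix E :: "nat => (real^2) set"
    assume E: "B \<subseteq> (\<Union>i. E i)" "\<forall>i. bounded (E i) \<and> diameter (E i) \<le> 1"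
    define S where "S i = {s. chart s 0 \<in> E i}" for i
    define J where "J i = (if S i = {} then {} else {Inf (S i)..Sup (S i)})" for i
    have d: "\<bar>s - t\<bar> \<le> diameter (E i)" if "s \<in> S i" "t \<in> S i" for s t i
    proof -
      have "\<bar>s - t\<bar> \<le> dist (chart s 0) (chart t 0)" using hor_dist[of "chart s 0" "chart t 0"] by simp
      also have "... \<le> diameter (E i)" using E(2) that by (intro diameter_bounded_bound) (auto simp: S_def)
      finally show ?thesis .
    qed
    have bdd: "bdd_above (S i)" "bdd_below (S i)" for i
    proof -
      have "bdd_above (S i) \<and> bdd_below (S i)"
      proof (cases "S i = {}")
        case False
        then obtain s0 where s0: "s0 \<in> S i" by blast
        have "S i \<subseteq> {s0 - diameter (E i)..s0 + diameter (E i)}"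
        proof
          fix s assume "s \<in> S i"
          then show "s \<in> {s0 - diameter (E i)..s0 + diameter (E i)}" using d[OF _ s0, of s] by (simp add: abs_le_iff)
        qed
        then show ?thesis by (intro conjI bdd_above_mono[OF bdd_above_Icc] bdd_below_mono[OF bdd_below_Icc])
      qed simp
      then show "bdd_above (S i)" "bdd_below (S i)" by auto
    qed
    have SJ: "S i \<subseteq> J i" for i using bdd[of i] by (auto simp: J_def intro: cInf_lower cSup_upper)
    have J: "emeasure lborel (J i) \<le> ennreal (diameter (E i))" for i
    proof (cases "S i = {}")
      case False
      have "Sup (S i) \<le> Inf (S i) + diameter (E i)"
      proof (rule cSup_least[OF False])
        fix s assume s: "s \<in> S i"
        have "s - diameter (E i) \<le> Inf (S i)"
        proof (rule cInf_greatest[OF False])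
          fix t assume "t \<in> S i"
          then show "s - diameter (E i) \<le> t" using d[OF s, of t] by simp
        qed
        then show "s \<le> Inf (S i) + diameter (E i)" by simp
      qed
      moreover have "Inf (S i) \<le> Sup (S i)" using False bdd by (intro cInf_le_cSup)
      ultimately show ?thesis using False by (auto simp: J_def intro: ennreal_leI)
    qed (simp add: J_def)
    have [measurable]: "J i \<in> sets borel" for i by (simp add: J_def)
    have "emeasure lborel {s. chart s 0 \<in> B} \<le> emeasure lborel (\<Union>i. J i)"
      using E(1) SJ by (intro emeasure_mono) (force simp: S_def)+
    also have "... \<le> (\<Sum>i. emeasure lborel (J i))" by (rule emeasure_subadditive_countably) auto
    also have "... \<le> (\<Sum>i. ennreal (diameter (E i)))" by (intro suminf_le summableI J)
    finally show "emeasure lborel {s. chart s 0 \<in> B} \<le> (\<Sum>i. ennreal (diameter (E i)))" .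
  qed
  also have "... \<le> hausdorff1_outer B" by (rule hausdorff1_pre_le_outer) simp
  finally show ?thesis .
qed

text \<open>The images of N pieces of equal length have diameter at most 1 + L times that length.\<close>

lemma graph_hausdorff1_interval:
  assumes "c \<le> d"
  shows "hausdorff1_outer ((\<lambda>s. chart s 0) ` {c..d}) \<le> ennreal ((1 + L) * (d - c))"
  unfolding hausdorff1_outer_def
proof (rule SUP_least)
  fix \<delta> :: real assume "\<delta> \<in> {0<..}"
  then have \<delta>: "\<delta> > 0" by simp
  obtain N :: nat where N: "N > 0" "(1 + L) * (d - c) / \<delta> < N"
    using reals_Archimedean2[of "max 1 ((1 + L) * (d - c) / \<delta>)"] by (metis less_trans max_less_iff_conj of_nat_0_less_iff zero_less_one)
  define h where "h = (d - c) / N"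
  have h: "h \<ge> 0" "(1 + L) * h \<le> \<delta>" "real N * h = d - c" using N \<delta> assms by (auto simp: h_def field_simps)
  define E where "E i = (if i < N then (\<lambda>s. chart s 0) ` {c + real i * h..c + (real i + 1) * h} else {})" for i
  have diam: "diameter (E i) \<le> (1 + L) * h" for i
  proof (rule diameter_le)
    show "E i \<noteq> {} \<or> 0 \<le> (1 + L) * h" using h(1) L_nonneg by simp
    fix x y assume "x \<in> E i" "y \<in> E i"
    then obtain s t where st: "x = chart s 0" "y = chart t 0" "s \<in> {c + real i * h..c + (real i + 1) * h}"
      "t \<in> {c + real i * h..c + (real i + 1) * h}" by (auto simp: E_def split: if_splits)
    have "\<bar>s - t\<bar> \<le> h" using st(3,4) by (auto simp: algebra_simps abs_le_iff)
    then have "(1 + L) * \<bar>s - t\<bar> \<le> (1 + L) * h" using L_nonneg by (intro mult_left_mono) auto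
    then show "norm (x - y) \<le> (1 + L) * h" using graph_dist[of s t] st(1,2) by (simp add: dist_norm)
  qed
  have bdd: "bounded (E i)" for i
  proof -
    have "compact ((\<lambda>s. chart s 0) ` {c + real i * h..c + (real i + 1) * h})"
    proof (rule compact_continuous_image)
      show "continuous_on {c + real i * h..c + (real i + 1) * h} (\<lambda>s. chart s 0)" by (rule graph_continuous)
    qed simp
    then show ?thesis by (simp add: E_def compact_imp_bounded)
  qed
  have cover: "(\<lambda>s. chart s 0) ` {c..d} \<subseteq> (\<Union>i. E i)"
  proof
    fix x assume "x \<in> (\<lambda>s. chart s 0) ` {c..d}"
    then obtain s where s: "x = chart s 0" "c \<le> s" "s \<le> d" by auto
    show "x \<in> (\<Union>i. E i)"
    proof (cases "s = d")
      case True
      have "s = c + (real (N - 1) + 1) * h" using True h(3) N(1) by (simp add: of_nat_diff algebra_simps)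
      then have "s \<in> {c + real (N - 1) * h..c + (real (N - 1) + 1) * h}" using h(1) by (simp add: algebra_simps)
      then have "x \<in> E (N - 1)" using s(1) N(1) by (auto simp: E_def)
      then show ?thesis by blast
    next
      case False
      then have "h > 0" using s N(1) by (simp add: h_def)
      define i where "i = nat \<lfloor>(s - c) / h\<rfloor>"
      have fl: "real i \<le> (s - c) / h" "(s - c) / h < real i + 1" using s(2) \<open>h > 0\<close> by (auto simp: i_def)
      have "(s - c) / h < N" using h(3) \<open>h > 0\<close> s False by (simp add: pos_divide_less_eq)
      then have "i < N" using fl(1) by simp
      moreover have "s \<in> {c + real i * h..c + (real i + 1) * h}" using fl \<open>h > 0\<close> by (simp add: field_simps)
      ultimately have "x \<in> E i" using s(1) by (auto simp: E_def)
      then show ?thesis by blast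
    qed
  qed
  have "hausdorff1_pre \<delta> ((\<lambda>s. chart s 0) ` {c..d}) \<le> (\<Sum>i. ennreal (diameter (E i)))"
    by (rule hausdorff1_pre_le[OF cover bdd order_trans[OF diam h(2)]])
  also have "... = (\<Sum>i<N. ennreal (diameter (E i)))" by (rule suminf_finite) (auto simp: E_def)
  also have "... \<le> (\<Sum>i<N. ennreal ((1 + L) * h))" by (intro sum_mono ennreal_leI diam)
  also have "... = ennreal (real N * ((1 + L) * h))"
    using h(1) L_nonneg by (simp add: ennreal_mult ennreal_of_nat_eq_real_of_nat)
  also have "real N * ((1 + L) * h) = (1 + L) * (d - c)" using h(3) by (simp add: mult.left_commute)
  finally show "hausdorff1_pre \<delta> ((\<lambda>s. chart s 0) ` {c..d}) \<le> ennreal ((1 + L) * (d - c))" .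
qed

text \<open>
  Outer regularity: A is covered by intervals without common interior points, whose total length exceeds the
  measure of A by little.
\<close>

lemma graph_hausdorff1_upper:
  assumes A: "A \<in> sets borel" "A \<subseteq> {-a..a}"
  shows "hausdorff1_outer ((\<lambda>s. chart s 0) ` A) \<le> ennreal (1 + L) * emeasure lborel A"
proof (rule ennreal_le_epsilon)
  fix \<epsilon> :: real assume \<epsilon>: "\<epsilon> > 0"
  have L1: "1 + L > 0" using L_nonneg by simp
  have Afin: "emeasure lborel A < \<infinity>"
    using emeasure_bounded_finite[of A] bounded_subset[OF bounded_closed_interval A(2)] by simp
  have lm: "A \<in> lmeasurable" using A(1) Afin by (intro fmeasurableI) auto
  obtain \<D> where D: "countable \<D>" "\<And>K. K \<in> \<D> ==> K \<subseteq> cbox (-a) a \<and> K \<noteq> {} \<and> (\<exists>c d. K = cbox c d)"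
    "pairwise (\<lambda>A B. interior A \<inter> interior B = {}) \<D>" "A \<subseteq> \<Union>\<D>" "\<Union>\<D> \<in> lmeasurable"
    "measure lebesgue (\<Union>\<D>) \<le> measure lebesgue A + \<epsilon> / (1 + L)"
  proof -
    have sub: "A \<subseteq> cbox (-a) a" "\<epsilon> / (1 + L) > 0" using A(2) \<epsilon> L1 by (auto simp: cbox_interval)
    show thesis by (rule measurable_outer_intervals_bounded[OF lm sub], rule that, assumption+)
  qed
  define X where "X i = (if i \<in> to_nat_on \<D> ` \<D> then from_nat_into \<D> i else {})" for i
  have X: "X i = {} \<or> X i \<in> \<D>" for i using D(1) by (auto simp: X_def)
  have XD: "\<exists>i. X i = K" if "K \<in> \<D>" for K
    using that D(1) by (intro exI[of _ "to_nat_on \<D> K"]) (auto simp: X_def)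
  have Xcb: "\<exists>c d. X i = {c..d} \<and> c \<le> d" if "X i \<noteq> {}" for i
    using X[of i] D(2)[of "X i"] that by (auto simp: cbox_interval)
  have [measurable]: "X i \<in> sets borel" for i using Xcb[of i] by (cases "X i = {}") auto
  have Xem: "emeasure lborel (interior (X i)) = emeasure lborel (X i)" for i
    using Xcb[of i] by (cases "X i = {}") auto
  have disj: "disjoint_family (\<lambda>i. interior (X i))"
    unfolding disjoint_family_on_def
  proof (intro ballI impI)
    fix i j :: nat assume "i \<noteq> j"
    show "interior (X i) \<inter> interior (X j) = {}"
    proof (cases "i \<in> to_nat_on \<D> ` \<D> \<and> j \<in> to_nat_on \<D> ` \<D>")
      case True
      then obtain K K' where K: "K \<in> \<D>" "i = to_nat_on \<D> K" "K' \<in> \<D>" "j = to_nat_on \<D> K'" by blast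
      then have "X i = K" "X j = K'" "K \<noteq> K'" using D(1) \<open>i \<noteq> j\<close> by (auto simp: X_def)
      then show ?thesis using D(3) K by (auto simp: pairwise_def)
    qed (auto simp: X_def)
  qed
  have sumX: "(\<Sum>i. emeasure lborel (X i)) \<le> emeasure lborel A + ennreal (\<epsilon> / (1 + L))"
  proof -
    have "(\<Sum>i. emeasure lborel (X i)) = (\<Sum>i. emeasure lborel (interior (X i)))" by (simp add: Xem)
    also have "... = emeasure lborel (\<Union>i. interior (X i))" by (rule suminf_emeasure[OF _ disj]) auto
    also have "... = emeasure lebesgue (\<Union>i. interior (X i))" by simp
    also have "... \<le> emeasure lebesgue (\<Union>\<D>)"
    proof (rule emeasure_mono)
      show "(\<Union>i. interior (X i)) \<subseteq> \<Union>\<D>"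
      proof
        fix x assume "x \<in> (\<Union>i. interior (X i))"
        then obtain i where "x \<in> X i" using interior_subset by blast
        then show "x \<in> \<Union>\<D>" using X[of i] by blast
      qed
    qed (use D(5) in auto)
    also have "... = ennreal (measure lebesgue (\<Union>\<D>))" using D(5) by (simp add: emeasure_eq_measure2)
    also have "... \<le> ennreal (measure lebesgue A + \<epsilon> / (1 + L))" by (rule ennreal_leI[OF D(6)])
    also have "... = ennreal (measure lebesgue A) + ennreal (\<epsilon> / (1 + L))" using \<epsilon> L1 by simp
    also have "ennreal (measure lebesgue A) = emeasure lborel A" using emeasure_eq_measure2[OF lm] A(1) by simp
    finally show ?thesis .
  qed
  have "hausdorff1_outer ((\<lambda>s. chart s 0) ` A) \<le> hausdorff1_outer (\<Union>i. (\<lambda>s. chart s 0) ` X i)"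
    using D(4) XD by (intro hausdorff1_outer_mono) blast
  also have "... \<le> (\<Sum>i. hausdorff1_outer ((\<lambda>s. chart s 0) ` X i))" by (rule hausdorff1_outer_countably_subadditive)
  also have "... \<le> (\<Sum>i. ennreal (1 + L) * emeasure lborel (X i))"
  proof (intro suminf_le summableI)
    fix i
    show "hausdorff1_outer ((\<lambda>s. chart s 0) ` X i) \<le> ennreal (1 + L) * emeasure lborel (X i)"
    proof (cases "X i = {}")
      case False
      then obtain c d where cd: "X i = {c..d}" "c \<le> d" using Xcb by blast
      then show ?thesis using graph_hausdorff1_interval[OF cd(2)] L1 by (simp add: ennreal_mult)
    qed (simp add: hausdorff1_outer_empty)
  qed
  also have "... = ennreal (1 + L) * (\<Sum>i. emeasure lborel (X i))" by simp
  also have "... \<le> ennreal (1 + L) * (emeasure lborel A + ennreal (\<epsilon> / (1 + L)))" by (intro mult_left_mono sumX) simp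
  also have "... = ennreal (1 + L) * emeasure lborel A + ennreal \<epsilon>"
    using L1 \<epsilon> by (simp add: distrib_left flip: ennreal_mult)
  finally show "hausdorff1_outer ((\<lambda>s. chart s 0) ` A) \<le> ennreal (1 + L) * emeasure lborel A + ennreal \<epsilon>" .
qed

lemma graph_image_borel:
  assumes [measurable]: "I \<in> sets borel"
  shows "(\<lambda>s. chart s 0) ` I \<in> sets borel"
proof -
  have "(\<lambda>s. chart s 0) ` I = {x. hor x \<in> I \<and> depth x = 0}"
  proof (intro equalityI subsetI)
    fix x assume x: "x \<in> {x. hor x \<in> I \<and> depth x = 0}"
    then have "x = chart (hor x) 0" using chart_hor_depth[of x] by simp
    then show "x \<in> (\<lambda>s. chart s 0) ` I" using x by auto
  qed auto
  also have "... \<in> sets borel" by measurable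
  finally show ?thesis .
qed

lemma
  assumes I [measurable]: "I \<in> sets borel" and a: "I \<subseteq> {-a..a}" and [measurable]: "h \<in> borel_measurable borel"
  shows graph_nn_integral_upper: "(\<integral>\<^sup>+x. h x * indicator ((\<lambda>s. chart s 0) ` I) x \<partial>hausdorff1)
      \<le> ennreal (1 + L) * (\<integral>\<^sup>+s. h (chart s 0) * indicator I s \<partial>lborel)"
    and graph_nn_integral_lower: "(\<integral>\<^sup>+s. h (chart s 0) * indicator I s \<partial>lborel)
      \<le> (\<integral>\<^sup>+x. h x * indicator ((\<lambda>s. chart s 0) ` I) x \<partial>hausdorff1)"
proof -
  let ?\<Gamma> = "\<lambda>s. chart s 0"
  note [measurable] = graph_image_borel[OF I]
  define M1 where "M1 = density hausdorff1 (indicator (?\<Gamma> ` I))"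
  define M2 where "M2 = distr (density lborel (indicator I)) borel ?\<Gamma>"
  have sets: "sets M1 = sets borel" "sets M2 = sets borel" by (auto simp: M1_def M2_def)
  have im: "?\<Gamma> ` I \<inter> B = ?\<Gamma> ` (I \<inter> {s. chart s 0 \<in> B})" for B by auto
  have M1: "emeasure M1 B = hausdorff1_outer (?\<Gamma> ` (I \<inter> {s. chart s 0 \<in> B}))" if [measurable]: "B \<in> sets borel" for B
  proof -
    have ms: "?\<Gamma> ` I \<inter> B \<in> sets borel" by measurable
    have "emeasure M1 B = (\<integral>\<^sup>+x. indicator (?\<Gamma> ` I) x * indicator B x \<partial>hausdorff1)"
      unfolding M1_def by (rule emeasure_density) auto
    also have "... = (\<integral>\<^sup>+x. indicator (?\<Gamma> ` I \<inter> B) x \<partial>hausdorff1)"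
      by (intro nn_integral_cong) (simp add: indicator_inter_arith)
    also have "... = emeasure hausdorff1 (?\<Gamma> ` I \<inter> B)" by (rule nn_integral_indicator) auto
    finally show ?thesis by (simp only: emeasure_hausdorff1[OF ms], simp only: im)
  qed
  have M2: "emeasure M2 B = emeasure lborel (I \<inter> {s. chart s 0 \<in> B})" if [measurable]: "B \<in> sets borel" for B
  proof -
    have vi: "?\<Gamma> -` B = {s. chart s 0 \<in> B}" by auto
    have "emeasure M2 B = emeasure (density lborel (indicator I)) {s. chart s 0 \<in> B}"
      unfolding M2_def by (subst emeasure_distr) (auto simp: vi)
    also have "... = (\<integral>\<^sup>+x. indicator I x * indicator {s. chart s 0 \<in> B} x \<partial>lborel)"
      by (rule emeasure_density) auto
    also have "... = (\<integral>\<^sup>+x. indicator (I \<inter> {s. chart s 0 \<in> B}) x \<partial>lborel)"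
      by (intro nn_integral_cong) (simp add: indicator_inter_arith)
    also have "... = emeasure lborel (I \<inter> {s. chart s 0 \<in> B})" by (rule nn_integral_indicator) auto
    finally show ?thesis .
  qed
  have i1: "nn_integral M1 h = (\<integral>\<^sup>+x. h x * indicator (?\<Gamma> ` I) x \<partial>hausdorff1)"
    unfolding M1_def by (subst nn_integral_density) (auto simp: mult.commute)
  have i2: "nn_integral M2 h = (\<integral>\<^sup>+s. h (chart s 0) * indicator I s \<partial>lborel)"
    unfolding M2_def by (subst nn_integral_distr) (auto simp: nn_integral_density mult.commute)
  have "M1 \<le> scale_measure (ennreal (1 + L)) M2"
  proof (subst le_measure)
    show "sets M1 = sets (scale_measure (ennreal (1 + L)) M2)" by (simp add: sets)
    show "\<forall>B\<in>sets M1. emeasure M1 B \<le> emeasure (scale_measure (ennreal (1 + L)) M2) B"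
    proof
      fix B assume "B \<in> sets M1"
      then have B [measurable]: "B \<in> sets borel" by (simp add: sets)
      show "emeasure M1 B \<le> emeasure (scale_measure (ennreal (1 + L)) M2) B"
        unfolding emeasure_scale_measure M1[OF B] M2[OF B] by (rule graph_hausdorff1_upper) (use a in auto)
    qed
  qed
  then have "nn_integral M1 h \<le> nn_integral (scale_measure (ennreal (1 + L)) M2) h"
    by (intro nn_integral_mono_measure) (simp_all add: sets)
  also have "... = ennreal (1 + L) * nn_integral M2 h"
    by (rule nn_integral_scale_measure) (simp add: measurable_cong_sets[OF sets(2) refl])
  finally show "(\<integral>\<^sup>+x. h x * indicator (?\<Gamma> ` I) x \<partial>hausdorff1)
      \<le> ennreal (1 + L) * (\<integral>\<^sup>+s. h (chart s 0) * indicator I s \<partial>lborel)" by (simp add: i1 i2)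
  have "M2 \<le> M1"
  proof (subst le_measure)
    show "sets M2 = sets M1" by (simp add: sets)
    show "\<forall>B\<in>sets M2. emeasure M2 B \<le> emeasure M1 B"
    proof
      fix B assume "B \<in> sets M2"
      then have B [measurable]: "B \<in> sets borel" by (simp add: sets)
      have eq: "I \<inter> {s. chart s 0 \<in> B} = {s. chart s 0 \<in> ?\<Gamma> ` I \<inter> B}" by (auto dest: arg_cong[of _ _ hor])
      have "emeasure lborel (I \<inter> {s. chart s 0 \<in> B}) \<le> hausdorff1_outer (?\<Gamma> ` I \<inter> B)"
        unfolding eq by (rule graph_hausdorff1_lower) auto
      then show "emeasure M2 B \<le> emeasure M1 B" unfolding M1[OF B] M2[OF B] im .
    qed
  qed
  then have "nn_integral M2 h \<le> nn_integral M1 h" by (intro nn_integral_mono_measure) (simp_all add: sets)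
  then show "(\<integral>\<^sup>+s. h (chart s 0) * indicator I s \<partial>lborel)
      \<le> (\<integral>\<^sup>+x. h x * indicator (?\<Gamma> ` I) x \<partial>hausdorff1)" by (simp add: i1 i2)
qed

end

section \<open>Traces on a Lipschitz graph\<close>

lemma square_le_double: "(a::real)\<^sup>2 \<le> 2 * b\<^sup>2 + 2 * (a - b)\<^sup>2" using norm_add_sq_le[of b "a - b"] by simp

context graph_chart
begin

text \<open>
  A Sobolev function that is continuous up to the graph differs between depth h and depth 0 by at most the integral of its
  gradient along the vertical segment. The translation identity gives this for almost all
  pairs of points at distance h; continuity extends it to every depth, in particular to depth 0.
\<close>

lemma depth_difference:
  assumes H: "H1 G v g" and G: "bounded G" "open G"
    and inside: "\<And>s t. \<bar>s\<bar> < a ==> 0 < t ==> t < b ==> chart s t \<in> G"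
    and cont: "continuous_on (G \<union> S) \<phi>" and S: "\<And>s. \<bar>s\<bar> < a ==> chart s 0 \<in> S"
    and eq: "\<And>x. x \<in> G ==> \<phi> x = v x" and h: "0 < h" "h < b"
  shows "AE s in lborel. \<bar>s\<bar> < a --> ennreal ((\<phi> (chart s h) - \<phi> (chart s 0))\<^sup>2)
     \<le> ennreal h * (\<integral>\<^sup>+t. ennreal ((norm (g (chart s t)))\<^sup>2) * indicator {0<..<b} t \<partial>lborel)"
proof -
  note [measurable] = H1_borel[OF H]
  let ?N = unit_interval_measure
  define A where "A = {x. \<bar>hor x\<bar> < a \<and> 0 < depth x \<and> depth x < b - h}"
  have "open A"
    unfolding A_def by (intro open_Collect_conj open_Collect_less continuous_intros hor_continuous depth_continuous)
  have chA: "chart s t \<in> A \<longleftrightarrow> \<bar>s\<bar> < a \<and> 0 < t \<and> t < b - h" for s t by (simp add: A_def)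
  define P where "P x \<longleftrightarrow> ennreal ((v (x + - h *\<^sub>R n) - v x)\<^sup>2)
     \<le> ennreal ((norm (- h *\<^sub>R n))\<^sup>2) * (\<integral>\<^sup>+r. ennreal ((norm (g (x + r *\<^sub>R (- h *\<^sub>R n))))\<^sup>2) \<partial>?N)" for x
  have rm [measurable]: "(\<lambda>r. r) \<in> borel_measurable ?N" by (intro measurable_restrict_space1) simp
  interpret N: finite_measure ?N by (rule finite_unit_interval)
  have Pm [measurable]: "Measurable.pred borel P" unfolding P_def by measurable
  have AEx: "AE x in lborel. x \<in> A --> P x"
    unfolding P_def
  proof (rule translation_estimate_pointwise[OF H G(1) \<open>open A\<close>])
    fix x r :: real and y :: "real^2" assume y: "y \<in> A" and r: "r \<in> {0..1}"
    have "y + r *\<^sub>R (- h *\<^sub>R n) = chart (hor y) (depth y) - (r * h) *\<^sub>R n" by simp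
    also have "... = chart (hor y) (depth y + r * h)" by (rule chart_shift)
    also have "... \<in> G"
    proof (rule inside)
      have "r * h \<le> h" using r h by (simp add: mult_left_le_one_le)
      then show "depth y + r * h < b" using y by (simp add: A_def)
      show "0 < depth y + r * h" using y r h by (simp add: A_def add_pos_nonneg)
    qed (use y in \<open>simp add: A_def\<close>)
    finally show "y + r *\<^sub>R (- h *\<^sub>R n) \<in> G" .
  qed
  have [measurable]: "A \<in> sets borel" using \<open>open A\<close> by simp
  have "emeasure lborel {x. x \<in> A \<and> \<not> P x} = 0"
  proof -
    have "AE x in lborel. x \<notin> {x. x \<in> A \<and> \<not> P x}" using AEx by eventually_elim auto
    then show ?thesis by (subst (asm) AE_iff_null_sets[symmetric]) auto
  qed
  then have "(\<integral>\<^sup>+x. indicator {x. x \<in> A \<and> \<not> P x} x \<partial>lborel) = 0" by (subst nn_integral_indicator) auto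
  then have "(\<integral>\<^sup>+s. \<integral>\<^sup>+t. indicator {x. x \<in> A \<and> \<not> P x} (chart s t) \<partial>lborel \<partial>lborel) = 0"
    by (subst nn_integral_chart[symmetric]) auto
  then have "AE s in lborel. (\<integral>\<^sup>+t. indicator {x. x \<in> A \<and> \<not> P x} (chart s t) \<partial>lborel) = (0::ennreal)"
    by (subst (asm) nn_integral_0_iff_AE) auto
  then show ?thesis
  proof eventually_elim
    case (elim s)
    then have AEt: "AE t in lborel. chart s t \<in> A --> P (chart s t)"
      by (subst (asm) nn_integral_0_iff_AE) (auto simp: indicator_def split: if_splits elim!: eventually_mono)
    show ?case
    proof
      assume s: "\<bar>s\<bar> < a"
      let ?I = "\<integral>\<^sup>+t. ennreal ((norm (g (chart s t)))\<^sup>2) * indicator {0<..<b} t \<partial>lborel"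
      show "ennreal ((\<phi> (chart s h) - \<phi> (chart s 0))\<^sup>2) \<le> ennreal h * ?I"
      proof (cases "?I = \<infinity>")
        case True
        then show ?thesis using h(1) by (simp add: ennreal_mult_top)
      next
        case False
        then obtain J where J: "?I = ennreal J" "J \<ge> 0" by (cases ?I) auto
        have Pimp: "(v (chart s (t + h)) - v (chart s t))\<^sup>2 \<le> h * J" if t: "0 < t" "t < b - h" and P: "P (chart s t)" for t
        proof -
          have sh: "chart s t + r *\<^sub>R (- h *\<^sub>R n) = chart s (t + r * h)" for r
            using chart_shift[of s t "r * h"] by simp
          have "(\<integral>\<^sup>+r. ennreal ((norm (g (chart s t + r *\<^sub>R (- h *\<^sub>R n))))\<^sup>2) \<partial>?N)
              = (\<integral>\<^sup>+r. ennreal ((norm (g (chart s (t + h * r))))\<^sup>2) * indicator {0..1} r \<partial>lborel)"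
            unfolding sh by (subst nn_integral_restrict_space) (auto simp: mult.commute[of h])
          also have "... = (\<integral>\<^sup>+r. ennreal ((norm (g (chart s (t + h * r))))\<^sup>2) * indicator {t..t + h} (t + h * r) \<partial>lborel)"
            using h(1) by (intro nn_integral_cong) (auto simp: indicator_def zero_le_mult_iff)
          finally have "ennreal h * (\<integral>\<^sup>+r. ennreal ((norm (g (chart s t + r *\<^sub>R (- h *\<^sub>R n))))\<^sup>2) \<partial>?N)
              = (\<integral>\<^sup>+y. ennreal ((norm (g (chart s y)))\<^sup>2) * indicator {t..t + h} y \<partial>lborel)"
            using h(1) nn_integral_real_affine[of "\<lambda>y. ennreal ((norm (g (chart s y)))\<^sup>2) * indicator {t..t + h} y" h t] by simp
          also have "... \<le> ?I" using t by (intro nn_integral_mono mult_left_mono) (auto simp: indicator_def)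
          finally have le: "ennreal h * (\<integral>\<^sup>+r. ennreal ((norm (g (chart s t + r *\<^sub>R (- h *\<^sub>R n))))\<^sup>2) \<partial>?N) \<le> ennreal J"
            by (simp add: J)
          have "(norm (- h *\<^sub>R n))\<^sup>2 = h * h" using n1 h(1) by (simp add: power2_eq_square)
          then have "ennreal ((v (chart s (t + h)) - v (chart s t))\<^sup>2)
             \<le> ennreal (h * h) * (\<integral>\<^sup>+r. ennreal ((norm (g (chart s t + r *\<^sub>R (- h *\<^sub>R n))))\<^sup>2) \<partial>?N)"
            using P sh[of 1] unfolding P_def by simp
          also have "... = ennreal h * (ennreal h * (\<integral>\<^sup>+r. ennreal ((norm (g (chart s t + r *\<^sub>R (- h *\<^sub>R n))))\<^sup>2) \<partial>?N))"
            using h(1) by (simp add: ennreal_mult mult.assoc)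
          also have "... \<le> ennreal h * ennreal J" by (intro mult_left_mono le) simp
          also have "... = ennreal (h * J)" using h(1) J by (simp add: ennreal_mult)
          finally show ?thesis using h(1) J(2) by simp
        qed
        (* almost every depth is good, hence there are good depths that tend to 0 *)
        have good: "\<exists>t. 0 < t \<and> t < \<epsilon> \<and> t < b - h \<and> P (chart s t)" if "\<epsilon> > 0" for \<epsilon>
        proof (rule ccontr)
          assume no: "\<not> (\<exists>t. 0 < t \<and> t < \<epsilon> \<and> t < b - h \<and> P (chart s t))"
          define m where "m = min \<epsilon> (b - h)"
          have "m > 0" using that h by (simp add: m_def)
          have "AE t in lborel. t \<notin> {0<..<m}" using AEt by eventually_elim (use no s in \<open>auto simp: chA m_def\<close>)
          then have "emeasure lborel {0<..<m} = 0" by (subst (asm) AE_iff_null_sets[symmetric]) auto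
          then show False using \<open>m > 0\<close> by simp
        qed
        define t where "t k = (SOME t. 0 < t \<and> t < 1 / real (Suc k) \<and> t < b - h \<and> P (chart s t))" for k
        have t: "0 < t k" "t k < 1 / real (Suc k)" "t k < b - h" "P (chart s (t k))" for k
          using someI_ex[OF good[of "1 / real (Suc k)"]] unfolding t_def[symmetric] by auto
        have t0: "t \<longlonglongrightarrow> 0"
          using t(1,2) by (intro tendsto_sandwich[OF _ _ tendsto_const LIMSEQ_inverse_real_of_nat])
            (auto intro!: always_eventually less_imp_le simp: inverse_eq_divide)
        have mem: "chart s y \<in> G \<union> S" if "0 \<le> y" "y < b" for y
          using inside[OF s, of y] S[OF s] that by (cases "y = 0") auto
        have cc: "continuous_on {0..<b} (\<lambda>y. \<phi> (chart s y))"
        proof (rule continuous_on_compose2[OF cont])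
          show "continuous_on {0..<b} (chart s)" unfolding chart_def[abs_def] by (intro continuous_intros)
          show "chart s ` {0..<b} \<subseteq> G \<union> S" by (intro image_subsetI mem) auto
        qed
        have l1: "(\<lambda>k. \<phi> (chart s (t k))) \<longlonglongrightarrow> \<phi> (chart s 0)"
        proof (rule continuous_on_tendsto_compose[OF cc t0])
          have "t k \<in> {0..<b}" for k using t(1,3)[of k] h by simp
          then show "\<forall>\<^sub>F k in sequentially. t k \<in> {0..<b}" by simp
        qed (use h in auto)
        have l2: "(\<lambda>k. \<phi> (chart s (t k + h))) \<longlonglongrightarrow> \<phi> (chart s (0 + h))"
        proof (rule continuous_on_tendsto_compose[OF cc tendsto_add[OF t0 tendsto_const]])
          have "t k + h \<in> {0..<b}" for k using t(1,3)[of k] h by simp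
          then show "\<forall>\<^sub>F k in sequentially. t k + h \<in> {0..<b}" by simp
        qed (use h in auto)
        have lim: "(\<lambda>k. (\<phi> (chart s (t k + h)) - \<phi> (chart s (t k)))\<^sup>2) \<longlonglongrightarrow> (\<phi> (chart s h) - \<phi> (chart s 0))\<^sup>2"
          using l1 l2 by (auto intro!: tendsto_intros)
        have "(\<phi> (chart s (t k + h)) - \<phi> (chart s (t k)))\<^sup>2 \<le> h * J" for k
        proof -
          have "chart s (t k + h) \<in> G" "chart s (t k) \<in> G" using t(1,3)[of k] h by (auto intro!: inside[OF s])
          then show ?thesis using Pimp[OF t(1,3,4)] eq by simp
        qed
        then have "(\<phi> (chart s h) - \<phi> (chart s 0))\<^sup>2 \<le> h * J" by (intro LIMSEQ_le_const2[OF lim]) auto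
        then show ?thesis unfolding J(1) using h(1) J(2) by (simp add: ennreal_leI flip: ennreal_mult)
      qed
    qed
  qed
qed

context
  fixes G S :: "(real^2) set" and a b :: real and v :: "real^2 => real" and g :: "real^2 => real^2" and \<phi> :: "real^2 => real"
  assumes H: "H1 G v g" and G: "bounded G" "open G"
    and inside: "\<And>s t. \<bar>s\<bar> < a ==> 0 < t ==> t < b ==> chart s t \<in> G"
    and cont: "continuous_on (G \<union> S) \<phi>" and S: "\<And>s. \<bar>s\<bar> < a ==> chart s 0 \<in> S" and Sb: "S \<in> sets borel"
    and eq: "\<And>x. x \<in> G ==> \<phi> x = v x" and b: "b > 0"
begin

abbreviation "I \<equiv> {-a<..<a}"
abbreviation "\<Phi> \<equiv> (\<lambda>x. indicator (G \<union> S) x * \<phi> x)"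
abbreviation "slice h \<equiv> (\<integral>\<^sup>+s. ennreal ((\<Phi> (chart s h))\<^sup>2) * indicator I s \<partial>lborel)"

lemma graph_mem: "- a < s ==> s < a ==> chart s 0 \<in> S" using S[of s] by (simp add: abs_less_iff)

lemma \<Phi>_borel: "\<Phi> \<in> borel_measurable borel"
proof -
  have "(\<lambda>x. indicator (G \<union> S) x *\<^sub>R \<phi> x) \<in> borel_measurable borel"
    using cont Sb G(2) by (intro borel_measurable_continuous_on_indicator) auto
  then show ?thesis by simp
qed

lemma slice_difference:
  assumes h: "0 < h" "h < b"
  shows "(\<integral>\<^sup>+s. ennreal ((\<Phi> (chart s h) - \<Phi> (chart s 0))\<^sup>2) * indicator I s \<partial>lborel) \<le> ennreal (h * sqn g)"
proof -
  note [measurable] = \<Phi>_borel H1_borel[OF H]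
  let ?J = "\<lambda>s. \<integral>\<^sup>+t. ennreal ((norm (g (chart s t)))\<^sup>2) * indicator {0<..<b} t \<partial>lborel"
  have dd: "AE s in lborel. \<bar>s\<bar> < a --> ennreal ((\<phi> (chart s h) - \<phi> (chart s 0))\<^sup>2) \<le> ennreal h * ?J s"
    by (rule depth_difference[OF H G inside cont S eq h])
  have "(\<integral>\<^sup>+s. ennreal ((\<Phi> (chart s h) - \<Phi> (chart s 0))\<^sup>2) * indicator I s \<partial>lborel)
     \<le> (\<integral>\<^sup>+s. ennreal h * ?J s \<partial>lborel)"
  proof (rule nn_integral_mono_AE)
    show "AE s in lborel. ennreal ((\<Phi> (chart s h) - \<Phi> (chart s 0))\<^sup>2) * indicator I s \<le> ennreal h * ?J s"
      using dd
    proof eventually_elim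
      case (elim s)
      show ?case
      proof (cases "s \<in> I")
        case True
        then have s: "\<bar>s\<bar> < a" by auto
        then have "chart s h \<in> G" "chart s 0 \<in> S" using inside[OF s h] S[OF s] by auto
        then show ?thesis using elim s True by simp
      qed simp
    qed
  qed
  also have "... = ennreal h * (\<integral>\<^sup>+s. ?J s \<partial>lborel)" by (rule nn_integral_cmult) measurable
  also have "(\<integral>\<^sup>+s. ?J s \<partial>lborel) \<le> (\<integral>\<^sup>+s. \<integral>\<^sup>+t. ennreal ((norm (g (chart s t)))\<^sup>2) \<partial>lborel \<partial>lborel)"
    by (intro nn_integral_mono) (auto simp: indicator_def)
  also have "... = (\<integral>\<^sup>+x. ennreal ((norm (g x))\<^sup>2) \<partial>lborel)" by (rule nn_integral_chart[symmetric]) measurable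
  also have "... = ennreal (sqn g)" by (rule nsq_nn_integral[OF H1_L2(2)[OF H]])
  finally show ?thesis using h(1) by (simp add: ennreal_mult mult_left_mono)
qed

lemma slice_compare:
  assumes h: "0 < h" "h < b"
  shows "slice h \<le> 2 * slice 0 + ennreal (2 * h * sqn g)" "slice 0 \<le> 2 * slice h + ennreal (2 * h * sqn g)"
proof -
  note [measurable] = \<Phi>_borel
  have gen: "(\<integral>\<^sup>+s. ennreal ((f s)\<^sup>2) * indicator I s \<partial>lborel) \<le> 2 * (\<integral>\<^sup>+s. ennreal ((k s)\<^sup>2) * indicator I s \<partial>lborel)
      + ennreal (2 * h * sqn g)"
    if [measurable]: "f \<in> borel_measurable borel" "k \<in> borel_measurable borel"
      and le: "(\<integral>\<^sup>+s. ennreal ((f s - k s)\<^sup>2) * indicator I s \<partial>lborel) \<le> ennreal (h * sqn g)" for f k :: "real => real"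
  proof -
    have "(\<integral>\<^sup>+s. ennreal ((f s)\<^sup>2) * indicator I s \<partial>lborel)
       \<le> (\<integral>\<^sup>+s. 2 * (ennreal ((k s)\<^sup>2) * indicator I s) + 2 * (ennreal ((f s - k s)\<^sup>2) * indicator I s) \<partial>lborel)"
    proof (rule nn_integral_mono)
      fix s
      have "ennreal ((f s)\<^sup>2) \<le> ennreal (2 * (k s)\<^sup>2 + 2 * (f s - k s)\<^sup>2)" by (intro ennreal_leI square_le_double)
      also have "... = 2 * ennreal ((k s)\<^sup>2) + 2 * ennreal ((f s - k s)\<^sup>2)" by (simp add: ennreal_mult)
      finally show "ennreal ((f s)\<^sup>2) * indicator I s
          \<le> 2 * (ennreal ((k s)\<^sup>2) * indicator I s) + 2 * (ennreal ((f s - k s)\<^sup>2) * indicator I s)"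
        by (simp add: indicator_def)
    qed
    also have "... = 2 * (\<integral>\<^sup>+s. ennreal ((k s)\<^sup>2) * indicator I s \<partial>lborel)
        + 2 * (\<integral>\<^sup>+s. ennreal ((f s - k s)\<^sup>2) * indicator I s \<partial>lborel)"
      by (subst nn_integral_add) (auto simp: nn_integral_cmult)
    also have "... \<le> 2 * (\<integral>\<^sup>+s. ennreal ((k s)\<^sup>2) * indicator I s \<partial>lborel) + 2 * ennreal (h * sqn g)"
      by (intro add_left_mono mult_left_mono le) simp
    also have "2 * ennreal (h * sqn g) = ennreal (2 * h * sqn g)"
      using h(1) by (simp add: ennreal_mult mult.assoc)
    finally show ?thesis .
  qed
  show "slice h \<le> 2 * slice 0 + ennreal (2 * h * sqn g)" by (rule gen) (use slice_difference[OF h] in auto)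
  show "slice 0 \<le> 2 * slice h + ennreal (2 * h * sqn g)"
    by (rule gen) (use slice_difference[OF h] in \<open>auto simp: power2_commute[of "\<Phi> (chart _ 0)"]\<close>)
qed

lemma slices_integral:
  "(\<integral>\<^sup>+h. slice h * indicator {0<..<b} h \<partial>lborel)
     = (\<integral>\<^sup>+x. ennreal ((v x)\<^sup>2) * indicator {x. hor x \<in> I \<and> depth x \<in> {0<..<b}} x \<partial>lborel)"
proof -
  note [measurable] = \<Phi>_borel H1_borel[OF H]
  have "(\<integral>\<^sup>+h. slice h * indicator {0<..<b} h \<partial>lborel)
     = (\<integral>\<^sup>+h. \<integral>\<^sup>+s. ennreal ((\<Phi> (chart s h))\<^sup>2) * indicator I s * indicator {0<..<b} h \<partial>lborel \<partial>lborel)"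
    by (intro nn_integral_cong nn_integral_multc[symmetric]) measurable
  also have "... = (\<integral>\<^sup>+s. \<integral>\<^sup>+h. ennreal ((\<Phi> (chart s h))\<^sup>2) * indicator I s * indicator {0<..<b} h \<partial>lborel \<partial>lborel)"
    by (rule lborel_pair.Fubini') measurable
  also have "... = (\<integral>\<^sup>+s. \<integral>\<^sup>+h. ennreal ((v (chart s h))\<^sup>2)
      * indicator {x. hor x \<in> I \<and> depth x \<in> {0<..<b}} (chart s h) \<partial>lborel \<partial>lborel)"
  proof (intro nn_integral_cong)
    fix s h
    show "ennreal ((\<Phi> (chart s h))\<^sup>2) * indicator I s * indicator {0<..<b} h
        = ennreal ((v (chart s h))\<^sup>2) * indicator {x. hor x \<in> I \<and> depth x \<in> {0<..<b}} (chart s h)"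
      using inside[of s h] eq[of "chart s h"] by (auto simp: indicator_def abs_less_iff minus_less_iff)
  qed
  also have "... = (\<integral>\<^sup>+x. ennreal ((v x)\<^sup>2) * indicator {x. hor x \<in> I \<and> depth x \<in> {0<..<b}} x \<partial>lborel)"
    by (rule nn_integral_chart[symmetric]) measurable
  finally show ?thesis .
qed

text \<open>
  The comparison of slices is averaged over all depths between 0 and b, which turns the slices into an area integral.
\<close>

lemma trace_upper:
  "(\<integral>\<^sup>+x. ennreal ((\<phi> x)\<^sup>2) * indicator ((\<lambda>s. chart s 0) ` I) x \<partial>hausdorff1)
    \<le> ennreal ((1 + L) * (2 / b * sqn v + 2 * b * sqn g))"
proof -
  note [measurable] = \<Phi>_borel H1_borel[OF H]
  have L1: "1 + L > 0" using L_nonneg by simp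
  have "(\<integral>\<^sup>+x. ennreal ((\<phi> x)\<^sup>2) * indicator ((\<lambda>s. chart s 0) ` I) x \<partial>hausdorff1)
     = (\<integral>\<^sup>+x. ennreal ((\<Phi> x)\<^sup>2) * indicator ((\<lambda>s. chart s 0) ` I) x \<partial>hausdorff1)"
    by (intro nn_integral_cong) (auto simp: indicator_def graph_mem)
  also have "... \<le> ennreal (1 + L) * slice 0" by (rule graph_nn_integral_upper[where a=a]) auto
  also have "slice 0 \<le> ennreal (2 / b * sqn v + 2 * b * sqn g)"
  proof -
    have "slice 0 * ennreal b = (\<integral>\<^sup>+h. slice 0 * indicator {0<..<b} h \<partial>lborel)"
      using b by (simp add: nn_integral_cmult)
    also have "... \<le> (\<integral>\<^sup>+h. 2 * (slice h * indicator {0<..<b} h) + ennreal (2 * b * sqn g) * indicator {0<..<b} h \<partial>lborel)"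
    proof (rule nn_integral_mono)
      fix h
      show "slice 0 * indicator {0<..<b} h \<le> 2 * (slice h * indicator {0<..<b} h) + ennreal (2 * b * sqn g) * indicator {0<..<b} h"
      proof (cases "h \<in> {0<..<b}")
        case True
        have "slice 0 \<le> 2 * slice h + ennreal (2 * h * sqn g)" using True by (intro slice_compare) auto
        also have "... \<le> 2 * slice h + ennreal (2 * b * sqn g)"
          using True by (intro add_left_mono ennreal_leI mult_right_mono) auto
        finally show ?thesis using True by simp
      qed simp
    qed
    also have "... = 2 * (\<integral>\<^sup>+h. slice h * indicator {0<..<b} h \<partial>lborel) + ennreal (2 * b * sqn g) * ennreal b"
      using b by (subst nn_integral_add) (auto simp: nn_integral_cmult)
    also have "(\<integral>\<^sup>+h. slice h * indicator {0<..<b} h \<partial>lborel) \<le> ennreal (sqn v)"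
      unfolding slices_integral nsq_nn_integral[OF H1_L2(1)[OF H], symmetric]
      by (intro nn_integral_mono) (auto simp: indicator_def)
    finally have "slice 0 * ennreal b \<le> 2 * ennreal (sqn v) + ennreal (2 * b * sqn g) * ennreal b"
      by (simp add: mult_left_mono add_right_mono)
    also have "... = ennreal ((2 / b * sqn v + 2 * b * sqn g) * b)"
      using b by (simp add: distrib_right ennreal_mult)
    finally have *: "slice 0 * ennreal b \<le> ennreal (2 / b * sqn v + 2 * b * sqn g) * ennreal b"
      using b by (simp add: ennreal_mult)
    then show ?thesis using b by (simp add: ennreal_mult_le_mult_iff mult.commute[of _ "ennreal b"])
  qed
  finally show ?thesis using L1 b by (simp add: ennreal_mult mult_left_mono)
qed

lemma trace_lower:
  "(\<integral>\<^sup>+x. ennreal ((v x)\<^sup>2) * indicator {x. hor x \<in> I \<and> depth x \<in> {0<..<b}} x \<partial>lborel)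
    \<le> ennreal (2 * b) * (\<integral>\<^sup>+x. ennreal ((\<phi> x)\<^sup>2) * indicator S x \<partial>hausdorff1) + ennreal (2 * b * b * sqn g)"
proof -
  note [measurable] = \<Phi>_borel H1_borel[OF H]
  have "slice 0 \<le> (\<integral>\<^sup>+x. ennreal ((\<Phi> x)\<^sup>2) * indicator ((\<lambda>s. chart s 0) ` I) x \<partial>hausdorff1)"
    by (rule graph_nn_integral_lower[where a=a]) auto
  also have "... \<le> (\<integral>\<^sup>+x. ennreal ((\<phi> x)\<^sup>2) * indicator S x \<partial>hausdorff1)"
    by (intro nn_integral_mono) (auto simp: indicator_def graph_mem)
  finally have s0: "slice 0 \<le> (\<integral>\<^sup>+x. ennreal ((\<phi> x)\<^sup>2) * indicator S x \<partial>hausdorff1)" .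
  have "(\<integral>\<^sup>+h. slice h * indicator {0<..<b} h \<partial>lborel)
     \<le> (\<integral>\<^sup>+h. (2 * slice 0 + ennreal (2 * b * sqn g)) * indicator {0<..<b} h \<partial>lborel)"
  proof (rule nn_integral_mono)
    fix h
    show "slice h * indicator {0<..<b} h \<le> (2 * slice 0 + ennreal (2 * b * sqn g)) * indicator {0<..<b} h"
    proof (cases "h \<in> {0<..<b}")
      case True
      have "slice h \<le> 2 * slice 0 + ennreal (2 * h * sqn g)" using True by (intro slice_compare) auto
      also have "... \<le> 2 * slice 0 + ennreal (2 * b * sqn g)"
        using True by (intro add_left_mono ennreal_leI mult_right_mono) auto
      finally show ?thesis using True by simp
    qed simp
  qed
  also have "... = (2 * slice 0 + ennreal (2 * b * sqn g)) * ennreal b" using b by (simp add: nn_integral_cmult)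
  also have "... = ennreal (2 * b) * slice 0 + ennreal (2 * b * b * sqn g)"
    using b by (simp add: distrib_right distrib_left ennreal_mult ac_simps)
  also have "... \<le> ennreal (2 * b) * (\<integral>\<^sup>+x. ennreal ((\<phi> x)\<^sup>2) * indicator S x \<partial>hausdorff1) + ennreal (2 * b * b * sqn g)"
    by (intro add_right_mono mult_left_mono s0) simp
  finally show ?thesis unfolding slices_integral .
qed

end

end

section \<open>The geometry of the domain\<close>

lemma H1_cong:
  assumes "H1 U v g" "w \<in> borel_measurable borel" "\<And>x. x \<notin> U ==> w x = 0" "AE x in lborel. w x = v x"
  shows "H1 U w g"
proof -
  note [measurable] = assms(2) H1_borel[OF assms(1)]
  have "integrable lborel (\<lambda>x. (norm (w x))\<^sup>2)"
    by (rule integrable_cong_AE_imp[OF L2_integrable_sq[OF H1_L2(1)[OF assms(1)]]])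
      (use assms(4) in \<open>auto elim: eventually_mono\<close>)
  then have L: "L2 lborel w" using assms(2) by (simp add: L2_def)
  have "(\<integral>x. w x *\<^sub>R gradient \<phi> x \<partial>lborel) = - (\<integral>x. \<phi> x *\<^sub>R g x \<partial>lborel)" if "\<phi> \<in> test_functions U" for \<phi>
  proof -
    note [measurable] = test_borel[OF that]
    have "(\<integral>x. w x *\<^sub>R gradient \<phi> x \<partial>lborel) = (\<integral>x. v x *\<^sub>R gradient \<phi> x \<partial>lborel)"
      by (rule integral_cong_AE) (use assms(4) in \<open>auto elim: eventually_mono\<close>)
    then show ?thesis using H1_weak[OF assms(1) that] by simp
  qed
  then show ?thesis using L assms H1_L2(2)[OF assms(1)] H1_outside(2)[OF assms(1)] by (simp add: H1_def)
qed

lemma continuous_representative: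
  assumes r: "represents U u v g" and U: "open U" and c: "continuous_on U u"
  shows "H1 U (\<lambda>x. indicator U x * u x) g" "AE x in lborel. indicator U x * u x = v x"
proof -
  have m: "(\<lambda>x. indicator U x * u x) \<in> borel_measurable borel"
    using borel_measurable_continuous_on_indicator[OF _ c] U by simp
  have H: "H1 U v g" using r by (simp add: represents_def)
  have "AE x in lborel. x \<in> U --> u x = v x" using r AE_lebesgue_on[OF U] by (simp add: represents_def)
  then show ae: "AE x in lborel. indicator U x * u x = v x"
    by eventually_elim (use H1_outside(1)[OF H] in \<open>auto simp: indicator_def\<close>)
  show "H1 U (\<lambda>x. indicator U x * u x) g" by (rule H1_cong[OF H m _ ae]) simp
qed

lemma finite_cover_property:
  assumes X: "compact X" and empty: "P {}"
    and Un: "\<And>A B. open A ==> open B ==> P A ==> P B ==> P (A \<union> B)"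
    and local: "\<And>x. x \<in> X ==> \<exists>V. open V \<and> x \<in> V \<and> P V"
  shows "\<exists>V. open V \<and> X \<subseteq> V \<and> P V"
proof -
  obtain V where V: "\<And>x. x \<in> X ==> open (V x) \<and> x \<in> V x \<and> P (V x)" using local by metis
  obtain F where F: "F \<subseteq> X" "finite F" "X \<subseteq> (\<Union>x\<in>F. V x)"
    by (rule compactE_image[OF X, of X V]) (use V in blast)+
  have "P (\<Union>x\<in>F. V x)" using F(2,1)
  proof (induction F)
    case (insert x F)
    moreover have "open (\<Union>x\<in>F. V x)" "open (V x)" using V insert.prems by auto
    ultimately show ?case using V by (simp add: Un)
  qed (simp add: empty)
  moreover have "open (\<Union>x\<in>F. V x)" using V F(1) by auto
  ultimately show ?thesis using F(3) by blast
qed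

lemma closure_UN_finite: "finite I ==> closure (\<Union>i\<in>I. A i) = (\<Union>i\<in>I. closure (A i))"
  by (induction I rule: finite_induct) auto

locale image_domain =
  fixes \<Omega> K G :: "(real^2) set" and C :: "nat => (real^2) set" and N :: nat
  assumes \<Omega>_bounded: "bounded \<Omega>" and \<Omega>_lipschitz: "lipschitz_domain \<Omega>" and N: "N \<ge> 1"
    and C_lipschitz: "\<And>i. i \<in> {1..N} ==> lipschitz_domain (C i)"
    and C_separated: "\<And>i j. i \<in> {1..N} ==> j \<in> {1..N} ==> i \<noteq> j ==> setdist (C i) (C j) > 0"
    and K_def: "K = closure (\<Union>i\<in>{1..N}. C i)" and G_def: "G = \<Omega> - K"
    and K_compact: "compact K" and K_sub: "K \<subseteq> \<Omega>"
begin

abbreviation "S \<equiv> frontier K"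

lemma \<Omega>_open: "open \<Omega>" and \<Omega>_connected: "connected \<Omega>" using \<Omega>_lipschitz by (auto simp: lipschitz_domain_def)

lemma K_closed: "closed K" using K_compact by (rule compact_imp_closed)

lemma G_open: "open G" unfolding G_def using \<Omega>_open K_closed by (rule open_Diff)

lemma G_bounded: "bounded G" using \<Omega>_bounded by (rule bounded_subset) (auto simp: G_def)

lemma S_closed: "closed S" by simp

lemma S_sub_K: "S \<subseteq> K" using K_closed by (rule frontier_subset_closed)

lemma S_compact: "compact S" using compact_Int_closed[OF K_compact S_closed] S_sub_K by (simp add: Int_absorb1)

lemma S_borel: "S \<in> sets borel" using S_closed by (rule borel_closed)

lemma G_borel [measurable]: "G \<in> sets borel" using G_open by simp

lemma closure_G_in_\<Omega>: "x \<in> closure G ==> x \<in> \<Omega> ==> x \<in> G \<or> x \<in> S"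
proof -
  assume x: "x \<in> closure G" "x \<in> \<Omega>"
  have "G \<inter> interior K = {}" using interior_subset[of K] by (auto simp: G_def)
  then have "closure G \<inter> interior K = {}" using open_Int_closure_eq_empty[of "interior K" G] by auto
  then show ?thesis using x K_closed by (auto simp: G_def frontier_def)
qed

lemma K_nonempty: "K \<noteq> {}"
proof -
  have "C 1 \<noteq> {}" using C_lipschitz[of 1] N by (simp add: lipschitz_domain_def)
  then show ?thesis using N closure_subset unfolding K_def by fastforce
qed

lemma K_eq: "K = (\<Union>i\<in>{1..N}. closure (C i))" unfolding K_def by (rule closure_UN_finite) simp

text \<open>
  Near a point of the boundary of K, only one of the sets whose closures make up K is present, and its complement is
  the set of points of positive depth in the chart.
\<close>

lemma boundary_chart:
  assumes x0: "x0 \<in> S"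
  obtains r e n L \<gamma> where "r > 0" "graph_chart e n L \<gamma>" "\<gamma> 0 = 0" "ball x0 r \<subseteq> \<Omega>"
    "\<And>y. y \<in> ball x0 r ==> y \<in> G \<longleftrightarrow> graph_chart.depth x0 e n \<gamma> y > 0"
    "\<And>y. y \<in> ball x0 r ==> y \<in> S \<longleftrightarrow> graph_chart.depth x0 e n \<gamma> y = 0"
proof -
  have x0K: "x0 \<in> K" "x0 \<notin> interior K" using x0 S_sub_K by (auto simp: frontier_def)
  then obtain i where i: "i \<in> {1..N}" "x0 \<in> closure (C i)" by (auto simp: K_eq)
  have Co: "open (C i)" using C_lipschitz[OF i(1)] by (simp add: lipschitz_domain_def)
  have "C i \<subseteq> K" using i(1) closure_subset by (force simp: K_eq)
  then have CK: "C i \<subseteq> interior K" using Co by (rule interior_maximal)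
  then have "x0 \<in> frontier (C i)" using i(2) x0K Co by (auto simp: frontier_def interior_open)
  with C_lipschitz[OF i(1)] obtain r0 e n L \<gamma> where c: "r0 > 0" "norm e = 1" "norm n = 1" "e \<bullet> n = 0"
    "L-lipschitz_on UNIV \<gamma>" "\<gamma> 0 = 0"
    "\<And>y. y \<in> ball x0 r0 ==> y \<in> C i \<longleftrightarrow> \<gamma> ((y - x0) \<bullet> e) < (y - x0) \<bullet> n" by (rule lipschitz_domain_chart) blast
  interpret graph_chart x0 e n L \<gamma> by unfold_locales (use c in auto)
  have C_depth: "y \<in> C i \<longleftrightarrow> depth y < 0" if "y \<in> ball x0 r0" for y
    using c(7)[OF that] by (simp add: depth_def hor_def)
  define R where "R = (\<Union>j\<in>{1..N} - {i}. closure (C j))"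
  have "closed R" unfolding R_def by (intro closed_UN) auto
  have "x0 \<notin> R"
  proof
    assume "x0 \<in> R"
    then obtain j where j: "j \<in> {1..N}" "j \<noteq> i" "x0 \<in> closure (C j)" unfolding R_def by blast
    have "setdist (closure (C i)) (closure (C j)) = 0" using i(2) j(3) by (rule setdist_eq_0I)
    then show False using C_separated[OF i(1) j(1)] j(2) by simp
  qed
  have "open (\<Omega> - R)" using \<Omega>_open \<open>closed R\<close> by (rule open_Diff)
  moreover have "x0 \<in> \<Omega> - R" using x0K K_sub \<open>x0 \<notin> R\<close> by blast
  ultimately obtain r1 where r1: "r1 > 0" "ball x0 r1 \<subseteq> \<Omega> - R" using openE by blast
  define r where "r = min r0 r1"
  have r: "r > 0" "ball x0 r \<subseteq> ball x0 r0" "ball x0 r \<subseteq> \<Omega> - R" using c(1) r1 by (auto simp: r_def)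
  have KC: "y \<in> K \<longleftrightarrow> y \<in> closure (C i)" if "y \<in> ball x0 r" for y using that r(3) i(1) by (auto simp: K_eq R_def)
  have move: "\<exists>d>0. \<forall>t. \<bar>t\<bar> < d --> y - t *\<^sub>R n \<in> ball x0 r \<inter> ball y \<epsilon>" if "y \<in> ball x0 r" "\<epsilon> > 0" for y \<epsilon>
  proof -
    define d where "d = min \<epsilon> (r - dist x0 y)"
    have "d > 0" using that by (simp add: d_def)
    moreover have "y - t *\<^sub>R n \<in> ball x0 r \<inter> ball y \<epsilon>" if "\<bar>t\<bar> < d" for t
    proof -
      have "dist y (y - t *\<^sub>R n) = \<bar>t\<bar>" using n1 by (simp add: dist_norm)
      then show ?thesis using that dist_triangle[of x0 "y - t *\<^sub>R n" y] by (simp add: d_def n1)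
    qed
    ultimately show ?thesis by blast
  qed
  have depth_move: "depth (y - t *\<^sub>R n) = depth y + t" for y t using chart_shift[of "hor y" "depth y" t] by simp
  have K_depth: "y \<in> K \<longleftrightarrow> depth y \<le> 0" if y: "y \<in> ball x0 r" for y
  proof
    assume "y \<in> K"
    then have "y \<in> closure (C i)" using KC[OF y] by simp
    show "depth y \<le> 0"
    proof (rule ccontr)
      assume "\<not> depth y \<le> 0"
      then have "y \<in> ball x0 r \<inter> {z. 0 < depth z}" using y by simp
      moreover have "open (ball x0 r \<inter> {z. 0 < depth z})"
        by (intro open_Int open_ball open_Collect_less continuous_intros depth_continuous)
      moreover have "ball x0 r \<inter> {z. 0 < depth z} \<inter> C i = {}" using C_depth r(2) by force
      ultimately show False using \<open>y \<in> closure (C i)\<close> open_Int_closure_eq_empty by blast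
    qed
  next
    assume le: "depth y \<le> 0"
    have "\<exists>z\<in>C i. dist z y < \<epsilon>" if "\<epsilon> > 0" for \<epsilon>
    proof -
      obtain d where d: "d > 0" "\<And>t. \<bar>t\<bar> < d ==> y - t *\<^sub>R n \<in> ball x0 r \<inter> ball y \<epsilon>" using move[OF y \<open>\<epsilon> > 0\<close>] by blast
      let ?z = "y - (- d / 2) *\<^sub>R n"
      have z: "?z \<in> ball x0 r \<inter> ball y \<epsilon>" using d(1) by (intro d(2)) simp
      have "depth ?z < 0" using le d(1) unfolding depth_move by simp
      then have "?z \<in> C i" using C_depth z r(2) by blast
      then show ?thesis using z by (intro bexI[of _ ?z]) (auto simp: dist_commute)
    qed
    then have "y \<in> closure (C i)" by (simp add: closure_approachable)
    then show "y \<in> K" using KC[OF y] by simp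
  qed
  have S_depth: "y \<in> S \<longleftrightarrow> depth y = 0" if y: "y \<in> ball x0 r" for y
  proof
    assume "y \<in> S"
    then have "y \<in> K" "y \<notin> interior K" using S_sub_K by (auto simp: frontier_def)
    then have "depth y \<le> 0" "y \<notin> C i" using K_depth[OF y] CK by auto
    then show "depth y = 0" using C_depth y r(2) by force
  next
    assume eq: "depth y = 0"
    have "y \<notin> interior K"
    proof
      assume "y \<in> interior K"
      then obtain \<epsilon> where \<epsilon>: "\<epsilon> > 0" "ball y \<epsilon> \<subseteq> K" by (auto simp: mem_interior)
      obtain d where d: "d > 0" "\<And>t. \<bar>t\<bar> < d ==> y - t *\<^sub>R n \<in> ball x0 r \<inter> ball y \<epsilon>" using move[OF y \<epsilon>(1)] by blast
      have z: "y - (d / 2) *\<^sub>R n \<in> ball x0 r \<inter> ball y \<epsilon>" using d(1) by (intro d(2)) simp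
      have "depth (y - (d / 2) *\<^sub>R n) = d / 2" unfolding depth_move using eq by simp
      moreover have "y - (d / 2) *\<^sub>R n \<in> K" using z \<epsilon>(2) by blast
      then have "depth (y - (d / 2) *\<^sub>R n) \<le> 0" using K_depth[of "y - (d / 2) *\<^sub>R n"] z by blast
      ultimately show False using d(1) by simp
    qed
    then show "y \<in> S" using K_depth[OF y] eq closure_subset[of K] by (auto simp: frontier_def)
  qed
  show thesis
  proof (rule that[OF r(1) graph_chart_axioms c(6)])
    show "ball x0 r \<subseteq> \<Omega>" using r(3) by blast
    fix y assume y: "y \<in> ball x0 r"
    show "y \<in> G \<longleftrightarrow> depth y > 0" using K_depth[OF y] r(3) y by (auto simp: G_def)
    show "y \<in> S \<longleftrightarrow> depth y = 0" by (rule S_depth[OF y])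
  qed
qed

lemma boundary_box:
  assumes x0: "x0 \<in> S"
  obtains a b e n L \<gamma> V where "b > 0" "graph_chart e n L \<gamma>" "open V" "x0 \<in> V"
    "\<And>s t. \<bar>s\<bar> < a ==> 0 < t ==> t < b ==> graph_chart.chart x0 e n \<gamma> s t \<in> G"
    "\<And>s. \<bar>s\<bar> < a ==> graph_chart.chart x0 e n \<gamma> s 0 \<in> S"
    "\<And>y. y \<in> V \<inter> G ==> graph_chart.hor x0 e y \<in> {-a<..<a} \<and> graph_chart.depth x0 e n \<gamma> y \<in> {0<..<b}"
    "\<And>y. y \<in> V \<inter> S ==> y \<in> (\<lambda>s. graph_chart.chart x0 e n \<gamma> s 0) ` {-a<..<a}"
proof -
  obtain r e n L \<gamma> where r: "r > 0" and gc: "graph_chart e n L \<gamma>" and \<gamma>0: "\<gamma> 0 = 0"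
    and GS: "\<And>y. y \<in> ball x0 r ==> y \<in> G \<longleftrightarrow> graph_chart.depth x0 e n \<gamma> y > 0"
    "\<And>y. y \<in> ball x0 r ==> y \<in> S \<longleftrightarrow> graph_chart.depth x0 e n \<gamma> y = 0" using boundary_chart[OF x0] by metis
  interpret graph_chart x0 e n L \<gamma> by (rule gc)
  define a where "a = r / (2 + L)"
  have a: "a > 0" "(2 + L) * a = r" using r L_nonneg by (auto simp: a_def)
  have chart_ball: "chart s t \<in> ball x0 r" if "\<bar>s\<bar> < a" "0 \<le> t" "t < a" for s t
  proof -
    have "dist x0 (chart s t) = norm (s *\<^sub>R e + (\<gamma> s - t) *\<^sub>R n)"
      by (simp only: dist_norm norm_minus_commute[of x0]) (simp add: chart_def)
    also have "... \<le> \<bar>s\<bar> + \<bar>\<gamma> s - t\<bar>" using norm_triangle_ineq[of "s *\<^sub>R e" "(\<gamma> s - t) *\<^sub>R n"] e1 n1 by simp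
    also have "... \<le> \<bar>s\<bar> + (L * \<bar>s\<bar> + t)" using \<gamma>_diff[of s 0] \<gamma>0 that(2) by simp
    also have "... < a + (L * a + a)" using that mult_left_mono[OF less_imp_le[OF that(1)] L_nonneg] by simp
    also have "... = r" using a(2) by (simp add: algebra_simps)
    finally show ?thesis by simp
  qed
  define V where "V = ball x0 r \<inter> {y. \<bar>hor y\<bar> < a} \<inter> {y. \<bar>depth y\<bar> < a}"
  have "open V"
    unfolding V_def by (intro open_Int open_ball open_Collect_less continuous_intros hor_continuous depth_continuous)
  have "depth x0 = 0" using GS(2)[of x0] x0 r by simp
  then have "x0 \<in> V" using r a by (simp add: V_def hor_def)
  show thesis
  proof (rule that[OF a(1) gc \<open>open V\<close> \<open>x0 \<in> V\<close>])
    show "chart s t \<in> G" if "\<bar>s\<bar> < a" "0 < t" "t < a" for s t using GS(1)[OF chart_ball, of s t] that by simp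
    show "chart s 0 \<in> S" if "\<bar>s\<bar> < a" for s using GS(2)[OF chart_ball, of s 0] that a by simp
    show "hor y \<in> {-a<..<a} \<and> depth y \<in> {0<..<a}" if "y \<in> V \<inter> G" for y
      using that GS(1)[of y] by (auto simp: V_def abs_less_iff)
    show "y \<in> (\<lambda>s. chart s 0) ` {-a<..<a}" if "y \<in> V \<inter> S" for y
    proof -
      have "depth y = 0" "hor y \<in> {-a<..<a}" using that GS(2)[of y] by (auto simp: V_def abs_less_iff)
      then show ?thesis using chart_hor_depth[of y] by (intro image_eqI[of _ _ "hor y"]) auto
    qed
  qed
qed

text \<open>
  The two directions of the comparison between a function and its boundary values, localised to A. They are stated for
  functions that are continuous up to the boundary, for which boundary values need no limit.
\<close>

definition trace_bounded :: "(real^2) set => real => bool" where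
  "trace_bounded A M \<longleftrightarrow> M \<ge> 0 \<and> (\<forall>\<phi> v g. represents G \<phi> v g --> continuous_on (G \<union> S) \<phi> -->
     (\<integral>\<^sup>+x. ennreal ((\<phi> x)\<^sup>2) * indicator (S \<inter> A) x \<partial>hausdorff1) \<le> ennreal (M * (sqn v + sqn g)))"

definition trace_controls :: "(real^2) set => real => bool" where
  "trace_controls A M \<longleftrightarrow> M \<ge> 0 \<and> (\<forall>\<phi> v g. represents G \<phi> v g --> continuous_on (G \<union> S) \<phi> -->
     (\<integral>\<^sup>+x. ennreal ((v x)\<^sup>2) * indicator (A \<inter> G) x \<partial>lborel)
       \<le> ennreal M * ((\<integral>\<^sup>+x. ennreal ((\<phi> x)\<^sup>2) * indicator S x \<partial>hausdorff1) + ennreal (sqn g)))"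

lemma local_trace_estimates:
  assumes x0: "x0 \<in> S"
  shows "\<exists>V M. open V \<and> x0 \<in> V \<and> trace_bounded V M \<and> trace_controls V M"
proof -
  obtain a b e n L \<gamma> V where b: "b > 0" and gc: "graph_chart e n L \<gamma>" and V: "open V" "x0 \<in> V"
    and ins: "\<And>s t. \<bar>s\<bar> < a ==> 0 < t ==> t < b ==> graph_chart.chart x0 e n \<gamma> s t \<in> G"
    and sS: "\<And>s. \<bar>s\<bar> < a ==> graph_chart.chart x0 e n \<gamma> s 0 \<in> S"
    and VG: "\<And>y. y \<in> V \<inter> G ==> graph_chart.hor x0 e y \<in> {-a<..<a} \<and> graph_chart.depth x0 e n \<gamma> y \<in> {0<..<b}"
    and VS: "\<And>y. y \<in> V \<inter> S ==> y \<in> (\<lambda>s. graph_chart.chart x0 e n \<gamma> s 0) ` {-a<..<a}"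
    by (rule boundary_box[OF x0]) blast
  interpret graph_chart x0 e n L \<gamma> by (rule gc)
  define M1 where "M1 = (1 + L) * (2 / b + 2 * b)"
  define M where "M = max M1 (max (2 * b) (2 * b * b))"
  have M: "M1 \<le> M" "2 * b \<le> M" "2 * b * b \<le> M" "M \<ge> 0" using b by (auto simp: M_def)
  have "(\<integral>\<^sup>+x. ennreal ((\<phi> x)\<^sup>2) * indicator (S \<inter> V) x \<partial>hausdorff1) \<le> ennreal (M * (sqn v + sqn g)) \<and>
      (\<integral>\<^sup>+x. ennreal ((v x)\<^sup>2) * indicator (V \<inter> G) x \<partial>lborel)
        \<le> ennreal M * ((\<integral>\<^sup>+x. ennreal ((\<phi> x)\<^sup>2) * indicator S x \<partial>hausdorff1) + ennreal (sqn g))"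
    if r: "represents G \<phi> v g" and \<phi>: "continuous_on (G \<union> S) \<phi>" for \<phi> v g
  proof
    define w where "w x = indicator G x * \<phi> x" for x
    have H: "H1 G w g" and ae: "AE x in lborel. w x = v x"
      using continuous_representative[OF r G_open continuous_on_subset[OF \<phi>]] by (auto simp: w_def[abs_def])
    have eq: "\<phi> x = w x" if "x \<in> G" for x using that by (simp add: w_def)
    have nw: "sqn w = sqn v"
      by (rule nsq_cong_AE[OF ae]) (use H1_borel(1)[OF H] r H1_borel(1) in \<open>auto simp: represents_def\<close>)
    have "(\<integral>\<^sup>+x. ennreal ((\<phi> x)\<^sup>2) * indicator (S \<inter> V) x \<partial>hausdorff1)
       \<le> (\<integral>\<^sup>+x. ennreal ((\<phi> x)\<^sup>2) * indicator ((\<lambda>s. chart s 0) ` {-a<..<a}) x \<partial>hausdorff1)"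
      using VS by (intro nn_integral_mono mult_left_mono) (auto simp: indicator_def)
    also have "... \<le> ennreal ((1 + L) * (2 / b * sqn w + 2 * b * sqn g))"
      by (rule trace_upper[OF H G_bounded G_open ins \<phi> sS S_borel eq b])
    also have "... \<le> ennreal (M * (sqn v + sqn g))"
    proof (rule ennreal_leI)
      have "2 / b * sqn v + 2 * b * sqn g \<le> (2 / b + 2 * b) * (sqn v + sqn g)"
        using b mult_nonneg_nonneg[of "2 * b" "sqn v"] mult_nonneg_nonneg[of "2 / b" "sqn g"]
        by (simp add: algebra_simps)
      then have "(1 + L) * (2 / b * sqn v + 2 * b * sqn g) \<le> M1 * (sqn v + sqn g)"
        using L_nonneg mult_left_mono[of _ _ "1 + L"] by (simp add: M1_def mult.assoc)
      also have "... \<le> M * (sqn v + sqn g)" using M(1) by (intro mult_right_mono) auto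
      finally show "(1 + L) * (2 / b * sqn w + 2 * b * sqn g) \<le> M * (sqn v + sqn g)"
        unfolding nw .
    qed
    finally show "(\<integral>\<^sup>+x. ennreal ((\<phi> x)\<^sup>2) * indicator (S \<inter> V) x \<partial>hausdorff1) \<le> ennreal (M * (sqn v + sqn g))" .
    let ?T = "\<integral>\<^sup>+x. ennreal ((\<phi> x)\<^sup>2) * indicator S x \<partial>hausdorff1"
    have "(\<integral>\<^sup>+x. ennreal ((v x)\<^sup>2) * indicator (V \<inter> G) x \<partial>lborel)
        = (\<integral>\<^sup>+x. ennreal ((w x)\<^sup>2) * indicator (V \<inter> G) x \<partial>lborel)"
      by (rule nn_integral_cong_AE) (use ae in eventually_elim, simp)
    also have "... \<le> (\<integral>\<^sup>+x. ennreal ((w x)\<^sup>2) * indicator {x. hor x \<in> {-a<..<a} \<and> depth x \<in> {0<..<b}} x \<partial>lborel)"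
      using VG by (intro nn_integral_mono mult_left_mono) (auto simp: indicator_def)
    also have "... \<le> ennreal (2 * b) * ?T + ennreal (2 * b * b * sqn g)"
      by (rule trace_lower[OF H G_bounded G_open ins \<phi> sS S_borel eq b])
    also have "... \<le> ennreal M * ?T + ennreal (M * sqn g)"
      using M by (intro add_mono mult_right_mono ennreal_leI) auto
    also have "... = ennreal M * (?T + ennreal (sqn g))" using M(4) by (simp add: distrib_left ennreal_mult)
    finally show "(\<integral>\<^sup>+x. ennreal ((v x)\<^sup>2) * indicator (V \<inter> G) x \<partial>lborel) \<le> ennreal M * (?T + ennreal (sqn g))" .
  qed
  then have "trace_bounded V M" "trace_controls V M" using M(4) by (auto simp: trace_bounded_def trace_controls_def)
  then show ?thesis using V by blast
qed

lemma trace_bounded_Un: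
  assumes M: "trace_bounded A M" "trace_bounded A' M'" and o: "open A" "open A'"
  shows "trace_bounded (A \<union> A') (M + M')"
  unfolding trace_bounded_def
proof (intro conjI allI impI)
  show "0 \<le> M + M'" using M by (simp add: trace_bounded_def)
  fix \<phi> v g assume a: "represents G \<phi> v g" "continuous_on (G \<union> S) \<phi>"
  let ?f = "\<lambda>y. ennreal ((indicator S y * \<phi> y)\<^sup>2)"
  have "(\<lambda>x. indicator S x * \<phi> x) \<in> borel_measurable borel"
    using borel_measurable_continuous_on_indicator[OF S_borel continuous_on_subset[OF a(2), of S]] by simp
  then have fm: "?f \<in> borel_measurable hausdorff1" by simp
  have eqA: "(\<integral>\<^sup>+x. ennreal ((\<phi> x)\<^sup>2) * indicator (S \<inter> B) x \<partial>hausdorff1) = (\<integral>\<^sup>+x. ?f x * indicator B x \<partial>hausdorff1)" for B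
    by (intro nn_integral_cong) (auto simp: indicator_def)
  have "(\<integral>\<^sup>+y. ennreal ((\<phi> y)\<^sup>2) * indicator (S \<inter> (A \<union> A')) y \<partial>hausdorff1)
    \<le> (\<integral>\<^sup>+y. ?f y * indicator A y + ?f y * indicator A' y \<partial>hausdorff1)"
    unfolding eqA by (intro nn_integral_mono) (auto simp: indicator_def)
  also have "... = (\<integral>\<^sup>+y. ?f y * indicator A y \<partial>hausdorff1) + (\<integral>\<^sup>+y. ?f y * indicator A' y \<partial>hausdorff1)"
    using o by (intro nn_integral_add borel_measurable_times_ennreal fm borel_measurable_indicator) auto
  also have "... \<le> ennreal (M * (sqn v + sqn g)) + ennreal (M' * (sqn v + sqn g))"
    unfolding eqA[symmetric] using M a unfolding trace_bounded_def by (intro add_mono) blast+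
  also have "... = ennreal ((M + M') * (sqn v + sqn g))" using M by (simp add: trace_bounded_def distrib_right)
  finally show "(\<integral>\<^sup>+y. ennreal ((\<phi> y)\<^sup>2) * indicator (S \<inter> (A \<union> A')) y \<partial>hausdorff1)
      \<le> ennreal ((M + M') * (sqn v + sqn g))" .
qed

lemma trace_inequality: "\<exists>V M. S \<subseteq> V \<and> trace_bounded V M"
proof -
  have "\<exists>V. open V \<and> S \<subseteq> V \<and> (\<exists>M. trace_bounded V M)"
  proof (rule finite_cover_property[OF S_compact])
    show "\<exists>M. trace_bounded {} M" by (intro exI[of _ 0]) (simp add: trace_bounded_def)
    show "\<exists>M. trace_bounded (A \<union> B) M" if "open A" "open B" "\<exists>M. trace_bounded A M" "\<exists>M. trace_bounded B M" for A B
      using that trace_bounded_Un by blast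
    show "\<exists>V. open V \<and> x \<in> V \<and> (\<exists>M. trace_bounded V M)" if "x \<in> S" for x
      using local_trace_estimates[OF that] by blast
  qed
  then show ?thesis by blast
qed

end

section \<open>Poincare's inequality for functions with zero trace\<close>

context image_domain
begin

definition W0 :: "(real^2 => real) => (real^2 => real^2) => bool" where
  "W0 v g \<longleftrightarrow> H1 G v g \<and> has_trace G S v (\<lambda>_. 0)"

abbreviation "\<Gamma>S \<equiv> restrict_space hausdorff1 S"

lemma nn_integral_arc: "(\<integral>\<^sup>+x. f x \<partial>\<Gamma>S) = (\<integral>\<^sup>+x\<in>S. f x \<partial>hausdorff1)"
  using S_borel by (intro nn_integral_restrict_space) (simp add: sets_hausdorff1)

lemma continuous_arc_measurable:
  fixes \<phi> :: "real^2 => real"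
  assumes "continuous_on (G \<union> S) \<phi>"
  shows "\<phi> \<in> borel_measurable \<Gamma>S"
proof -
  have "\<phi> \<in> borel_measurable (restrict_space borel S)"
    by (rule borel_measurable_continuous_on_restrict[OF continuous_on_subset[OF assms]]) simp
  moreover have "sets \<Gamma>S = sets (restrict_space borel S)" by (rule sets_restrict_space_cong[OF sets_hausdorff1])
  ultimately show ?thesis using measurable_cong_sets by blast
qed

lemma trace_bound:
  obtains M where "M \<ge> 0" "\<And>\<phi> w h. continuous_on (G \<union> S) \<phi> ==> represents G \<phi> w h ==>
    L2 \<Gamma>S \<phi> \<and> nsq \<Gamma>S \<phi> \<le> M * (sqn w + sqn h)"
proof -
  obtain V M where M: "S \<subseteq> V" "trace_bounded V M" using trace_inequality by blast
  have M0: "M \<ge> 0" using M(2) by (simp add: trace_bounded_def)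
  have SV: "S \<inter> V = S" using M(1) by blast
  show thesis
  proof (rule that[OF M0])
    fix \<phi> w h assume c: "continuous_on (G \<union> S) \<phi>" and r: "represents G \<phi> w h"
    have "(\<integral>\<^sup>+x. ennreal ((norm (\<phi> x))\<^sup>2) \<partial>\<Gamma>S) \<le> ennreal (M * (sqn w + sqn h))"
      using M(2) c r by (simp add: nn_integral_arc trace_bounded_def SV)
    from L2_nn_integralI[OF continuous_arc_measurable[OF c] this] M0
    show "L2 \<Gamma>S \<phi> \<and> nsq \<Gamma>S \<phi> \<le> M * (sqn w + sqn h)" by simp
  qed
qed

text \<open>
  The trace relation for representatives. Approximations of every accuracy take the place of a convergent sequence, so
  that diagonal arguments become applications of the triangle inequality.
\<close>

definition is_trace :: "(real^2 => real) => (real^2 => real^2) => (real^2 => real) => bool" where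
  "is_trace v g a \<longleftrightarrow> L2 \<Gamma>S a \<and> (\<forall>e>0. \<exists>\<phi> w h. continuous_on (G \<union> S) \<phi> \<and> represents G \<phi> w h \<and>
     sqd w v < e \<and> sqd h g < e \<and> sq_dist \<Gamma>S \<phi> a < e)"

lemma is_trace_approx:
  assumes "is_trace v g a" "e > 0"
  obtains \<phi> w h where "continuous_on (G \<union> S) \<phi>" "represents G \<phi> w h"
    "sqd w v < e" "sqd h g < e" "sq_dist \<Gamma>S \<phi> a < e"
  using assms(1)[unfolded is_trace_def, THEN conjunct2, rule_format, OF assms(2)] by (elim exE conjE) (rule that)

lemma arc_distance:
  assumes "continuous_on (G \<union> S) \<phi>" "represents G \<phi> w h" "L2 \<Gamma>S a"
  shows "(\<integral>\<^sup>+x\<in>S. ennreal ((\<phi> x - a x)\<^sup>2) \<partial>hausdorff1) = ennreal (sq_dist \<Gamma>S \<phi> a)"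
proof -
  have "L2 \<Gamma>S \<phi>" by (rule trace_bound) (use assms in blast)
  then have "L2 \<Gamma>S (\<lambda>x. \<phi> x - a x)" using assms(3) by (rule L2_diff(1))
  from nsq_nn_integral[OF this] show ?thesis by (simp add: nn_integral_arc)
qed

lemma has_trace_iff:
  assumes u: "represents G u v g"
  shows "has_trace G S u a \<longleftrightarrow> is_trace v g a"
proof
  have norm_eq: "sobolev_norm 2 G (\<lambda>x. \<phi> x - u x) = sqrt (sqd w v + sqd h g)"
    if "represents G \<phi> w h" for \<phi> w h
    by (rule sobolev_norm_represents[OF represents_diff[OF that u G_bounded] G_open G_bounded])
  {
    assume tr: "has_trace G S u a"
    then obtain \<phi> where \<phi>: "\<And>n. \<phi> n \<in> sobolev 2 G" "\<And>n. continuous_on (G \<union> S) (\<phi> n)"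
      "(\<lambda>n. sobolev_norm 2 G (\<lambda>x. \<phi> n x - u x)) \<longlonglongrightarrow> 0"
      "(\<lambda>n. \<integral>\<^sup>+x\<in>S. ennreal ((\<phi> n x - a x)\<^sup>2) \<partial>hausdorff1) \<longlonglongrightarrow> 0"
      and am: "a \<in> borel_measurable \<Gamma>S" "(\<integral>\<^sup>+x\<in>S. ennreal ((a x)\<^sup>2) \<partial>hausdorff1) < \<infinity>"
      by (auto simp: has_trace_def)
    have "(\<integral>\<^sup>+x. ennreal ((norm (a x))\<^sup>2) \<partial>\<Gamma>S) = ennreal (enn2real (\<integral>\<^sup>+x\<in>S. ennreal ((a x)\<^sup>2) \<partial>hausdorff1))"
      using am(2) by (simp add: nn_integral_arc)
    then have La: "L2 \<Gamma>S a" by (intro L2_nn_integralI(1)[OF am(1) eq_refl]) auto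
    show "is_trace v g a"
      unfolding is_trace_def
    proof (intro conjI allI impI La)
      fix e :: real assume e: "e > 0"
      then have "sqrt e > 0" "ennreal e > 0" by auto
      then have "\<forall>\<^sub>F n in sequentially. sobolev_norm 2 G (\<lambda>x. \<phi> n x - u x) < sqrt e
          \<and> (\<integral>\<^sup>+x\<in>S. ennreal ((\<phi> n x - a x)\<^sup>2) \<partial>hausdorff1) < ennreal e"
        by (intro eventually_conj order_tendstoD(2)[OF \<phi>(3)] order_tendstoD(2)[OF \<phi>(4)])
      then obtain n where n: "sobolev_norm 2 G (\<lambda>x. \<phi> n x - u x) < sqrt e"
          "(\<integral>\<^sup>+x\<in>S. ennreal ((\<phi> n x - a x)\<^sup>2) \<partial>hausdorff1) < ennreal e"
        by (elim eventually_happens'[OF sequentially_bot, THEN exE] conjE) (rule that)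
      obtain w h where r: "represents G (\<phi> n) w h" using sobolev_imp_represents[OF \<phi>(1) G_open] by blast
      have "sqd w v + sqd h g < e" using n(1) by (simp add: norm_eq[OF r])
      then have "sqd w v < e" "sqd h g < e"
        using nsq_nonneg[of lborel "\<lambda>x. w x - v x"] nsq_nonneg[of lborel "\<lambda>x. h x - g x"] by linarith+
      moreover have "sq_dist \<Gamma>S (\<phi> n) a < e" using n(2) by (simp add: arc_distance[OF \<phi>(2) r La] ennreal_less_iff)
      ultimately show "\<exists>\<phi> w h. continuous_on (G \<union> S) \<phi> \<and> represents G \<phi> w h \<and>
        sqd w v < e \<and> sqd h g < e \<and> sq_dist \<Gamma>S \<phi> a < e" using \<phi>(2) r by blast
    qed
  next
    assume t: "is_trace v g a"
    then have La: "L2 \<Gamma>S a" by (simp add: is_trace_def)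
    define \<delta> where "\<delta> n = inverse (real (Suc n))" for n
    have \<delta>: "\<delta> n > 0" "\<delta> \<longlonglongrightarrow> 0" for n using LIMSEQ_inverse_real_of_nat by (simp_all add: \<delta>_def[abs_def])
    have "\<forall>n. \<exists>\<phi>. continuous_on (G \<union> S) \<phi> \<and> \<phi> \<in> sobolev 2 G \<and> sobolev_norm 2 G (\<lambda>x. \<phi> x - u x) \<le> sqrt (2 * \<delta> n)
        \<and> (\<integral>\<^sup>+x\<in>S. ennreal ((\<phi> x - a x)\<^sup>2) \<partial>hausdorff1) \<le> ennreal (\<delta> n)"
    proof
      fix n
      obtain \<phi> w h where z: "continuous_on (G \<union> S) \<phi>" "represents G \<phi> w h"
        "sqd w v < \<delta> n" "sqd h g < \<delta> n" "sq_dist \<Gamma>S \<phi> a < \<delta> n" by (rule is_trace_approx[OF t \<delta>(1)])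
      have "sobolev_norm 2 G (\<lambda>x. \<phi> x - u x) \<le> sqrt (2 * \<delta> n)" using z(3,4) by (simp add: norm_eq[OF z(2)])
      moreover have "(\<integral>\<^sup>+x\<in>S. ennreal ((\<phi> x - a x)\<^sup>2) \<partial>hausdorff1) \<le> ennreal (\<delta> n)"
        unfolding arc_distance[OF z(1,2) La] using z(5) by (intro ennreal_leI) simp
      ultimately show "\<exists>\<phi>. continuous_on (G \<union> S) \<phi> \<and> \<phi> \<in> sobolev 2 G \<and> sobolev_norm 2 G (\<lambda>x. \<phi> x - u x) \<le> sqrt (2 * \<delta> n)
        \<and> (\<integral>\<^sup>+x\<in>S. ennreal ((\<phi> x - a x)\<^sup>2) \<partial>hausdorff1) \<le> ennreal (\<delta> n)"
        using z(1) represents_imp_sobolev[OF z(2) G_open G_bounded] by (intro exI[of _ \<phi>] conjI)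
    qed
    from choice[OF this] obtain \<phi> where \<phi>: "\<And>n. continuous_on (G \<union> S) (\<phi> n)" "\<And>n. \<phi> n \<in> sobolev 2 G"
      "\<And>n. sobolev_norm 2 G (\<lambda>x. \<phi> n x - u x) \<le> sqrt (2 * \<delta> n)"
      "\<And>n. (\<integral>\<^sup>+x\<in>S. ennreal ((\<phi> n x - a x)\<^sup>2) \<partial>hausdorff1) \<le> ennreal (\<delta> n)"
      by (elim exE) (rule_tac \<phi> = f in that; blast)
    show "has_trace G S u a"
      unfolding has_trace_def
    proof (intro conjI exI[of _ \<phi>] allI \<phi>(1,2))
      show "u \<in> sobolev 2 G" by (rule represents_imp_sobolev[OF u G_open G_bounded])
      show "a \<in> borel_measurable \<Gamma>S" by (rule L2_measurable[OF La])
      show "(\<integral>\<^sup>+x\<in>S. ennreal ((a x)\<^sup>2) \<partial>hausdorff1) < \<infinity>"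
        using nsq_nn_integral[OF La] by (simp add: nn_integral_arc)
      have "(\<lambda>n. sqrt (2 * \<delta> n)) \<longlonglongrightarrow> sqrt (2 * 0)" by (intro tendsto_intros \<delta>(2))
      then have l: "(\<lambda>n. sqrt (2 * \<delta> n)) \<longlonglongrightarrow> 0" by simp
      show "(\<lambda>n. sobolev_norm 2 G (\<lambda>x. \<phi> n x - u x)) \<longlonglongrightarrow> 0"
        by (rule tendsto_sandwich[OF _ _ tendsto_const l]) (simp_all add: \<phi>(3), simp add: sobolev_norm_def)
      have l: "(\<lambda>n. ennreal (\<delta> n)) \<longlonglongrightarrow> 0" using tendsto_ennrealI[OF \<delta>(2)] by simp
      show "(\<lambda>n. \<integral>\<^sup>+x\<in>S. ennreal ((\<phi> n x - a x)\<^sup>2) \<partial>hausdorff1) \<longlonglongrightarrow> 0"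
        by (rule tendsto_sandwich[OF _ _ tendsto_const l]) (simp_all add: \<phi>(4))
    qed
  }
qed

lemma W0_iff: "W0 v g \<longleftrightarrow> H1 G v g \<and> is_trace v g (\<lambda>_. 0)"
  unfolding W0_def using has_trace_iff[OF represents_self] by blast

text \<open>The local form of Poincare's inequality, which passes to unions and along segments.\<close>

definition controlled :: "(real^2) set => bool" where
  "controlled A \<longleftrightarrow> (\<exists>M\<ge>0. \<forall>v g. W0 v g --> sqn (\<lambda>x. indicator A x * v x) \<le> M * sqn g)"

lemma L2_indicator:
  fixes v :: "'a::euclidean_space => real"
  assumes "L2 lborel v" "A \<in> sets borel"
  shows "L2 lborel (\<lambda>x. indicator A x * v x)"
  by (rule L2_dominated(1)[OF assms(1), of _ 1]) (use assms in \<open>auto simp: indicator_def L2_def\<close>)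

lemma nsq_indicator_mono:
  fixes v :: "'a::euclidean_space => real"
  assumes "L2 lborel v" "A \<in> sets borel" "B \<in> sets borel" "A \<subseteq> B"
  shows "sqn (\<lambda>x. indicator A x * v x) \<le> sqn (\<lambda>x. indicator B x * v x)"
proof -
  have "sqn (\<lambda>x. indicator A x * v x) \<le> 1\<^sup>2 * sqn (\<lambda>x. indicator B x * v x)"
    by (rule L2_dominated(2)[OF L2_indicator[OF assms(1,3)]])
      (use assms in \<open>auto simp: indicator_def L2_def subset_eq\<close>)
  then show ?thesis by simp
qed

lemma controlled_Un:
  assumes "controlled A" "controlled B" "A \<in> sets borel" "B \<in> sets borel"
  shows "controlled (A \<union> B)"
proof -
  obtain M where M: "M \<ge> 0" "\<And>v g. W0 v g ==> sqn (\<lambda>x. indicator A x * v x) \<le> M * sqn g"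
    using assms(1) by (auto simp: controlled_def)
  obtain M' where M': "M' \<ge> 0" "\<And>v g. W0 v g ==> sqn (\<lambda>x. indicator B x * v x) \<le> M' * sqn g"
    using assms(2) by (auto simp: controlled_def)
  have "sqn (\<lambda>x. indicator (A \<union> B) x * v x) \<le> (2 * M + 2 * M') * sqn g" if w: "W0 v g" for v g
  proof -
    have L: "L2 lborel v" using w H1_L2(1) by (auto simp: W0_def)
    have "sqn (\<lambda>x. indicator (A \<union> B) x * v x)
       = sqn (\<lambda>x. indicator A x * v x + indicator (B - A) x * v x)"
      unfolding nsq_def by (intro Bochner_Integration.integral_cong) (auto simp: indicator_def)
    also have "... \<le> 2 * sqn (\<lambda>x. indicator A x * v x) + 2 * sqn (\<lambda>x. indicator (B - A) x * v x)"
      by (rule L2_add(2)) (use assms in \<open>auto intro!: L2_indicator[OF L]\<close>)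
    also have "sqn (\<lambda>x. indicator (B - A) x * v x) \<le> sqn (\<lambda>x. indicator B x * v x)"
      by (rule nsq_indicator_mono[OF L]) (use assms in auto)
    finally show ?thesis using M(2)[OF w] M'(2)[OF w] by (simp add: algebra_simps)
  qed
  then show ?thesis using M(1) M'(1) unfolding controlled_def by (intro exI[of _ "2 * M + 2 * M'"]) auto
qed

text \<open>The translation estimate for the segments from A in direction c, which stay in G and end in B.\<close>

lemma controlled_translate:
  assumes "controlled B" "open A" "\<And>x r. x \<in> A ==> r \<in> {0..1} ==> x + r *\<^sub>R c \<in> G"
    "B \<in> sets borel" "\<And>x. x \<in> A ==> x + c \<in> B"
  shows "controlled A"
proof -
  obtain M where M: "M \<ge> 0" "\<And>v g. W0 v g ==> sqn (\<lambda>x. indicator B x * v x) \<le> M * sqn g"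
    using assms(1) by (auto simp: controlled_def)
  have "sqn (\<lambda>x. indicator A x * v x) \<le> (2 * M + 2 * (norm c)\<^sup>2) * sqn g" if w: "W0 v g" for v g
  proof -
    have "H1 G v g" using w by (simp add: W0_def)
    from translation_estimate[OF this G_bounded assms(2) assms(3) assms(4) assms(5)]
    have "sqn (\<lambda>x. indicator A x * v x) \<le> 2 * sqn (\<lambda>x. indicator B x * v x) + 2 * (norm c)\<^sup>2 * sqn g" .
    then show ?thesis using M(2)[OF w] by (simp add: algebra_simps)
  qed
  then show ?thesis using M(1) unfolding controlled_def by (intro exI[of _ "2 * M + 2 * (norm c)\<^sup>2"]) auto
qed

text \<open>Points near which Poincare's inequality holds.\<close>

definition good :: "real^2 => bool" where
  "good x \<longleftrightarrow> (\<exists>V. open V \<and> x \<in> V \<and> controlled (V \<inter> G))"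

text \<open>
  A continuous approximation is bounded near the boundary by its boundary values and its gradient, and these boundary
  values are small because the trace is zero.
\<close>

lemma controlled_near_trace:
  assumes V: "open V" and M: "trace_controls V M"
  shows "controlled (V \<inter> G)"
proof -
  have M0: "M \<ge> 0" using M by (simp add: trace_controls_def)
  have VG: "V \<inter> G \<in> sets borel" using V by auto
  note LI = L2_indicator[OF _ VG]
  have "sqn (\<lambda>x. indicator (V \<inter> G) x * v x) \<le> 4 * M * sqn g" if W: "W0 v g" for v g
  proof (rule field_le_epsilon)
    fix e :: real assume "e > 0"
    define d where "d = e / (2 + 6 * M)"
    have d: "d > 0" "(2 + 6 * M) * d = e" using \<open>e > 0\<close> M0 by (auto simp: d_def)
    have H: "H1 G v g" and t: "is_trace v g (\<lambda>_. 0)" using W by (auto simp: W0_iff)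
    obtain \<phi> w h where 1: "continuous_on (G \<union> S) \<phi>" "represents G \<phi> w h"
      "sqd w v < d" "sqd h g < d" "nsq \<Gamma>S (\<lambda>x. \<phi> x - 0) < d" by (rule is_trace_approx[OF t d(1)])
    have H': "H1 G w h" using 1(2) by (simp add: represents_def)
    have T: "(\<integral>\<^sup>+x. ennreal ((\<phi> x)\<^sup>2) * indicator S x \<partial>hausdorff1) = ennreal (nsq \<Gamma>S \<phi>)"
      using arc_distance[OF 1(1,2) L2_zero] by simp
    have "(\<integral>\<^sup>+x. ennreal ((norm (indicator (V \<inter> G) x * w x))\<^sup>2) \<partial>lborel)
       = (\<integral>\<^sup>+x. ennreal ((w x)\<^sup>2) * indicator (V \<inter> G) x \<partial>lborel)"
      by (intro nn_integral_cong) (auto simp: indicator_def)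
    also have "... \<le> ennreal M * (ennreal (nsq \<Gamma>S \<phi>) + ennreal (sqn h))"
      using M 1(1,2) unfolding trace_controls_def T[symmetric] by blast
    also have "... = ennreal (M * (nsq \<Gamma>S \<phi> + sqn h))" using M0 by (simp add: ennreal_mult)
    finally have "sqn (\<lambda>x. indicator (V \<inter> G) x * w x) \<le> M * (nsq \<Gamma>S \<phi> + sqn h)"
      using M0 by (intro L2_nn_integralI(2)[OF L2_measurable[OF LI[OF H1_L2(1)[OF H']]]]) auto
    also have "... \<le> M * (d + (2 * d + 2 * sqn g))"
      using 1(4,5) nsq_triangle'[OF H1_L2(2)[OF H'] H1_L2(2)[OF H]] M0 by (intro mult_left_mono add_mono) auto
    finally have b: "sqn (\<lambda>x. indicator (V \<inter> G) x * w x) \<le> M * (d + (2 * d + 2 * sqn g))" .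
    have m: "(\<lambda>x. indicator (V \<inter> G) x * v x - indicator (V \<inter> G) x * w x) \<in> borel_measurable lborel"
      by (rule L2_measurable[OF L2_diff(1)[OF LI[OF H1_L2(1)[OF H]] LI[OF H1_L2(1)[OF H']]]])
    have "sqn (\<lambda>x. indicator (V \<inter> G) x * v x - indicator (V \<inter> G) x * w x) \<le> 1\<^sup>2 * sqd w v"
      by (rule L2_dominated(2)[OF L2_diff(1)[OF H1_L2(1)[OF H'] H1_L2(1)[OF H]] m]) (auto simp: indicator_def)
    then have "sqn (\<lambda>x. indicator (V \<inter> G) x * v x) \<le> 2 * d + 2 * (M * (d + (2 * d + 2 * sqn g)))"
      using nsq_triangle'[OF LI[OF H1_L2(1)[OF H]] LI[OF H1_L2(1)[OF H']]] b 1(3) by simp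
    also have "... = 4 * M * sqn g + (2 + 6 * M) * d" by (simp add: algebra_simps)
    finally show "sqn (\<lambda>x. indicator (V \<inter> G) x * v x) \<le> 4 * M * sqn g + e" by (simp add: d(2))
  qed
  then show ?thesis using M0 unfolding controlled_def by (intro exI[of _ "4 * M"]) auto
qed

lemma good_boundary: "x \<in> S ==> good x"
  using local_trace_estimates[of x] controlled_near_trace unfolding good_def by blast

lemma good_spreads:
  assumes "ball x d \<subseteq> G" "y \<in> ball x (d / 2)" "good y"
  shows "good x"
proof -
  obtain V where V: "open V" "y \<in> V" "controlled (V \<inter> G)" using assms(3) by (auto simp: good_def)
  obtain \<rho> where \<rho>: "\<rho> > 0" "ball y \<rho> \<subseteq> V" using V(1,2) openE by blast
  have "dist x y < d / 2" using assms(2) by simp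
  then have d: "d > 0" using zero_le_dist[of x y] by linarith
  define \<rho>' where "\<rho>' = min \<rho> (d / 2)"
  have \<rho>': "\<rho>' > 0" "\<rho>' \<le> \<rho>" "\<rho>' \<le> d / 2" using \<rho>(1) d by (auto simp: \<rho>'_def)
  have sub: "ball x \<rho>' \<subseteq> G" using assms(1) \<rho>' d by (auto intro: subsetD)
  have "controlled (ball x \<rho>')"
  proof (rule controlled_translate[OF V(3), of _ "y - x"])
    have yd: "norm (y - x) < d / 2" using assms(2) by (simp add: dist_norm norm_minus_commute)
    show "z + r *\<^sub>R (y - x) \<in> G" if z: "z \<in> ball x \<rho>'" and r: "r \<in> {0..1}" for z r
    proof -
      have "dist x (z + r *\<^sub>R (y - x)) \<le> dist x z + r * norm (y - x)"
        using dist_triangle[of x "z + r *\<^sub>R (y - x)" z] r by (simp add: dist_norm)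
      also have "r * norm (y - x) \<le> norm (y - x)" using r by (simp add: mult_left_le_one_le)
      finally have "dist x (z + r *\<^sub>R (y - x)) < d" using z \<rho>'(3) yd by simp
      then show ?thesis using assms(1) by auto
    qed
    show "z + (y - x) \<in> V \<inter> G" if z: "z \<in> ball x \<rho>'" for z
    proof
      have "dist y (z + (y - x)) = dist x z" by (simp add: dist_norm norm_minus_commute algebra_simps)
      then show "z + (y - x) \<in> V" using z \<rho>(2) \<rho>'(2) by auto
      have "dist x (z + (y - x)) \<le> dist x z + norm (y - x)"
        using dist_triangle[of x "z + (y - x)" z] by (simp add: dist_norm norm_minus_commute[of x y])
      then have "dist x (z + (y - x)) < d" using z \<rho>'(3) yd by simp
      then show "z + (y - x) \<in> G" using assms(1) by auto
    qed
  qed (use V(1) in auto)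
  moreover have "ball x \<rho>' \<inter> G = ball x \<rho>'" using sub by blast
  ultimately show ?thesis unfolding good_def using \<rho>'(1) by (intro exI[of _ "ball x \<rho>'"]) auto
qed

text \<open>
  The good points of a component of G form a set that is open and closed in the component. It is not
  empty: the closure of a component meets the boundary of K, since otherwise the component
  would be open and closed in the connected set \<Omega>.
\<close>

lemma component_meets_boundary:
  assumes U: "U \<in> components G"
  shows "closure U \<inter> S \<noteq> {}"
proof
  assume e: "closure U \<inter> S = {}"
  have Uo: "open U" using open_components[OF G_open U] .
  have U_sub: "U \<subseteq> G" "U \<noteq> {}" using U in_components_subset in_components_nonempty by auto
  have "closure U \<inter> \<Omega> \<subseteq> U"
  proof
    fix x assume x: "x \<in> closure U \<inter> \<Omega>"
    then have "x \<in> closure G" using closure_mono[OF U_sub(1)] by blast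
    then have "x \<in> G" using closure_G_in_\<Omega>[of x] x e by blast
    moreover have "closedin (top_of_set G) U" by (rule closedin_component[OF U])
    ultimately show "x \<in> U" using x by (auto simp: closedin_closed_Int closed_closedin closedin_limpt closure_def)
  qed
  then have "closure U \<inter> \<Omega> = U" using closure_subset U_sub(1) by (auto simp: G_def)
  then have "closedin (top_of_set \<Omega>) U" by (metis closed_closure closedin_closed_Int inf_commute)
  moreover have "openin (top_of_set \<Omega>) U" using Uo U_sub(1) by (auto simp: G_def openin_open)
  ultimately have "U = \<Omega>" using \<Omega>_connected U_sub(2) connected_clopen by blast
  then show False using U_sub(1) K_nonempty K_sub by (auto simp: G_def)
qed

lemma good_interior:
  assumes "x \<in> G"
  shows "good x"
proof -
  define U where "U = connected_component_set G x"
  have U: "U \<in> components G" "x \<in> U" using assms by (auto simp: U_def componentsI)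
  have Uo: "open U" using open_components[OF G_open U(1)] .
  have U_sub: "U \<subseteq> G" using U(1) in_components_subset by blast
  obtain x0 where x0: "x0 \<in> closure U" "x0 \<in> S" using component_meets_boundary[OF U(1)] by blast
  obtain V where V: "open V" "x0 \<in> V" "controlled (V \<inter> G)" using good_boundary[OF x0(2)] by (auto simp: good_def)
  have "V \<inter> U \<noteq> {}" using x0(1) V(1,2) open_Int_closure_eq_empty[OF V(1), of U] by blast
  then obtain z where "z \<in> V" "z \<in> U" by blast
  then have z: "good z" using V by (auto simp: good_def)
  define Y where "Y = {y \<in> U. good y}"
  have "open Y"
  proof (rule openI)
    fix y assume "y \<in> Y"
    then obtain W where W: "open W" "y \<in> W" "controlled (W \<inter> G)" "y \<in> U" by (auto simp: Y_def good_def)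
    then have "open (W \<inter> U)" "y \<in> W \<inter> U" using Uo by auto
    then obtain \<epsilon> where "\<epsilon> > 0" "ball y \<epsilon> \<subseteq> W \<inter> U" using openE by blast
    then show "\<exists>e>0. ball y e \<subseteq> Y" using W by (intro exI[of _ \<epsilon>]) (auto simp: Y_def good_def)
  qed
  then have op: "openin (top_of_set U) Y" by (auto simp: Y_def openin_open)
  have "open (U - Y)"
  proof (rule openI)
    fix y assume y: "y \<in> U - Y"
    then have "y \<in> U" by simp
    then obtain d where d: "d > 0" "ball y d \<subseteq> U" using Uo openE by blast
    have "ball y (d / 2) \<subseteq> U - Y"
    proof
      fix p assume p: "p \<in> ball y (d / 2)"
      have "p \<in> U" using p d by auto
      moreover have "\<not> good p"
      proof
        assume "good p"
        then have "good y" using d(2) U_sub p by (intro good_spreads[of y d p]) auto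
        then show False using y by (simp add: Y_def)
      qed
      ultimately show "p \<in> U - Y" by (simp add: Y_def)
    qed
    then show "\<exists>e>0. ball y e \<subseteq> U - Y" using d(1) by (intro exI[of _ "d / 2"]) auto
  qed
  then have "openin (top_of_set U) (U - Y)" by (auto simp: openin_open)
  then have "closedin (top_of_set U) Y" by (auto simp: closedin_def Y_def double_diff Int_absorb2 Diff_Diff_Int)
  then have "Y = U" using op \<open>z \<in> U\<close> z in_components_connected[OF U(1)] connected_clopen by (auto simp: Y_def)
  then show ?thesis using U(2) by (auto simp: Y_def)
qed

text \<open>
  Near a boundary point of \<Omega> all segments of a fixed length in direction n stay in G, and they lead to the
  neighbourhood of a point of G.
\<close>

lemma good_outer_boundary:
  assumes x: "x \<in> closure G" "x \<notin> \<Omega>"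
  shows "good x"
proof -
  have "x \<in> closure \<Omega>" using x(1) closure_mono[of G \<Omega>] by (auto simp: G_def)
  then have "x \<in> frontier \<Omega>" using x(2) \<Omega>_open by (simp add: frontier_def interior_open)
  with \<Omega>_lipschitz obtain r0 e n L \<gamma> where c: "r0 > 0" "norm e = 1" "norm n = 1" "e \<bullet> n = 0"
    "L-lipschitz_on UNIV \<gamma>" "\<gamma> 0 = 0"
    "\<And>y. y \<in> ball x r0 ==> y \<in> \<Omega> \<longleftrightarrow> \<gamma> ((y - x) \<bullet> e) < (y - x) \<bullet> n" by (rule lipschitz_domain_chart) blast
  have nn: "n \<bullet> n = 1" "n \<bullet> e = 0" using c by (auto simp: dot_square_norm inner_commute)
  have "open (- K)" "x \<in> - K" using K_closed K_sub x(2) by auto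
  then obtain r1 where r1: "r1 > 0" "ball x r1 \<subseteq> - K" using openE by blast
  define r where "r = min r0 r1"
  have r: "r > 0" "r \<le> r0" "r \<le> r1" using c(1) r1(1) by (auto simp: r_def)
  have G_iff: "y \<in> G \<longleftrightarrow> \<gamma> ((y - x) \<bullet> e) < (y - x) \<bullet> n" if "y \<in> ball x r" for y
  proof -
    have "y \<in> ball x r0" "y \<in> ball x r1" using that r by auto
    then show ?thesis using c(7)[of y] r1(2) by (auto simp: G_def)
  qed
  define q where "q = (r / 4) *\<^sub>R n"
  have q: "norm q = r / 4" using c(3) r(1) by (simp add: q_def)
  have "x + q \<in> G" using q r c(6) by (subst G_iff) (simp_all add: dist_norm, simp add: q_def nn)
  then obtain V where V: "open V" "x + q \<in> V" "controlled (V \<inter> G)" using good_interior by (auto simp: good_def)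
  obtain \<rho> where \<rho>: "\<rho> > 0" "ball (x + q) \<rho> \<subseteq> V" using V(1,2) openE by blast
  define \<rho>' where "\<rho>' = min \<rho> (r / 2)"
  have \<rho>': "\<rho>' > 0" "\<rho>' \<le> \<rho>" "\<rho>' \<le> r / 2" using \<rho>(1) r(1) by (auto simp: \<rho>'_def)
  have seg: "z + s *\<^sub>R q \<in> G" if z: "z \<in> ball x \<rho>' \<inter> G" and s: "s \<in> {0..1}" for z s
  proof (subst G_iff)
    have "dist x (z + s *\<^sub>R q) \<le> dist x z + s * norm q"
      using dist_triangle[of x "z + s *\<^sub>R q" z] s by (simp add: dist_norm)
    also have "s * norm q \<le> norm q" using s by (simp add: mult_left_le_one_le)
    finally show "z + s *\<^sub>R q \<in> ball x r" using z \<rho>'(3) q r(1) by simp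
    have "\<gamma> ((z - x) \<bullet> e) < (z - x) \<bullet> n" using z \<rho>'(3) r(1) by (subst G_iff[symmetric]) auto
    moreover have "(z + s *\<^sub>R q - x) \<bullet> e = (z - x) \<bullet> e" by (simp add: q_def nn algebra_simps)
    moreover have "(z + s *\<^sub>R q - x) \<bullet> n = (z - x) \<bullet> n + s * (r / 4)" by (simp add: q_def nn algebra_simps)
    moreover have "0 \<le> s * (r / 4)" using s r(1) by (intro mult_nonneg_nonneg) auto
    ultimately show "\<gamma> ((z + s *\<^sub>R q - x) \<bullet> e) < (z + s *\<^sub>R q - x) \<bullet> n" by (simp only:)
  qed
  have "controlled (ball x \<rho>' \<inter> G)"
  proof (rule controlled_translate[OF V(3), of _ q])
    show "z + s *\<^sub>R q \<in> G" if "z \<in> ball x \<rho>' \<inter> G" "s \<in> {0..1}" for z s using seg[OF that] .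
    show "z + q \<in> V \<inter> G" if z: "z \<in> ball x \<rho>' \<inter> G" for z
    proof
      have "dist (x + q) (z + q) = dist x z" by (simp add: dist_norm)
      then show "z + q \<in> V" using z \<rho>(2) \<rho>'(2) by auto
      show "z + q \<in> G" using seg[OF z, of 1] by simp
    qed
  qed (use V(1) G_open in auto)
  then show ?thesis unfolding good_def using \<rho>'(1) by (intro exI[of _ "ball x \<rho>'"]) auto
qed

text \<open>
  All points of the closure of G are good: those on the boundary of K because the trace vanishes there, the others because
  control spreads along segments. Compactness then yields one constant.
\<close>

lemma poincare: "\<exists>M\<ge>0. \<forall>v g. W0 v g --> sqn v \<le> M * sqn g"
proof -
  have "\<exists>V. open V \<and> closure G \<subseteq> V \<and> controlled (V \<inter> G)"
  proof (rule finite_cover_property)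
    show "compact (closure G)" using G_bounded by (simp add: compact_closure)
    show "controlled ({} \<inter> G)" by (auto simp: controlled_def intro: exI[of _ 0])
    show "controlled ((A \<union> B) \<inter> G)" if "open A" "open B" "controlled (A \<inter> G)" "controlled (B \<inter> G)" for A B
      unfolding Int_Un_distrib2 by (rule controlled_Un) (use that in auto)
    show "\<exists>V. open V \<and> x \<in> V \<and> controlled (V \<inter> G)" if "x \<in> closure G" for x
      using that closure_G_in_\<Omega>[OF that] good_interior good_boundary good_outer_boundary unfolding good_def by blast
  qed
  then obtain V where V: "closure G \<subseteq> V" "controlled (V \<inter> G)" by blast
  then have VG: "V \<inter> G = G" using closure_subset by blast
  have "(\<lambda>x. indicator G x * v x) = v" if "W0 v g" for v g
    using that H1_outside(1)[of G v g] by (auto simp: W0_def indicator_def fun_eq_iff)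
  then show ?thesis using V(2) unfolding VG controlled_def by metis
qed

end

section \<open>The affine space of admissible functions\<close>

context image_domain
begin

lemma represents_linear:
  assumes "represents G u v g" "represents G u' v' g'"
  shows "represents G (\<lambda>x. u x + c * u' x) (\<lambda>x. v x + c * v' x) (\<lambda>x. g x + c *\<^sub>R g' x)"
  unfolding represents_def
proof
  show "H1 G (\<lambda>x. v x + c * v' x) (\<lambda>x. g x + c *\<^sub>R g' x)"
    by (rule H1_linear) (use assms G_bounded in \<open>auto simp: represents_def\<close>)
  have "AE x in lebesgue_on G. u x = v x" "AE x in lebesgue_on G. u' x = v' x"
    using assms by (auto simp: represents_def)
  then show "AE x in lebesgue_on G. u x + c * u' x = v x + c * v' x" by eventually_elim simp
qed

lemma nsq_linear_combination:
  fixes f f' :: "'a => 'b::euclidean_space"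
  assumes "L2 M f" "L2 M f'" "L2 M k" "L2 M k'"
    and "sq_dist M f k < e" "sq_dist M f' k' < e"
  shows "nsq M (\<lambda>x. (f x + c *\<^sub>R f' x) - (k x + c *\<^sub>R k' x)) < (2 + 2 * c\<^sup>2) * e"
proof -
  have "nsq M (\<lambda>x. (f x + c *\<^sub>R f' x) - (k x + c *\<^sub>R k' x)) = nsq M (\<lambda>x. (f x - k x) + c *\<^sub>R (f' x - k' x))"
    by (simp add: algebra_simps)
  also have "... \<le> 2 * sq_dist M f k + 2 * nsq M (\<lambda>x. c *\<^sub>R (f' x - k' x))"
    by (intro L2_add(2) L2_diff(1) L2_scaleR assms)
  also have "... = 2 * sq_dist M f k + 2 * (c\<^sup>2 * sq_dist M f' k')" by (simp only: nsq_scaleR)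
  also have "... < 2 * e + 2 * (c\<^sup>2 * e)"
    using assms(5) mult_left_mono[OF less_imp_le[OF assms(6)], of "c\<^sup>2"] by simp
  finally show ?thesis by (simp add: algebra_simps)
qed

lemma is_trace_linear:
  assumes H: "H1 G v g" "H1 G v' g'" and t: "is_trace v g a" "is_trace v' g' a'"
  shows "is_trace (\<lambda>x. v x + c * v' x) (\<lambda>x. g x + c *\<^sub>R g' x) (\<lambda>x. a x + c * a' x)"
proof -
  have La: "L2 \<Gamma>S a" "L2 \<Gamma>S a'" using t by (auto simp: is_trace_def)
  show ?thesis
    unfolding is_trace_def
  proof (intro conjI allI impI)
    show "L2 \<Gamma>S (\<lambda>x. a x + c * a' x)" using L2_add(1)[OF La(1) L2_scaleR[OF La(2), of c]] by simp
    fix e :: real assume "e > 0"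
    define d where "d = e / (2 + 2 * c\<^sup>2)"
    have pos: "2 + 2 * c\<^sup>2 > 0" using zero_le_power2[of c] by linarith
    have d: "d > 0" "(2 + 2 * c\<^sup>2) * d = e" using \<open>e > 0\<close> pos by (auto simp: d_def)
    obtain \<phi> w h where 1: "continuous_on (G \<union> S) \<phi>" "represents G \<phi> w h"
      "sqd w v < d" "sqd h g < d" "sq_dist \<Gamma>S \<phi> a < d" by (rule is_trace_approx[OF t(1) d(1)])
    obtain \<phi>' w' h' where 2: "continuous_on (G \<union> S) \<phi>'" "represents G \<phi>' w' h'"
      "sqd w' v' < d" "sqd h' g' < d" "sq_dist \<Gamma>S \<phi>' a' < d" by (rule is_trace_approx[OF t(2) d(1)])
    have L: "L2 \<Gamma>S \<phi>" "L2 \<Gamma>S \<phi>'" by (rule trace_bound; use 1 2 in blast)+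
    have Hw: "H1 G w h" "H1 G w' h'" using 1 2 by (auto simp: represents_def)
    have "continuous_on (G \<union> S) (\<lambda>x. \<phi> x + c * \<phi>' x)" by (intro continuous_intros 1 2)
    moreover have "represents G (\<lambda>x. \<phi> x + c * \<phi>' x) (\<lambda>x. w x + c * w' x) (\<lambda>x. h x + c *\<^sub>R h' x)"
      by (rule represents_linear[OF 1(2) 2(2)])
    moreover have "sqn (\<lambda>x. w x + c * w' x - (v x + c * v' x)) < e"
      using nsq_linear_combination[OF H1_L2(1)[OF Hw(1)] H1_L2(1)[OF Hw(2)] H1_L2(1)[OF H(1)] H1_L2(1)[OF H(2)] 1(3) 2(3), of c] d(2)
      by simp
    moreover have "sqn (\<lambda>x. h x + c *\<^sub>R h' x - (g x + c *\<^sub>R g' x)) < e"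
      using nsq_linear_combination[OF H1_L2(2)[OF Hw(1)] H1_L2(2)[OF Hw(2)] H1_L2(2)[OF H(1)] H1_L2(2)[OF H(2)] 1(4) 2(4), of c] d(2)
      by simp
    moreover have "nsq \<Gamma>S (\<lambda>x. \<phi> x + c * \<phi>' x - (a x + c * a' x)) < e"
      using nsq_linear_combination[OF L La 1(5) 2(5), of c] d(2) by simp
    ultimately show "\<exists>\<phi> w h. continuous_on (G \<union> S) \<phi> \<and> represents G \<phi> w h \<and>
      sqn (\<lambda>x. w x - (v x + c * v' x)) < e \<and> sqn (\<lambda>x. h x - (g x + c *\<^sub>R g' x)) < e \<and>
      nsq \<Gamma>S (\<lambda>x. \<phi> x - (a x + c * a' x)) < e" by (intro exI conjI)
  qed
qed

lemma is_trace_zero: "is_trace (\<lambda>_. 0) (\<lambda>_. 0) (\<lambda>_. 0)"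
proof -
  have "represents G (\<lambda>_. 0) (\<lambda>_. 0) (\<lambda>_. 0)" by (rule represents_self[OF H1_zero])
  then have "\<exists>\<phi> w h. continuous_on (G \<union> S) \<phi> \<and> represents G \<phi> w h \<and>
     sqn (\<lambda>x. w x - 0) < e \<and> sqn (\<lambda>x. h x - 0) < e \<and> nsq \<Gamma>S (\<lambda>x. \<phi> x - 0) < e" if "e > 0" for e
    using that by (intro exI[of _ "\<lambda>_. 0"] conjI) (simp_all)
  then show ?thesis unfolding is_trace_def by simp
qed

lemma W0_zero: "W0 (\<lambda>_. 0) (\<lambda>_. 0)" unfolding W0_iff using H1_zero is_trace_zero by blast

lemma W0_linear:
  assumes "W0 v g" "W0 w h"
  shows "W0 (\<lambda>x. v x + c * w x) (\<lambda>x. g x + c *\<^sub>R h x)"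
  using is_trace_linear[of v g w h "\<lambda>_. 0" "\<lambda>_. 0" c] H1_linear[of G v g w h c] assms G_bounded
  unfolding W0_iff by simp

lemma W0_closed:
  assumes W: "\<And>n. W0 (v n) (g n)" and H: "H1 G w h"
    and lim: "(\<lambda>n. sqd (v n) w) \<longlonglongrightarrow> 0" "(\<lambda>n. sqd (g n) h) \<longlonglongrightarrow> 0"
  shows "W0 w h"
  unfolding W0_iff is_trace_def
proof (intro conjI allI impI H L2_zero)
  fix e :: real assume "e > 0"
  define d where "d = e / 4"
  have d: "d > 0" "d < e" using \<open>e > 0\<close> by (auto simp: d_def)
  have "\<forall>\<^sub>F n in sequentially. sqd (v n) w < d \<and> sqd (g n) h < d"
    by (intro eventually_conj order_tendstoD(2)[OF lim(1) d(1)] order_tendstoD(2)[OF lim(2) d(1)])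
  then obtain n where n: "sqd (v n) w < d" "sqd (g n) h < d"
    by (elim eventually_happens'[OF sequentially_bot, THEN exE] conjE) (rule that)
  have Hn: "H1 G (v n) (g n)" and t: "is_trace (v n) (g n) (\<lambda>_. 0)" using W[of n] by (auto simp: W0_iff)
  obtain \<phi> a b where 1: "continuous_on (G \<union> S) \<phi>" "represents G \<phi> a b"
    "sqd a (v n) < d" "sqd b (g n) < d" "nsq \<Gamma>S (\<lambda>x. \<phi> x - 0) < d" by (rule is_trace_approx[OF t d(1)])
  have Ha: "H1 G a b" using 1 by (simp add: represents_def)
  have "sqd a w \<le> 2 * sqd a (v n) + 2 * sqd (v n) w"
    by (rule nsq_triangle[OF H1_L2(1)[OF Ha] H1_L2(1)[OF Hn] H1_L2(1)[OF H]])
  then have 2: "sqd a w < e" using n 1(3) by (simp add: d_def)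
  have "sqd b h \<le> 2 * sqd b (g n) + 2 * sqd (g n) h"
    by (rule nsq_triangle[OF H1_L2(2)[OF Ha] H1_L2(2)[OF Hn] H1_L2(2)[OF H]])
  then have 3: "sqd b h < e" using n 1(4) by (simp add: d_def)
  show "\<exists>\<phi> a b. continuous_on (G \<union> S) \<phi> \<and> represents G \<phi> a b \<and>
     sqd a w < e \<and> sqd b h < e \<and> nsq \<Gamma>S (\<lambda>x. \<phi> x - 0) < e"
    using 1(1,2) 2 3 less_trans[OF 1(5) d(2)] by (intro exI conjI)
qed

text \<open>
  By Poincare's inequality a Cauchy sequence of gradients comes from a Cauchy sequence of functions, so the gradients
  of the functions with zero trace are complete.
\<close>

lemma W0_complete:
  assumes W: "\<And>n. W0 (v n) (g n)"
    and C: "\<And>e. e > 0 ==> \<exists>N. \<forall>m\<ge>N. \<forall>n\<ge>N. sqd (g m) (g n) < e"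
  shows "\<exists>w h. W0 w h \<and> (\<lambda>n. sqd (g n) h) \<longlonglongrightarrow> 0"
proof -
  obtain M where M: "M \<ge> 0" "\<And>v g. W0 v g ==> sqn v \<le> M * sqn g" using poincare by blast
  have H: "H1 G (v n) (g n)" for n using W by (simp add: W0_iff)
  note L = H1_L2[OF H]
  have P: "sqd (v m) (v n) \<le> M * sqd (g m) (g n)" for m n
    using M(2)[OF W0_linear[OF W[of m] W[of n], of "-1"]] by simp
  have "\<exists>N. \<forall>m\<ge>N. \<forall>n\<ge>N. sqd (v m) (v n) < e" if "e > 0" for e
  proof -
    have "e / (M + 1) > 0" using that M(1) by simp
    from C[OF this] obtain N where N: "\<And>m n. m \<ge> N ==> n \<ge> N ==> sqd (g m) (g n) < e / (M + 1)"
      by (elim exE) (rule that; blast)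
    have "sqd (v m) (v n) < e" if "m \<ge> N" "n \<ge> N" for m n
    proof -
      have "sqd (v m) (v n) \<le> (M + 1) * sqd (g m) (g n)"
        using P[of m n] nsq_nonneg[of lborel "\<lambda>x. g m x - g n x"] by (simp add: distrib_right del: nsq_nonneg)
      also have "... < e" using N[OF that] M(1) by (simp add: pos_less_divide_eq mult.commute)
      finally show ?thesis .
    qed
    then show ?thesis by blast
  qed
  from L2_complete[OF L(1) this] obtain w0 where w0: "L2 lborel w0" "(\<lambda>n. sqd (v n) w0) \<longlonglongrightarrow> 0" by blast
  from L2_complete[OF L(2) C] obtain h0 where h0: "L2 lborel h0" "(\<lambda>n. sqd (g n) h0) \<longlonglongrightarrow> 0" by blast
  let ?w = "\<lambda>x. indicator G x * w0 x" and ?h = "\<lambda>x. indicator G x *\<^sub>R h0 x"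
  have HL: "H1 G ?w ?h" by (rule H1_limit[OF H G_bounded G_open w0(1) h0(1) w0(2) h0(2)])
  have "sqd (v n) ?w \<le> 1\<^sup>2 * sqd (v n) w0" for n
    by (rule L2_dominated(2)[OF L2_diff(1)[OF L(1) w0(1)] L2_measurable[OF L2_diff(1)[OF L(1) H1_L2(1)[OF HL]]]])
      (use H1_outside(1)[OF H] in \<open>auto simp: indicator_def\<close>)
  then have 1: "(\<lambda>n. sqd (v n) ?w) \<longlonglongrightarrow> 0" by (intro tendsto_sandwich[OF _ _ tendsto_const w0(2)]) auto
  have "sqd (g n) ?h \<le> 1\<^sup>2 * sqd (g n) h0" for n
    by (rule L2_dominated(2)[OF L2_diff(1)[OF L(2) h0(1)] L2_measurable[OF L2_diff(1)[OF L(2) H1_L2(2)[OF HL]]]])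
      (use H1_outside(2)[OF H] in \<open>auto simp: indicator_def\<close>)
  then have 2: "(\<lambda>n. sqd (g n) ?h) \<longlonglongrightarrow> 0" by (intro tendsto_sandwich[OF _ _ tendsto_const h0(2)]) auto
  show ?thesis using W0_closed[OF W HL 1 2] 2 by blast
qed

text \<open>
  A Sobolev function on \<Omega> has a trace on the boundary of K: it is the limit of Sobolev functions that are continuous
  on all of \<Omega>, and by the trace inequality their restrictions to the boundary of K converge.
\<close>

lemma trace_exists:
  assumes "u \<in> sobolev 2 \<Omega>"
  shows "\<exists>v g a. represents G u v g \<and> is_trace v g a"
proof -
  have sub: "G \<subseteq> \<Omega>" "S \<subseteq> \<Omega>" using S_sub_K K_sub by (auto simp: G_def)
  obtain v g where u: "represents \<Omega> u v g" using sobolev_imp_represents[OF assms \<Omega>_open] by blast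
  then have H: "H1 \<Omega> v g" by (simp add: represents_def)
  let ?v = "\<lambda>x. indicator G x * v x" and ?g = "\<lambda>x. indicator G x *\<^sub>R g x"
  have HG: "H1 G ?v ?g" by (rule H1_restrict[OF H G_open sub(1)])
  have uG: "represents G u ?v ?g"
    unfolding represents_def
  proof
    have "AE x in lborel. x \<in> \<Omega> --> u x = v x" using u by (simp add: represents_def AE_lebesgue_on[OF \<Omega>_open])
    then show "AE x in lebesgue_on G. u x = ?v x"
      unfolding AE_lebesgue_on[OF G_open] by eventually_elim (use sub(1) in auto)
  qed (rule HG)
  define \<delta> where "\<delta> n = inverse (real (Suc n))" for n
  have \<delta>: "\<delta> n > 0" "\<delta> \<longlonglongrightarrow> 0" for n using LIMSEQ_inverse_real_of_nat by (simp_all add: \<delta>_def[abs_def])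
  have "\<forall>n. \<exists>z. H1 \<Omega> (fst z) (snd z) \<and> sqd (fst z) v < \<delta> n \<and> sqd (snd z) g < \<delta> n
     \<and> continuous_on \<Omega> (fst z)"
  proof
    fix n
    have "\<exists>u' g'. H1 \<Omega> u' g' \<and> sqd u' v < \<delta> n \<and> sqd g' g < \<delta> n \<and> continuous_on \<Omega> u'"
      by (rule continuous_approximation[OF \<Omega>_open \<Omega>_bounded _ H \<delta>(1)]) (rule lipschitz_domain_inward_cone[OF \<Omega>_lipschitz])
    then obtain u' g' where "H1 \<Omega> u' g' \<and> sqd u' v < \<delta> n \<and> sqd g' g < \<delta> n \<and> continuous_on \<Omega> u'"
      by (elim exE) (rule that)
    then show "\<exists>z. H1 \<Omega> (fst z) (snd z) \<and> sqd (fst z) v < \<delta> n \<and> sqd (snd z) g < \<delta> n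
     \<and> continuous_on \<Omega> (fst z)" by (intro exI[of _ "(u', g')"]) (simp only: fst_conv snd_conv)
  qed
  from choice[OF this] obtain z where z: "\<And>n. H1 \<Omega> (fst (z n)) (snd (z n))"
     "\<And>n. sqd (fst (z n)) v < \<delta> n" "\<And>n. sqd (snd (z n)) g < \<delta> n"
     "\<And>n. continuous_on \<Omega> (fst (z n))" by (elim exE) (rule that; blast)
  define \<phi> where "\<phi> n = fst (z n)" for n
  let ?w = "\<lambda>n x. indicator G x * \<phi> n x" and ?h = "\<lambda>n x. indicator G x *\<^sub>R snd (z n) x"
  have Hn: "H1 G (?w n) (?h n)" for n unfolding \<phi>_def by (rule H1_restrict[OF z(1) G_open sub(1)])
  have rep: "represents G (\<phi> n) (?w n) (?h n)" for n
    unfolding represents_def AE_lebesgue_on[OF G_open] using Hn by (intro conjI AE_I2) auto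
  have cont: "continuous_on (G \<union> S) (\<phi> n)" for n
    unfolding \<phi>_def by (rule continuous_on_subset[OF z(4)]) (use sub in blast)
  have dw: "sqd (?w n) ?v < \<delta> n" for n
  proof -
    have "sqd (?w n) ?v \<le> 1\<^sup>2 * sqd (fst (z n)) v"
      by (rule L2_dominated(2)[OF L2_diff(1)[OF H1_L2(1)[OF z(1)] H1_L2(1)[OF H]]
            L2_measurable[OF L2_diff(1)[OF H1_L2(1)[OF Hn] H1_L2(1)[OF HG]]]])
        (auto simp: indicator_def \<phi>_def)
    then show ?thesis using z(2)[of n] by simp
  qed
  have dh: "sqd (?h n) ?g < \<delta> n" for n
  proof -
    have "sqd (?h n) ?g \<le> 1\<^sup>2 * sqd (snd (z n)) g"
      by (rule L2_dominated(2)[OF L2_diff(1)[OF H1_L2(2)[OF z(1)] H1_L2(2)[OF H]]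
            L2_measurable[OF L2_diff(1)[OF H1_L2(2)[OF Hn] H1_L2(2)[OF HG]]]])
        (auto simp: indicator_def)
    then show ?thesis using z(3)[of n] by simp
  qed
  obtain M where M: "M \<ge> 0" "\<And>\<phi> w h. continuous_on (G \<union> S) \<phi> ==> represents G \<phi> w h ==>
    L2 \<Gamma>S \<phi> \<and> nsq \<Gamma>S \<phi> \<le> M * (sqn w + sqn h)" by (rule trace_bound) blast
  have La: "L2 \<Gamma>S (\<phi> n)" for n using M(2)[OF cont rep] by blast
  have dist: "sq_dist \<Gamma>S (\<phi> m) (\<phi> n) \<le> 4 * M * (\<delta> m + \<delta> n)" for m n
  proof -
    have "sq_dist \<Gamma>S (\<phi> m) (\<phi> n)
        \<le> M * (sqd (?w m) (?w n) + sqd (?h m) (?h n))"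
      using M(2)[OF continuous_on_diff[OF cont cont] represents_diff[OF rep rep G_bounded], of m n] by simp
    also have "... \<le> M * ((2 * \<delta> m + 2 * \<delta> n) + (2 * \<delta> m + 2 * \<delta> n))"
    proof (intro mult_left_mono add_mono M(1))
      show "sqd (?w m) (?w n) \<le> 2 * \<delta> m + 2 * \<delta> n"
        using nsq_triangle[OF H1_L2(1)[OF Hn] H1_L2(1)[OF HG] H1_L2(1)[OF Hn], of m n] dw[of m] dw[of n]
          nsq_diff_commute[of lborel ?v "?w n"] by linarith
      show "sqd (?h m) (?h n) \<le> 2 * \<delta> m + 2 * \<delta> n"
        using nsq_triangle[OF H1_L2(2)[OF Hn] H1_L2(2)[OF HG] H1_L2(2)[OF Hn], of m n] dh[of m] dh[of n]
          nsq_diff_commute[of lborel ?g "?h n"] by linarith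
    qed
    finally show ?thesis by (simp add: algebra_simps)
  qed
  have "\<exists>N. \<forall>m\<ge>N. \<forall>n\<ge>N. sq_dist \<Gamma>S (\<phi> m) (\<phi> n) < e" if "e > 0" for e
  proof -
    have "(\<lambda>n. 8 * M * \<delta> n) \<longlonglongrightarrow> 8 * M * 0" by (intro tendsto_intros \<delta>(2))
    then have "\<forall>\<^sub>F n in sequentially. 8 * M * \<delta> n < e" using that by (intro order_tendstoD(2)) auto
    then obtain N where N: "\<And>n. n \<ge> N ==> 8 * M * \<delta> n < e" by (auto simp: eventually_sequentially)
    have "sq_dist \<Gamma>S (\<phi> m) (\<phi> n) < e" if "m \<ge> N" "n \<ge> N" for m n
      using dist[of m n] N[OF that(1)] N[OF that(2)] by (simp add: algebra_simps)
    then show ?thesis by blast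
  qed
  from L2_complete[OF La this] obtain a where a: "L2 \<Gamma>S a" "(\<lambda>n. sq_dist \<Gamma>S (\<phi> n) a) \<longlonglongrightarrow> 0" by blast
  have "is_trace ?v ?g a"
    unfolding is_trace_def
  proof (intro conjI allI impI a(1))
    fix e :: real assume "e > 0"
    have "\<forall>\<^sub>F n in sequentially. \<delta> n < e \<and> sq_dist \<Gamma>S (\<phi> n) a < e"
      by (intro eventually_conj order_tendstoD(2)[OF \<delta>(2) \<open>e > 0\<close>] order_tendstoD(2)[OF a(2) \<open>e > 0\<close>])
    then obtain n where n: "\<delta> n < e" "sq_dist \<Gamma>S (\<phi> n) a < e"
      by (elim eventually_happens'[OF sequentially_bot, THEN exE] conjE) (rule that)
    show "\<exists>\<phi> w h. continuous_on (G \<union> S) \<phi> \<and> represents G \<phi> w h \<and>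
     sqd w ?v < e \<and> sqd h ?g < e \<and> sq_dist \<Gamma>S \<phi> a < e"
      using cont rep less_trans[OF dw n(1)] less_trans[OF dh n(1)] n(2) by (intro exI conjI)
  qed
  then show ?thesis using uG by blast
qed

text \<open>Traces are additive, so v and f have a common trace if and only if their difference has trace zero.\<close>

lemma admissible_iff:
  assumes f: "represents G f vf gf" "is_trace vf gf a"
  shows "v \<in> admissible G K f \<longleftrightarrow> (\<exists>w h. W0 w h \<and> represents G v (\<lambda>x. vf x + w x) (\<lambda>x. gf x + h x))"
proof
  assume "v \<in> admissible G K f"
  then obtain b where v: "v \<in> sobolev 2 G" and b: "has_trace G S v b" "has_trace G S f b"
    by (auto simp: admissible_def equal_trace_def)
  obtain v' g' where v': "represents G v v' g'" using sobolev_imp_represents[OF v G_open] by blast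
  have H: "H1 G v' g'" "H1 G vf gf" using v' f by (auto simp: represents_def)
  have "is_trace (\<lambda>x. v' x + (-1) * vf x) (\<lambda>x. g' x + (-1) *\<^sub>R gf x) (\<lambda>x. b x + (-1) * b x)"
    by (rule is_trace_linear[OF H]) (use b has_trace_iff[OF v'] has_trace_iff[OF f(1)] in auto)
  then have "W0 (\<lambda>x. v' x - vf x) (\<lambda>x. g' x - gf x)" using H1_diff[OF H G_bounded] by (simp add: W0_iff)
  then show "\<exists>w h. W0 w h \<and> represents G v (\<lambda>x. vf x + w x) (\<lambda>x. gf x + h x)"
    using v' by (intro exI[of _ "\<lambda>x. v' x - vf x"] exI[of _ "\<lambda>x. g' x - gf x"]) simp
next
  assume "\<exists>w h. W0 w h \<and> represents G v (\<lambda>x. vf x + w x) (\<lambda>x. gf x + h x)"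
  then obtain w h where w: "W0 w h" and v: "represents G v (\<lambda>x. vf x + w x) (\<lambda>x. gf x + h x)" by blast
  have "is_trace (\<lambda>x. vf x + 1 * w x) (\<lambda>x. gf x + 1 *\<^sub>R h x) (\<lambda>x. a x + 1 * 0)"
    by (rule is_trace_linear) (use f w in \<open>auto simp: represents_def W0_iff\<close>)
  then have "has_trace G S v a" "has_trace G S f a" using has_trace_iff[OF v] has_trace_iff[OF f(1)] f(2) by auto
  then show "v \<in> admissible G K f"
    using represents_imp_sobolev[OF v G_open G_bounded] by (auto simp: admissible_def equal_trace_def)
qed

lemma zero_trace_represents:
  assumes "\<phi> \<in> sobolev 2 G" "has_trace G S \<phi> (\<lambda>_. 0)"
  shows "\<exists>w h. represents G \<phi> w h \<and> W0 w h"
proof -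
  obtain w h where w: "represents G \<phi> w h" using sobolev_imp_represents[OF assms(1) G_open] by blast
  then have "W0 w h" using assms(2) has_trace_iff[OF w] by (simp add: W0_iff represents_def)
  then show ?thesis using w by blast
qed

end

section \<open>The linear Dirichlet problem\<close>

lemma matrix_vector_norm: "norm (A *v q) \<le> norm A * norm (q :: real^'n)" for A :: "real^'n^'m"
proof -
  have "norm (A *v q) = L2_set (\<lambda>i. \<bar>A $ i \<bullet> q\<bar>) UNIV" by (simp add: norm_vec_def matrix_vector_mul_component)
  also have "... \<le> L2_set (\<lambda>i. norm (A $ i) * norm q) UNIV" by (intro L2_set_mono Cauchy_Schwarz_ineq2) simp
  also have "... = norm A * norm q" unfolding norm_vec_def[of A] by (rule L2_set_left_distrib[symmetric]) simp
  finally show ?thesis .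
qed

lemma symmetric_matrix_inner:
  fixes A :: "real^'n^'n"
  assumes "transpose A = A"
  shows "(A *v x) \<bullet> y = (A *v y) \<bullet> x"
proof -
  have "(A *v x) \<bullet> y = (x v* A) \<bullet> y" using vector_transpose_matrix[of x A] assms by simp
  also have "... = x \<bullet> (A *v y)" by (rule dot_lmul_matrix)
  finally show ?thesis by (simp add: inner_commute)
qed

lemma borel_measurable_matrix_vector_mult:
  fixes A :: "'a => real^'n^'m"
  assumes "A \<in> borel_measurable M" "g \<in> borel_measurable M"
  shows "(\<lambda>x. A x *v g x) \<in> borel_measurable M"
proof (rule borel_measurable_continuous_Pair[OF assms])
  show "continuous_on UNIV (\<lambda>x :: (real^'n^'m) \<times> (real^'n). fst x *v snd x)"
    unfolding matrix_vector_mult_def by (intro continuous_intros)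
qed

definition coefficient :: "(real^2 => real^2^2) => real => bool" where
  "coefficient A \<alpha> \<longleftrightarrow> \<alpha> > 0 \<and> A \<in> borel_measurable borel \<and> (\<forall>x. transpose (A x) = A x) \<and>
     (\<exists>B. \<forall>x. norm (A x) \<le> B) \<and> (\<forall>x q. \<alpha> * (norm q)\<^sup>2 \<le> (A x *v q) \<bullet> q)"

definition form :: "(real^2 => real^2^2) => (real^2 => real^2) => (real^2 => real^2) => real" where
  "form A g h = (\<integral>x. (A x *v g x) \<bullet> h x \<partial>lborel)"

lemma L2_bounded_matrix:
  fixes g :: "real^2 => real^2" and A :: "real^2 => real^2^2"
  assumes "A \<in> borel_measurable borel" "\<And>x. norm (A x) \<le> B" "L2 lborel g"
  shows "L2 lborel (\<lambda>x. A x *v g x)" "sqn (\<lambda>x. A x *v g x) \<le> B\<^sup>2 * sqn g"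
proof -
  have g: "g \<in> borel_measurable borel" using L2_measurable[OF assms(3)] by simp
  have "norm (A x *v g x) \<le> B * norm (g x)" for x
    using matrix_vector_norm[of "A x" "g x"] mult_right_mono[OF assms(2)[of x] norm_ge_zero[of "g x"]] by linarith
  moreover have "B \<ge> 0" using order_trans[OF norm_ge_zero assms(2)] .
  ultimately show "L2 lborel (\<lambda>x. A x *v g x)" "sqn (\<lambda>x. A x *v g x) \<le> B\<^sup>2 * sqn g"
    using borel_measurable_matrix_vector_mult[OF assms(1) g] by (auto intro!: L2_dominated[OF assms(3)])
qed

context
  fixes A \<alpha> assumes A: "coefficient A \<alpha>"
begin

lemma coefficient_L2: "L2 lborel g ==> L2 lborel (\<lambda>x. A x *v g x)"
  using A unfolding coefficient_def by (elim conjE exE) (rule L2_bounded_matrix(1); blast)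

lemma form_integrable: "L2 lborel g ==> L2 lborel h ==> integrable lborel (\<lambda>x. (A x *v g x) \<bullet> h x)"
  by (rule L2_inner[OF coefficient_L2])

lemma form_commute: "form A g h = form A h g"
  unfolding form_def by (intro Bochner_Integration.integral_cong refl symmetric_matrix_inner)
    (use A in \<open>simp add: coefficient_def\<close>)

lemma form_linear_right:
  assumes "L2 lborel g" "L2 lborel h" "L2 lborel k"
  shows "form A g (\<lambda>x. h x + c *\<^sub>R k x) = form A g h + c * form A g k"
  unfolding form_def using form_integrable[OF assms(1,2)] form_integrable[OF assms(1,3)]
  by (simp add: inner_add_right)

lemma form_linear_left:
  assumes "L2 lborel g" "L2 lborel h" "L2 lborel k"
  shows "form A (\<lambda>x. h x + c *\<^sub>R k x) g = form A h g + c * form A k g"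
  using form_linear_right[OF assms, of c] by (simp add: form_commute[of g])

lemma form_expand:
  assumes "L2 lborel g" "L2 lborel h"
  shows "form A (\<lambda>x. g x + c *\<^sub>R h x) (\<lambda>x. g x + c *\<^sub>R h x) = form A g g + 2 * c * form A g h + c\<^sup>2 * form A h h"
proof -
  have "L2 lborel (\<lambda>x. g x + c *\<^sub>R h x)" by (intro L2_add L2_scaleR assms)
  then show ?thesis
    by (simp add: form_linear_right assms form_linear_left form_commute[of h g] power2_eq_square algebra_simps)
qed

lemma form_coercive:
  assumes "L2 lborel g"
  shows "\<alpha> * sqn g \<le> form A g g"
proof -
  have "\<alpha> * sqn g = (\<integral>x. \<alpha> * (norm (g x))\<^sup>2 \<partial>lborel)" by (simp add: nsq_def)
  also have "... \<le> form A g g"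
    unfolding form_def by (intro integral_mono form_integrable assms integrable_mult_right L2_integrable_sq)
      (use A in \<open>simp add: coefficient_def\<close>)
  finally show ?thesis .
qed

lemma form_nonneg: "L2 lborel g ==> 0 \<le> form A g g"
  using order_trans[OF mult_nonneg_nonneg[OF _ nsq_nonneg] form_coercive[of g]] A
  by (simp add: coefficient_def less_imp_le)

end

context image_domain
begin

definition solves :: "(real^2 => real^2^2) => (real^2 => real^2) => (real^2 => real) => (real^2 => real^2) => bool" where
  "solves A g0 w h \<longleftrightarrow> W0 w h \<and> (\<forall>w' k. W0 w' k --> form A (\<lambda>x. g0 x + h x) k = 0)"

lemma W0_L2: "W0 w h ==> L2 lborel h" "W0 w h ==> L2 lborel w" using H1_L2 by (auto simp: W0_def)

text \<open>
  A minimising sequence is Cauchy by the parallelogram identity, since the midpoint of two of its members has no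
  smaller energy than the infimum. The minimiser is a critical point.
\<close>

lemma dirichlet_problem:
  assumes A: "coefficient A \<alpha>" and g0: "L2 lborel g0"
  shows "\<exists>w h. solves A g0 w h"
proof -
  have \<alpha>: "\<alpha> > 0" using A by (simp add: coefficient_def)
  define J where "J h = form A (\<lambda>x. g0 x + h x) (\<lambda>x. g0 x + h x)" for h
  define E where "E = {J h | w h. W0 w h}"
  have L: "L2 lborel (\<lambda>x. g0 x + h x)" if "W0 w h" for w h by (intro L2_add g0 W0_L2(1)[OF that])
  have J_expand: "J (\<lambda>x. h x + c *\<^sub>R k x) = J h + 2 * c * form A (\<lambda>x. g0 x + h x) k + c\<^sup>2 * form A k k"
    if "W0 w h" "W0 w' k" for w h w' k c
    using form_expand[OF A L[OF that(1)] W0_L2(1)[OF that(2)], of c] by (simp add: J_def add.assoc)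
  have bdd: "bdd_below E" by (rule bdd_belowI[of _ 0]) (auto simp: E_def J_def intro!: form_nonneg[OF A] L)
  define m where "m = Inf E"
  have m_le: "m \<le> J h" if "W0 w h" for w h
    unfolding m_def by (rule cInf_lower[OF _ bdd]) (use that in \<open>auto simp: E_def\<close>)
  define \<delta> where "\<delta> n = inverse (real (Suc n))" for n
  have \<delta>: "\<delta> n > 0" "\<delta> \<longlonglongrightarrow> 0" for n using LIMSEQ_inverse_real_of_nat by (simp_all add: \<delta>_def[abs_def])
  have "\<forall>n. \<exists>z. W0 (fst z) (snd z) \<and> J (snd z) < m + \<delta> n"
  proof
    fix n
    have "E \<noteq> {}" using W0_zero by (auto simp: E_def)
    then have "\<exists>y\<in>E. y < m + \<delta> n" using cInf_lessD[of E "m + \<delta> n"] \<delta>(1)[of n] by (simp add: m_def)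
    then show "\<exists>z. W0 (fst z) (snd z) \<and> J (snd z) < m + \<delta> n" by (auto simp: E_def)
  qed
  from choice[OF this] obtain z where z: "\<And>n. W0 (fst (z n)) (snd (z n))" "\<And>n. J (snd (z n)) < m + \<delta> n"
    by (elim exE) (rule that; blast)
  define h where "h n = snd (z n)" for n
  have W: "W0 (fst (z n)) (h n)" and Jh: "J (h n) < m + \<delta> n" for n using z by (auto simp: h_def)
  note Lh = W0_L2(1)[OF W]
  (* the parallelogram identity, in terms of the expansion of J at h j *)
  have par: "\<alpha> * sqd (h i) (h j) \<le> 2 * \<delta> i + 2 * \<delta> j" for i j
  proof -
    let ?d = "\<lambda>x. h i x - h j x"
    have Wd: "W0 (\<lambda>x. fst (z i) x + (- 1) * fst (z j) x) (\<lambda>x. h i x + (- 1) *\<^sub>R h j x)" by (rule W0_linear[OF W W])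
    then have Wd: "W0 (\<lambda>x. fst (z i) x + (- 1) * fst (z j) x) ?d" by simp
    have 1: "J (h i) = J (h j) + 2 * form A (\<lambda>x. g0 x + h j x) ?d + form A ?d ?d"
      using J_expand[OF W[of j] Wd, of 1] by simp
    have 2: "m \<le> J (h j) + form A (\<lambda>x. g0 x + h j x) ?d + form A ?d ?d / 4"
      using J_expand[OF W[of j] Wd, of "1/2"] m_le[OF W0_linear[OF W[of j] Wd, of "1/2"]]
      by (simp add: power2_eq_square)
    have "\<alpha> * sqn ?d \<le> form A ?d ?d" by (rule form_coercive[OF A W0_L2(1)[OF Wd]])
    also have "... \<le> 2 * \<delta> i + 2 * \<delta> j" using 1 2 Jh[of i] Jh[of j] by linarith
    finally show ?thesis .
  qed
  have "\<exists>N. \<forall>i\<ge>N. \<forall>j\<ge>N. sqd (h i) (h j) < e" if "e > 0" for e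
  proof -
    have "\<forall>\<^sub>F n in sequentially. \<delta> n < \<alpha> * e / 4" using \<alpha> that by (intro order_tendstoD(2)[OF \<delta>(2)]) simp
    then obtain N where N: "\<And>n. n \<ge> N ==> \<delta> n < \<alpha> * e / 4" by (auto simp: eventually_sequentially)
    have "sqd (h i) (h j) < e" if "i \<ge> N" "j \<ge> N" for i j
    proof -
      have "\<alpha> * sqd (h i) (h j) < \<alpha> * e" using par[of i j] N[OF that(1)] N[OF that(2)] by linarith
      then show ?thesis using \<alpha> by simp
    qed
    then show ?thesis by blast
  qed
  from W0_complete[OF W this] obtain w k where wk: "W0 w k" and lim: "(\<lambda>n. sqd (h n) k) \<longlonglongrightarrow> 0" by blast
  let ?a = "\<lambda>x. g0 x + k x"
  have lim2: "(\<lambda>n. form A ?a (h n)) \<longlonglongrightarrow> form A ?a k"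
    using L2_limit_inner[OF Lh W0_L2(1)[OF wk] lim coefficient_L2[OF A L[OF wk]]]
    unfolding form_def by (simp add: inner_commute)
  have low: "J k + 2 * (form A ?a (h n) - form A ?a k) \<le> m + \<delta> n" for n
  proof -
    define d where "d = (\<lambda>x. h n x + (- 1) *\<^sub>R k x)"
    have Wd: "W0 (\<lambda>x. fst (z n) x + (- 1) * w x) d" unfolding d_def by (rule W0_linear[OF W wk])
    have "(\<lambda>x. k x + 1 *\<^sub>R d x) = h n" by (simp add: d_def)
    then have "J (h n) = J k + 2 * form A ?a d + form A d d" using J_expand[OF wk Wd, of 1] by simp
    moreover have "form A ?a d = form A ?a (h n) - form A ?a k"
      using form_linear_right[OF A L[OF wk] Lh[of n] W0_L2(1)[OF wk], of "- 1"] by (simp add: d_def)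
    ultimately have "J k + 2 * (form A ?a (h n) - form A ?a k) = J (h n) - form A d d" by simp
    also have "... \<le> m + \<delta> n" using form_nonneg[OF A W0_L2(1)[OF Wd]] Jh[of n] by linarith
    finally show ?thesis .
  qed
  have "J k + 2 * (form A ?a k - form A ?a k) \<le> m + 0"
  proof (rule LIMSEQ_le)
    show "(\<lambda>n. J k + 2 * (form A ?a (h n) - form A ?a k)) \<longlonglongrightarrow> J k + 2 * (form A ?a k - form A ?a k)"
      by (intro tendsto_intros lim2)
    show "(\<lambda>n. m + \<delta> n) \<longlonglongrightarrow> m + 0" by (intro tendsto_intros \<delta>(2))
  qed (use low in blast)
  then have Jk: "J k \<le> m" by simp
  have "form A ?a k' = 0" if k': "W0 w' k'" for w' k'
  proof -
    have "0 \<le> 0 + 2 * t * form A ?a k' + t\<^sup>2 * form A k' k'" for t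
      using Jk m_le[OF W0_linear[OF wk k', of t]] J_expand[OF wk k', of t] by simp
    from quadratic_nonneg_imp[OF this form_nonneg[OF A W0_L2(1)[OF k']]] show ?thesis by simp
  qed
  then show ?thesis using wk unfolding solves_def by blast
qed

text \<open>The mixed term vanishes by the Euler-Lagrange equation.\<close>

lemma solution_energy:
  assumes A: "coefficient A \<alpha>" and g0: "L2 lborel g0" and s: "solves A g0 w h" and W: "W0 w' k"
  shows "form A (\<lambda>x. g0 x + k x) (\<lambda>x. g0 x + k x)
     = form A (\<lambda>x. g0 x + h x) (\<lambda>x. g0 x + h x) + form A (\<lambda>x. k x - h x) (\<lambda>x. k x - h x)"
proof -
  have wh: "W0 w h" using s by (simp add: solves_def)
  have Wd: "W0 (\<lambda>x. w' x + (- 1) * w x) (\<lambda>x. k x + (- 1) *\<^sub>R h x)" by (rule W0_linear[OF W wh])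
  then have d: "form A (\<lambda>x. g0 x + h x) (\<lambda>x. k x - h x) = 0" "L2 lborel (\<lambda>x. k x - h x)"
    using s W0_L2(1)[OF Wd] by (auto simp: solves_def)
  show ?thesis using form_expand[OF A L2_add(1)[OF g0 W0_L2(1)[OF wh]] d(2), of 1] d(1) by simp
qed

text \<open>The datum itself is a competitor.\<close>

lemma solution_bound:
  assumes A: "coefficient A \<alpha>" and g0: "L2 lborel g0" and s: "solves A g0 w h"
    and c: "\<And>x q. (A x *v q) \<bullet> q \<le> c * (norm q)\<^sup>2"
  shows "\<alpha> * sqn (\<lambda>x. g0 x + h x) \<le> c * sqn g0"
proof -
  have wh: "W0 w h" using s by (simp add: solves_def)
  have "\<alpha> * sqn (\<lambda>x. g0 x + h x) \<le> form A (\<lambda>x. g0 x + h x) (\<lambda>x. g0 x + h x)"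
    by (rule form_coercive[OF A L2_add(1)[OF g0 W0_L2(1)[OF wh]]])
  also have "... \<le> form A g0 g0"
    using solution_energy[OF A g0 s W0_zero] form_nonneg[OF A L2_minus[OF W0_L2(1)[OF wh]]] by simp
  also have "... \<le> (\<integral>x. c * (norm (g0 x))\<^sup>2 \<partial>lborel)"
    unfolding form_def by (intro integral_mono form_integrable[OF A] g0 integrable_mult_right L2_integrable_sq c)
  also have "... = c * sqn g0" by (simp add: nsq_def)
  finally show ?thesis .
qed

text \<open>The difference of the two Euler-Lagrange equations is tested with the difference of the solutions.\<close>

lemma solution_stable:
  assumes A: "coefficient A \<alpha>" and A': "coefficient A' \<alpha>'" and g0: "L2 lborel g0"
    and s: "solves A g0 w h" "solves A' g0 w' h'" and \<delta>: "\<And>x. norm (A x - A' x) \<le> \<delta>"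
  shows "\<alpha>\<^sup>2 * sqd h h' \<le> \<delta>\<^sup>2 * sqn (\<lambda>x. g0 x + h' x)"
proof -
  have \<alpha>: "\<alpha> > 0" using A by (simp add: coefficient_def)
  have W: "W0 w h" "W0 w' h'" using s by (auto simp: solves_def)
  let ?d = "\<lambda>x. h x - h' x" and ?a = "\<lambda>x. g0 x + h x" and ?a' = "\<lambda>x. g0 x + h' x"
  have L: "L2 lborel ?a" "L2 lborel ?a'" using L2_add(1)[OF g0] W0_L2(1) W by blast+
  have "W0 (\<lambda>x. w x + (- 1) * w' x) (\<lambda>x. h x + (- 1) *\<^sub>R h' x)" by (rule W0_linear[OF W])
  then have Wd: "W0 (\<lambda>x. w x + (- 1) * w' x) ?d" by simp
  note Ld = W0_L2(1)[OF Wd]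
  have m: "(\<lambda>x. A' x - A x) \<in> borel_measurable borel" using A A' by (auto simp: coefficient_def)
  have nd: "norm (A' x - A x) \<le> \<delta>" for x using \<delta>[of x] by (simp add: norm_minus_commute)
  note LA = L2_bounded_matrix[OF m nd L(2)]
  have "\<alpha> * sqn ?d \<le> form A ?d ?d" by (rule form_coercive[OF A Ld])
  also have "... = form A ?a ?d - form A ?a' ?d" using form_linear_left[OF A Ld L, of "- 1"] by simp
  also have "... = form A' ?a' ?d - form A ?a' ?d" using s Wd by (simp add: solves_def)
  also have "... = (\<integral>x. ((A' x - A x) *v ?a' x) \<bullet> ?d x \<partial>lborel)"
    unfolding form_def using form_integrable[OF A L(2) Ld] form_integrable[OF A' L(2) Ld]
    by (simp add: matrix_vector_mult_diff_rdistrib inner_diff_left del: inner_diff_right)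
  finally have 1: "\<alpha> * sqn ?d \<le> (\<integral>x. ((A' x - A x) *v ?a' x) \<bullet> ?d x \<partial>lborel)" .
  have "(\<alpha> * sqn ?d)\<^sup>2 \<le> (\<integral>x. ((A' x - A x) *v ?a' x) \<bullet> ?d x \<partial>lborel)\<^sup>2" using 1 \<alpha> by (intro power_mono) auto
  also have "... \<le> sqn (\<lambda>x. (A' x - A x) *v ?a' x) * sqn ?d" by (rule L2_Cauchy_Schwarz[OF LA(1) Ld])
  also have "... \<le> (\<delta>\<^sup>2 * sqn ?a') * sqn ?d" by (intro mult_right_mono LA(2)) simp
  finally have "(\<alpha>\<^sup>2 * sqn ?d) * sqn ?d \<le> (\<delta>\<^sup>2 * sqn ?a') * sqn ?d" by (simp add: power2_eq_square ac_simps)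
  then show ?thesis
    using nsq_nonneg[of lborel ?d] by (cases "sqn ?d = 0") (auto simp: mult_le_cancel_right less_le)
qed

end

section \<open>Gaussian smoothing\<close>

definition gauss_gradient :: "real => real^2 => real^2" where
  "gauss_gradient \<sigma> z = (- gauss_kernel \<sigma> z / \<sigma>\<^sup>2) *\<^sub>R z"

lemma gauss_kernel_has_derivative:
  assumes "\<sigma> > 0"
  shows "(gauss_kernel \<sigma> has_derivative (\<lambda>h. gauss_gradient \<sigma> z \<bullet> h)) (at z)"
proof -
  define c d where "c = 1 / (2 * pi * \<sigma>\<^sup>2)" and "d = - (1 / (2 * \<sigma>\<^sup>2))"
  have k: "gauss_kernel \<sigma> = (\<lambda>z. c * exp (d * (z \<bullet> z)))"
    by (simp add: gauss_kernel_def power2_norm_eq_inner fun_eq_iff c_def d_def)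
  have "((\<lambda>z. c * exp (d * (z \<bullet> z))) has_derivative (\<lambda>h. c * (exp (d * (z \<bullet> z)) * (d * (z \<bullet> h + h \<bullet> z))))) (at z)"
    by (auto intro!: derivative_eq_intros simp: fun_eq_iff algebra_simps)
  moreover have "c * (exp (d * (z \<bullet> z)) * (d * (z \<bullet> h + h \<bullet> z))) = gauss_gradient \<sigma> z \<bullet> h" for h
    by (simp add: gauss_gradient_def k inner_commute[of h] d_def)
  ultimately show ?thesis unfolding k by (simp only:)
qed

lemma gauss_gradient_has_derivative:
  assumes "\<sigma> > 0"
  shows "(gauss_gradient \<sigma> has_derivative
    (\<lambda>h. (- gauss_kernel \<sigma> z / \<sigma>\<^sup>2) *\<^sub>R h + (- (gauss_gradient \<sigma> z \<bullet> h) / \<sigma>\<^sup>2) *\<^sub>R z)) (at z)"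
proof -
  have "((\<lambda>z. - gauss_kernel \<sigma> z / \<sigma>\<^sup>2) has_derivative (\<lambda>h. - (gauss_gradient \<sigma> z \<bullet> h) / \<sigma>\<^sup>2)) (at z)"
    using has_derivative_mult_right[OF gauss_kernel_has_derivative[OF assms], of "- 1 / \<sigma>\<^sup>2"] by simp
  from has_derivative_scaleR[OF this has_derivative_ident] show ?thesis
    by (simp add: gauss_gradient_def[abs_def])
qed

text \<open>
  In terms of s = |z|^2 / (2 \<sigma>^2) all bounds reduce to the inequality 1 + s \<le> exp s. The last two come from the bound
  for the second derivative of the kernel.
\<close>

lemma gauss_bounds:
  assumes \<sigma>: "\<sigma> > 0"
  obtains M where "M \<ge> 0" "\<And>z. norm (gauss_gradient \<sigma> z) \<le> M"
    "\<And>y z. norm (gauss_gradient \<sigma> y - gauss_gradient \<sigma> z) \<le> M * norm (y - z)"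
    "\<And>y z. \<bar>gauss_kernel \<sigma> y - gauss_kernel \<sigma> z - gauss_gradient \<sigma> z \<bullet> (y - z)\<bar> \<le> M * (norm (y - z))\<^sup>2"
proof -
  define c where "c = 1 / (2 * pi * \<sigma>\<^sup>2)"
  have c: "c > 0" using \<sigma> by (simp add: c_def)
  define s where "s z = (norm z)\<^sup>2 / (2 * \<sigma>\<^sup>2)" for z :: "real^2"
  have s: "s z \<ge> 0" for z by (simp add: s_def)
  have k: "gauss_kernel \<sigma> z = c * exp (- s z)" for z by (simp add: gauss_kernel_def c_def s_def)
  have k0: "gauss_kernel \<sigma> z \<ge> 0" for z using c by (simp add: k)
  have ng: "norm (gauss_gradient \<sigma> z) = gauss_kernel \<sigma> z / \<sigma>\<^sup>2 * norm z" for z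
    using k0[of z] by (simp add: gauss_gradient_def)
  have ex: "(1 + a * s z) * exp (- s z) \<le> a" if "a \<ge> 1" for a z
  proof -
    have "1 + a * s z \<le> a * (1 + s z)" using that s[of z] by (simp add: algebra_simps)
    also have "... \<le> a * exp (s z)" using that exp_ge_add_one_self[of "s z"] by (intro mult_left_mono) auto
    finally show ?thesis by (simp add: exp_minus field_simps)
  qed
  have b0: "norm (gauss_gradient \<sigma> z) \<le> c / \<sigma>" for z
  proof -
    have "0 \<le> (norm z / \<sigma> - 1)\<^sup>2" by simp
    then have "2 * (norm z / \<sigma>) \<le> 1 + (norm z / \<sigma>)\<^sup>2" by (simp only: power2_diff) simp
    moreover have "(norm z / \<sigma>)\<^sup>2 = 2 * s z" by (simp add: s_def power_divide)
    ultimately have "norm z / \<sigma> \<le> 1 + 1 * s z" by linarith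
    then have "norm z / \<sigma> * exp (- s z) \<le> (1 + 1 * s z) * exp (- s z)" by (intro mult_right_mono) auto
    also have "... \<le> 1" by (rule ex) simp
    finally have "c / \<sigma> * (norm z / \<sigma> * exp (- s z)) \<le> c / \<sigma> * 1" using c \<sigma> by (intro mult_left_mono) auto
    then show ?thesis by (simp add: ng k power2_eq_square ac_simps)
  qed
  define L where "L = 2 * c / \<sigma>\<^sup>2"
  have L: "L \<ge> 0" using c by (simp add: L_def)
  have b1: "norm ((- gauss_kernel \<sigma> z / \<sigma>\<^sup>2) *\<^sub>R h + (- (gauss_gradient \<sigma> z \<bullet> h) / \<sigma>\<^sup>2) *\<^sub>R z) \<le> L * norm h" for z h
  proof -
    have "norm ((- gauss_kernel \<sigma> z / \<sigma>\<^sup>2) *\<^sub>R h + (- (gauss_gradient \<sigma> z \<bullet> h) / \<sigma>\<^sup>2) *\<^sub>R z)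
       \<le> norm ((- gauss_kernel \<sigma> z / \<sigma>\<^sup>2) *\<^sub>R h) + norm ((- (gauss_gradient \<sigma> z \<bullet> h) / \<sigma>\<^sup>2) *\<^sub>R z)"
      by (rule norm_triangle_ineq)
    also have "... = gauss_kernel \<sigma> z / \<sigma>\<^sup>2 * norm h + \<bar>gauss_gradient \<sigma> z \<bullet> h\<bar> / \<sigma>\<^sup>2 * norm z"
      using k0[of z] by simp
    also have "... \<le> gauss_kernel \<sigma> z / \<sigma>\<^sup>2 * norm h + (norm (gauss_gradient \<sigma> z) * norm h) / \<sigma>\<^sup>2 * norm z"
      by (intro add_left_mono mult_right_mono divide_right_mono Cauchy_Schwarz_ineq2) auto
    also have "... = c / \<sigma>\<^sup>2 * ((1 + 2 * s z) * exp (- s z)) * norm h"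
      using \<sigma> by (simp add: ng k s_def power2_eq_square field_simps)
    also have "... \<le> c / \<sigma>\<^sup>2 * 2 * norm h" using c by (intro mult_right_mono mult_left_mono ex) auto
    finally show ?thesis by (simp add: L_def mult.commute[of 2])
  qed
  have lip: "norm (gauss_gradient \<sigma> y - gauss_gradient \<sigma> z) \<le> L * norm (y - z)" for y z
  proof (rule differentiable_bound[OF convex_UNIV])
    show "(gauss_gradient \<sigma> has_derivative
      (\<lambda>h. (- gauss_kernel \<sigma> x / \<sigma>\<^sup>2) *\<^sub>R h + (- (gauss_gradient \<sigma> x \<bullet> h) / \<sigma>\<^sup>2) *\<^sub>R x)) (at x within UNIV)" for x
      using gauss_gradient_has_derivative[OF \<sigma>] by simp
    show "onorm (\<lambda>h. (- gauss_kernel \<sigma> x / \<sigma>\<^sup>2) *\<^sub>R h + (- (gauss_gradient \<sigma> x \<bullet> h) / \<sigma>\<^sup>2) *\<^sub>R x) \<le> L" for x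
      by (rule onorm_bound[OF L b1])
  qed auto
  have tay: "\<bar>gauss_kernel \<sigma> y - gauss_kernel \<sigma> z - gauss_gradient \<sigma> z \<bullet> (y - z)\<bar> \<le> L * (norm (y - z))\<^sup>2" for y z
  proof -
    have "norm ((gauss_kernel \<sigma> y - gauss_gradient \<sigma> z \<bullet> y) - (gauss_kernel \<sigma> z - gauss_gradient \<sigma> z \<bullet> z))
       \<le> (L * norm (y - z)) * norm (y - z)"
    proof (rule differentiable_bound[OF convex_cball[of z "norm (y - z)"]])
      fix x assume x: "x \<in> cball z (norm (y - z))"
      show "((\<lambda>y. gauss_kernel \<sigma> y - gauss_gradient \<sigma> z \<bullet> y) has_derivative
          (\<lambda>h. gauss_gradient \<sigma> x \<bullet> h - gauss_gradient \<sigma> z \<bullet> h)) (at x within cball z (norm (y - z)))"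
        by (intro has_derivative_diff has_derivative_inner_right has_derivative_ident
          has_derivative_at_withinI[OF gauss_kernel_has_derivative[OF \<sigma>]])
      show "onorm (\<lambda>h. gauss_gradient \<sigma> x \<bullet> h - gauss_gradient \<sigma> z \<bullet> h) \<le> L * norm (y - z)"
      proof (rule onorm_bound)
        fix h
        have "norm (gauss_gradient \<sigma> x \<bullet> h - gauss_gradient \<sigma> z \<bullet> h) \<le> norm (gauss_gradient \<sigma> x - gauss_gradient \<sigma> z) * norm h"
          using Cauchy_Schwarz_ineq2[of "gauss_gradient \<sigma> x - gauss_gradient \<sigma> z" h] by (simp add: inner_diff_left)
        also have "... \<le> (L * norm (x - z)) * norm h" by (intro mult_right_mono lip) simp
        also have "... \<le> (L * norm (y - z)) * norm h"
          using x L by (intro mult_right_mono mult_left_mono) (auto simp: dist_norm norm_minus_commute)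
        finally show "norm (gauss_gradient \<sigma> x \<bullet> h - gauss_gradient \<sigma> z \<bullet> h) \<le> L * norm (y - z) * norm h" .
      qed (use L in simp)
    qed (auto simp: dist_norm norm_minus_commute)
    then show ?thesis by (simp add: power2_eq_square inner_diff_right algebra_simps)
  qed
  define M where "M = max (c / \<sigma>) L"
  have M: "c / \<sigma> \<le> M" "L \<le> M" by (auto simp: M_def)
  show thesis
  proof (rule that[of M])
    show "M \<ge> 0" using L M by linarith
    show "norm (gauss_gradient \<sigma> z) \<le> M" for z using b0[of z] M by linarith
    show "norm (gauss_gradient \<sigma> y - gauss_gradient \<sigma> z) \<le> M * norm (y - z)" for y z
      using lip[of y z] mult_right_mono[OF M(2) norm_ge_zero[of "y - z"]] by linarith
    show "\<bar>gauss_kernel \<sigma> y - gauss_kernel \<sigma> z - gauss_gradient \<sigma> z \<bullet> (y - z)\<bar> \<le> M * (norm (y - z))\<^sup>2" for y z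
      using tay[of y z] mult_right_mono[OF M(2) zero_le_power2[of "norm (y - z)"]] by linarith
  qed
qed

lemma gauss_gradient_borel: "\<sigma> > 0 ==> (\<lambda>z. gauss_gradient \<sigma> (x - z)) \<in> borel_measurable borel"
  and gauss_kernel_borel: "\<sigma> > 0 ==> (\<lambda>z. gauss_kernel \<sigma> (x - z)) \<in> borel_measurable borel"
proof -
  assume \<sigma>: "\<sigma> > 0"
  have "continuous_on UNIV (gauss_gradient \<sigma>)" "continuous_on UNIV (gauss_kernel \<sigma>)"
    using has_derivative_continuous[OF gauss_gradient_has_derivative[OF \<sigma>]]
      has_derivative_continuous[OF gauss_kernel_has_derivative[OF \<sigma>]]
    by (auto simp: continuous_on_eq_continuous_at)
  note c = this
  have "continuous_on UNIV (\<lambda>z. x - z)" by (intro continuous_intros)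
  then have "continuous_on UNIV (\<lambda>z. gauss_gradient \<sigma> (x - z))" "continuous_on UNIV (\<lambda>z. gauss_kernel \<sigma> (x - z))"
    using continuous_on_compose2[OF c(1)] continuous_on_compose2[OF c(2)] by blast+
  from this show "(\<lambda>z. gauss_gradient \<sigma> (x - z)) \<in> borel_measurable borel"
    "(\<lambda>z. gauss_kernel \<sigma> (x - z)) \<in> borel_measurable borel"
    by - (rule borel_measurable_continuous_onI; assumption)+
qed

lemma gauss_kernel_bounded:
  assumes "\<sigma> > 0"
  shows "\<bar>gauss_kernel \<sigma> z\<bar> \<le> 1 / (2 * pi * \<sigma>\<^sup>2)"
proof -
  have "exp (- (norm z)\<^sup>2 / (2 * \<sigma>\<^sup>2)) \<le> 1" by simp
  then have "1 / (2 * pi * \<sigma>\<^sup>2) * exp (- (norm z)\<^sup>2 / (2 * \<sigma>\<^sup>2)) \<le> 1 / (2 * pi * \<sigma>\<^sup>2) * 1"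
    by (intro mult_left_mono) auto
  then show ?thesis by (simp add: gauss_kernel_def abs_mult)
qed

definition smoothed_gradient :: "real => (real^2 => real) => real^2 => real^2" where
  "smoothed_gradient \<sigma> v x = (\<integral>z. v z *\<^sub>R gauss_gradient \<sigma> (x - z) \<partial>lborel)"

lemma smoothed_gradient_integrable:
  assumes "\<sigma> > 0" "integrable lborel v"
  shows "integrable lborel (\<lambda>z. v z *\<^sub>R gauss_gradient \<sigma> (x - z))"
proof (rule gauss_bounds[OF assms(1)])
  fix M :: real assume "\<And>z. norm (gauss_gradient \<sigma> z) \<le> M"
  moreover have "(\<lambda>z. gauss_gradient \<sigma> (x - z)) \<in> borel_measurable lborel"
    unfolding measurable_lborel2 by (rule gauss_gradient_borel[OF assms(1)])
  ultimately show ?thesis by (intro integrable_bounded_mult'[OF assms(2)])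
qed

text \<open>The quadratic bound for the remainder of the kernel is integrated against v.\<close>

lemma gauss_smoothing_has_derivative:
  assumes \<sigma>: "\<sigma> > 0" and v: "integrable lborel v"
  shows "((\<lambda>x. \<integral>z. gauss_kernel \<sigma> (x - z) * v z \<partial>lborel) has_derivative (\<lambda>h. smoothed_gradient \<sigma> v x \<bullet> h)) (at x)"
proof (rule gauss_bounds[OF \<sigma>])
  fix M :: real assume M: "M \<ge> 0"
    and tay: "\<And>y z. \<bar>gauss_kernel \<sigma> y - gauss_kernel \<sigma> z - gauss_gradient \<sigma> z \<bullet> (y - z)\<bar> \<le> M * (norm (y - z))\<^sup>2"
  let ?U = "\<lambda>x. \<integral>z. gauss_kernel \<sigma> (x - z) * v z \<partial>lborel" and ?P = "smoothed_gradient \<sigma> v x"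
  let ?V = "\<integral>z. \<bar>v z\<bar> \<partial>lborel"
  have iU: "integrable lborel (\<lambda>z. gauss_kernel \<sigma> (y - z) * v z)" for y
  proof -
    have "(\<lambda>z. gauss_kernel \<sigma> (y - z)) \<in> borel_measurable lborel"
      unfolding measurable_lborel2 by (rule gauss_kernel_borel[OF \<sigma>])
    from integrable_bounded_mult[OF v this gauss_kernel_bounded[OF \<sigma>]] show ?thesis by simp
  qed
  have est: "\<bar>?U y - ?U x - ?P \<bullet> (y - x)\<bar> \<le> M * (norm (y - x))\<^sup>2 * ?V" for y
  proof -
    let ?f = "\<lambda>z. gauss_kernel \<sigma> (y - z) * v z - gauss_kernel \<sigma> (x - z) * v z - (v z *\<^sub>R gauss_gradient \<sigma> (x - z)) \<bullet> (y - x)"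
    have iP: "integrable lborel (\<lambda>z. (v z *\<^sub>R gauss_gradient \<sigma> (x - z)) \<bullet> (y - x))"
      by (intro integrable_inner_left smoothed_gradient_integrable[OF \<sigma> v])
    have "?P \<bullet> (y - x) = (\<integral>z. (v z *\<^sub>R gauss_gradient \<sigma> (x - z)) \<bullet> (y - x) \<partial>lborel)"
      unfolding smoothed_gradient_def
      by (intro integral_inner_left[symmetric] smoothed_gradient_integrable[OF \<sigma> v])
    then have "?U y - ?U x - ?P \<bullet> (y - x) = (\<integral>z. ?f z \<partial>lborel)"
      using iU iP by (simp only: Bochner_Integration.integral_diff[OF Bochner_Integration.integrable_diff[OF iU iU] iP]
        Bochner_Integration.integral_diff[OF iU iU])
    also have "\<bar>...\<bar> \<le> (\<integral>z. M * (norm (y - x))\<^sup>2 * \<bar>v z\<bar> \<partial>lborel)"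
    proof (rule integral_abs_bound_integral)
      show "integrable lborel ?f" by (intro Bochner_Integration.integrable_diff iU iP)
      show "integrable lborel (\<lambda>z. M * (norm (y - x))\<^sup>2 * \<bar>v z\<bar>)" by (intro integrable_mult_right integrable_abs v)
      fix z
      have "?f z = (gauss_kernel \<sigma> (y - z) - gauss_kernel \<sigma> (x - z) - gauss_gradient \<sigma> (x - z) \<bullet> ((y - z) - (x - z))) * v z"
        by (simp add: algebra_simps)
      also have "\<bar>...\<bar> \<le> M * (norm ((y - z) - (x - z)))\<^sup>2 * \<bar>v z\<bar>"
        unfolding abs_mult by (intro mult_right_mono tay) simp
      finally show "\<bar>?f z\<bar> \<le> M * (norm (y - x))\<^sup>2 * \<bar>v z\<bar>" by simp
    qed
    also have "... = M * (norm (y - x))\<^sup>2 * ?V" by simp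
    finally show ?thesis .
  qed
  show ?thesis
  proof (rule has_derivativeI_sandwich[of 1])
    show "bounded_linear (\<lambda>h. ?P \<bullet> h)" by (rule bounded_linear_inner_right)
    show "norm (?U y - ?U x - ?P \<bullet> (y - x)) / norm (y - x) \<le> M * ?V * norm (y - x)" if "y \<noteq> x" for y
      using est[of y] that by (simp add: pos_divide_le_eq power2_eq_square ac_simps)
    have "((\<lambda>y. M * ?V * norm (y - x)) \<longlongrightarrow> M * ?V * norm (x - x)) (at x)" by (intro tendsto_intros)
    then show "((\<lambda>y. M * ?V * norm (y - x)) \<longlongrightarrow> 0) (at x)" by simp
  qed simp
qed

lemma gradient_smoothed:
  assumes \<sigma>: "\<sigma> > 0" and G: "open G" "bounded G" and v: "represents G u v g"
  shows "gradient (smoothed G \<sigma> u) x = smoothed_gradient \<sigma> v x"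
proof -
  have H: "H1 G v g" using v by (simp add: represents_def)
  have "smoothed G \<sigma> u x = (\<integral>z. gauss_kernel \<sigma> (x - z) * v z \<partial>lborel)" for x
    unfolding smoothed_def
  proof (rule lebesgue_on_integral_AE_borel[OF G(1)])
    show "(\<lambda>z. gauss_kernel \<sigma> (x - z) * v z) \<in> borel_measurable borel"
      by (intro borel_measurable_times gauss_kernel_borel[OF \<sigma>] H1_borel(1)[OF H])
    have "AE z in lebesgue_on G. u z = v z" using v by (simp add: represents_def)
    then show "AE z in lebesgue_on G. gauss_kernel \<sigma> (x - z) * u z = gauss_kernel \<sigma> (x - z) * v z"
      by eventually_elim simp
  qed (simp add: H1_outside(1)[OF H])
  then show ?thesis
    using gradient_eqI[OF gauss_smoothing_has_derivative[OF \<sigma> H1_integrable(1)[OF H G(2)], unfolded inner_commute[of "smoothed_gradient \<sigma> v _"]]]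
    by presburger
qed

lemma smoothed_gradient_bounds:
  assumes \<sigma>: "\<sigma> > 0"
  obtains M where "M \<ge> 0" "\<And>v x. integrable lborel v ==> norm (smoothed_gradient \<sigma> v x) \<le> M * (\<integral>z. \<bar>v z\<bar> \<partial>lborel)"
    "\<And>v x y. integrable lborel v ==>
       norm (smoothed_gradient \<sigma> v x - smoothed_gradient \<sigma> v y) \<le> M * (\<integral>z. \<bar>v z\<bar> \<partial>lborel) * norm (x - y)"
proof (rule gauss_bounds[OF \<sigma>])
  fix M :: real assume M: "M \<ge> 0" "\<And>z. norm (gauss_gradient \<sigma> z) \<le> M"
    "\<And>y z. norm (gauss_gradient \<sigma> y - gauss_gradient \<sigma> z) \<le> M * norm (y - z)"
  show thesis
  proof (rule that[OF M(1)])
    fix v :: "real^2 => real" and x y :: "real^2" assume v: "integrable lborel v"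
    have "norm (smoothed_gradient \<sigma> v x) \<le> (\<integral>z. M * \<bar>v z\<bar> \<partial>lborel)"
      unfolding smoothed_gradient_def
    proof (rule Bochner_Integration.integral_norm_bound_integral)
      show "integrable lborel (\<lambda>z. v z *\<^sub>R gauss_gradient \<sigma> (x - z))" by (rule smoothed_gradient_integrable[OF \<sigma> v])
      show "integrable lborel (\<lambda>z. M * \<bar>v z\<bar>)" by (intro integrable_mult_right integrable_abs v)
      show "norm (v z *\<^sub>R gauss_gradient \<sigma> (x - z)) \<le> M * \<bar>v z\<bar>" for z
        using mult_right_mono[OF M(2)[of "x - z"] abs_ge_zero[of "v z"]] by (simp add: mult.commute)
    qed
    then show "norm (smoothed_gradient \<sigma> v x) \<le> M * (\<integral>z. \<bar>v z\<bar> \<partial>lborel)" by simp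
    have "smoothed_gradient \<sigma> v x - smoothed_gradient \<sigma> v y
       = (\<integral>z. v z *\<^sub>R gauss_gradient \<sigma> (x - z) - v z *\<^sub>R gauss_gradient \<sigma> (y - z) \<partial>lborel)"
      unfolding smoothed_gradient_def
      by (rule Bochner_Integration.integral_diff[symmetric]; rule smoothed_gradient_integrable[OF \<sigma> v])
    also have "norm ... \<le> (\<integral>z. (M * norm (x - y)) * \<bar>v z\<bar> \<partial>lborel)"
    proof (rule Bochner_Integration.integral_norm_bound_integral)
      show "integrable lborel (\<lambda>z. v z *\<^sub>R gauss_gradient \<sigma> (x - z) - v z *\<^sub>R gauss_gradient \<sigma> (y - z))"
        by (intro Bochner_Integration.integrable_diff smoothed_gradient_integrable[OF \<sigma> v])
      show "integrable lborel (\<lambda>z. (M * norm (x - y)) * \<bar>v z\<bar>)" by (intro integrable_mult_right integrable_abs v)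
      fix z
      have "norm (v z *\<^sub>R gauss_gradient \<sigma> (x - z) - v z *\<^sub>R gauss_gradient \<sigma> (y - z))
         = \<bar>v z\<bar> * norm (gauss_gradient \<sigma> (x - z) - gauss_gradient \<sigma> (y - z))"
        by (simp only: scaleR_diff_right[symmetric] norm_scaleR)
      also have "... \<le> \<bar>v z\<bar> * (M * norm ((x - z) - (y - z)))" by (intro mult_left_mono M(3)) simp
      finally show "norm (v z *\<^sub>R gauss_gradient \<sigma> (x - z) - v z *\<^sub>R gauss_gradient \<sigma> (y - z)) \<le> (M * norm (x - y)) * \<bar>v z\<bar>"
        by (simp add: mult.commute)
    qed
    finally show "norm (smoothed_gradient \<sigma> v x - smoothed_gradient \<sigma> v y) \<le> M * (\<integral>z. \<bar>v z\<bar> \<partial>lborel) * norm (x - y)"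
      by (simp add: ac_simps)
  qed
qed

lemma smoothed_gradient_diff:
  assumes "\<sigma> > 0" "integrable lborel v" "integrable lborel w"
  shows "smoothed_gradient \<sigma> v x - smoothed_gradient \<sigma> w x = smoothed_gradient \<sigma> (\<lambda>z. v z - w z) x"
  unfolding smoothed_gradient_def scaleR_diff_left
  by (rule Bochner_Integration.integral_diff[symmetric]; rule smoothed_gradient_integrable[OF assms(1)]; fact)

lemma L1_le_L2:
  fixes v :: "'a::euclidean_space => real"
  assumes v: "L2 lborel v" and G: "bounded G" "G \<in> sets borel" "\<And>x. x \<notin> G ==> v x = 0"
  shows "(\<integral>z. \<bar>v z\<bar> \<partial>lborel)\<^sup>2 \<le> measure lborel G * sqn v"
proof -
  have fin: "emeasure lborel G < \<infinity>" using emeasure_bounded_finite[OF G(1)] by simp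
  let ?i = "indicator G :: 'a => real"
  have sq: "(norm (?i x))\<^sup>2 = ?i x" for x by (simp add: indicator_def)
  have i: "L2 lborel ?i" unfolding L2_def sq using fin G(2) by auto
  have n: "sqn ?i = measure lborel G" unfolding nsq_def sq using G(2) by simp
  have a: "L2 lborel (\<lambda>x. \<bar>v x\<bar>)" using v by (auto simp: L2_def intro: borel_measurable_abs)
  have "(\<integral>z. \<bar>v z\<bar> \<partial>lborel) = (\<integral>z. ?i z \<bullet> \<bar>v z\<bar> \<partial>lborel)"
    using G(3) by (intro Bochner_Integration.integral_cong) (auto simp: indicator_def)
  then show ?thesis using L2_Cauchy_Schwarz[OF i a] n by (simp add: nsq_def)
qed

section \<open>A fixed point theorem of Schauder type\<close>

text \<open>
  Kuhn's lemma on the grid of mesh 1/p. The label of a grid point in direction i tells whether F moves it up or down in that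
  direction; a point with coordinate 1 cannot be moved up and is labelled accordingly. In the cell that Kuhn's lemma
  provides, each direction carries both labels, so that F almost fixes its corners.
\<close>

lemma approximate_fixed_point_cube:
  fixes F :: "('i => real) => 'i => real"
  assumes I: "finite I"
    and maps: "\<And>x i. \<forall>j\<in>I. x j \<in> {0..1} ==> i \<in> I ==> F x i \<in> {0..1}"
    and unif: "\<And>e. e > 0 ==> \<exists>d>0. \<forall>x y. (\<forall>j\<in>I. x j \<in> {0..1}) --> (\<forall>j\<in>I. y j \<in> {0..1}) -->
       (\<forall>j\<in>I. \<bar>x j - y j\<bar> \<le> d) --> (\<forall>i\<in>I. \<bar>F x i - F y i\<bar> \<le> e)"
    and e: "e > 0"
  shows "\<exists>x. (\<forall>j\<in>I. x j \<in> {0..1}) \<and> (\<forall>i\<in>I. \<bar>F x i - x i\<bar> \<le> e)"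
proof -
  define n where "n = card I"
  obtain h where h: "bij_betw h I {0..<n}" using ex_bij_betw_finite_nat[OF I] by (auto simp: n_def)
  define k where "k = inv_into I h"
  have hn: "h j < n" if "j \<in> I" for j using bij_betwE[OF h] that by auto
  have kh: "k (h j) = j" if "j \<in> I" for j using bij_betw_inv_into_left[OF h that] by (simp add: k_def)
  have kI: "k i \<in> I" "h (k i) = i" if "i < n" for i
    using bij_betwE[OF bij_betw_inv_into[OF h]] bij_betw_inv_into_right[OF h] that by (auto simp: k_def)
  obtain d where d: "d > 0" "\<And>x y i. \<forall>j\<in>I. x j \<in> {0..1} ==> \<forall>j\<in>I. y j \<in> {0..1} ==>
       \<forall>j\<in>I. \<bar>x j - y j\<bar> \<le> d ==> i \<in> I ==> \<bar>F x i - F y i\<bar> \<le> e / 2" using unif[of "e / 2"] e by auto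
  obtain p where p: "p > 0" "inverse (real p) < min d (e / 2)"
    using ex_inverse_of_nat_less[of "min d (e / 2)"] d(1) e by auto
  define pt where "pt q j = real (q (h j)) / real p" for q j
  define label where "label q i = (if q i \<noteq> p \<and> real (q i) / real p \<le> F (pt q) (k i) then 0 else 1 :: nat)" for q i
  have cube: "\<forall>j\<in>I. pt q j \<in> {0..1}" if "\<forall>i<n. q i \<le> p" for q using that hn p(1) by (auto simp: pt_def)
  obtain q where q: "\<forall>i<n. q i < p"
    and rs: "\<forall>i<n. \<exists>r s. (\<forall>j<n. q j \<le> r j \<and> r j \<le> q j + 1) \<and> (\<forall>j<n. q j \<le> s j \<and> s j \<le> q j + 1) \<and> label r i \<noteq> label s i"
  proof (rule kuhn_lemma[of p n label])
    show "0 < p" by (rule p(1))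
    show "\<forall>x. (\<forall>i<n. x i \<le> p) --> (\<forall>i<n. label x i = 0 \<or> label x i = 1)" by (simp add: label_def)
    show "\<forall>x. (\<forall>i<n. x i \<le> p) --> (\<forall>i<n. x i = p --> label x i = 1)" by (simp add: label_def)
    show "\<forall>x. (\<forall>i<n. x i \<le> p) --> (\<forall>i<n. x i = 0 --> label x i = 0)"
    proof (intro allI impI)
      fix x :: "nat => nat" and i assume x: "\<forall>i<n. x i \<le> p" "i < n" "x i = 0"
      have "0 \<le> F (pt x) (k i)" using maps[OF cube[OF x(1)] kI(1)[OF x(2)]] by simp
      then show "label x i = 0" using x p(1) by (simp add: label_def)
    qed
  qed
  have qp: "\<forall>i<n. q i \<le> p" using q by (simp add: less_imp_le)
  have "\<bar>F (pt q) i - pt q i\<bar> \<le> e" if i: "i \<in> I" for i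
  proof -
    have neighbour: "\<bar>F (pt q) i - F (pt r) i\<bar> \<le> e / 2 \<and> (\<forall>j<n. r j \<le> p)"
      if r: "\<forall>j<n. q j \<le> r j \<and> r j \<le> q j + 1" for r
    proof
      show rp: "\<forall>j<n. r j \<le> p" using r q by (metis Suc_eq_plus1 Suc_leI le_trans)
      show "\<bar>F (pt q) i - F (pt r) i\<bar> \<le> e / 2"
      proof (rule d(2)[OF cube[OF qp] cube[OF rp] _ i], intro ballI)
        fix j assume "j \<in> I"
        then have "q (h j) \<le> r (h j)" "r (h j) \<le> q (h j) + 1" using r hn by auto
        then have "\<bar>real (q (h j)) - real (r (h j))\<bar> \<le> 1" by linarith
        then have "\<bar>real (q (h j)) - real (r (h j))\<bar> / real p \<le> 1 / real p" by (intro divide_right_mono) auto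
        also have "\<bar>real (q (h j)) - real (r (h j))\<bar> / real p = \<bar>pt q j - pt r j\<bar>"
          by (simp add: pt_def diff_divide_distrib[symmetric])
        finally show "\<bar>pt q j - pt r j\<bar> \<le> d" using p(2) by (simp add: inverse_eq_divide)
      qed
    qed
    have zero: "pt q i - e / 2 \<le> F (pt q) i"
      if r: "\<forall>j<n. q j \<le> r j \<and> r j \<le> q j + 1" and l: "label r (h i) = 0" for r
    proof -
      have "real (r (h i)) / real p \<le> F (pt r) i" using l kh[OF i] by (simp add: label_def split: if_splits)
      moreover have "pt q i \<le> real (r (h i)) / real p"
        unfolding pt_def using r hn[OF i] by (intro divide_right_mono) auto
      ultimately show ?thesis using neighbour[OF r] by linarith
    qed
    have one: "F (pt q) i \<le> pt q i + e"
      if r: "\<forall>j<n. q j \<le> r j \<and> r j \<le> q j + 1" and l: "label r (h i) \<noteq> 0" for r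
    proof -
      have "F (pt r) i \<le> 1" using maps[OF cube i] neighbour[OF r] by simp
      have "F (pt r) i \<le> real (r (h i)) / real p"
      proof (cases "r (h i) = p")
        case True
        then show ?thesis using \<open>F (pt r) i \<le> 1\<close> p(1) by simp
      next
        case False
        then show ?thesis using l kh[OF i] by (simp add: label_def split: if_splits)
      qed
      moreover have "real (r (h i)) \<le> real (q (h i)) + 1" using r hn[OF i] by (metis of_nat_1 of_nat_add of_nat_le_iff)
      then have "real (r (h i)) / real p \<le> (real (q (h i)) + 1) / real p" by (intro divide_right_mono) auto
      then have "real (r (h i)) / real p \<le> pt q i + inverse (real p)"
        by (simp add: pt_def add_divide_distrib inverse_eq_divide)
      ultimately show ?thesis using neighbour[OF r] p(2) by linarith
    qed
    obtain r s where "\<forall>j<n. q j \<le> r j \<and> r j \<le> q j + 1" "\<forall>j<n. q j \<le> s j \<and> s j \<le> q j + 1"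
      "label r (h i) \<noteq> label s (h i)" using rs hn[OF i] by blast
    moreover have "label r (h i) = 0 \<or> label s (h i) = 0"
      using calculation(3) by (simp add: label_def split: if_splits)
    ultimately have "pt q i - e / 2 \<le> F (pt q) i \<and> F (pt q) i \<le> pt q i + e" using zero one by metis
    then show ?thesis using e by (simp add: abs_le_iff)
  qed
  then show ?thesis using cube[OF qp] by blast
qed

lemma norm_le_DIM:
  fixes u :: "'b::euclidean_space" and c :: real
  assumes "\<And>b. b \<in> Basis ==> \<bar>u \<bullet> b\<bar> \<le> c"
  shows "norm u \<le> DIM('b) * c"
  using order_trans[OF norm_le_l1 sum_mono[of Basis "\<lambda>b. \<bar>u \<bullet> b\<bar>" "\<lambda>_. c"]] assms by simp

text \<open>A partition of unity by tent functions on a finite net.\<close>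

lemma interpolation_weights:
  fixes X :: "'a::metric_space set"
  assumes "compact X" "\<eta> > 0"
  obtains A w where "finite A" "A \<subseteq> X" "\<And>a. continuous_on X (w a)" "\<And>a x. x \<in> X ==> 0 \<le> (w a x :: real)"
    "\<And>x. x \<in> X ==> (\<Sum>a\<in>A. w a x) = 1" "\<And>a x. x \<in> X ==> w a x \<noteq> 0 ==> dist a x < \<eta>"
proof -
  obtain A where A: "A \<subseteq> X" "finite A" "X \<subseteq> (\<Union>a\<in>A. ball a \<eta>)"
    by (rule compactE_image[OF assms(1), of X "\<lambda>a. ball a \<eta>"]) (use assms(2) in auto)
  define \<psi> where "\<psi> a x = max 0 (\<eta> - dist a x)" for a x :: 'a
  define \<Psi> where "\<Psi> x = (\<Sum>a\<in>A. \<psi> a x)" for x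
  have pos: "\<Psi> x > 0" if "x \<in> X" for x
  proof -
    have "x \<in> (\<Union>a\<in>A. ball a \<eta>)" using A(3) that by blast
    then obtain a where a: "a \<in> A" "dist a x < \<eta>" by auto
    have "0 < \<psi> a x" using a(2) by (simp add: \<psi>_def)
    then show ?thesis unfolding \<Psi>_def by (intro sum_pos2[OF A(2) a(1)]) (auto simp: \<psi>_def)
  qed
  show thesis
  proof (rule that[of A "\<lambda>a x. \<psi> a x / \<Psi> x"])
    show "continuous_on X (\<lambda>x. \<psi> a x / \<Psi> x)" for a
    proof (rule continuous_on_divide)
      show "continuous_on X (\<psi> a)" "continuous_on X \<Psi>"
        unfolding \<psi>_def[abs_def] \<Psi>_def[abs_def] by (intro continuous_intros)+
      show "\<forall>x\<in>X. \<Psi> x \<noteq> 0" using pos less_numeral_extra(3) by metis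
    qed
    show "0 \<le> \<psi> a x / \<Psi> x" if "x \<in> X" for a x using pos[OF that] by (simp add: \<psi>_def)
    show "(\<Sum>a\<in>A. \<psi> a x / \<Psi> x) = 1" if "x \<in> X" for x
      using pos[OF that] by (simp add: sum_divide_distrib[symmetric] \<Psi>_def[symmetric])
    show "dist a x < \<eta>" if "x \<in> X" "\<psi> a x / \<Psi> x \<noteq> 0" for a x
      using that by (auto simp: \<psi>_def max_def split: if_splits)
  qed (use A in auto)
qed

lemma convex_combination_bound:
  fixes f :: "'a => 'b::real_normed_vector"
  assumes "\<And>a. a \<in> A ==> 0 \<le> w a" "(\<Sum>a\<in>A. w a) = 1" "\<And>a. a \<in> A ==> w a \<noteq> 0 ==> norm (f a) \<le> c"
  shows "norm (\<Sum>a\<in>A. w a *\<^sub>R f a) \<le> c"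
proof -
  have "norm (\<Sum>a\<in>A. w a *\<^sub>R f a) \<le> (\<Sum>a\<in>A. w a * c)"
  proof (rule order_trans[OF norm_sum], rule sum_mono)
    fix a assume a: "a \<in> A"
    show "norm (w a *\<^sub>R f a) \<le> w a * c"
      using assms(1)[OF a] assms(3)[OF a] by (cases "w a = 0") (auto intro: mult_left_mono)
  qed
  also have "... = c" using assms(2) by (simp add: sum_distrib_right[symmetric])
  finally show ?thesis .
qed

definition sup_ball :: "'a::topological_space set => real => ('a => 'b::euclidean_space) => bool" where
  "sup_ball X R p \<longleftrightarrow> continuous_on X p \<and> (\<forall>x\<in>X. \<forall>b\<in>Basis. \<bar>p x \<bullet> b\<bar> \<le> R)"

text \<open>
  Functions are replaced by interpolations of their values on a finite net, which range over a cube of finite dimension.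
  Since \<Phi> produces Lipschitz functions, interpolation changes them little on a fine net.
\<close>

lemma approximate_fixed_point:
  fixes \<Phi> :: "('a::real_normed_vector => 'b::euclidean_space) => 'a => 'b"
  assumes X: "compact X" and R: "R > 0"
    and maps: "\<And>p x b. sup_ball X R p ==> x \<in> X ==> b \<in> Basis ==> \<bar>\<Phi> p x \<bullet> b\<bar> \<le> R"
    and lip: "\<And>p x y. sup_ball X R p ==> x \<in> X ==> y \<in> X ==> norm (\<Phi> p x - \<Phi> p y) \<le> L * norm (x - y)"
    and unif: "\<And>e. e > 0 ==> \<exists>d>0. \<forall>p q. sup_ball X R p --> sup_ball X R q --> (\<forall>x\<in>X. norm (p x - q x) \<le> d) -->
       (\<forall>x\<in>X. norm (\<Phi> p x - \<Phi> q x) \<le> e)"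
    and e: "e > 0"
  shows "\<exists>p. sup_ball X R p \<and> (\<forall>x\<in>X. norm (\<Phi> p x - p x) \<le> e)"
proof -
  define \<eta> where "\<eta> = e / (2 * (\<bar>L\<bar> + 1))"
  have \<eta>: "\<eta> > 0" "\<bar>L\<bar> * \<eta> \<le> e / 2" using e by (auto simp: \<eta>_def field_simps)
  obtain A w where A: "finite A" "A \<subseteq> X" and w: "\<And>a. continuous_on X (w a)" "\<And>a x. x \<in> X ==> 0 \<le> (w a x :: real)"
    "\<And>x. x \<in> X ==> (\<Sum>a\<in>A. w a x) = 1" "\<And>a x. x \<in> X ==> w a x \<noteq> 0 ==> dist a x < \<eta>"
    by (rule interpolation_weights[OF X \<eta>(1)]) blast
  define I where "I = A \<times> (Basis :: 'b set)"
  define val where "val c a = (\<Sum>b\<in>Basis. (2 * R * c (a, b) - R) *\<^sub>R b)" for c :: "'a \<times> 'b => real" and a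
  have val: "val c a \<bullet> b = 2 * R * c (a, b) - R" if "b \<in> Basis" for c a b
    using that by (simp add: val_def inner_sum_left_Basis)
  define P where "P c x = (\<Sum>a\<in>A. w a x *\<^sub>R val c a)" for c x
  define F where "F c i = (\<Phi> (P c) (fst i) \<bullet> snd i + R) / (2 * R)" for c i
  have P: "sup_ball X R (P c)" if c: "\<forall>i\<in>I. c i \<in> {0..1}" for c
    unfolding sup_ball_def
  proof (intro conjI ballI)
    show "continuous_on X (P c)" unfolding P_def by (intro continuous_intros w(1))
    fix x and b :: 'b assume x: "x \<in> X" and b: "b \<in> Basis"
    have "norm (\<Sum>a\<in>A. w a x *\<^sub>R (val c a \<bullet> b)) \<le> R"
    proof (rule convex_combination_bound[OF w(2)[OF x] w(3)[OF x]])
      fix a assume "a \<in> A"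
      then have "c (a, b) \<in> {0..1}" using c b by (auto simp: I_def)
      then have "0 \<le> 2 * R * c (a, b)" "2 * R * c (a, b) \<le> 2 * R * 1" using R by (auto intro!: mult_left_mono)
      then show "norm (val c a \<bullet> b) \<le> R" by (simp add: val[OF b] abs_le_iff)
    qed
    then show "\<bar>P c x \<bullet> b\<bar> \<le> R" by (simp add: P_def inner_sum_left)
  qed
  have "\<exists>c. (\<forall>i\<in>I. c i \<in> {0..1}) \<and> (\<forall>i\<in>I. \<bar>F c i - c i\<bar> \<le> e / (4 * R * DIM('b)))"
  proof (rule approximate_fixed_point_cube)
    show "finite I" using A(1) by (simp add: I_def)
    show "F c i \<in> {0..1}" if c: "\<forall>j\<in>I. c j \<in> {0..1}" and i: "i \<in> I" for c i
    proof -
      have "\<bar>\<Phi> (P c) (fst i) \<bullet> snd i\<bar> \<le> R" using maps[OF P[OF c]] i A(2) by (auto simp: I_def)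
      then show ?thesis using R by (auto simp: F_def abs_le_iff pos_divide_le_eq)
    qed
    show "0 < e / (4 * R * DIM('b))" using e R by simp
    fix \<epsilon> :: real assume "\<epsilon> > 0"
    then have "2 * R * \<epsilon> > 0" using R by simp
    from unif[OF this] obtain d where d: "d > 0" "\<And>p q x. sup_ball X R p ==> sup_ball X R q ==>
        \<forall>x\<in>X. norm (p x - q x) \<le> d ==> x \<in> X ==> norm (\<Phi> p x - \<Phi> q x) \<le> 2 * R * \<epsilon>" by blast
    define \<delta> where "\<delta> = d / (DIM('b) * (2 * R))"
    have \<delta>: "\<delta> > 0" "DIM('b) * (2 * R * \<delta>) = d" using d(1) R by (auto simp: \<delta>_def)
    show "\<exists>d>0. \<forall>x y. (\<forall>j\<in>I. x j \<in> {0..1}) --> (\<forall>j\<in>I. y j \<in> {0..1}) -->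
       (\<forall>j\<in>I. \<bar>x j - y j\<bar> \<le> d) --> (\<forall>i\<in>I. \<bar>F x i - F y i\<bar> \<le> \<epsilon>)"
    proof (intro exI[of _ \<delta>] conjI allI impI ballI \<delta>(1))
      fix c c' i assume c: "\<forall>j\<in>I. c j \<in> {0..1}" "\<forall>j\<in>I. c' j \<in> {0..1}" "\<forall>j\<in>I. \<bar>c j - c' j\<bar> \<le> \<delta>" and i: "i \<in> I"
      have "norm (P c x - P c' x) \<le> d" if x: "x \<in> X" for x
      proof -
        have "P c x - P c' x = (\<Sum>a\<in>A. w a x *\<^sub>R (val c a - val c' a))"
          by (simp add: P_def sum_subtractf scaleR_diff_right)
        also have "norm ... \<le> d"
        proof (rule convex_combination_bound[OF w(2)[OF x] w(3)[OF x]])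
          fix a assume a: "a \<in> A"
          have "norm (val c a - val c' a) \<le> DIM('b) * (2 * R * \<delta>)"
          proof (rule norm_le_DIM)
            fix b :: 'b assume b: "b \<in> Basis"
            have "(val c a - val c' a) \<bullet> b = 2 * R * (c (a, b) - c' (a, b))"
              by (simp add: inner_diff_left val[OF b] algebra_simps)
            also have "\<bar>...\<bar> = 2 * R * \<bar>c (a, b) - c' (a, b)\<bar>" using R by (simp add: abs_mult)
            also have "... \<le> 2 * R * \<delta>" using c(3) a b R by (intro mult_left_mono) (auto simp: I_def)
            finally show "\<bar>(val c a - val c' a) \<bullet> b\<bar> \<le> 2 * R * \<delta>" .
          qed
          then show "norm (val c a - val c' a) \<le> d" using \<delta>(2) by simp
        qed
        finally show ?thesis .
      qed
      then have "norm (\<Phi> (P c) (fst i) - \<Phi> (P c') (fst i)) \<le> 2 * R * \<epsilon>"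
        using i A(2) by (intro d(2) P c ballI) (auto simp: I_def)
      moreover have "\<bar>(\<Phi> (P c) (fst i) - \<Phi> (P c') (fst i)) \<bullet> snd i\<bar> \<le> norm (\<Phi> (P c) (fst i) - \<Phi> (P c') (fst i))"
        using i by (intro Basis_le_norm) (auto simp: I_def)
      moreover have "F c i - F c' i = ((\<Phi> (P c) (fst i) - \<Phi> (P c') (fst i)) \<bullet> snd i) / (2 * R)"
        by (simp add: F_def diff_divide_distrib[symmetric] inner_diff_left)
      ultimately show "\<bar>F c i - F c' i\<bar> \<le> \<epsilon>" using R by (simp add: abs_divide pos_divide_le_eq mult.commute)
    qed
  qed
  then obtain c where c: "\<forall>i\<in>I. c i \<in> {0..1}" "\<And>i. i \<in> I ==> \<bar>F c i - c i\<bar> \<le> e / (4 * R * DIM('b))" by blast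
  have net: "norm (\<Phi> (P c) a - val c a) \<le> e / 2" if a: "a \<in> A" for a
  proof -
    have "norm (\<Phi> (P c) a - val c a) \<le> DIM('b) * (e / (2 * DIM('b)))"
    proof (rule norm_le_DIM)
      fix b :: 'b assume b: "b \<in> Basis"
      have "(\<Phi> (P c) a - val c a) \<bullet> b = 2 * R * (F c (a, b) - c (a, b))"
        using R by (simp add: F_def inner_diff_left val[OF b] field_simps)
      also have "\<bar>...\<bar> = 2 * R * \<bar>F c (a, b) - c (a, b)\<bar>" using R by (simp add: abs_mult)
      also have "... \<le> 2 * R * (e / (4 * R * DIM('b)))" using c(2) a b R by (intro mult_left_mono) (auto simp: I_def)
      also have "... = e / (2 * DIM('b))" using R by simp
      finally show "\<bar>(\<Phi> (P c) a - val c a) \<bullet> b\<bar> \<le> e / (2 * DIM('b))" .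
    qed
    then show ?thesis by simp
  qed
  have "norm (\<Phi> (P c) x - P c x) \<le> e" if x: "x \<in> X" for x
  proof -
    have "(\<Sum>a\<in>A. w a x *\<^sub>R \<Phi> (P c) x) = \<Phi> (P c) x" using w(3)[OF x] by (simp add: scaleR_left.sum[symmetric])
    then have "\<Phi> (P c) x - P c x = (\<Sum>a\<in>A. w a x *\<^sub>R (\<Phi> (P c) x - val c a))"
      by (simp add: P_def sum_subtractf scaleR_diff_right)
    also have "norm ... \<le> e"
    proof (rule convex_combination_bound[OF w(2)[OF x] w(3)[OF x]])
      fix a assume a: "a \<in> A" "w a x \<noteq> 0"
      have "norm (\<Phi> (P c) x - \<Phi> (P c) a) \<le> L * norm (x - a)" using a A(2) by (intro lip P c(1) x) auto
      also have "... \<le> \<bar>L\<bar> * \<eta>"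
        using w(4)[OF x a(2)] by (intro mult_mono) (auto simp: dist_norm norm_minus_commute)
      finally have "norm (\<Phi> (P c) x - \<Phi> (P c) a) \<le> e / 2" using \<eta>(2) by linarith
      moreover have "norm (\<Phi> (P c) x - val c a) \<le> norm (\<Phi> (P c) x - \<Phi> (P c) a) + norm (\<Phi> (P c) a - val c a)"
        using norm_triangle_ineq[of "\<Phi> (P c) x - \<Phi> (P c) a" "\<Phi> (P c) a - val c a"] by simp
      ultimately show "norm (\<Phi> (P c) x - val c a) \<le> e" using net[OF a(1)] by linarith
    qed
    finally show ?thesis .
  qed
  then show ?thesis using P[OF c(1)] by blast
qed

text \<open>
  The images of approximate fixed points are equicontinuous, and a uniform limit of a subsequence is a fixed point.
\<close>

theorem schauder_lipschitz:
  fixes \<Phi> :: "('a::euclidean_space => 'b::euclidean_space) => 'a => 'b"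
  assumes X: "compact X" and R: "R > 0"
    and maps: "\<And>p x b. sup_ball X R p ==> x \<in> X ==> b \<in> Basis ==> \<bar>\<Phi> p x \<bullet> b\<bar> \<le> R"
    and lip: "\<And>p x y. sup_ball X R p ==> x \<in> X ==> y \<in> X ==> norm (\<Phi> p x - \<Phi> p y) \<le> L * norm (x - y)"
    and unif: "\<And>e. e > 0 ==> \<exists>d>0. \<forall>p q. sup_ball X R p --> sup_ball X R q --> (\<forall>x\<in>X. norm (p x - q x) \<le> d) -->
       (\<forall>x\<in>X. norm (\<Phi> p x - \<Phi> q x) \<le> e)"
  shows "\<exists>p. sup_ball X R p \<and> (\<forall>x\<in>X. \<Phi> p x = p x)"
proof -
  define \<delta> where "\<delta> n = inverse (real (Suc n))" for n
  have \<delta>: "\<delta> n > 0" "\<delta> \<longlonglongrightarrow> 0" for n using LIMSEQ_inverse_real_of_nat by (simp_all add: \<delta>_def[abs_def])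
  have "\<forall>n. \<exists>p. sup_ball X R p \<and> (\<forall>x\<in>X. norm (\<Phi> p x - p x) \<le> \<delta> n)"
    by (intro allI approximate_fixed_point[OF X R maps lip unif \<delta>(1)])
  from choice[OF this] obtain p where p: "\<And>n. sup_ball X R (p n)" "\<And>n x. x \<in> X ==> norm (\<Phi> (p n) x - p n x) \<le> \<delta> n"
    by blast
  define u where "u n = \<Phi> (p n)" for n
  have ulip: "norm (u n x - u n y) \<le> L * norm (x - y)" if "x \<in> X" "y \<in> X" for n x y
    unfolding u_def by (rule lip[OF p(1) that])
  have umax: "norm (u n x) \<le> DIM('b) * R" if "x \<in> X" for n x
    unfolding u_def by (rule norm_le_DIM[OF maps[OF p(1) that]])
  have equi: "\<exists>d. 0 < d \<and> (\<forall>n y. y \<in> X \<and> norm (x - y) < d --> norm (u n x - u n y) < e)"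
    if x: "x \<in> X" and e: "0 < e" for x e
  proof (intro exI[of _ "e / (\<bar>L\<bar> + 1)"] conjI allI impI)
    show "0 < e / (\<bar>L\<bar> + 1)" using e by simp
    fix n y assume y: "y \<in> X \<and> norm (x - y) < e / (\<bar>L\<bar> + 1)"
    have "norm (u n x - u n y) \<le> (\<bar>L\<bar> + 1) * norm (x - y)"
    proof -
      have "L * norm (x - y) \<le> (\<bar>L\<bar> + 1) * norm (x - y)" by (intro mult_right_mono) auto
      then show ?thesis using ulip[OF x, of y n] y by linarith
    qed
    also have "... < e" using y by (simp add: pos_less_divide_eq mult.commute)
    finally show "norm (u n x - u n y) < e" .
  qed
  obtain g k where g: "continuous_on X g" and k: "strict_mono (k :: nat => nat)"
    and conv: "\<And>e. 0 < e ==> \<exists>N. \<forall>n x. n \<ge> N \<and> x \<in> X --> norm (u (k n) x - g x) < e"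
    using Arzela_Ascoli[OF X umax equi] by metis
  have lim: "(\<lambda>n. u (k n) x) \<longlonglongrightarrow> g x" if "x \<in> X" for x using conv that by (intro LIMSEQ_I) blast
  have gball: "sup_ball X R g"
    unfolding sup_ball_def
  proof (intro conjI ballI g)
    fix x and b :: 'b assume xb: "x \<in> X" "b \<in> Basis"
    have "(\<lambda>n. \<bar>u (k n) x \<bullet> b\<bar>) \<longlonglongrightarrow> \<bar>g x \<bullet> b\<bar>" by (intro tendsto_intros lim xb)
    then show "\<bar>g x \<bullet> b\<bar> \<le> R" by (rule tendsto_upperbound) (use maps[OF p(1) xb] in \<open>auto simp: u_def\<close>)
  qed
  have "\<Phi> g x = g x" if x: "x \<in> X" for x
  proof -
    have "(\<lambda>n. u (k n) x) \<longlonglongrightarrow> \<Phi> g x"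
    proof (rule LIMSEQ_I)
      fix e :: real assume "e > 0"
      then have "e / 2 > 0" by simp
      from unif[OF this] obtain d where d: "d > 0" "\<And>p q x. sup_ball X R p ==> sup_ball X R q ==>
        \<forall>x\<in>X. norm (p x - q x) \<le> d ==> x \<in> X ==> norm (\<Phi> p x - \<Phi> q x) \<le> e / 2" by blast
      obtain N1 where N1: "\<And>n x. n \<ge> N1 ==> x \<in> X ==> norm (u (k n) x - g x) < d / 2"
        using conv[of "d / 2"] d(1) by auto
      have "\<forall>\<^sub>F n in sequentially. \<delta> n < d / 2" using d(1) by (intro order_tendstoD(2)[OF \<delta>(2)]) simp
      then obtain N2 where N2: "\<And>n. n \<ge> N2 ==> \<delta> n < d / 2" by (auto simp: eventually_sequentially)
      have "norm (u (k n) x - \<Phi> g x) < e" if n: "n \<ge> max N1 N2" for n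
      proof -
        have "norm (p (k n) y - g y) \<le> d" if y: "y \<in> X" for y
        proof -
          have "\<delta> (k n) < d / 2" using N2 n seq_suble[OF k, of n] by auto
          then have "norm (p (k n) y - u (k n) y) < d / 2"
            using p(2)[OF y, of "k n"] by (simp add: u_def norm_minus_commute)
          then show ?thesis
            using N1[of n y] n y norm_triangle_ineq[of "p (k n) y - u (k n) y" "u (k n) y - g y"] by simp
        qed
        then have "norm (u (k n) x - \<Phi> g x) \<le> e / 2" unfolding u_def by (intro d(2) p(1) gball x) auto
        then show ?thesis using \<open>e > 0\<close> by simp
      qed
      then show "\<exists>no. \<forall>n\<ge>no. norm (u (k n) x - \<Phi> g x) < e" by blast
    qed
    then show ?thesis using lim[OF x] by (rule LIMSEQ_unique)
  qed
  then show ?thesis using gball by blast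
qed

section \<open>Existence of a weak solution\<close>

text \<open>
  The datum f enters through a representative (vf, gf) on G and a trace a, so that the admissible functions are represented by
  vf plus the functions with zero trace.
\<close>

locale image_problem = image_domain \<Omega> K G C N
  for \<Omega> K G :: "(real^2) set" and C :: "nat => (real^2) set" and N :: nat +
  fixes f :: "real^2 => real" and D :: "real^2 => real^2^2" and lam c1 c2 \<sigma> :: real
    and vf :: "real^2 => real" and gf :: "real^2 => real^2" and a :: "real^2 => real"
  assumes f: "represents G f vf gf" "is_trace vf gf a"
    and D_continuous: "continuous_on UNIV D" and D_symmetric: "\<And>p. transpose (D p) = D p"
    and pos: "lam > 0" "c1 > 0" "c2 > 0" "\<sigma> > 0"
    and D_lower: "\<And>p q. c1 * (1 + (norm p)\<^sup>2 / lam\<^sup>2) powr (- 1 / 2) * (norm q)\<^sup>2 \<le> (D p *v q) \<bullet> q"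
    and D_upper: "\<And>p q. (D p *v q) \<bullet> q \<le> c2 * (norm q)\<^sup>2"
begin

abbreviation "X \<equiv> closure G"

abbreviation gradient_ball :: "real => (real^2 => real^2) => bool" where
  "gradient_ball \<equiv> sup_ball X"

lemma X_compact: "compact X" using G_bounded by (simp add: compact_closure)

definition ellipticity :: "real => real" where
  "ellipticity R = c1 * (1 + (2 * R)\<^sup>2 / lam\<^sup>2) powr (- 1 / 2)"

text \<open>
  Replacing p by 0 outside the closure of G makes the coefficient bounded and Borel measurable on the whole plane.
\<close>

definition coeff :: "(real^2 => real^2) => real^2 => real^2^2" where
  "coeff p x = D (indicator X x *\<^sub>R p x)"

lemma sup_ball_norm:
  fixes p :: "real^2 => real^2"
  assumes "gradient_ball R p" "R \<ge> 0"
  shows "norm (indicator X x *\<^sub>R p x) \<le> 2 * R"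
proof (cases "x \<in> X")
  case True
  then have "norm (p x) \<le> DIM(real^2) * R" using assms(1) by (intro norm_le_DIM) (auto simp: sup_ball_def)
  then show ?thesis using True by simp
qed (use assms in simp)

lemma ellipticity_pos: "ellipticity R > 0"
proof -
  have "0 < 1 + (2 * R)\<^sup>2 / lam\<^sup>2" by (intro add_pos_nonneg) auto
  then show ?thesis using pos by (simp add: ellipticity_def)
qed

lemma ellipticity_bound:
  assumes "norm p \<le> 2 * R"
  shows "ellipticity R * (norm q)\<^sup>2 \<le> (D p *v q) \<bullet> q"
proof -
  have "(norm p)\<^sup>2 / lam\<^sup>2 \<le> (2 * R)\<^sup>2 / lam\<^sup>2" using assms by (intro divide_right_mono power_mono) auto
  moreover have "0 < 1 + (norm p)\<^sup>2 / lam\<^sup>2" by (intro add_pos_nonneg) auto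
  ultimately have "(1 + (2 * R)\<^sup>2 / lam\<^sup>2) powr (- 1 / 2) \<le> (1 + (norm p)\<^sup>2 / lam\<^sup>2) powr (- 1 / 2)"
    by (intro powr_mono2') auto
  then have "ellipticity R \<le> c1 * (1 + (norm p)\<^sup>2 / lam\<^sup>2) powr (- 1 / 2)"
    unfolding ellipticity_def using pos by (intro mult_left_mono) auto
  then have "ellipticity R * (norm q)\<^sup>2 \<le> c1 * (1 + (norm p)\<^sup>2 / lam\<^sup>2) powr (- 1 / 2) * (norm q)\<^sup>2"
    by (intro mult_right_mono) auto
  then show ?thesis using D_lower[of p q] by linarith
qed

lemma ellipticity_decay:
  assumes "R \<ge> 0"
  shows "1 / ellipticity R \<le> (1 + 2 * R / lam) / c1"
proof -
  define t where "t = 1 + (2 * R)\<^sup>2 / lam\<^sup>2"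
  have t: "t > 0" unfolding t_def by (intro add_pos_nonneg) auto
  have "t \<le> (1 + 2 * R / lam)\<^sup>2" using assms pos by (simp add: t_def power2_sum power_divide)
  then have "sqrt t \<le> 1 + 2 * R / lam" using assms pos by (intro real_le_lsqrt) auto
  moreover have "t powr (- 1 / 2) = 1 / sqrt t"
    using t powr_minus_divide[of t "1 / 2"] powr_half_sqrt[of t] by simp
  then have "1 / ellipticity R = sqrt t / c1" unfolding ellipticity_def t_def[symmetric] by simp
  ultimately show ?thesis using pos by (simp add: divide_right_mono)
qed

lemma coeff_coefficient:
  assumes "gradient_ball R p" "R \<ge> 0"
  shows "coefficient (coeff p) (ellipticity R)"
  unfolding coefficient_def
proof (intro conjI allI)
  show "0 < ellipticity R" by (rule ellipticity_pos)
  have "(\<lambda>x. indicator X x *\<^sub>R p x) \<in> borel_measurable borel"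
    using assms(1) by (intro borel_measurable_continuous_on_indicator) (auto simp: sup_ball_def)
  from measurable_compose[OF this borel_measurable_continuous_onI[OF D_continuous]]
  show "coeff p \<in> borel_measurable borel" by (simp add: coeff_def[abs_def])
  show "transpose (coeff p x) = coeff p x" for x unfolding coeff_def by (rule D_symmetric)
  have "compact (D ` cball 0 (2 * R))"
    by (intro compact_continuous_image compact_cball continuous_on_subset[OF D_continuous]) simp
  then obtain B where "\<And>y. y \<in> D ` cball 0 (2 * R) ==> norm y \<le> B"
    using compact_imp_bounded bounded_iff by metis
  then show "\<exists>B. \<forall>x. norm (coeff p x) \<le> B"
    using sup_ball_norm[OF assms] by (intro exI[of _ B] allI) (auto simp: coeff_def)
  show "ellipticity R * (norm q)\<^sup>2 \<le> (coeff p x *v q) \<bullet> q" for x q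
    unfolding coeff_def by (rule ellipticity_bound[OF sup_ball_norm[OF assms]])
qed

lemma Hf: "H1 G vf gf" using f(1) by (simp add: represents_def)

lemmas Lf = H1_L2[OF Hf]

definition sol :: "(real^2 => real^2) => (real^2 => real) \<times> (real^2 => real^2)" where
  "sol p = (SOME z. solves (coeff p) gf (fst z) (snd z))"

definition sol_fun :: "(real^2 => real^2) => real^2 => real" where
  "sol_fun p x = vf x + fst (sol p) x"

definition sol_grad :: "(real^2 => real^2) => real^2 => real^2" where
  "sol_grad p x = gf x + snd (sol p) x"

lemma sol_solves:
  assumes "gradient_ball R p" "R \<ge> 0"
  shows "solves (coeff p) gf (fst (sol p)) (snd (sol p))"
proof -
  obtain w h where "solves (coeff p) gf w h"
    using dirichlet_problem[OF coeff_coefficient[OF assms] Lf(2)] by blast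
  then have "solves (coeff p) gf (fst (w, h)) (snd (w, h))" by simp
  then show ?thesis unfolding sol_def by (rule someI)
qed

lemma sol_W0: "gradient_ball R p ==> R \<ge> 0 ==> W0 (fst (sol p)) (snd (sol p))"
  using sol_solves by (auto simp: solves_def)

lemma sol_H1:
  assumes "gradient_ball R p" "R \<ge> 0"
  shows "H1 G (sol_fun p) (sol_grad p)"
proof -
  have "H1 G (fst (sol p)) (snd (sol p))" using sol_W0[OF assms] by (simp add: W0_def)
  from H1_linear[OF Hf this G_bounded, of 1] show ?thesis by (simp add: sol_fun_def[abs_def] sol_grad_def[abs_def])
qed

lemma sol_grad_bound:
  assumes "gradient_ball R p" "R \<ge> 0"
  shows "sqn (sol_grad p) \<le> c2 / ellipticity R * sqn gf"
proof -
  have "ellipticity R * sqn (sol_grad p) \<le> c2 * sqn gf"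
    using solution_bound[OF coeff_coefficient[OF assms] Lf(2) sol_solves[OF assms], of c2] D_upper
    by (simp add: sol_grad_def[abs_def] coeff_def)
  then show ?thesis using ellipticity_pos[of R] by (simp add: pos_le_divide_eq mult.commute)
qed

text \<open>
  The ellipticity constant of D decays only like the reciprocal of its argument, so that the squared norm of the
  solution grows at most linearly with the bound on p.
\<close>

lemma sol_fun_growth:
  obtains b where "b \<ge> 0" "\<And>R p. gradient_ball R p ==> R \<ge> 1 ==> sqn (sol_fun p) \<le> b * R"
proof -
  obtain M where M: "M \<ge> 0" "\<And>v g. W0 v g ==> sqn v \<le> M * sqn g" using poincare by blast
  define b where "b = 2 * sqn vf + 4 * M * ((c2 * ((1 + 2 / lam) / c1) + 1) * sqn gf)"
  show thesis
  proof (rule that[of b])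
    show "b \<ge> 0" unfolding b_def using M(1) pos by (intro add_nonneg_nonneg mult_nonneg_nonneg) auto
    fix R p assume p: "gradient_ball R p" and R: "R \<ge> 1"
    then have R0: "R \<ge> 0" by simp
    let ?w = "fst (sol p)" and ?h = "snd (sol p)"
    have W: "W0 ?w ?h" by (rule sol_W0[OF p R0])
    have "1 / ellipticity R \<le> (1 + 2 * R / lam) / c1" by (rule ellipticity_decay[OF R0])
    also have "... \<le> (R * (1 + 2 / lam)) / c1" using R pos by (intro divide_right_mono) (auto simp: algebra_simps)
    finally have "c2 * (1 / ellipticity R) \<le> c2 * ((R * (1 + 2 / lam)) / c1)" using pos by (intro mult_left_mono) auto
    then have dec: "c2 / ellipticity R + 1 \<le> R * (c2 * ((1 + 2 / lam) / c1) + 1)"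
      using R by (simp add: algebra_simps)
    have "(\<lambda>x. sol_grad p x - gf x) = ?h" by (simp add: sol_grad_def fun_eq_iff)
    then have "sqn ?h \<le> 2 * sqn (sol_grad p) + 2 * sqn gf"
      using L2_diff(2)[OF H1_L2(2)[OF sol_H1[OF p R0]] Lf(2)] by simp
    also have "... \<le> 2 * ((c2 / ellipticity R + 1) * sqn gf)"
      using sol_grad_bound[OF p R0] by (simp add: distrib_right)
    also have "... \<le> 2 * (R * (c2 * ((1 + 2 / lam) / c1) + 1) * sqn gf)"
      using dec by (intro mult_left_mono mult_right_mono) auto
    finally have h: "sqn ?h \<le> 2 * (R * (c2 * ((1 + 2 / lam) / c1) + 1) * sqn gf)" .
    have "sqn (sol_fun p) \<le> 2 * sqn vf + 2 * sqn ?w"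
      unfolding sol_fun_def[abs_def] by (rule L2_add(2)[OF Lf(1) W0_L2(2)[OF W]])
    also have "... \<le> 2 * (R * sqn vf) + 2 * (M * (2 * (R * (c2 * ((1 + 2 / lam) / c1) + 1) * sqn gf)))"
      using order_trans[OF M(2)[OF W] mult_left_mono[OF h M(1)]] mult_right_mono[OF R nsq_nonneg[of lborel vf]]
      by (intro add_mono mult_left_mono) auto
    also have "... = b * R" by (simp add: b_def algebra_simps)
    finally show "sqn (sol_fun p) \<le> b * R" .
  qed
qed

definition next_gradient :: "(real^2 => real^2) => real^2 => real^2" where
  "next_gradient p = smoothed_gradient \<sigma> (sol_fun p)"

lemma sol_fun_L1:
  assumes "gradient_ball R p" "R \<ge> 0" "sqn (sol_fun p) \<le> E"
  shows "(\<integral>z. \<bar>sol_fun p z\<bar> \<partial>lborel) \<le> sqrt (measure lborel G * E)"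
proof (rule real_le_rsqrt)
  have H: "H1 G (sol_fun p) (sol_grad p)" by (rule sol_H1[OF assms(1,2)])
  have "(\<integral>z. \<bar>sol_fun p z\<bar> \<partial>lborel)\<^sup>2 \<le> measure lborel G * sqn (sol_fun p)"
    by (rule L1_le_L2[OF H1_L2(1)[OF H] G_bounded G_borel H1_outside(1)[OF H]])
  also have "... \<le> measure lborel G * E" by (intro mult_left_mono assms(3)) simp
  finally show "(\<integral>z. \<bar>sol_fun p z\<bar> \<partial>lborel)\<^sup>2 \<le> measure lborel G * E" .
qed

text \<open>
  The smoothed gradient is bounded by the integral norm of the solution, hence by a multiple of the square root of R, so
  that a large ball is mapped into itself.
\<close>

lemma next_gradient_bounds:
  obtains R L where "R > 0" "\<And>p x. gradient_ball R p ==> norm (next_gradient p x) \<le> R"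
    "\<And>p x y. gradient_ball R p ==> norm (next_gradient p x - next_gradient p y) \<le> L * norm (x - y)"
proof -
  obtain M where M: "M \<ge> 0" "\<And>v x. integrable lborel v ==> norm (smoothed_gradient \<sigma> v x) \<le> M * (\<integral>z. \<bar>v z\<bar> \<partial>lborel)"
    "\<And>v x y. integrable lborel v ==>
       norm (smoothed_gradient \<sigma> v x - smoothed_gradient \<sigma> v y) \<le> M * (\<integral>z. \<bar>v z\<bar> \<partial>lborel) * norm (x - y)"
    by (rule smoothed_gradient_bounds[OF pos(4)]) blast
  obtain b where b: "b \<ge> 0" "\<And>R p. gradient_ball R p ==> R \<ge> 1 ==> sqn (sol_fun p) \<le> b * R"
    by (rule sol_fun_growth) blast
  (* the square of the bound for the images is k R, which is at most R^2 once R \<ge> k *)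
  define k where "k = M\<^sup>2 * (measure lborel G * b)"
  define R where "R = 1 + k"
  have k: "k \<ge> 0" using b(1) by (simp add: k_def)
  have R: "R \<ge> 1" "k \<le> R" using k by (auto simp: R_def)
  define V where "V = sqrt (measure lborel G * (b * R))"
  have "(M * V)\<^sup>2 = k * R" using b(1) R by (simp add: V_def k_def power_mult_distrib)
  also have "... \<le> R\<^sup>2" using R by (simp add: power2_eq_square mult_right_mono)
  finally have MV: "M * V \<le> R" by (rule power2_le_imp_le) (use R in simp)
  have V: "integrable lborel (sol_fun p)" "(\<integral>z. \<bar>sol_fun p z\<bar> \<partial>lborel) \<le> V" if p: "gradient_ball R p" for p
  proof -
    have R0: "R \<ge> 0" using R by simp
    show "integrable lborel (sol_fun p)" by (rule H1_integrable(1)[OF sol_H1[OF p R0] G_bounded])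
    show "(\<integral>z. \<bar>sol_fun p z\<bar> \<partial>lborel) \<le> V" unfolding V_def by (rule sol_fun_L1[OF p R0 b(2)[OF p R(1)]])
  qed
  show thesis
  proof (rule that[of R "M * V"])
    show "R > 0" using R by simp
    fix p x y assume p: "gradient_ball R p"
    have "M * (\<integral>z. \<bar>sol_fun p z\<bar> \<partial>lborel) \<le> M * V" by (intro mult_left_mono V(2)[OF p] M(1))
    note le = this
    show "norm (next_gradient p x) \<le> R"
      unfolding next_gradient_def by (rule order_trans[OF M(2)[OF V(1)[OF p]] order_trans[OF le MV]])
    show "norm (next_gradient p x - next_gradient p y) \<le> M * V * norm (x - y)"
      unfolding next_gradient_def
      by (rule order_trans[OF M(3)[OF V(1)[OF p]] mult_right_mono[OF le norm_ge_zero]])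
  qed
qed

lemma coeff_uniform:
  assumes "R \<ge> 0" "\<delta> > 0"
  shows "\<exists>d>0. \<forall>p q. gradient_ball R p --> gradient_ball R q --> (\<forall>x\<in>X. norm (p x - q x) \<le> d) -->
    (\<forall>x. norm (coeff p x - coeff q x) \<le> \<delta>)"
proof -
  have "uniformly_continuous_on (cball 0 (2 * R)) D"
    by (intro compact_uniformly_continuous compact_cball continuous_on_subset[OF D_continuous]) simp
  then obtain d where d: "d > 0" "\<And>y z. y \<in> cball 0 (2 * R) ==> z \<in> cball 0 (2 * R) ==> dist z y < d ==> dist (D z) (D y) < \<delta>"
    using assms(2) unfolding uniformly_continuous_on_def by metis
  show ?thesis
  proof (intro exI[of _ "d / 2"] conjI allI impI)
    show "0 < d / 2" using d(1) by simp
    fix p q x assume p: "gradient_ball R p" and q: "gradient_ball R q" and pq: "\<forall>x\<in>X. norm (p x - q x) \<le> d / 2"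
    have "dist (indicator X x *\<^sub>R p x) (indicator X x *\<^sub>R q x) < d"
      using pq d(1) by (cases "x \<in> X") (auto simp: dist_norm)
    then have "dist (coeff p x) (coeff q x) < \<delta>"
      unfolding coeff_def using sup_ball_norm[OF p assms(1)] sup_ball_norm[OF q assms(1)] by (intro d(2)) auto
    then show "norm (coeff p x - coeff q x) \<le> \<delta>" by (simp add: dist_norm)
  qed
qed

text \<open>
  D is uniformly continuous on bounded sets, and solutions depend on the coefficient in a Lipschitz way.
\<close>

lemma next_gradient_uniform:
  assumes R: "R \<ge> 0" and e: "e > 0"
  shows "\<exists>d>0. \<forall>p q. gradient_ball R p --> gradient_ball R q --> (\<forall>x\<in>X. norm (p x - q x) \<le> d) -->
    (\<forall>x\<in>X. norm (next_gradient p x - next_gradient q x) \<le> e)"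
proof -
  obtain M where M: "M \<ge> 0" "\<And>v x. integrable lborel v ==> norm (smoothed_gradient \<sigma> v x) \<le> M * (\<integral>z. \<bar>v z\<bar> \<partial>lborel)"
    by (rule smoothed_gradient_bounds[OF pos(4)]) blast
  obtain P where P: "P \<ge> 0" "\<And>v g. W0 v g ==> sqn v \<le> P * sqn g" using poincare by blast
  let ?\<alpha> = "ellipticity R"
  have \<alpha>: "?\<alpha> > 0" by (rule ellipticity_pos)
  define E where "E = c2 / ?\<alpha> * sqn gf"
  have E: "E \<ge> 0" using \<alpha> pos by (simp add: E_def)
  define Q where "Q = measure lborel G * (P * (E / ?\<alpha>\<^sup>2))"
  have Q: "Q \<ge> 0" using P(1) E by (simp add: Q_def)
  define \<delta> where "\<delta> = e / (M * sqrt Q + 1)"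
  have MQ: "M * sqrt Q \<ge> 0" using M(1) Q by simp
  have \<delta>: "\<delta> > 0" using e MQ by (simp add: \<delta>_def)
  have "M * sqrt Q * \<delta> \<le> (M * sqrt Q + 1) * \<delta>" using \<delta> by simp
  also have "... = e" using MQ by (simp add: \<delta>_def)
  finally have \<delta>e: "M * (sqrt Q * \<delta>) \<le> e" by (simp add: mult.assoc)
  obtain d where d: "d > 0" "\<And>p q x. gradient_ball R p ==> gradient_ball R q ==> \<forall>x\<in>X. norm (p x - q x) \<le> d ==>
      norm (coeff p x - coeff q x) \<le> \<delta>" using coeff_uniform[OF R \<delta>] by blast
  show ?thesis
  proof (intro exI[of _ d] conjI allI impI ballI d(1))
    fix p q x assume p: "gradient_ball R p" and q: "gradient_ball R q" and pq: "\<forall>x\<in>X. norm (p x - q x) \<le> d"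
    let ?w = "\<lambda>x. fst (sol p) x - fst (sol q) x" and ?h = "\<lambda>x. snd (sol p) x - snd (sol q) x"
    have "W0 (\<lambda>x. fst (sol p) x + (- 1) * fst (sol q) x) (\<lambda>x. snd (sol p) x + (- 1) *\<^sub>R snd (sol q) x)"
      by (rule W0_linear[OF sol_W0[OF p R] sol_W0[OF q R]])
    then have W: "W0 ?w ?h" by simp
    then have Hw: "H1 G ?w ?h" by (simp add: W0_def)
    have "?\<alpha>\<^sup>2 * sqn ?h \<le> \<delta>\<^sup>2 * sqn (sol_grad q)"
      using solution_stable[OF coeff_coefficient[OF p R] coeff_coefficient[OF q R] Lf(2) sol_solves[OF p R] sol_solves[OF q R] d(2)[OF p q pq]]
      by (simp add: sol_grad_def[abs_def])
    also have "... \<le> \<delta>\<^sup>2 * E" unfolding E_def by (intro mult_left_mono sol_grad_bound[OF q R]) simp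
    finally have h: "sqn ?h \<le> \<delta>\<^sup>2 * (E / ?\<alpha>\<^sup>2)" using \<alpha> by (simp add: pos_le_divide_eq mult.commute)
    have "(\<integral>z. \<bar>?w z\<bar> \<partial>lborel)\<^sup>2 \<le> measure lborel G * sqn ?w"
      by (rule L1_le_L2[OF H1_L2(1)[OF Hw] G_bounded G_borel H1_outside(1)[OF Hw]])
    also have "... \<le> measure lborel G * (P * (\<delta>\<^sup>2 * (E / ?\<alpha>\<^sup>2)))"
      using order_trans[OF P(2)[OF W] mult_left_mono[OF h P(1)]] by (intro mult_left_mono) auto
    also have "... = (sqrt Q * \<delta>)\<^sup>2" using Q by (simp add: power_mult_distrib) (simp add: Q_def)
    finally have w: "(\<integral>z. \<bar>?w z\<bar> \<partial>lborel) \<le> sqrt Q * \<delta>" by (rule power2_le_imp_le) (use Q \<delta> in simp)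
    have i: "integrable lborel (sol_fun p)" "integrable lborel (sol_fun q)"
      using H1_integrable(1)[OF sol_H1 G_bounded] p q R by blast+
    have "(\<lambda>z. sol_fun p z - sol_fun q z) = ?w" by (simp add: sol_fun_def fun_eq_iff)
    then have "next_gradient p x - next_gradient q x = smoothed_gradient \<sigma> ?w x"
      unfolding next_gradient_def smoothed_gradient_diff[OF pos(4) i] by simp
    then have "norm (next_gradient p x - next_gradient q x) \<le> M * (\<integral>z. \<bar>?w z\<bar> \<partial>lborel)"
      using M(2)[OF H1_integrable(1)[OF Hw G_bounded]] by simp
    also have "... \<le> M * (sqrt Q * \<delta>)" by (intro mult_left_mono w M(1))
    finally show "norm (next_gradient p x - next_gradient q x) \<le> e" using \<delta>e by linarith
  qed
qed

lemma fixed_gradient: "\<exists>R p. R \<ge> 0 \<and> gradient_ball R p \<and> (\<forall>x\<in>X. next_gradient p x = p x)"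
proof (rule next_gradient_bounds)
  fix R L :: real
  assume R: "R > 0" and b: "\<And>p x. gradient_ball R p ==> norm (next_gradient p x) \<le> R"
    and l: "\<And>p x y. gradient_ball R p ==> norm (next_gradient p x - next_gradient p y) \<le> L * norm (x - y)"
  have "\<exists>p. gradient_ball R p \<and> (\<forall>x\<in>X. next_gradient p x = p x)"
  proof (rule schauder_lipschitz[OF X_compact R _ l next_gradient_uniform])
    fix p x and i :: "real^2" assume "gradient_ball R p" "i \<in> Basis"
    then show "\<bar>next_gradient p x \<bullet> i\<bar> \<le> R" using Basis_le_norm[of i "next_gradient p x"] b[of p x] by linarith
  qed (use R in auto)
  then show ?thesis using R by (auto intro!: exI[of _ R])
qed

lemma diffusion_form_eq:
  assumes A: "A \<in> borel_measurable borel" "\<And>x. x \<in> G ==> D (gradient (smoothed G \<sigma> u) x) = A x"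
    and v: "represents G v v' g" and \<phi>: "represents G \<phi> \<phi>' h"
  shows "diffusion_form G D \<sigma> u v \<phi> = form A g h"
  unfolding diffusion_form_def form_def
proof (rule lebesgue_on_integral_AE_borel[OF G_open])
  have H: "H1 G v' g" "H1 G \<phi>' h" using v \<phi> by (auto simp: represents_def)
  show "(\<lambda>x. (A x *v g x) \<bullet> h x) \<in> borel_measurable borel"
    by (intro borel_measurable_inner borel_measurable_matrix_vector_mult A(1) H1_borel(2)[OF H(1)] H1_borel(2)[OF H(2)])
  show "(A x *v g x) \<bullet> h x = 0" if "x \<notin> G" for x using H1_outside(2)[OF H(2) that] by simp
  have "AE x in lborel. x \<in> G --> weak_gradient G v x = g x" "AE x in lborel. x \<in> G --> weak_gradient G \<phi> x = h x"
    using weak_gradient_represents[OF v G_open G_bounded] weak_gradient_represents[OF \<phi> G_open G_bounded]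
    by (simp_all add: AE_lebesgue_on[OF G_open])
  then show "AE x in lebesgue_on G. (D (gradient (smoothed G \<sigma> u) x) *v weak_gradient G v x) \<bullet> weak_gradient G \<phi> x
      = (A x *v g x) \<bullet> h x" unfolding AE_lebesgue_on[OF G_open] by eventually_elim (simp add: A(2))
qed

lemma H1_sobolev_1:
  assumes "H1 G v g"
  shows "v \<in> sobolev 1 G"
proof -
  have ind: "indicator G x * v x = v x" "indicator G x *\<^sub>R g x = g x" for x
    using H1_outside[OF assms] by (auto simp: indicator_def)
  have "integrable (lebesgue_on G) v" "integrable (lebesgue_on G) g"
    using H1_integrable[OF assms G_bounded] H1_borel[OF assms] by (simp_all add: integrable_lebesgue_on[OF G_open] ind)
  then have "v \<in> lebesgue_space 1 G" "g \<in> lebesgue_space 1 G"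
    using borel_imp_lebesgue_on[OF H1_borel(1)[OF assms]] borel_imp_lebesgue_on[OF H1_borel(2)[OF assms]]
    by (auto simp: lebesgue_space_def)
  then show ?thesis
    using H1_has_weak_gradient(3)[OF represents_self[OF assms] G_open G_bounded] by (auto simp: sobolev_def)
qed

text \<open>
  At a fixed point p the coefficient D(p) is the one that belongs to the solution u of the linear problem. The energy
  identity for that problem gives minimality, and with Poincare's inequality uniqueness.
\<close>

theorem exists_weak_solution:
  "\<exists>u. weak_solution G K f D \<sigma> u \<and> u \<in> admissible G K f \<and>
     (\<forall>\<phi>\<in>sobolev 2 G. has_trace G (frontier K) \<phi> (\<lambda>_. 0) --> diffusion_form G D \<sigma> u u \<phi> = 0)"
proof -
  obtain R p where R: "R \<ge> 0" and p: "gradient_ball R p" and fp: "\<And>x. x \<in> X ==> next_gradient p x = p x"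
    using fixed_gradient by blast
  let ?A = "coeff p" and ?u = "sol_fun p" and ?w = "fst (sol p)" and ?h = "snd (sol p)"
  have A: "coefficient ?A (ellipticity R)" by (rule coeff_coefficient[OF p R])
  have s: "solves ?A gf ?w ?h" by (rule sol_solves[OF p R])
  have W: "W0 ?w ?h" by (rule sol_W0[OF p R])
  have H: "H1 G ?u (sol_grad p)" by (rule sol_H1[OF p R])
  have rep: "represents G ?u (\<lambda>x. vf x + ?w x) (\<lambda>x. gf x + ?h x)"
    using represents_self[OF H] by (simp add: sol_fun_def[abs_def] sol_grad_def[abs_def])
  have Am: "?A \<in> borel_measurable borel" using A by (simp add: coefficient_def)
  have AD: "D (gradient (smoothed G \<sigma> ?u) x) = ?A x" if "x \<in> G" for x
  proof -
    have x: "x \<in> X" using that closure_subset by blast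
    have "gradient (smoothed G \<sigma> ?u) x = next_gradient p x"
      unfolding next_gradient_def by (rule gradient_smoothed[OF pos(4) G_open G_bounded represents_self[OF H]])
    then show ?thesis using x fp[OF x] by (simp add: coeff_def)
  qed
  have u_adm: "?u \<in> admissible G K f" unfolding admissible_iff[OF f] using W rep by blast
  have en: "energy G D \<sigma> ?u v = form ?A (\<lambda>x. gf x + ?h x) (\<lambda>x. gf x + ?h x) + form ?A (\<lambda>x. k x - ?h x) (\<lambda>x. k x - ?h x)"
    if "W0 w' k" "represents G v (\<lambda>x. vf x + w' x) (\<lambda>x. gf x + k x)" for v w' k
  proof -
    have "energy G D \<sigma> ?u v = form ?A (\<lambda>x. gf x + k x) (\<lambda>x. gf x + k x)"
      unfolding energy_def by (rule diffusion_form_eq[OF Am AD that(2) that(2)])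
    then show ?thesis using solution_energy[OF A Lf(2) s that(1)] by simp
  qed
  have en_u: "energy G D \<sigma> ?u ?u = form ?A (\<lambda>x. gf x + ?h x) (\<lambda>x. gf x + ?h x)"
    unfolding energy_def by (rule diffusion_form_eq[OF Am AD rep rep])
  obtain P where P: "P \<ge> 0" "\<And>v g. W0 v g ==> sqn v \<le> P * sqn g" using poincare by blast
  have min: "energy G D \<sigma> ?u ?u \<le> energy G D \<sigma> ?u v" and uniq: "energy G D \<sigma> ?u v \<le> energy G D \<sigma> ?u ?u ==> AE x in lebesgue_on G. v x = ?u x"
    if v: "v \<in> admissible G K f" for v
  proof -
    obtain w' k where w': "W0 w' k" and r: "represents G v (\<lambda>x. vf x + w' x) (\<lambda>x. gf x + k x)"
      using v unfolding admissible_iff[OF f] by blast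
    have "W0 (\<lambda>x. w' x + (- 1) * ?w x) (\<lambda>x. k x + (- 1) *\<^sub>R ?h x)" by (rule W0_linear[OF w' W])
    then have Wd: "W0 (\<lambda>x. w' x - ?w x) (\<lambda>x. k x - ?h x)" by simp
    note Ld = W0_L2[OF Wd]
    show "energy G D \<sigma> ?u ?u \<le> energy G D \<sigma> ?u v" unfolding en[OF w' r] en_u using form_nonneg[OF A Ld(1)] by simp
    assume "energy G D \<sigma> ?u v \<le> energy G D \<sigma> ?u ?u"
    then have "ellipticity R * sqd k ?h \<le> 0" unfolding en[OF w' r] en_u using form_coercive[OF A Ld(1)] by simp
    then have "sqd k ?h \<le> 0" using ellipticity_pos[of R] by (simp add: mult_le_0_iff)
    then have "sqd w' ?w \<le> P * 0" using order_trans[OF P(2)[OF Wd] mult_left_mono[OF _ P(1)]] by blast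
    then have "sqd w' ?w = 0" using nsq_nonneg[of lborel "\<lambda>x. w' x - ?w x"] by linarith
    from nsq_eq_0_AE[OF Ld(2) this] have "AE x in lborel. w' x - ?w x = 0" .
    moreover have "AE x in lborel. x \<in> G --> v x = vf x + w' x"
      using r by (simp add: represents_def AE_lebesgue_on[OF G_open])
    ultimately show "AE x in lebesgue_on G. v x = ?u x"
      unfolding AE_lebesgue_on[OF G_open] by eventually_elim (simp add: sol_fun_def)
  qed
  have um: "unique_minimiser G (energy G D \<sigma> ?u) (admissible G K f) ?u"
    unfolding unique_minimiser_def using u_adm min uniq by blast
  then have T: "unique_minimiser G (energy G D \<sigma> ?u) (admissible G K f) (T_op G K f D \<sigma> ?u)"
    unfolding T_op_def by (rule someI[of "unique_minimiser G (energy G D \<sigma> ?u) (admissible G K f)"])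
  then have "AE x in lebesgue_on G. T_op G K f D \<sigma> ?u x = ?u x"
    using uniq u_adm by (simp add: unique_minimiser_def)
  then have ws: "weak_solution G K f D \<sigma> ?u" using T H1_sobolev_1[OF H] by (simp add: weak_solution_def)
  have "diffusion_form G D \<sigma> ?u ?u \<phi> = 0" if \<phi>: "\<phi> \<in> sobolev 2 G" "has_trace G S \<phi> (\<lambda>_. 0)" for \<phi>
  proof -
    obtain w' k where "represents G \<phi> w' k" "W0 w' k" using zero_trace_represents[OF \<phi>] by blast
    then show ?thesis using diffusion_form_eq[OF Am AD rep] s by (simp add: solves_def)
  qed
  then show ?thesis using ws u_adm by blast
qed

end

theorem theorem2p1:
  fixes \<Omega> K G :: "(real^2) set" and C :: "nat \<Rightarrow> (real^2) set" and N :: nat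
    and f :: "real^2 \<Rightarrow> real" and D :: "real^2 \<Rightarrow> real^2^2"
    and lam c1 c2 \<sigma> :: real
  assumes "bounded \<Omega>" and "lipschitz_domain \<Omega>"
    and "N \<ge> 1"
    and "\<And>i. i \<in> {1..N} \<Longrightarrow> lipschitz_domain (C i) \<and> C i \<subseteq> \<Omega> \<and> C i \<noteq> \<Omega>"
    and "\<And>i j. i \<in> {1..N} \<Longrightarrow> j \<in> {1..N} \<Longrightarrow> i \<noteq> j \<Longrightarrow>
           C i \<inter> C j = {} \<and> setdist (C i) (C j) > 0"
    and "K = closure (\<Union>i\<in>{1..N}. C i)"
    and "G = \<Omega> - K"
    and "compact K" and "K \<subseteq> \<Omega>"
    and "f \<in> sobolev 2 (\<Union>i\<in>{1..N}. C i)"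
    and "AE x in lebesgue_on (\<Union>i\<in>{1..N}. C i). 0 \<le> f x \<and> f x \<le> 1"
    and "f \<in> sobolev 2 \<Omega>"
    and "continuous_on UNIV D"
    and "\<And>p. transpose (D p) = D p"
    and "lam > 0" and "c1 > 0" and "c2 > 0"
    and "\<And>p q. c1 * (1 + (norm p)\<^sup>2 / lam\<^sup>2) powr (- 1 / 2) * (norm q)\<^sup>2 \<le> (D p *v q) \<bullet> q
             \<and> (D p *v q) \<bullet> q \<le> c2 * (norm q)\<^sup>2"
    and "\<sigma> > 0"
  shows "\<exists>u. weak_solution G K f D \<sigma> u \<and>
           u \<in> admissible G K f \<and>
           (\<forall>\<phi>\<in>sobolev 2 G. has_trace G (frontier K) \<phi> (\<lambda>_. 0) \<longrightarrow> diffusion_form G D \<sigma> u u \<phi> = 0)"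
proof -
  interpret image_domain \<Omega> K G C N by unfold_locales (use assms in auto)
  obtain vf gf a where f: "represents G f vf gf" "is_trace vf gf a" using trace_exists[OF assms(12)] by blast
  interpret image_problem \<Omega> K G C N f D lam c1 c2 \<sigma> vf gf a
    by unfold_locales (use f assms in auto)
  show ?thesis by (rule exists_weak_solution)
qed

end
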